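(* Let $c\ge 2$ be a fixed integer. There is a deterministic algorithm that, given an undirected graph $G$ with $n$ vertices, a positive integer $\ell$, and a tree decomposition of $G$ of width ${\rm tw}$, decides in time $(3c)^{{\rm tw}}\cdot {\rm tw}^{\mathcal{O}(1)}\cdot n$ whether there exists a matching $M\subseteq E(G)$ with $|M|\ge \ell$ such that $G[V_M]$ has at least $c$ connected components.
   Context: A matching in $G$ is a set of edges no two of which share an endpoint; $V_M$ denotes the set of endpoints of edges of $M$ and $G[V_M]$ the subgraph of $G$ induced by $V_M$. A tree decomposition of $G$ is a pair $(\mathbb{T},\{\mathcal{B}_x\}_{x\in V(\mathbb{T})})$ where $\mathbb{T}$ is a tree and the bags $\mathcal{B}_x\subseteq V(G)$ satisfy: every vertex lies in some bag; for every edge $uv$ some bag contains both $u$ and $v$; and for every vertex $v$ the nodes whose bags contain $v$ form a connected subtree. Its width is the maximum bag size minus one.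
   Formalization: The time bound is stated for tree decompositions with at most tw^O(1)·n nodes (any polynomial, constants depending on it) and n ≥ 1; with unboundedly many redundant nodes the given decomposition could not even be read in the claimed time. The factor tw^O(1) is read as (tw+1)^O(1). *)

theory Defs
  imports Main
begin

section \<open>Finite simple graphs, given by a vertex set and a set of two-element edges\<close>

definition simple_graph :: "'a set \<Rightarrow> 'a set set \<Rightarrow> bool" where
  "simple_graph V E \<longleftrightarrow> finite V \<and> (\<forall>e\<in>E. e \<subseteq> V \<and> card e = 2)"

definition induced_edges :: "'a set set \<Rightarrow> 'a set \<Rightarrow> 'a set set" where
  "induced_edges E X = {e \<in> E. e \<subseteq> X}"

definition reachable :: "'a set \<Rightarrow> 'a set set \<Rightarrow> ('a \<times> 'a) set" where
  "reachable V E = {(u, v). u \<in> V \<and> v \<in> V \<and> (u, v) \<in> {(x, y). {x, y} \<in> E}\<^sup>*}"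

definition connected_components :: "'a set \<Rightarrow> 'a set set \<Rightarrow> 'a set set" where
  "connected_components V E = V // reachable V E"

definition connected_graph :: "'a set \<Rightarrow> 'a set set \<Rightarrow> bool" where
  "connected_graph V E \<longleftrightarrow> V \<noteq> {} \<and> (\<forall>u\<in>V. \<forall>v\<in>V. (u, v) \<in> reachable V E)"

definition is_cycle :: "'a set set \<Rightarrow> 'a list \<Rightarrow> bool" where
  "is_cycle E vs \<longleftrightarrow> 3 \<le> length vs \<and> distinct vs \<and>
     (\<forall>i. Suc i < length vs \<longrightarrow> {vs ! i, vs ! Suc i} \<in> E) \<and> {last vs, hd vs} \<in> E"

definition is_tree :: "'a set \<Rightarrow> 'a set set \<Rightarrow> bool" where
  "is_tree V E \<longleftrightarrow> simple_graph V E \<and> connected_graph V E \<and> (\<nexists>vs. is_cycle E vs)"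

definition matching :: "'a set set \<Rightarrow> 'a set set \<Rightarrow> bool" where
  "matching E M \<longleftrightarrow> M \<subseteq> E \<and> (\<forall>e\<in>M. \<forall>f\<in>M. e \<noteq> f \<longrightarrow> e \<inter> f = {})"

definition has_disconnected_matching :: "nat \<Rightarrow> 'a set set \<Rightarrow> nat \<Rightarrow> bool" where
  "has_disconnected_matching c E l \<longleftrightarrow>
     (\<exists>M. matching E M \<and> l \<le> card M \<and>
          c \<le> card (connected_components (\<Union>M) (induced_edges E (\<Union>M))))"

definition tree_decomposition ::
    "'a set \<Rightarrow> 'a set set \<Rightarrow> 'b set \<Rightarrow> 'b set set \<Rightarrow> ('b \<Rightarrow> 'a set) \<Rightarrow> bool" where
  "tree_decomposition V E X F B \<longleftrightarrow>
     is_tree X F \<and> (\<forall>x\<in>X. B x \<subseteq> V) \<and>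
     (\<forall>v\<in>V. \<exists>x\<in>X. v \<in> B x) \<and>
     (\<forall>e\<in>E. \<exists>x\<in>X. e \<subseteq> B x) \<and>
     (\<forall>v\<in>V. let S = {x \<in> X. v \<in> B x} in connected_graph S (induced_edges F S))"

text \<open>The subtraction is exact as soon as some bag is nonempty, in particular for every tree
  decomposition of a graph with at least one vertex.\<close>

definition width :: "'b set \<Rightarrow> ('b \<Rightarrow> 'a set) \<Rightarrow> nat" where
  "width X B = Max ((\<lambda>x. card (B x)) ` X) - 1"

section \<open>A deterministic word RAM with structured control flow\<close>

text \<open>A program uses finitely many registers and an unbounded memory addressed indirectly
  through registers. It is executed relative to a bound \<open>W\<close> on the numbers that fit into a
  machine word; the program cannot inspect \<open>W\<close>. An instruction that would put a larger number
  into a register has no transition, so a terminating run never overflows and never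
  uses an address above \<open>W\<close>.\<close>

datatype binop = Add | Sub | Mul | Div | Mod

fun apply_binop :: "binop \<Rightarrow> nat \<Rightarrow> nat \<Rightarrow> nat" where
  "apply_binop Add a b = a + b"
| "apply_binop Sub a b = a - b"
| "apply_binop Mul a b = a * b"
| "apply_binop Div a b = a div b"
| "apply_binop Mod a b = a mod b"

datatype prog =
    Skip
  | Const nat nat            \<comment> \<open>\<open>Const i k\<close>: register \<open>i\<close> becomes \<open>k\<close>\<close>
  | Op binop nat nat nat     \<comment> \<open>\<open>Op f i j k\<close>: register \<open>i\<close> becomes \<open>f\<close> of registers \<open>j\<close>, \<open>k\<close>\<close>
  | Load nat nat             \<comment> \<open>\<open>Load i j\<close>: register \<open>i\<close> becomes the cell addressed by register \<open>j\<close>\<close>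
  | Store nat nat            \<comment> \<open>\<open>Store i j\<close>: the cell addressed by register \<open>i\<close> becomes register \<open>j\<close>\<close>
  | Seq prog prog
  | IfNZ nat prog prog
  | WhileNZ nat prog

text \<open>A state is a pair of register contents and memory contents. In \<open>exec W p s t s'\<close>, \<open>t\<close> is the
  number of executed instructions and tests.\<close>

type_synonym state = "(nat \<Rightarrow> nat) \<times> (nat \<Rightarrow> nat)"

inductive exec :: "nat \<Rightarrow> prog \<Rightarrow> state \<Rightarrow> nat \<Rightarrow> state \<Rightarrow> bool" for W :: nat where
  Skip: "exec W Skip s 1 s"
| Const: "k \<le> W \<Longrightarrow> exec W (Const i k) (r, m) 1 (r(i := k), m)"
| Op: "apply_binop f (r j) (r k) \<le> W \<Longrightarrow>
    exec W (Op f i j k) (r, m) 1 (r(i := apply_binop f (r j) (r k)), m)"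
| Load: "m (r j) \<le> W \<Longrightarrow> exec W (Load i j) (r, m) 1 (r(i := m (r j)), m)"
| Store: "exec W (Store i j) (r, m) 1 (r, m(r i := r j))"
| Seq: "exec W p s t s' \<Longrightarrow> exec W q s' u s'' \<Longrightarrow> exec W (Seq p q) s (t + u) s''"
| IfTrue: "r i \<noteq> 0 \<Longrightarrow> exec W p (r, m) t s' \<Longrightarrow> exec W (IfNZ i p q) (r, m) (Suc t) s'"
| IfFalse: "r i = 0 \<Longrightarrow> exec W q (r, m) t s' \<Longrightarrow> exec W (IfNZ i p q) (r, m) (Suc t) s'"
| WhileTrue: "r i \<noteq> 0 \<Longrightarrow> exec W p (r, m) t s' \<Longrightarrow> exec W (WhileNZ i p) s' u s'' \<Longrightarrow>
    exec W (WhileNZ i p) (r, m) (Suc (t + u)) s''"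
| WhileFalse: "r i = 0 \<Longrightarrow> exec W (WhileNZ i p) (r, m) 1 (r, m)"

inductive_cases exec_cases:
  "exec W Skip s t s'"
  "exec W (Const i k) s t s'"
  "exec W (Op f i j k) s t s'"
  "exec W (Load i j) s t s'"
  "exec W (Store i j) s t s'"
  "exec W (Seq p q) s t s'"
  "exec W (IfNZ i p q) s t s'"
  "exec W (WhileNZ i p) s t s'"

lemma exec_deterministic:
  assumes "exec W p s t s'" and "exec W p s u s''"
  shows "u = t \<and> s'' = s'"
  using assms
proof (induction arbitrary: u s'' rule: exec.induct)
  case (Seq p s t s' q v s2)
  from Seq.prems obtain t1 s1 t2 where
    "exec W p s t1 s1" "exec W q s1 t2 s''" "u = t1 + t2"
    by (rule exec_cases)
  with Seq.IH show ?case by blast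
next
  case (IfTrue r i p m t s' q)
  from IfTrue.prems IfTrue.hyps(1) obtain t1 where "exec W p (r, m) t1 s''" "u = Suc t1"
    by (elim exec_cases) simp_all
  with IfTrue.IH show ?case by blast
next
  case (IfFalse r i q m t s' p)
  from IfFalse.prems IfFalse.hyps(1) obtain t1 where "exec W q (r, m) t1 s''" "u = Suc t1"
    by (elim exec_cases) simp_all
  with IfFalse.IH show ?case by blast
next
  case (WhileTrue r i p m t s' v s2)
  from WhileTrue.prems show ?case
  proof (rule exec_cases(8))
    fix r' m' t1 s1 t2
    assume "(r, m) = (r', m')" "u = Suc (t1 + t2)"
      "exec W p (r', m') t1 s1" "exec W (WhileNZ i p) s1 t2 s''"
    with WhileTrue.IH show ?thesis by blast
  next
    fix r' m' assume "(r, m) = (r', m')" "r' i = 0"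
    with WhileTrue.hyps(1) show ?thesis by simp
  qed
next
  case (WhileFalse r i p m)
  from WhileFalse.prems show ?case
    by (rule exec_cases(8)) (use WhileFalse.hyps in simp_all)
qed (erule exec_cases, simp)+

definition initial_state :: "nat list \<Rightarrow> state" where
  "initial_state xs = ((\<lambda>_. 0), (\<lambda>a. if a < length xs then xs ! a else 0))"

definition answers_in_time :: "nat \<Rightarrow> prog \<Rightarrow> nat list \<Rightarrow> nat \<Rightarrow> bool \<Rightarrow> bool" where
  "answers_in_time W p xs T b \<longleftrightarrow>
     (\<exists>t r m. t \<le> T \<and> exec W p (initial_state xs) t (r, m) \<and> r 0 = (if b then 1 else 0))"

section \<open>Encoding of inputs\<close>

text \<open>The graph has vertex set \<open>{..<n}\<close> and the decomposition tree has node set \<open>{..<N}\<close>. The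
  edges of both, and the vertices of each bag, are listed in arbitrary order without repetition.\<close>

definition edge_list :: "(nat \<times> nat) list \<Rightarrow> nat set set \<Rightarrow> bool" where
  "edge_list es E \<longleftrightarrow> (let ps = map (\<lambda>(u, v). {u, v}) es in distinct ps \<and> set ps = E)"

definition flatten_edges :: "(nat \<times> nat) list \<Rightarrow> nat list" where
  "flatten_edges es = length es # concat (map (\<lambda>(u, v). [u, v]) es)"

definition encodes_input ::
    "nat list \<Rightarrow> nat \<Rightarrow> nat set set \<Rightarrow> nat \<Rightarrow> nat \<Rightarrow> nat set set \<Rightarrow> (nat \<Rightarrow> nat set) \<Rightarrow> bool" where
  "encodes_input xs n E l N F B \<longleftrightarrow>
     (\<exists>es fs bs. edge_list es E \<and> edge_list fs F \<and>
        length bs = N \<and> (\<forall>x<N. distinct (bs ! x) \<and> set (bs ! x) = B x) \<and>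
        xs = [n, l] @ flatten_edges es @ [N] @ flatten_edges fs @
             concat (map (\<lambda>b. length b # b) bs))"

text \<open>The time bound \<open>(3c)^tw \<cdot> tw^O(1) \<cdot> n\<close> with explicit constant \<open>K\<close>; the polynomial factor is taken
  in \<open>tw + 1\<close> so that it does not vanish for edgeless graphs. A bound linear in \<open>n\<close> is meaningful only for
  decompositions with at most \<open>tw^O(1) \<cdot> n\<close> nodes, since the decomposition itself has to be read; the
  implied constant may be arbitrary, but \<open>K\<close> depends on it.\<close>

definition time_bound :: "nat \<Rightarrow> nat \<Rightarrow> nat \<Rightarrow> nat \<Rightarrow> nat" where
  "time_bound c K tw n = K * (3 * c) ^ tw * (tw + 1) ^ K * n"

text \<open>Words of \<open>O(log (T + l))\<close> bits, where \<open>T\<close> is the time bound: large enough to address the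
  memory that can be touched and to hold the input number \<open>l\<close>, up to a constant factor.\<close>

definition word_bound :: "nat \<Rightarrow> nat \<Rightarrow> nat \<Rightarrow> nat \<Rightarrow> nat \<Rightarrow> nat" where
  "word_bound c K tw n l = (time_bound c K tw n + l) ^ K"

end

theory Submission
  imports Defs "HOL-Library.Nat_Bijection"
begin

text \<open>A matching \<open>M\<close> whose induced subgraph has at least \<open>c\<close> components amounts to a map from the
  vertices to the colours \<open>0, \<dots>, c\<close> that is positive exactly on the endpoints of \<open>M\<close>, attains every
  positive colour, and assigns no two different positive colours to adjacent vertices. In a bag, a vertex is
  uncoloured, or has one of \<open>c\<close> colours and is already matched or not; as \<open>c \<ge> 2\<close>, this
  gives \<open>(2 * c + 1) ^ t \<le> (3 * c) ^ t\<close> states for a bag of size \<open>t\<close>. A table stores the largest size of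
  a partial matching for each state and each set of colours seen so far.

  Joining two tables requires that the sets of matched vertices be disjoint. Naive enumeration of
  pairs of states is too slow, so ranked subset convolution is used, which counts pairs and therefore
  decides existence but does not maximize. By an exchange argument, only table entries that are at most
  \<open>t\<close> below the best entry for the same colouring of the bag are needed; so it suffices to run one
  convolution for each of polynomially many pairs of offsets.

  The decomposition tree is processed by stripping leaves, merging the table of a leaf into that of its
  unique remaining neighbour. The edges of the graph are introduced as joins with tables of single
  edges; the same edge may be introduced in several bags, because a matched vertex cannot be matched again.\<close>

section \<open>A language of bounded loops\<close>

text \<open>The machine is stuck when a word overflows and cannot inspect the word size, so besides
  the combinatorics the obstacle is to keep every intermediate number small. The program computes
  from the input a bound \<open>B\<close>, the square of a sum of all relevant sizes, and caps at
  \<open>B\<close> whatever is not bounded for obvious reasons. Absence of overflow becomes a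
  syntactic check, and the correctness proofs show that the caps do not change relevant values:
  counts of pairs are at most \<open>q ^ t * q ^ t\<close>, table entries at most
  \<open>n + 1\<close>.

  The program has to be fixed before \<open>d\<close>, so \<open>d\<close> may enter only the
  constant \<open>K\<close>. Whatever depends on \<open>c\<close> alone is hard-wired, in particular
  the unions of colour sets.

  Two features keep the time linear in the number of nodes. Memory is initially zero, so a sparse
  array such as the adjacency matrix costs only the cells that are written. And the states of two
  neighbouring bags are compared through a common key instead of pair by pair.\<close>

text \<open>Programs work on registers and finitely many unbounded arrays; \<open>Ar a e\<close> reads a cell of array
  \<open>a\<close>, and \<open>For i r c\<close> runs \<open>c\<close> with \<open>i\<close> counting from \<open>0\<close> up to the value of register \<open>r\<close>.\<close>

datatype expr = Vr nat | Kn nat | Ar nat expr | Bop binop expr expr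

datatype stmt = Asg nat expr | Sto nat expr expr | Sq stmt stmt | Cond expr stmt stmt
  | For nat nat stmt

type_synonym store = "(nat \<Rightarrow> nat) \<times> (nat \<Rightarrow> nat \<Rightarrow> nat)"

abbreviation (input) "rOFF \<equiv> (1::nat)"
abbreviation (input) "rB \<equiv> (9::nat)"
abbreviation (input) "numVars \<equiv> (40::nat)"

fun ev :: "expr \<Rightarrow> store \<Rightarrow> nat" where
  "ev (Vr r) s = fst s r"
| "ev (Kn k) s = k"
| "ev (Ar a e) s = snd s a (ev e s)"
| "ev (Bop f e1 e2) s = apply_binop f (ev e1 s) (ev e2 s)"

definition setr :: "nat \<Rightarrow> nat \<Rightarrow> store \<Rightarrow> store" where
  "setr r v s = ((fst s)(r := v), snd s)"

definition seta :: "nat \<Rightarrow> nat \<Rightarrow> nat \<Rightarrow> store \<Rightarrow> store" where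
  "seta a i v s = (fst s, (snd s)(a := (snd s a)(i := v)))"

lemma fst_setr [simp]: "fst (setr r v s) r' = (if r' = r then v else fst s r')"
  and snd_setr [simp]: "snd (setr r v s) = snd s"
  and fst_seta [simp]: "fst (seta a i v s) = fst s"
  and snd_seta [simp]: "snd (seta a i v s) a' i' = (if a' = a \<and> i' = i then v else snd s a' i')"
  by (simp_all add: setr_def seta_def)

primrec den :: "stmt \<Rightarrow> store \<Rightarrow> store" where
  "den (Asg r e) = (\<lambda>s. setr r (ev e s) s)"
| "den (Sto a e1 e2) = (\<lambda>s. seta a (ev e1 s) (ev e2 s) s)"
| "den (Sq c1 c2) = (\<lambda>s. den c2 (den c1 s))"
| "den (Cond e c1 c2) = (\<lambda>s. if ev e s \<noteq> 0 then den c1 s else den c2 s)"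
| "den (For i r c) =
     (\<lambda>s. ((\<lambda>s. let s' = den c s in setr i (Suc (fst s' i)) s') ^^ fst s r) (setr i 0 s))"

text \<open>The state after \<open>k\<close> rounds, with the counter already advanced.
  \<open>den\<close> hides the intermediate states because it reads the number of rounds from the
  store; invariants and overflow conditions speak about them, so the equation of \<open>den\<close>
  for \<open>For\<close> is kept folded from here on.\<close>

definition loop :: "nat \<Rightarrow> stmt \<Rightarrow> nat \<Rightarrow> store \<Rightarrow> store" where
  "loop i c k s = ((\<lambda>s. let s' = den c s in setr i (Suc (fst s' i)) s') ^^ k) (setr i 0 s)"

lemma loop_0 [simp]: "loop i c 0 s = setr i 0 s"
  and loop_Suc: "loop i c (Suc k) s =
    setr i (Suc (fst (den c (loop i c k s)) i)) (den c (loop i c k s))"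
  and den_For: "den (For i r c) s = loop i c (fst s r) s"
  by (simp_all add: loop_def Let_def)

declare den.simps(5) [simp del]

fun wr :: "stmt \<Rightarrow> nat set" where
  "wr (Asg r e) = {r}"
| "wr (Sto a e1 e2) = {}"
| "wr (Sq c1 c2) = wr c1 \<union> wr c2"
| "wr (Cond e c1 c2) = wr c1 \<union> wr c2"
| "wr (For i r c) = insert i (wr c)"

fun wa :: "stmt \<Rightarrow> nat set" where
  "wa (Asg r e) = {}"
| "wa (Sto a e1 e2) = {a}"
| "wa (Sq c1 c2) = wa c1 \<union> wa c2"
| "wa (Cond e c1 c2) = wa c1 \<union> wa c2"
| "wa (For i r c) = wa c"

lemma den_frame:
  "(r \<notin> wr c \<longrightarrow> fst (den c s) r = fst s r) \<and> (a \<notin> wa c \<longrightarrow> snd (den c s) a = snd s a)"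
proof (induction c arbitrary: s)
  case (Sto a' e1 e2)
  then show ?case by (auto simp: seta_def)
next
  case (For i q c)
  have "(r \<notin> wr (For i q c) \<longrightarrow> fst (loop i c k s) r = fst s r) \<and>
    (a \<notin> wa c \<longrightarrow> snd (loop i c k s) a = snd s a)" for k
    by (induction k) (use For.IH in \<open>auto simp: loop_Suc\<close>)
  then show ?case by (simp only: den_For wr.simps wa.simps)
qed auto

lemma fst_den [simp]: "r \<notin> wr c \<Longrightarrow> fst (den c s) r = fst s r"
  and snd_den [simp]: "a \<notin> wa c \<Longrightarrow> snd (den c s) a = snd s a"
  using den_frame by blast+

lemma fst_loop: "i \<notin> wr c \<Longrightarrow> fst (loop i c k s) i = k"
  by (induction k) (auto simp: loop_Suc)

text \<open>A Hoare rule whose invariant is indexed by the counter. The number of rounds is the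
  value of \<open>r\<close> on entry, and the preservation premise includes the increment, so
  \<open>P\<close> has to survive \<open>setr i\<close>.\<close>

lemma for_rule:
  assumes "i \<notin> wr c" and "P 0 (setr i 0 s)"
    and "\<And>k s'. k < fst s r \<Longrightarrow> P k s' \<Longrightarrow> fst s' i = k \<Longrightarrow> P (Suc k) (setr i (Suc k) (den c s'))"
  shows "P (fst s r) (den (For i r c) s)"
proof -
  have "k \<le> fst s r \<Longrightarrow> P k (loop i c k s)" for k
  proof (induction k)
    case (Suc k)
    then show ?case using assms(3)[of k "loop i c k s"] fst_loop[OF assms(1)] assms(1)
      by (simp add: loop_Suc)
  qed (use assms(2) in simp)
  then show ?thesis by (simp only: den_For)
qed

subsection \<open>Compilation\<close>

text \<open>Stack code: the value ends up in register \<open>d\<close>, and operands evaluated later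
  use registers from \<open>d + 1\<close> on. The machine has no move instruction, so a register is
  copied by adding it to a zero.\<close>

fun ecomp :: "nat \<Rightarrow> expr \<Rightarrow> nat \<Rightarrow> prog" where
  "ecomp NA (Vr r) d = Seq (Const d 0) (Op Add d r d)"
| "ecomp NA (Kn k) d = Const d k"
| "ecomp NA (Ar a e) d = Seq (ecomp NA e d) (Seq (Const (d+1) NA) (Seq (Op Mul d d (d+1))
     (Seq (Const (d+1) a) (Seq (Op Add d d (d+1)) (Seq (Op Add d d rOFF) (Load d d))))))"
| "ecomp NA (Bop f e1 e2) d = Seq (ecomp NA e1 d) (Seq (ecomp NA e2 (d+1)) (Op f d d (d+1)))"

fun ecost :: "expr \<Rightarrow> nat" where
  "ecost (Vr r) = 2"
| "ecost (Kn k) = 1"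
| "ecost (Ar a e) = ecost e + 6"
| "ecost (Bop f e1 e2) = ecost e1 + ecost e2 + 1"

text \<open>\<open>WhileNZ\<close> tests a single register. The scratch register
  \<open>numVars\<close> is therefore reloaded with the number of remaining rounds
  \<open>r - i\<close> at the end of every round, after the body may have destroyed it.\<close>

fun comp :: "nat \<Rightarrow> stmt \<Rightarrow> prog" where
  "comp NA (Asg r e) = Seq (ecomp NA e numVars)
     (Seq (Const (numVars+1) 0) (Op Add r numVars (numVars+1)))"
| "comp NA (Sto a e1 e2) = Seq (ecomp NA e1 numVars) (Seq (Const (numVars+1) NA)
     (Seq (Op Mul numVars numVars (numVars+1)) (Seq (Const (numVars+1) a)
     (Seq (Op Add numVars numVars (numVars+1)) (Seq (Op Add numVars numVars rOFF)
     (Seq (ecomp NA e2 (numVars+1)) (Store numVars (numVars+1))))))))"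
| "comp NA (Sq c1 c2) = Seq (comp NA c1) (comp NA c2)"
| "comp NA (Cond e c1 c2) = Seq (ecomp NA e numVars) (IfNZ numVars (comp NA c1) (comp NA c2))"
| "comp NA (For i r c) = Seq (Const i 0) (Seq (Op Sub numVars r i) (WhileNZ numVars
     (Seq (comp NA c) (Seq (Const numVars 1) (Seq (Op Add i i numVars) (Op Sub numVars r i))))))"

text \<open>\<open>\<sigma> r\<close> stands for the value of the loop bound \<open>r\<close>; loop bounds are never written inside the
  program, so their values are known in advance.\<close>

fun scost :: "(nat \<Rightarrow> nat) \<Rightarrow> stmt \<Rightarrow> nat" where
  "scost \<sigma> (Asg r e) = ecost e + 2"
| "scost \<sigma> (Sto a e1 e2) = ecost e1 + ecost e2 + 6"
| "scost \<sigma> (Sq c1 c2) = scost \<sigma> c1 + scost \<sigma> c2"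
| "scost \<sigma> (Cond e c1 c2) = ecost e + 1 + scost \<sigma> c1 + scost \<sigma> c2"
| "scost \<sigma> (For i r c) = 3 + \<sigma> r * (scost \<sigma> c + 4)"

text \<open>Every register write of the compiled code must fit into a word, including address
  computations; the partial results of an address are at most the sum that is tested.\<close>

fun okE :: "nat \<Rightarrow> nat \<Rightarrow> expr \<Rightarrow> store \<Rightarrow> bool" where
  "okE NA W (Vr r) s \<longleftrightarrow> fst s r \<le> W"
| "okE NA W (Kn k) s \<longleftrightarrow> k \<le> W"
| "okE NA W (Ar a e) s \<longleftrightarrow> okE NA W e s \<and> NA \<le> W \<and> a \<le> W \<and>
     ev e s * NA + a + fst s rOFF \<le> W \<and> snd s a (ev e s) \<le> W"
| "okE NA W (Bop f e1 e2) s \<longleftrightarrow> okE NA W e1 s \<and> okE NA W e2 s \<and>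
     apply_binop f (ev e1 s) (ev e2 s) \<le> W"

primrec ok :: "nat \<Rightarrow> nat \<Rightarrow> stmt \<Rightarrow> store \<Rightarrow> bool" where
  "ok NA W (Asg r e) = (\<lambda>s. okE NA W e s \<and> ev e s \<le> W)"
| "ok NA W (Sto a e1 e2) = (\<lambda>s. okE NA W e1 s \<and> okE NA W e2 s \<and> NA \<le> W \<and> a \<le> W \<and>
     ev e1 s * NA + a + fst s rOFF \<le> W)"
| "ok NA W (Sq c1 c2) = (\<lambda>s. ok NA W c1 s \<and> ok NA W c2 (den c1 s))"
| "ok NA W (Cond e c1 c2) =
     (\<lambda>s. okE NA W e s \<and> (if ev e s \<noteq> 0 then ok NA W c1 s else ok NA W c2 s))"
| "ok NA W (For i r c) =
     (\<lambda>s. 1 \<le> W \<and> fst s r \<le> W \<and> (\<forall>k<fst s r. ok NA W c (loop i c k s)))"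

fun echk :: "nat \<Rightarrow> expr \<Rightarrow> bool" where
  "echk NA (Vr r) \<longleftrightarrow> r < numVars"
| "echk NA (Kn k) \<longleftrightarrow> True"
| "echk NA (Ar a e) \<longleftrightarrow> a < NA \<and> echk NA e"
| "echk NA (Bop f e1 e2) \<longleftrightarrow> echk NA e1 \<and> echk NA e2"

fun chk :: "nat \<Rightarrow> stmt \<Rightarrow> bool" where
  "chk NA (Asg r e) \<longleftrightarrow> r < numVars \<and> r \<noteq> rOFF \<and> echk NA e"
| "chk NA (Sto a e1 e2) \<longleftrightarrow> a < NA \<and> echk NA e1 \<and> echk NA e2"
| "chk NA (Sq c1 c2) \<longleftrightarrow> chk NA c1 \<and> chk NA c2"
| "chk NA (Cond e c1 c2) \<longleftrightarrow> echk NA e \<and> chk NA c1 \<and> chk NA c2"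
| "chk NA (For i r c) \<longleftrightarrow> i < numVars \<and> i \<noteq> rOFF \<and> r < numVars \<and> i \<noteq> r \<and> i \<notin> wr c \<and> r \<notin> wr c
     \<and> chk NA c"

fun lb :: "stmt \<Rightarrow> nat set" where
  "lb (Asg r e) = {}"
| "lb (Sto a e1 e2) = {}"
| "lb (Sq c1 c2) = lb c1 \<union> lb c2"
| "lb (Cond e c1 c2) = lb c1 \<union> lb c2"
| "lb (For i r c) = insert r (lb c)"

text \<open>The \<open>NA\<close> arrays are interleaved in memory, starting at the address in register \<open>rOFF\<close>, which
  skips the input. Registers from \<open>numVars\<close> on are scratch space of the compiled code.\<close>

definition rel :: "nat \<Rightarrow> store \<Rightarrow> state \<Rightarrow> bool" where
  "rel NA s l \<longleftrightarrow> (\<forall>r<numVars. fst l r = fst s r) \<and>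
     (\<forall>a<NA. \<forall>i. snd l (i * NA + a + fst s rOFF) = snd s a i)"

section \<open>Correctness of the compiled programs\<close>

lemma exec_Op': "apply_binop f (r j) (r k) = v \<Longrightarrow> v \<le> W \<Longrightarrow> r' = r(i := v) \<Longrightarrow>
    exec W (Op f i j k) (r, m) 1 (r', m)"
  using exec.Op[of f r j k W i m] by simp

lemma exec_Load': "m (r j) = v \<Longrightarrow> v \<le> W \<Longrightarrow> r' = r(i := v) \<Longrightarrow> exec W (Load i j) (r, m) 1 (r', m)"
  using exec.Load[of m r j W i] by simp

lemma exec_Seq': "exec W p s t s' \<Longrightarrow> exec W q s' u s'' \<Longrightarrow> v = t + u \<Longrightarrow> exec W (Seq p q) s v s''"
  using exec.Seq by simp

text \<open>The five instructions shared by array reads and writes. Apart from the two loaded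
  constants, all partial results are at most the final sum, so bounding that sum suffices.\<close>

lemma exec_address:
  assumes "lr d = i" and "NA \<le> W" "a \<le> W" "i * NA + a + lr rOFF \<le> W" and "1 < d"
    and "exec W q ((lr(d := i * NA + a + lr rOFF))(d+1 := a), lm) t l'"
  shows "exec W (Seq (Const (d+1) NA) (Seq (Op Mul d d (d+1)) (Seq (Const (d+1) a)
     (Seq (Op Add d d (d+1)) (Seq (Op Add d d rOFF) q))))) (lr, lm) (5 + t) l'"
proof -
  let ?l1 = "lr(d+1 := NA)" let ?l2 = "?l1(d := i * NA)" let ?l3 = "?l2(d+1 := a)"
  let ?l4 = "?l3(d := i * NA + a)" let ?l5 = "?l4(d := i * NA + a + lr rOFF)"
  have "exec W (Const (d+1) NA) (lr, lm) 1 (?l1, lm)" by (rule exec.Const) fact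
  moreover have "exec W (Op Mul d d (d+1)) (?l1, lm) 1 (?l2, lm)"
    by (rule exec_Op'[where v = "i * NA"]) (use assms in auto)
  moreover have "exec W (Const (d+1) a) (?l2, lm) 1 (?l3, lm)" by (rule exec.Const) fact
  moreover have "exec W (Op Add d d (d+1)) (?l3, lm) 1 (?l4, lm)"
    by (rule exec_Op'[where v = "i * NA + a"]) (use assms in auto)
  moreover have "exec W (Op Add d d rOFF) (?l4, lm) 1 (?l5, lm)"
    by (rule exec_Op'[where v = "i * NA + a + lr rOFF"]) (use assms in auto)
  moreover have "?l5 = (lr(d := i * NA + a + lr rOFF))(d+1 := a)" by (auto simp: fun_eq_iff)
  ultimately show ?thesis using assms(6) by (simp only:) (auto intro!: exec_Seq')
qed

text \<open>Leaving all registers below \<open>d\<close> alone protects the first operand of a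
  binary operation while the second one is computed in \<open>d + 1\<close>, and likewise the
  program variables, which lie below \<open>numVars\<close>.\<close>

lemma ecomp_correct:
  assumes "rel NA s (lr, lm)" and "okE NA W e s" and "echk NA e" and "numVars \<le> d"
  shows "\<exists>lr'. exec W (ecomp NA e d) (lr, lm) (ecost e) (lr', lm) \<and> lr' d = ev e s \<and>
    (\<forall>r<d. lr' r = lr r)"
  using assms
proof (induction e arbitrary: d lr)
  case (Vr r)
  have "exec W (ecomp NA (Vr r) d) (lr, lm) 2 (lr(d := fst s r), lm)"
    unfolding ecomp.simps
    by (rule exec_Seq', rule exec.Const, simp, rule exec_Op'[OF refl])
       (use Vr in \<open>auto simp: rel_def\<close>)
  then show ?case by (intro exI[of _ "lr(d := fst s r)"]) (simp del: fun_upd_apply, simp)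
next
  case (Kn k)
  have "exec W (ecomp NA (Kn k) d) (lr, lm) 1 (lr(d := k), lm)"
    unfolding ecomp.simps by (rule exec.Const) (use Kn in auto)
  then show ?case by (intro exI[of _ "lr(d := k)"]) (simp del: fun_upd_apply, simp)
next
  case (Ar a e)
  then obtain lr1 where 1: "exec W (ecomp NA e d) (lr, lm) (ecost e) (lr1, lm)"
    "lr1 d = ev e s" "\<forall>r<d. lr1 r = lr r" by force
  let ?i = "ev e s"
  have off: "lr1 rOFF = fst s rOFF" using 1 Ar.prems by (auto simp: rel_def)
  have mem: "lm (?i * NA + a + fst s rOFF) = snd s a ?i" using Ar.prems by (auto simp: rel_def)
  have le: "?i * NA + a + fst s rOFF \<le> W" "snd s a ?i \<le> W" "NA \<le> W" "a \<le> W" using Ar.prems by auto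
  have "exec W (ecomp NA (Ar a e) d) (lr, lm) (ecost (Ar a e))
     ((lr1(d := snd s a ?i))(d+1 := a), lm)"
    unfolding ecomp.simps
  proof (rule exec_Seq'[OF 1(1)], rule exec_address)
    show "exec W (Load d d) ((lr1(d := ?i * NA + a + lr1 rOFF))(d + 1 := a), lm) 1
       ((lr1(d := snd s a ?i))(d+1 := a), lm)"
      by (rule exec_Load'[where v = "snd s a ?i"]) (use 1 le off mem in \<open>auto simp: fun_eq_iff\<close>)
  qed (use 1 le off Ar.prems in auto)
  then show ?case by (intro exI conjI) (assumption, use 1 in auto)
next
  case (Bop f e1 e2)
  then obtain lr1 where 1: "exec W (ecomp NA e1 d) (lr, lm) (ecost e1) (lr1, lm)"
    "lr1 d = ev e1 s" "\<forall>r<d. lr1 r = lr r" by force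
  have "rel NA s (lr1, lm)" using Bop.prems 1 by (auto simp: rel_def)
  with Bop.IH(2)[of lr1 "d+1"] Bop.prems obtain lr2 where
    2: "exec W (ecomp NA e2 (d+1)) (lr1, lm) (ecost e2) (lr2, lm)"
    "lr2 (d+1) = ev e2 s" "\<forall>r<d+1. lr2 r = lr1 r" by force
  let ?v = "ev (Bop f e1 e2) s"
  have "exec W (ecomp NA (Bop f e1 e2) d) (lr, lm) (ecost (Bop f e1 e2)) (lr2(d := ?v), lm)"
    unfolding ecomp.simps
    by (rule exec_Seq'[OF 1(1)], rule exec_Seq'[OF 2(1)], rule exec_Op'[where v = ?v])
       (use 1 2 Bop.prems in auto)
  then show ?case by (intro exI conjI) (assumption, use 1 2 in auto)
qed

text \<open>Uniqueness of quotient and remainder: two cells of interleaved arrays share an address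
  only if they are the same cell.\<close>

lemma div_mod_unique_addr:
  fixes i i' a a' N :: nat
  assumes "i * N + a = i' * N + a'" "a < N" "a' < N"
  shows "i = i' \<and> a = a'"
proof -
  have "(i * N + a) div N = i" "(i' * N + a') div N = i'" using assms(2,3) by auto
  with assms(1) have "i = i'" by simp
  then show ?thesis using assms(1) by simp
qed

lemma comp_correct:
  assumes "rel NA s l" and "ok NA W c s" and "chk NA c"
    and "\<forall>r\<in>lb c. \<sigma> r = fst s r \<and> r \<notin> wr c"
  shows "\<exists>t l'. exec W (comp NA c) l t l' \<and> t \<le> scost \<sigma> c \<and> rel NA (den c s) l'"
  using assms
proof (induction c arbitrary: s l)
  case (Asg r e)
  obtain lr lm where l: "l = (lr, lm)" by (cases l)
  from ecomp_correct[of NA s lr lm W e numVars] Asg.prems l obtain lr1 where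
    1: "exec W (ecomp NA e numVars) (lr, lm) (ecost e) (lr1, lm)"
    "lr1 numVars = ev e s" "\<forall>r<numVars. lr1 r = lr r" by auto
  let ?l' = "((lr1(numVars+1 := 0))(r := ev e s), lm)"
  have "exec W (comp NA (Asg r e)) l (scost \<sigma> (Asg r e)) ?l'"
    unfolding comp.simps l
    by (rule exec_Seq'[OF 1(1)], rule exec_Seq', rule exec.Const, simp,
        rule exec_Op'[where v = "ev e s"]) (use 1 Asg.prems in auto)
  moreover have "rel NA (den (Asg r e) s) ?l'"
    using Asg.prems 1 l by (auto simp: rel_def)
  ultimately show ?case by blast
next
  case (Sto a e1 e2)
  obtain lr lm where l: "l = (lr, lm)" by (cases l)
  from ecomp_correct[of NA s lr lm W e1 numVars] Sto.prems l obtain lr1 where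
    1: "exec W (ecomp NA e1 numVars) (lr, lm) (ecost e1) (lr1, lm)"
    "lr1 numVars = ev e1 s" "\<forall>r<numVars. lr1 r = lr r" by auto
  let ?i = "ev e1 s" let ?ad = "ev e1 s * NA + a + fst s rOFF"
  let ?lr2 = "(lr1(numVars := ?ad))(numVars+1 := a)"
  have rel2: "rel NA s (?lr2, lm)" using Sto.prems(1) 1 l by (auto simp: rel_def)
  with ecomp_correct[of NA s ?lr2 lm W e2 "numVars+1"] Sto.prems obtain lr3 where
    3: "exec W (ecomp NA e2 (numVars+1)) (?lr2, lm) (ecost e2) (lr3, lm)"
    "lr3 (numVars+1) = ev e2 s" "\<forall>r<numVars+1. lr3 r = ?lr2 r" by auto
  have le: "?ad \<le> W" "NA \<le> W" "a \<le> W" using Sto.prems by auto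
  have off: "lr1 rOFF = fst s rOFF" using 1 Sto.prems l by (auto simp: rel_def)
  have ad: "lr3 numVars = ?ad" using 3 by simp
  let ?l' = "(lr3, lm(?ad := ev e2 s))"
  have "exec W (comp NA (Sto a e1 e2)) l (scost \<sigma> (Sto a e1 e2)) ?l'"
    unfolding comp.simps l
  proof (rule exec_Seq'[OF 1(1)], rule exec_address)
    show "exec W (Seq (ecomp NA e2 (numVars+1)) (Store numVars (numVars+1)))
      ((lr1(numVars := ?i * NA + a + lr1 rOFF))(numVars + 1 := a), lm) (ecost e2 + 1) ?l'"
      by (rule exec_Seq'[OF 3(1)[folded off]])
        (use exec.Store[of W numVars "numVars+1" lr3 lm] ad 3(2) in auto)
  qed (use 1 le off in auto)
  moreover have "rel NA (den (Sto a e1 e2) s) ?l'"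
  proof -
    have "i * NA + a' + fst s rOFF = ?ad \<longleftrightarrow> i = ?i \<and> a' = a" if "a' < NA" for i a'
      using div_mod_unique_addr[of i NA a' ?i a] that Sto.prems(3) by auto
    then show ?thesis using Sto.prems 1 3 l by (auto simp: rel_def)
  qed
  ultimately show ?case by blast
next
  case (Sq c1 c2)
  from Sq.IH(1)[of s l] Sq.prems obtain t1 l1 where
    1: "exec W (comp NA c1) l t1 l1" "t1 \<le> scost \<sigma> c1" "rel NA (den c1 s) l1" by auto
  from Sq.IH(2)[of "den c1 s" l1] Sq.prems 1 obtain t2 l2 where
    2: "exec W (comp NA c2) l1 t2 l2" "t2 \<le> scost \<sigma> c2" "rel NA (den c2 (den c1 s)) l2" by auto
  have "exec W (comp NA (Sq c1 c2)) l (t1 + t2) l2" using 1 2 exec.Seq by auto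
  then show ?case using 1 2 by (intro exI[of _ "t1 + t2"] exI[of _ l2]) auto
next
  case (Cond e c1 c2)
  obtain lr lm where l: "l = (lr, lm)" by (cases l)
  from ecomp_correct[of NA s lr lm W e numVars] Cond.prems l obtain lr1 where
    1: "exec W (ecomp NA e numVars) (lr, lm) (ecost e) (lr1, lm)"
    "lr1 numVars = ev e s" "\<forall>r<numVars. lr1 r = lr r" by auto
  have r1: "rel NA s (lr1, lm)" using Cond.prems 1 l by (auto simp: rel_def)
  show ?case
  proof (cases "ev e s \<noteq> 0")
    case True
    with Cond.IH(1)[OF r1] Cond.prems obtain t l' where
      2: "exec W (comp NA c1) (lr1, lm) t l'" "t \<le> scost \<sigma> c1" "rel NA (den c1 s) l'" by auto
    have "exec W (comp NA (Cond e c1 c2)) l (ecost e + Suc t) l'"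
      unfolding comp.simps l
      by (rule exec_Seq'[OF 1(1)], rule exec.IfTrue[OF _ 2(1)]) (use 1 True in auto)
    then show ?thesis using 2 True by (intro exI[of _ "ecost e + Suc t"] exI[of _ l']) auto
  next
    case False
    with Cond.IH(2)[OF r1] Cond.prems obtain t l' where
      2: "exec W (comp NA c2) (lr1, lm) t l'" "t \<le> scost \<sigma> c2" "rel NA (den c2 s) l'" by auto
    have "exec W (comp NA (Cond e c1 c2)) l (ecost e + Suc t) l'"
      unfolding comp.simps l
      by (rule exec_Seq'[OF 1(1)], rule exec.IfFalse[OF _ 2(1)]) (use 1 False in auto)
    then show ?thesis using 2 False by (intro exI[of _ "ecost e + Suc t"] exI[of _ l']) auto
  qed
next
  case (For i r c)
  obtain lr lm where l: "l = (lr, lm)" by (cases l)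
  let ?n = "fst s r" let ?nv = numVars
  let ?step = "Seq (comp NA c) (Seq (Const ?nv 1) (Seq (Op Add i i ?nv) (Op Sub ?nv r i)))"
  have ir: "i < ?nv" "r < ?nv" "i \<noteq> r" "i \<notin> wr c" "r \<notin> wr c" "i \<noteq> rOFF" "chk NA c" "r \<noteq> i"
    using For.prems(3) by auto
  have W: "1 \<le> W" "?n \<le> W" using For.prems(2) by auto
  have \<sigma>: "\<sigma> r = ?n" using For.prems(4) by auto
  have fr: "fst (loop i c k s) q = fst s q" if "q \<notin> wr c" "q \<noteq> i" for k q
    by (induction k) (use that in \<open>auto simp: loop_Suc\<close>)
  \<comment> \<open>Induction on the number \<open>k\<close> of remaining rounds, since
    \<open>WhileNZ\<close> unfolds at its front; the matching store is the one after
    \<open>?n - k\<close> rounds. A round costs the body, three instructions and one test, hence the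
    \<open>+ 4\<close>; the 1 is the final failing test.\<close>
  have iter: "\<exists>t l'. exec W (WhileNZ ?nv ?step) (lr1, lm1) t l' \<and>
      t \<le> 1 + k * (scost \<sigma> c + 4) \<and> rel NA (loop i c ?n s) l'"
    if "k \<le> ?n" "rel NA (loop i c (?n - k) s) (lr1, lm1)" "lr1 ?nv = k" for k lr1 lm1
    using that
  proof (induction k arbitrary: lr1 lm1)
    case 0
    then show ?case using exec.WhileFalse[of lr1 ?nv W ?step lm1] by auto
  next
    case (Suc k)
    let ?j = "?n - Suc k" let ?s1 = "loop i c ?j s"
    have j: "?j < ?n" "Suc ?j = ?n - k" using Suc.prems by auto
    have lbs: "\<forall>q\<in>lb c. \<sigma> q = fst ?s1 q \<and> q \<notin> wr c"
      using For.prems(4) fr by auto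
    from For.IH[OF Suc.prems(2) _ ir(7) lbs] For.prems(2) j obtain t2 l2 where
      2: "exec W (comp NA c) (lr1, lm1) t2 l2" "t2 \<le> scost \<sigma> c" "rel NA (den c ?s1) l2" by auto
    obtain lr2 lm2 where l2: "l2 = (lr2, lm2)" by (cases l2)
    have i2: "lr2 i = ?j" using 2(3) l2 ir fst_loop[OF ir(4)] by (auto simp: rel_def)
    have r2: "lr2 r = ?n" using 2(3) l2 ir fr[of r ?j] by (auto simp: rel_def)
    let ?lr3 = "(lr2(i := ?n - k))(?nv := k)"
    have st: "exec W ?step (lr1, lm1) (t2 + 3) (?lr3, lm2)"
      apply (rule exec_Seq'[OF 2(1)[unfolded l2]])
       apply (rule exec_Seq', rule exec.Const, rule W)
        apply (rule exec_Seq', rule exec_Op'[where v = "?n - k"])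
          apply (use i2 ir j in simp)
         apply (use W in simp)
        apply (rule refl)
        apply (rule exec_Op'[where v = k])
          apply (use r2 ir Suc.prems W in \<open>auto simp: fun_eq_iff\<close>)
      done
    have "rel NA (loop i c (?n - k) s) (?lr3, lm2)"
      using 2(3) l2 ir fst_loop[OF ir(4), of ?j s] unfolding j(2)[symmetric] loop_Suc rel_def
      by auto
    moreover have "?lr3 ?nv = k" by simp
    ultimately obtain t4 l4 where
      4: "exec W (WhileNZ ?nv ?step) (?lr3, lm2) t4 l4" "t4 \<le> 1 + k * (scost \<sigma> c + 4)"
      "rel NA (loop i c ?n s) l4" using Suc.IH[of ?lr3 lm2] Suc.prems(1) by (meson Suc_leD)
    have "exec W (WhileNZ ?nv ?step) (lr1, lm1) (Suc (t2 + 3 + t4)) l4"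
      by (rule exec.WhileTrue[OF _ st 4(1)]) (use Suc.prems in auto)
    then show ?case using 2(2) 4
      by (intro exI[of _ "Suc (t2 + 3 + t4)"] exI[of _ l4]) auto
  qed
  let ?lr0 = "(lr(i := 0))(?nv := ?n)"
  have "rel NA (loop i c (?n - ?n) s) (?lr0, lm)"
    using For.prems(1) l ir by (auto simp: rel_def)
  from iter[OF _ this] obtain t l' where
    3: "exec W (WhileNZ ?nv ?step) (?lr0, lm) t l'" "t \<le> 1 + ?n * (scost \<sigma> c + 4)"
    "rel NA (loop i c ?n s) l'" by auto
  have "exec W (comp NA (For i r c)) l (2 + t) l'"
    unfolding comp.simps l
    apply (rule exec_Seq', rule exec.Const, simp)
     apply (rule exec_Seq', rule exec_Op'[where v = ?n and r' = ?lr0])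
       apply (use For.prems(1) l ir in \<open>simp add: rel_def\<close>)
      apply (rule W)
     apply (use ir in \<open>simp add: fun_eq_iff\<close>)
     apply (rule 3(1))
    apply simp_all
    done
  then show ?case using 3 \<sigma>
    by (intro exI[of _ "2 + t"] exI[of _ l']) (simp only: den_For, simp)
qed

subsection \<open>Absence of overflow\<close>

text \<open>The minimum with \<open>rB\<close>, expressed by truncated subtraction. Wrapping an
  expression in it makes boundedness visible in the syntax; the semantic proofs have to show that
  the wrapped value does not exceed the bound.\<close>

definition clamp :: "expr \<Rightarrow> expr" where
  "clamp e = Bop Sub e (Bop Sub e (Vr rB))"

lemma ev_clamp: "ev (clamp e) s = min (ev e s) (fst s rB)"
  by (simp add: clamp_def)

text \<open>Expressions whose value cannot exceed a common bound, at least \<open>kb\<close>, of all registers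
  and cells; register \<open>rB\<close> holds that bound.\<close>

fun bd :: "nat \<Rightarrow> expr \<Rightarrow> bool" where
  "bd kb (Vr r) \<longleftrightarrow> True"
| "bd kb (Kn k) \<longleftrightarrow> k \<le> kb"
| "bd kb (Ar a e) \<longleftrightarrow> True"
| "bd kb (Bop Sub e1 e2) \<longleftrightarrow> bd kb e1 \<or> e2 = Bop Sub e1 (Vr rB)"
| "bd kb (Bop Div e1 e2) \<longleftrightarrow> bd kb e1"
| "bd kb (Bop Mod e1 e2) \<longleftrightarrow> bd kb e1"
| "bd kb (Bop Add e1 e2) \<longleftrightarrow> False"
| "bd kb (Bop Mul e1 e2) \<longleftrightarrow> False"

lemma bd_clamp [simp]: "bd kb (clamp e)"
  by (simp add: clamp_def)

fun sbd :: "nat \<Rightarrow> stmt \<Rightarrow> bool" where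
  "sbd kb (Asg r e) \<longleftrightarrow> r \<noteq> rB \<and> bd kb e"
| "sbd kb (Sto a e1 e2) \<longleftrightarrow> bd kb e2"
| "sbd kb (Sq c1 c2) \<longleftrightarrow> sbd kb c1 \<and> sbd kb c2"
| "sbd kb (Cond e c1 c2) \<longleftrightarrow> sbd kb c1 \<and> sbd kb c2"
| "sbd kb (For i r c) \<longleftrightarrow> i \<noteq> rB \<and> i \<notin> wr c \<and> sbd kb c"

definition bounded_store :: "nat \<Rightarrow> store \<Rightarrow> bool" where
  "bounded_store B s \<longleftrightarrow> fst s rB = B \<and> (\<forall>r. fst s r \<le> B) \<and> (\<forall>a i. snd s a i \<le> B)"

lemma bounded_storeD:
  assumes "bounded_store B s"
  shows "fst s rB = B" "fst s r \<le> B" "snd s a i \<le> B"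
  using assms by (auto simp: bounded_store_def)

lemma ev_le_bound: "bounded_store B s \<Longrightarrow> kb \<le> B \<Longrightarrow> bd kb e \<Longrightarrow> ev e s \<le> B"
proof (induction kb e rule: bd.induct)
  case (4 kb e1 e2)
  then show ?case
    by (auto simp: bounded_store_def intro: le_trans[OF diff_le_self])
next
  case (5 kb e1 e2)
  then show ?case by (auto intro: le_trans[OF div_le_dividend])
next
  case (6 kb e1 e2)
  then show ?case by (auto intro: le_trans[OF mod_less_eq_dividend])
qed (auto simp: bounded_store_def)

text \<open>An exponent rather than a mere size: the value of \<open>e\<close> is at most
  \<open>(B + 2) ^ esz NA e\<close>, since sums and products of powers with positive exponents are
  covered by adding the exponents. A constant \<open>k\<close> gets \<open>k + 1\<close>, which
  suffices as the base is at least 2.\<close>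

fun esz :: "nat \<Rightarrow> expr \<Rightarrow> nat" where
  "esz NA (Vr r) = 1"
| "esz NA (Kn k) = k + 1"
| "esz NA (Ar a e) = esz NA e + NA + a + 3"
| "esz NA (Bop f e1 e2) = esz NA e1 + esz NA e2"

fun ssz :: "nat \<Rightarrow> stmt \<Rightarrow> nat" where
  "ssz NA (Asg r e) = esz NA e"
| "ssz NA (Sto a e1 e2) = esz NA e1 + NA + a + 3 + esz NA e2"
| "ssz NA (Sq c1 c2) = ssz NA c1 + ssz NA c2"
| "ssz NA (Cond e c1 c2) = esz NA e + ssz NA c1 + ssz NA c2"
| "ssz NA (For i r c) = ssz NA c + 1"

lemma esz_pos: "1 \<le> esz NA e"
  by (induction e) auto

text \<open>With base at least 2 and positive exponents both powers are at least 2, and for such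
  numbers the sum is at most the product.\<close>

lemma add_le_power:
  fixes b :: nat
  assumes "2 \<le> b" "x \<le> b ^ i" "y \<le> b ^ j" "1 \<le> i" "1 \<le> j"
  shows "x + y \<le> b ^ (i + j)"
proof -
  have "b ^ 1 \<le> b ^ i" "b ^ 1 \<le> b ^ j"
    using assms by (intro power_increasing; simp)+
  then have "2 \<le> b ^ i" "2 \<le> b ^ j" using assms(1) by simp_all
  then obtain u v where "b ^ i = 2 + u" "b ^ j = 2 + v" by (metis le_Suc_ex)
  then have "b ^ i + b ^ j \<le> b ^ i * b ^ j" by simp
  with assms show ?thesis by (simp add: power_add)
qed

lemma apply_binop_le_power:
  fixes b :: nat
  assumes "2 \<le> b" "x \<le> b ^ i" "y \<le> b ^ j" "1 \<le> i" "1 \<le> j"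
  shows "apply_binop f x y \<le> b ^ (i + j)"
proof -
  have x: "x \<le> b ^ (i + j)"
    by (rule le_trans[OF assms(2)], rule power_increasing) (use assms(1) in auto)
  show ?thesis
  proof (cases f)
    case Add
    then show ?thesis using add_le_power[OF assms] by simp
  next
    case Mul
    then show ?thesis using mult_le_mono[OF assms(2,3)] by (simp add: power_add)
  qed (use x in \<open>auto intro: le_trans[OF diff_le_self] le_trans[OF div_le_dividend]
     le_trans[OF mod_less_eq_dividend]\<close>)
qed

text \<open>\<open>NA\<close>, \<open>a\<close> and \<open>off\<close> are absorbed by powers with
  exponents \<open>NA + 1\<close>, \<open>a + 1\<close> and 1; the three ones make up the constant
  3.\<close>

lemma address_le_power:
  fixes b :: nat
  assumes "2 \<le> b" "v \<le> b ^ k" "1 \<le> k" "off \<le> b"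
  shows "v * NA + a + off \<le> b ^ (k + NA + a + 3)"
proof -
  have n: "n \<le> b ^ (n + 1)" for n
  proof -
    have "n \<le> 2 ^ (n + 1)" by (rule le_trans[OF less_imp_le_nat[OF less_exp] power_increasing]) auto
    also have "\<dots> \<le> b ^ (n + 1)" by (rule power_mono) (use assms(1) in auto)
    finally show ?thesis .
  qed
  have "v * NA \<le> b ^ (k + (NA + 1))" using mult_le_mono[OF assms(2) n[of NA]] by (simp add: power_add algebra_simps)
  from add_le_power[OF assms(1) this n] have "v * NA + a \<le> b ^ (k + (NA + 1) + (a + 1))" by simp
  from add_le_power[OF assms(1) this, of off 1] assms(4)
  show ?thesis by (simp add: algebra_simps numeral_3_eq_3)
qed

lemma ev_le_power:
  assumes "bounded_store B s"
  shows "ev e s \<le> (B + 2) ^ esz NA e"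
proof (induction e)
  case (Vr r)
  then show ?case using bounded_storeD(2)[OF assms, of r] by simp
next
  case (Kn k)
  have "k \<le> 2 ^ (k + 1)" by (rule le_trans[OF less_imp_le_nat[OF less_exp] power_increasing]) auto
  also have "\<dots> \<le> (B + 2) ^ (k + 1)" by (rule power_mono) auto
  finally show ?case by simp
next
  case (Ar a e)
  have "ev (Ar a e) s \<le> (B + 2) ^ 1"
    using bounded_storeD(3)[OF assms, of a "ev e s"] by simp
  also have "\<dots> \<le> (B + 2) ^ esz NA (Ar a e)" by (rule power_increasing) auto
  finally show ?case .
next
  case (Bop f e1 e2)
  then show ?case using apply_binop_le_power[of "B + 2"] esz_pos by simp
qed

lemma nat_le_power: "n \<le> (B + 2) ^ (n :: nat)"
proof -
  have "n \<le> 2 ^ n" by (simp add: less_imp_le_nat)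
  also have "\<dots> \<le> (B + 2) ^ n" by (rule power_mono) auto
  finally show ?thesis .
qed

lemma power_le_imp_le_power:
  "(B + 2 :: nat) ^ n \<le> W \<Longrightarrow> m \<le> n \<Longrightarrow> (B + 2) ^ m \<le> W"
  by (erule le_trans[rotated], rule power_increasing) auto

lemma nat_le_word: "(B + 2 :: nat) ^ n \<le> W \<Longrightarrow> m \<le> n \<Longrightarrow> m \<le> W"
  by (rule le_trans[OF nat_le_power power_le_imp_le_power])

lemma okE_static:
  assumes "bounded_store B s" "(B + 2) ^ esz NA e \<le> W"
  shows "okE NA W e s"
  using assms(2)
proof (induction e)
  case (Vr r)
  have "fst s r \<le> (B + 2) ^ 1" using bounded_storeD(2)[OF assms(1), of r] by simp
  also have "\<dots> \<le> W" using Vr by simp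
  finally show ?case by simp
next
  case (Kn k)
  then show ?case using nat_le_word[of B "k+1" W k] by simp
next
  case (Ar a e)
  from Ar.prems have W: "(B + 2) ^ (esz NA e + NA + a + 3) \<le> W" by simp
  have "ev e s * NA + a + fst s rOFF \<le> (B + 2) ^ (esz NA e + NA + a + 3)"
    using address_le_power[of "B + 2" "ev e s" "esz NA e" "fst s rOFF" NA a]
      ev_le_power[OF assms(1), of e NA] bounded_storeD(2)[OF assms(1), of rOFF] esz_pos by simp
  moreover have "snd s a (ev e s) \<le> (B + 2) ^ 1"
    using bounded_storeD(3)[OF assms(1), of a "ev e s"] by simp
  moreover have "(B + 2) ^ 1 \<le> W" by (rule power_le_imp_le_power[OF W]) simp
  moreover have "okE NA W e s" by (rule Ar.IH, rule power_le_imp_le_power[OF W]) simp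
  moreover have "NA \<le> W" "a \<le> W" by (rule nat_le_word[OF W], simp)+
  ultimately show ?case using W by simp
next
  case (Bop f e1 e2)
  then show ?case
    using power_le_imp_le_power[OF Bop.prems, of "esz NA e1"]
      power_le_imp_le_power[OF Bop.prems, of "esz NA e2"]
      le_trans[OF ev_le_power[OF assms(1), of "Bop f e1 e2" NA] Bop.prems] by simp
qed

text \<open>Excludes overflow for a whole program without knowing what it computes: the syntactic
  test \<open>sbd\<close> keeps all registers and cells below \<open>B\<close>, and every
  intermediate value is bounded by a fixed power of \<open>B + 2\<close>.\<close>

lemma ok_static:
  assumes "bounded_store B s" "kb \<le> B" "sbd kb c" "(B + 2) ^ ssz NA c \<le> W"
  shows "ok NA W c s \<and> bounded_store B (den c s)"
  using assms(1,3,4)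
proof (induction c arbitrary: s)
  case (Asg r e)
  have "okE NA W e s" using okE_static[OF Asg.prems(1)] Asg.prems(3) by simp
  moreover have "ev e s \<le> B" using ev_le_bound[OF Asg.prems(1) assms(2)] Asg.prems by simp
  moreover have "(B + 2) ^ 1 \<le> W"
    using power_le_imp_le_power[of B "esz NA e" W 1] esz_pos Asg.prems by simp
  ultimately show ?case using Asg.prems by (auto simp: bounded_store_def)
next
  case (Sto a e1 e2)
  let ?n = "esz NA e1 + NA + a + 3"
  have W: "(B + 2) ^ ?n \<le> W" "(B + 2) ^ esz NA e1 \<le> W" "(B + 2) ^ esz NA e2 \<le> W"
    using power_le_imp_le_power[of B "ssz NA (Sto a e1 e2)" W] Sto.prems(3) by auto
  have "ev e1 s * NA + a + fst s rOFF \<le> (B + 2) ^ ?n"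
    using address_le_power[of "B + 2" "ev e1 s" "esz NA e1" "fst s rOFF" NA a]
      ev_le_power[OF Sto.prems(1), of e1 NA] bounded_storeD(2)[OF Sto.prems(1), of rOFF] esz_pos
    by simp
  moreover have "ev e2 s \<le> B" using ev_le_bound[OF Sto.prems(1) assms(2)] Sto.prems by simp
  ultimately show ?case
    using okE_static[OF Sto.prems(1) W(2)] okE_static[OF Sto.prems(1) W(3)] W
      nat_le_word[OF W(1), of NA] nat_le_word[OF W(1), of a] Sto.prems(1)
    by (auto simp: bounded_store_def)
next
  case (Sq c1 c2)
  then show ?case
    using power_le_imp_le_power[of B "ssz NA (Sq c1 c2)" W "ssz NA c1"]
      power_le_imp_le_power[of B "ssz NA (Sq c1 c2)" W "ssz NA c2"] by simp
next
  case (Cond e c1 c2)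
  have W: "(B + 2) ^ esz NA e \<le> W" "(B + 2) ^ ssz NA c1 \<le> W" "(B + 2) ^ ssz NA c2 \<le> W"
    using power_le_imp_le_power[of B "ssz NA (Cond e c1 c2)" W] Cond.prems(3) by auto
  show ?case using okE_static[OF Cond.prems(1) W(1)] Cond W by simp
next
  case (For i r c)
  have W: "(B + 2) ^ ssz NA c \<le> W" "(B + 2) ^ 1 \<le> W"
    by (rule power_le_imp_le_power[OF For.prems(3)], simp)+
  have i: "i \<notin> wr c" "sbd kb c" "i \<noteq> rB" using For.prems(2) by auto
  have inv: "bounded_store B (loop i c k s)" if "k \<le> fst s r" for k
    using that
  proof (induction k)
    case 0
    then show ?case using For.prems i by (auto simp: bounded_store_def)
  next
    case (Suc k)
    \<comment> \<open>The counter is incremented without a clamp, yet it stays bounded because it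
      never passes the value of its bound register.\<close>
    have "Suc k \<le> B" using Suc.prems For.prems(1) le_trans unfolding bounded_store_def by blast
    then show ?case
      using For.IH[of "loop i c k s"] Suc i W(1) fst_loop[OF i(1), of k s]
      by (auto simp: loop_Suc bounded_store_def)
  qed
  have "ok NA W c (loop i c k s)" if "k < fst s r" for k
    using For.IH[OF inv i(2) W(1)] that by simp
  moreover have "fst s r \<le> B" using For.prems(1) by (auto simp: bounded_store_def)
  ultimately show ?case using inv[of "fst s r"] W(2) by (simp only: den_For ok.simps) auto
qed

section \<open>Base-q digits\<close>

definition dig :: "nat \<Rightarrow> nat \<Rightarrow> nat \<Rightarrow> nat" where
  "dig q j i = i div q ^ j mod q"

definition enc :: "nat \<Rightarrow> nat \<Rightarrow> (nat \<Rightarrow> nat) \<Rightarrow> nat" where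
  "enc q t \<delta> = (\<Sum>k<t. \<delta> k * q ^ k)"

lemma enc_Suc: "enc q (Suc t) \<delta> = enc q t \<delta> + \<delta> t * q ^ t"
  by (simp add: enc_def)

lemma enc_0 [simp]: "enc q 0 \<delta> = 0"
  by (simp add: enc_def)

lemma enc_less: "(\<And>k. k < t \<Longrightarrow> \<delta> k < q) \<Longrightarrow> enc q t \<delta> < q ^ t"
proof (induction t)
  case (Suc t)
  have "\<delta> t * q ^ t + q ^ t \<le> q * q ^ t"
    using mult_le_mono1[of "Suc (\<delta> t)" q "q ^ t"] Suc.prems[of t] by simp
  moreover have "enc q t \<delta> < q ^ t" using Suc by simp
  ultimately show ?case by (simp add: enc_Suc)
qed simp

lemma dig_less: "0 < q \<Longrightarrow> dig q j i < q"
  by (simp add: dig_def)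

lemma dig_enc:
  assumes "\<And>k. k < t \<Longrightarrow> \<delta> k < q" "j < t"
  shows "dig q j (enc q t \<delta>) = \<delta> j"
  using assms
proof (induction t)
  case (Suc t)
  have q: "0 < q" using Suc.prems(1)[OF Suc.prems(2)] by simp
  show ?case
  proof (cases "j = t")
    case True
    have "enc q t \<delta> < q ^ t" using Suc.prems by (intro enc_less) auto
    then show ?thesis using True q Suc.prems(1)[of t] by (simp add: dig_def enc_Suc)
  next
    case False
    then have j: "j < t" using Suc.prems by simp
    \<comment> \<open>The top term is a multiple of \<open>q * q ^ j\<close>, so it disappears when
      digit \<open>j\<close> is extracted.\<close>
    then have "q ^ t = q ^ j * (q * q ^ (t - Suc j))"
      by (simp flip: power_Suc power_add add: Suc_diff_Suc)
    then have "enc q (Suc t) \<delta> = enc q t \<delta> + q ^ j * (q * (\<delta> t * q ^ (t - Suc j)))"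
      by (simp add: enc_Suc algebra_simps)
    then have "enc q (Suc t) \<delta> div q ^ j = enc q t \<delta> div q ^ j + q * (\<delta> t * q ^ (t - Suc j))"
      using q by simp
    then show ?thesis using Suc j by (simp add: dig_def)
  qed
qed simp

lemma enc_dig:
  assumes "i < q ^ t"
  shows "enc q t (\<lambda>k. dig q k i) = i"
proof -
  have "enc q t (\<lambda>k. dig q k i) = i mod q ^ t"
  proof (induction t)
    case (Suc t)
    have "i mod q ^ Suc t = q ^ t * (i div q ^ t mod q) + i mod q ^ t"
        using mod_mult2_eq[of i "q ^ t" q] by (simp add: mult.commute)
    then show ?case using Suc by (simp add: enc_Suc dig_def)
  qed simp
  with assms show ?thesis by simp
qed

lemma enc_cong: "(\<And>k. k < t \<Longrightarrow> \<delta> k = \<delta>' k) \<Longrightarrow> enc q t \<delta> = enc q t \<delta>'"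
  by (simp add: enc_def)

lemma dig_ext:
  assumes "i < q ^ t" "i' < q ^ t" "\<And>k. k < t \<Longrightarrow> dig q k i = dig q k i'"
  shows "i = i'"
proof -
  have "enc q t (\<lambda>k. dig q k i) = enc q t (\<lambda>k. dig q k i')" by (rule enc_cong) (rule assms(3))
  then show ?thesis by (simp only: enc_dig[OF assms(1)] enc_dig[OF assms(2)])
qed

lemma enc_upd: "j < t \<Longrightarrow> enc q t (\<delta>(j := x)) + \<delta> j * q ^ j = enc q t \<delta> + x * q ^ j"
  unfolding enc_def
  by (simp add: sum.remove[of "{..<t}" j])

definition upd :: "nat \<Rightarrow> nat \<Rightarrow> nat \<Rightarrow> nat \<Rightarrow> nat \<Rightarrow> nat" where
  "upd q t j x i = enc q t ((\<lambda>k. dig q k i)(j := x))"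

lemma upd_less: "0 < q \<Longrightarrow> x < q \<Longrightarrow> upd q t j x i < q ^ t"
  unfolding upd_def by (rule enc_less) (auto simp: dig_less)

lemma dig_upd: "0 < q \<Longrightarrow> x < q \<Longrightarrow> k < t \<Longrightarrow> dig q k (upd q t j x i) = (if k = j then x else dig q k i)"
  unfolding upd_def by (subst dig_enc) (auto simp: dig_less)

text \<open>Lowering one digit means subtracting one power of \<open>q\<close>; this is how the
  program reaches the neighbouring states of a transform without decoding the state.\<close>

lemma upd_dec: "i < q ^ t \<Longrightarrow> j < t \<Longrightarrow> 0 < dig q j i \<Longrightarrow> i - q ^ j = upd q t j (dig q j i - 1) i"
  using enc_upd[of j t q "\<lambda>k. dig q k i" "dig q j i - 1"] enc_dig[of i q t]
  by (cases "dig q j i") (auto simp: upd_def)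

lemma upd_inc: "i < q ^ t \<Longrightarrow> j < t \<Longrightarrow> i + q ^ j = upd q t j (Suc (dig q j i)) i"
  using enc_upd[of j t q "\<lambda>k. dig q k i" "Suc (dig q j i)"] enc_dig[of i q t]
  by (auto simp: upd_def)

section \<open>Ranked subset convolution\<close>

text \<open>The digit of a bag vertex is \<open>0\<close> if it is uncoloured, \<open>2 * i - 1\<close> if it has colour \<open>i\<close> and is
  not matched yet, and \<open>2 * i\<close> if it has colour \<open>i\<close> and is matched.\<close>

definition isM :: "nat \<Rightarrow> bool" where
  "isM d \<longleftrightarrow> 0 < d \<and> even d"

definition col :: "nat \<Rightarrow> nat" where
  "col d = Suc d div 2"

lemma isM_0 [simp]: "\<not> isM 0"
  by (simp add: isM_def)

lemma isM_dec: "isM d \<Longrightarrow> \<not> isM (d - 1) \<and> col (d - 1) = col d \<and> d - 1 \<noteq> d \<and> 0 < d \<and> d - 1 < d"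
  by (auto simp: isM_def col_def elim!: evenE)

lemma col_eq_cases:
  "col d1 = col d \<longleftrightarrow> d1 = d \<or> isM d \<and> d1 = d - 1 \<or> odd d \<and> d1 = d + 1"
  unfolding col_def isM_def by presburger

lemma col_pos: "0 < col d \<longleftrightarrow> 0 < d"
  by (auto simp: col_def)

lemma eq_if_col_eq: "col d1 = col d \<Longrightarrow> isM d1 = isM d \<Longrightarrow> d1 = d"
  unfolding col_def isM_def by presburger

lemma not_isM_if_col_eq: "col d1 = col d \<Longrightarrow> isM d \<Longrightarrow> \<not> isM d1 \<Longrightarrow> d1 = d - 1"
  unfolding col_def isM_def by presburger

text \<open>Zeta and Moebius transforms are computed one bag position at a time; the sets with index \<open>j\<close>
  are the summation ranges after the first \<open>j\<close> positions.\<close>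

definition rk :: "nat \<Rightarrow> nat \<Rightarrow> nat \<Rightarrow> nat" where
  "rk q t i = card {k. k < t \<and> isM (dig q k i)}"

definition zset :: "nat \<Rightarrow> nat \<Rightarrow> nat \<Rightarrow> nat \<Rightarrow> nat set" where
  "zset q t j i = {i1. i1 < q ^ t \<and> (\<forall>k<t. dig q k i1 = dig q k i \<or>
     k < j \<and> isM (dig q k i) \<and> dig q k i1 = dig q k i - 1)}"

definition zcount :: "nat \<Rightarrow> nat \<Rightarrow> (nat \<Rightarrow> bool) \<Rightarrow> nat \<Rightarrow> nat \<Rightarrow> nat" where
  "zcount q t P j i = card {i1 \<in> zset q t j i. P i1}"

text \<open>Partial Moebius inversion described without signs: after \<open>j\<close> positions, the
  pairs left are those whose matched sets cover the matched positions of \<open>i\<close> below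
  \<open>j\<close>. Each inversion step removes a subset of the pairs, so subtraction on natural
  numbers is exact.\<close>

definition mset :: "nat \<Rightarrow> nat \<Rightarrow> (nat \<Rightarrow> bool) \<Rightarrow> (nat \<Rightarrow> bool) \<Rightarrow> nat \<Rightarrow> nat \<Rightarrow> (nat \<times> nat) set" where
  "mset q t P Q j i = {(i1, i2). i1 \<in> zset q t t i \<and> P i1 \<and> i2 \<in> zset q t t i \<and> Q i2 \<and>
     (\<forall>k<j. isM (dig q k i) \<longrightarrow> isM (dig q k i1) \<or> isM (dig q k i2))}"

definition mcount :: "nat \<Rightarrow> nat \<Rightarrow> (nat \<Rightarrow> bool) \<Rightarrow> (nat \<Rightarrow> bool) \<Rightarrow> nat \<Rightarrow> nat \<Rightarrow> nat" where
  "mcount q t P Q j i = card (mset q t P Q j i)"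

definition cset :: "nat \<Rightarrow> nat \<Rightarrow> nat \<Rightarrow> nat \<Rightarrow> nat set" where
  "cset q t j i = {i1. i1 < q ^ t \<and> (\<forall>k<t. if k < j then col (dig q k i1) = col (dig q k i)
     else dig q k i1 = dig q k i)}"

definition cmax :: "nat \<Rightarrow> nat \<Rightarrow> (nat \<Rightarrow> nat) \<Rightarrow> nat \<Rightarrow> nat \<Rightarrow> nat" where
  "cmax q t f j i = Max (f ` cset q t j i)"

text \<open>A vertex has at most one matching edge, so it may be matched on only one side of a join,
  while its colour is common to both sides.\<close>

definition jn :: "nat \<Rightarrow> nat \<Rightarrow> nat \<Rightarrow> nat \<Rightarrow> nat \<Rightarrow> bool" where
  "jn q t i1 i2 i \<longleftrightarrow> (\<forall>k<t. col (dig q k i1) = col (dig q k i) \<and> col (dig q k i2) = col (dig q k i) \<and>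
     \<not> (isM (dig q k i1) \<and> isM (dig q k i2)) \<and>
     (isM (dig q k i) \<longleftrightarrow> isM (dig q k i1) \<or> isM (dig q k i2)))"

lemma finite_zset [simp]: "finite (zset q t j i)"
  by (rule finite_subset[of _ "{..<q ^ t}"]) (auto simp: zset_def)

lemma finite_cset [simp]: "finite (cset q t j i)"
  by (rule finite_subset[of _ "{..<q ^ t}"]) (auto simp: cset_def)

lemma finite_mset [simp]: "finite (mset q t P Q j i)"
  by (rule finite_subset[of _ "zset q t t i \<times> zset q t t i"]) (auto simp: mset_def)

lemma zcount_le: "zcount q t P j i \<le> q ^ t"
  unfolding zcount_def
  using card_mono[of "{..<q ^ t}" "{i1 \<in> zset q t j i. P i1}"] by (auto simp: zset_def)

lemma mcount_le: "mcount q t P Q j i \<le> q ^ t * q ^ t"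
  unfolding mcount_def
  using card_mono[of "{..<q ^ t} \<times> {..<q ^ t}" "mset q t P Q j i"]
  by (auto simp: zset_def mset_def card_cartesian_product)

lemma zset_0: "i < q ^ t \<Longrightarrow> zset q t 0 i = {i}"
  by (auto simp: zset_def intro: dig_ext)

lemma cset_0: "i < q ^ t \<Longrightarrow> cset q t 0 i = {i}"
  by (auto simp: cset_def intro: dig_ext)

lemma zcount_0: "i < q ^ t \<Longrightarrow> zcount q t P 0 i = (if P i then 1 else 0)"
proof -
  assume "i < q ^ t"
  then have "{i1 \<in> zset q t 0 i. P i1} = (if P i then {i} else {})" by (auto simp: zset_0)
  then show ?thesis by (simp add: zcount_def)
qed

lemma cmax_0: "i < q ^ t \<Longrightarrow> cmax q t f 0 i = f i"
  by (simp add: cmax_def cset_0)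

lemma mcount_0: "mcount q t P Q 0 i = zcount q t P t i * zcount q t Q t i"
proof -
  have "mset q t P Q 0 i = {i1 \<in> zset q t t i. P i1} \<times> {i1 \<in> zset q t t i. Q i1}"
    by (auto simp: mset_def)
  then show ?thesis by (simp add: mcount_def zcount_def card_cartesian_product)
qed

context
  fixes q t j i :: nat
  assumes q: "0 < q" and i: "i < q ^ t" and j: "j < t"
begin

lemma dig_dec:
  assumes "isM (dig q j i)" "k < t"
  shows "dig q k (i - q ^ j) = (if k = j then dig q j i - 1 else dig q k i)"
  using upd_dec[OF i j] dig_upd[of q "dig q j i - 1" k t j i] isM_dec[OF assms(1)] assms(2) q
    dig_less[OF q, of j i] by auto

text \<open>At position \<open>j\<close> a matched digit is either kept or lowered to the unmatched
  digit of the same colour. The states of the second kind form the range of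
  \<open>i - q ^ j\<close>, whose digit at \<open>j\<close> is already lowered.\<close>

lemma zset_Suc:
  "zset q t (Suc j) i = zset q t j i \<union> (if isM (dig q j i) then zset q t j (i - q ^ j) else {})"
proof (cases "isM (dig q j i)")
  case True
  note d = dig_dec[OF True] isM_dec[OF True]
  show ?thesis
  proof (intro set_eqI iffI)
    fix x assume "x \<in> zset q t (Suc j) i"
    then show "x \<in> zset q t j i \<union> (if isM (dig q j i) then zset q t j (i - q ^ j) else {})"
      using True d j by (auto simp: zset_def less_Suc_eq)
  next
    fix x assume "x \<in> zset q t j i \<union> (if isM (dig q j i) then zset q t j (i - q ^ j) else {})"
    then show "x \<in> zset q t (Suc j) i"
      using True d j by (fastforce simp: zset_def less_Suc_eq split: if_splits)
  qed
next
  case False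
  then show ?thesis by (auto simp: zset_def less_Suc_eq)
qed

lemma zset_disjoint:
  assumes "isM (dig q j i)"
  shows "zset q t j i \<inter> zset q t j (i - q ^ j) = {}"
proof -
  have "dig q j x = dig q j i" if "x \<in> zset q t j i" for x using that j by (auto simp: zset_def)
  moreover have "dig q j x = dig q j i - 1" if "x \<in> zset q t j (i - q ^ j)" for x
    using that j dig_dec[OF assms j] by (auto simp: zset_def)
  ultimately show ?thesis using isM_dec[OF assms] by fastforce
qed

lemma zcount_Suc:
  "zcount q t P (Suc j) i =
     zcount q t P j i + (if isM (dig q j i) then zcount q t P j (i - q ^ j) else 0)"
proof (cases "isM (dig q j i)")
  case True
  have "{i1 \<in> zset q t (Suc j) i. P i1} =
      {i1 \<in> zset q t j i. P i1} \<union> {i1 \<in> zset q t j (i - q ^ j). P i1}"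
    using zset_Suc True by auto
  moreover have "{i1 \<in> zset q t j i. P i1} \<inter> {i1 \<in> zset q t j (i - q ^ j). P i1} = {}"
    using zset_disjoint[OF True] by auto
  ultimately show ?thesis using True by (simp add: zcount_def card_Un_disjoint)
next
  case False
  then show ?thesis using zset_Suc by (simp add: zcount_def)
qed

lemma zset_dec:
  assumes "isM (dig q j i)"
  shows "x \<in> zset q t t (i - q ^ j) \<longleftrightarrow> x \<in> zset q t t i \<and> \<not> isM (dig q j x)"
proof -
  note d = dig_dec[OF assms] isM_dec[OF assms]
  show ?thesis
  proof
    assume x: "x \<in> zset q t t (i - q ^ j)"
    then have "dig q j x = dig q j i - 1" using d j by (auto simp: zset_def)
    then show "x \<in> zset q t t i \<and> \<not> isM (dig q j x)"
      using x d assms by (fastforce simp: zset_def split: if_splits)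
  next
    assume x: "x \<in> zset q t t i \<and> \<not> isM (dig q j x)"
    then have "dig q j x = dig q j i - 1" using assms j by (auto simp: zset_def)
    then show "x \<in> zset q t t (i - q ^ j)" using x d j by (auto simp: zset_def)
  qed
qed

text \<open>The pairs to be removed are those in which neither state is matched at position
  \<open>j\<close>. By \<open>zset_dec\<close> these are exactly the pairs belonging to
  \<open>i - q ^ j\<close>.\<close>

lemma mcount_Suc:
  "mcount q t P Q (Suc j) i =
     mcount q t P Q j i - (if isM (dig q j i) then mcount q t P Q j (i - q ^ j) else 0)"
proof (cases "isM (dig q j i)")
  case True
  have d: "dig q k (i - q ^ j) = dig q k i" if "k < j" for k
    using dig_dec[OF True, of k] that j by simp
  have "mset q t P Q (Suc j) i = mset q t P Q j i - mset q t P Q j (i - q ^ j)"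
    using True d by (auto simp: mset_def zset_dec[OF True] less_Suc_eq)
  moreover have "mset q t P Q j (i - q ^ j) \<subseteq> mset q t P Q j i"
    using d by (auto simp: mset_def zset_dec[OF True])
  ultimately show ?thesis using True by (simp add: mcount_def card_Diff_subset)
next
  case False
  then have "mset q t P Q (Suc j) i = mset q t P Q j i" by (auto simp: mset_def less_Suc_eq)
  then show ?thesis using False by (simp add: mcount_def)
qed

text \<open>Exchanges the two digits \<open>2 * k - 1\<close> and \<open>2 * k\<close> of a colour
  at position \<open>j\<close> and fixes 0. The closed form can be evaluated without a conditional:
  an odd digit goes up, a matched one goes down.\<close>

definition partner :: nat where
  "partner = i + (dig q j i mod 2) * q ^ j - (if isM (dig q j i) then 1 else 0) * q ^ j"

lemma dig_partner:
  assumes "odd q"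
  shows "partner < q ^ t" and "k < t \<Longrightarrow> dig q k partner =
    (if k = j then (if dig q j i = 0 then 0 else if isM (dig q j i) then dig q j i - 1 else dig q j i + 1)
     else dig q k i)"
proof -
  let ?d = "dig q j i"
  let ?x = "if ?d = 0 then 0 else if isM ?d then ?d - 1 else ?d + 1"
  have lt: "?d < q" using dig_less[OF q] .
  \<comment> \<open>Only odd digits are raised, and an odd digit is never the largest one because
    \<open>q - 1\<close> is even.\<close>
  have x: "?x < q" using lt assms
    by (auto simp: isM_def intro: less_imp_diff_less) (metis Suc_lessI even_Suc)
  have "partner = upd q t j ?x i"
  proof (cases "?d = 0 \<or> isM ?d")
    case True
    then show ?thesis
    proof
      assume "?d = 0"
      then have "partner = i" by (simp add: partner_def)
      moreover have "upd q t j 0 i = i"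
        by (rule dig_ext[of _ q t])
          (use \<open>?d = 0\<close> q i upd_less[of q 0 t j i] dig_upd[of q 0] in auto)
      ultimately show ?thesis using \<open>?d = 0\<close> by simp
    next
      assume m: "isM ?d"
      then have "partner = i - q ^ j" by (simp add: partner_def isM_def even_iff_mod_2_eq_zero)
      then show ?thesis using upd_dec[OF i j] m by (auto simp: isM_def)
    qed
  next
    case False
    then have "odd ?d" by (auto simp: isM_def)
    then have "partner = i + q ^ j" using False by (simp add: partner_def odd_iff_mod_2_eq_one)
    then show ?thesis using upd_inc[OF i j] False by auto
  qed
  then show "partner < q ^ t" "k < t \<Longrightarrow> dig q k partner = (if k = j then ?x else dig q k i)"
    using upd_less[OF q x] dig_upd[OF q x] by simp_all
qed

text \<open>A colour has at most two digits, so allowing position \<open>j\<close> to vary within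
  its colour adds just the class of the partner.\<close>

lemma cset_Suc:
  assumes "odd q"
  shows "cset q t (Suc j) i = cset q t j i \<union> cset q t j partner"
proof -
  note d = dig_partner(2)[OF assms]
  have dj: "dig q j partner = (if dig q j i = 0 then 0 else if isM (dig q j i) then dig q j i - 1 else dig q j i + 1)"
    using d[OF j] by simp
  have dk: "dig q k partner = dig q k i" if "k < t" "k \<noteq> j" for k using d that by simp
  have c: "col x = col (dig q j i) \<longleftrightarrow> x = dig q j i \<or> x = dig q j partner" for x
    unfolding dj using col_eq_cases[of x "dig q j i"] by (auto simp: isM_def)
  show ?thesis
  proof (intro set_eqI iffI)
    fix x assume x: "x \<in> cset q t (Suc j) i"
    then have "dig q j x = dig q j i \<or> dig q j x = dig q j partner" using c j by (auto simp: cset_def)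
    then show "x \<in> cset q t j i \<union> cset q t j partner"
      using x dk by (auto simp: cset_def less_Suc_eq) (metis nat_neq_iff)+
  next
    fix x assume x: "x \<in> cset q t j i \<union> cset q t j partner"
    then have "dig q j x = dig q j i \<or> dig q j x = dig q j partner" using j by (auto simp: cset_def)
    then have "col (dig q j x) = col (dig q j i)" using c by auto
    then show "x \<in> cset q t (Suc j) i" using x dk by (auto simp: cset_def less_Suc_eq)
  qed
qed

lemma cmax_Suc:
  assumes "odd q"
  shows "cmax q t f (Suc j) i = max (cmax q t f j i) (cmax q t f j partner)"
proof -
  have "i \<in> cset q t j i" "partner \<in> cset q t j partner"
    using i dig_partner(1)[OF assms] by (auto simp: cset_def)
  then show ?thesis unfolding cmax_def cset_Suc[OF assms] image_Un by (subst Max_Un) auto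
qed

end

lemma zset_col: "i1 \<in> zset q t t i \<Longrightarrow> k < t \<Longrightarrow> col (dig q k i1) = col (dig q k i)"
  by (auto simp: zset_def col_eq_cases)

lemma cmax_col_eq:
  assumes "\<And>k. k < t \<Longrightarrow> col (dig q k i1) = col (dig q k i)"
  shows "cmax q t f t i1 = cmax q t f t i"
  using assms by (simp add: cmax_def cset_def)

lemma cmax_ge: "i1 < q ^ t \<Longrightarrow> (\<And>k. k < t \<Longrightarrow> col (dig q k i1) = col (dig q k i)) \<Longrightarrow>
    f i1 \<le> cmax q t f t i"
  unfolding cmax_def by (rule Max_ge) (auto simp: cset_def)

lemma cmax_attained:
  assumes "i < q ^ t" "j \<le> t"
  obtains i1 where "i1 < q ^ t" "\<And>k. k < t \<Longrightarrow> col (dig q k i1) = col (dig q k i)"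
    "f i1 = cmax q t f j i"
proof -
  have "cset q t j i \<noteq> {}" using assms(1) by (auto simp: cset_def)
  then have "cmax q t f j i \<in> f ` cset q t j i" unfolding cmax_def by (intro Max_in) auto
  then obtain i1 where i1: "i1 \<in> cset q t j i" "f i1 = cmax q t f j i" by auto
  show ?thesis
  proof (rule that[of i1])
    show "col (dig q k i1) = col (dig q k i)" if "k < t" for k
      using i1(1) that by (cases "k < j") (auto simp: cset_def)
  qed (use i1 in \<open>auto simp: cset_def\<close>)
qed

lemma zset_if_col:
  assumes "i1 < q ^ t" "\<And>k. k < t \<Longrightarrow> col (dig q k i1) = col (dig q k i)"
    "\<And>k. k < t \<Longrightarrow> isM (dig q k i1) \<Longrightarrow> isM (dig q k i)"
  shows "i1 \<in> zset q t t i"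
  unfolding zset_def using assms eq_if_col_eq not_isM_if_col_eq by blast

text \<open>Ranks detect disjointness: two sets are disjoint iff the sizes add up to the size of the union.\<close>

lemma jn_iff:
  assumes "i1 < q ^ t" "i2 < q ^ t"
  shows "i1 \<in> zset q t t i \<and> i2 \<in> zset q t t i \<and>
    (\<forall>k<t. isM (dig q k i) \<longrightarrow> isM (dig q k i1) \<or> isM (dig q k i2)) \<and> rk q t i1 + rk q t i2 = rk q t i
    \<longleftrightarrow> jn q t i1 i2 i"
proof -
  define m where "m x = {k. k < t \<and> isM (dig q k x)}" for x
  have fin: "finite (m x)" for x by (simp add: m_def)
  have r: "rk q t x = card (m x)" for x by (simp add: rk_def m_def)
  have sub: "m x \<subseteq> m i" if "x \<in> zset q t t i" for x
  proof
    fix k assume k: "k \<in> m x"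
    have "isM (dig q k i)"
    proof (rule ccontr)
      assume "\<not> isM (dig q k i)"
      then have "dig q k x = dig q k i" using that k by (auto simp: zset_def m_def)
      then show False using \<open>\<not> isM (dig q k i)\<close> k by (simp add: m_def)
    qed
    then show "k \<in> m i" using k by (simp add: m_def)
  qed
  show ?thesis
  proof
    assume L: "i1 \<in> zset q t t i \<and> i2 \<in> zset q t t i \<and>
      (\<forall>k<t. isM (dig q k i) \<longrightarrow> isM (dig q k i1) \<or> isM (dig q k i2)) \<and> rk q t i1 + rk q t i2 = rk q t i"
    have un: "m i1 \<union> m i2 = m i" using L sub by (auto simp: m_def)
    have "card (m i1 \<inter> m i2) = 0" using card_Un_Int[OF fin fin, of i1 i2] L un by (simp add: r)
    then have "m i1 \<inter> m i2 = {}" using fin by auto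
    then show "jn q t i1 i2 i" using L un zset_col unfolding jn_def m_def by blast
  next
    assume R: "jn q t i1 i2 i"
    then have "i1 \<in> zset q t t i" "i2 \<in> zset q t t i" using zset_if_col assms unfolding jn_def by blast+
    moreover have "m i1 \<union> m i2 = m i" "m i1 \<inter> m i2 = {}" using R unfolding jn_def m_def by blast+
    then have "rk q t i1 + rk q t i2 = rk q t i" using card_Un_disjoint[OF fin fin, of i1 i2] by (simp add: r)
    ultimately show "i1 \<in> zset q t t i \<and> i2 \<in> zset q t t i \<and>
      (\<forall>k<t. isM (dig q k i) \<longrightarrow> isM (dig q k i1) \<or> isM (dig q k i2)) \<and> rk q t i1 + rk q t i2 = rk q t i"
      using R unfolding jn_def by blast
  qed
qed

lemma rk_le: "rk q t i \<le> t"
  unfolding rk_def using card_mono[of "{..<t}" "{k. k < t \<and> isM (dig q k i)}"] by auto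

section \<open>Matchings with coloured components\<close>

definition conflict_free :: "'a set set \<Rightarrow> ('a \<Rightarrow> nat) \<Rightarrow> bool" where
  "conflict_free E \<phi> \<longleftrightarrow> (\<forall>e\<in>E. \<forall>u\<in>e. \<forall>v\<in>e. \<phi> u = 0 \<or> \<phi> v = 0 \<or> \<phi> u = \<phi> v)"

definition solution :: "nat \<Rightarrow> 'a set set \<Rightarrow> ('a \<Rightarrow> nat) \<Rightarrow> 'a set set \<Rightarrow> bool" where
  "solution c E \<phi> M \<longleftrightarrow> matching E M \<and> (\<forall>v. 0 < \<phi> v \<longleftrightarrow> v \<in> \<Union>M) \<and> conflict_free E \<phi> \<and>
     \<phi> ` \<Union>M = {1..c}"

lemma simple_graph_finite:
  assumes "simple_graph V E"
  shows "finite V" "finite E" "e \<in> E \<Longrightarrow> e \<subseteq> V" "e \<in> E \<Longrightarrow> e \<noteq> {}" "e \<in> E \<Longrightarrow> finite e"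
proof -
  have "E \<subseteq> Pow V" using assms by (auto simp: simple_graph_def)
  then show "finite V" "finite E" "e \<in> E \<Longrightarrow> e \<subseteq> V"
    using assms finite_subset by (auto simp: simple_graph_def)
  then show "e \<in> E \<Longrightarrow> e \<noteq> {}" "e \<in> E \<Longrightarrow> finite e"
    using assms finite_subset by (fastforce simp: simple_graph_def)+
qed

lemma equiv_reachable: "equiv X (reachable X E)"
proof (rule equivI)
  show "reachable X E \<subseteq> X \<times> X" by (auto simp: reachable_def)
  show "refl_on X (reachable X E)" by (auto simp: reachable_def refl_on_def)
  have "sym ({(x, y). {x, y} \<in> E}\<^sup>*)"
    by (rule sym_rtrancl) (auto simp: sym_def insert_commute)
  then show "sym (reachable X E)" by (auto simp: reachable_def sym_def)
  show "trans (reachable X E)" unfolding trans_def reachable_def by (blast intro: rtrancl_trans)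
qed

text \<open>From a matching to a colouring: \<open>c\<close> components get different colours and
  all others colour 1. Conversely, an edge between matched vertices joins equal colours, so each
  component is monochromatic and the components map onto the \<open>c\<close> colours.\<close>

lemma solution_iff:
  assumes G: "simple_graph V E" and c: "1 \<le> c"
  shows "has_disconnected_matching c E l \<longleftrightarrow> (\<exists>\<phi> M. solution c E \<phi> M \<and> l \<le> card M)"
proof
  assume "has_disconnected_matching c E l"
  then obtain M where M: "matching E M" "l \<le> card M"
    "c \<le> card (connected_components (\<Union>M) (induced_edges E (\<Union>M)))"
    by (auto simp: has_disconnected_matching_def)
  define X R where "X = \<Union>M" and "R = reachable X (induced_edges E X)"
  have eq: "equiv X R" unfolding R_def by (rule equiv_reachable)
  have "c \<le> card (X // R)" using M(3) by (simp add: connected_components_def X_def R_def)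
  then obtain C where C: "C \<subseteq> X // R" "card C = c" by (rule obtain_subset_with_card_n)
  then have "finite C" using c card.infinite by fastforce
  then obtain h where h: "bij_betw h C {1..c}"
    using C(2) finite_same_card_bij[of C "{1..c}"] by auto
  \<comment> \<open>The components that were not chosen reuse colour 1, which is in range since
    \<open>c\<close> is positive; several components may share a colour.\<close>
  define g where "g K = (if K \<in> C then h K else 1)" for K
  define \<phi> where "\<phi> v = (if v \<in> X then g (R `` {v}) else 0)" for v
  have hC: "h ` C = {1..c}" using h by (simp add: bij_betw_def)
  have g: "g K \<in> {1..c}" for K using hC c by (auto simp: g_def)
  have "\<phi> ` X = {1..c}"
  proof
    show "\<phi> ` X \<subseteq> {1..c}" using g by (auto simp: \<phi>_def)
    show "{1..c} \<subseteq> \<phi> ` X"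
    proof
      fix i assume "i \<in> {1..c}"
      then obtain K where K: "K \<in> C" "h K = i" using hC by (metis imageE)
      then obtain v where "v \<in> X" "K = R `` {v}" using C(1) by (auto elim!: quotientE)
      then show "i \<in> \<phi> ` X" using K by (intro image_eqI[of _ _ v]) (auto simp: \<phi>_def g_def)
    qed
  qed
  moreover have "0 < \<phi> v \<longleftrightarrow> v \<in> X" for v using g by (auto simp: \<phi>_def Suc_le_eq)
  moreover have "conflict_free E \<phi>"
    unfolding conflict_free_def
  proof (intro ballI)
    fix e u v assume e: "e \<in> E" "u \<in> e" "v \<in> e"
    show "\<phi> u = 0 \<or> \<phi> v = 0 \<or> \<phi> u = \<phi> v"
    proof (cases "u \<in> X \<and> v \<in> X \<and> u \<noteq> v")
      case True
      have "card e = 2" using e G by (auto simp: simple_graph_def)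
      then have "e = {u, v}" using e True by (metis card_2_iff insert_iff singletonD insert_commute)
      then have "{u, v} \<in> induced_edges E X" using e True by (auto simp: induced_edges_def)
      then have "(u, v) \<in> R" using True by (auto simp: R_def reachable_def)
      then show ?thesis using equiv_class_eq[OF eq] True by (simp add: \<phi>_def)
    qed (auto simp: \<phi>_def)
  qed
  ultimately have "solution c E \<phi> M" using M(1) by (auto simp: solution_def X_def)
  then show "\<exists>\<phi> M. solution c E \<phi> M \<and> l \<le> card M" using M(2) by blast
next
  assume "\<exists>\<phi> M. solution c E \<phi> M \<and> l \<le> card M"
  then obtain \<phi> M where S: "solution c E \<phi> M" and l: "l \<le> card M" by blast
  define X R where "X = \<Union>M" and "R = reachable X (induced_edges E X)"
  have eq: "equiv X R" unfolding R_def by (rule equiv_reachable)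
  have M: "M \<subseteq> E" using S by (simp add: solution_def matching_def)
  then have fX: "finite X"
    unfolding X_def using simple_graph_finite[OF G] finite_subset by (intro finite_Union) blast+
  then have fC: "finite (X // R)" by (simp add: quotient_def)
  have pos: "0 < \<phi> v" if "v \<in> X" for v using that S by (auto simp: solution_def X_def)
  have const: "\<phi> u = \<phi> v" if "(u, v) \<in> R" for u v
  proof -
    have "(u, v) \<in> {(x, y). {x, y} \<in> induced_edges E X}\<^sup>*" using that by (simp add: R_def reachable_def)
    then show ?thesis
    proof induction
      case (step y z)
      then have "{y, z} \<in> E" "y \<in> X" "z \<in> X" by (auto simp: induced_edges_def)
      then have "\<phi> y = 0 \<or> \<phi> z = 0 \<or> \<phi> y = \<phi> z"
        using S unfolding solution_def conflict_free_def by blast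
      then show ?case using pos[OF \<open>y \<in> X\<close>] pos[OF \<open>z \<in> X\<close>] step.IH by simp
    qed simp
  qed
  \<comment> \<open>Any representative gives the same value, since the colour is constant on a
    class.\<close>
  define g where "g K = \<phi> (SOME v. v \<in> K)" for K
  have g: "g (R `` {v}) = \<phi> v" if "v \<in> X" for v
  proof -
    have "v \<in> R `` {v}" using equiv_class_self[OF eq that] .
    then have "(SOME w. w \<in> R `` {v}) \<in> R `` {v}" by (rule someI)
    then have "(v, SOME w. w \<in> R `` {v}) \<in> R" by simp
    then show ?thesis unfolding g_def using const by metis
  qed
  have "{1..c} = \<phi> ` X" using S by (simp add: solution_def X_def)
  also have "\<dots> \<subseteq> g ` (X // R)"
  proof
    fix i assume "i \<in> \<phi> ` X"
    then obtain v where "v \<in> X" "i = \<phi> v" by blast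
    then show "i \<in> g ` (X // R)" using g by (intro image_eqI[of _ _ "R `` {v}"]) (auto intro: quotientI)
  qed
  finally have "card {1..c} \<le> card (g ` (X // R))" using fC by (intro card_mono) auto
  also have "\<dots> \<le> card (X // R)" by (rule card_image_le[OF fC])
  finally have "c \<le> card (connected_components (\<Union>M) (induced_edges E (\<Union>M)))"
    by (simp add: connected_components_def X_def R_def)
  then show "has_disconnected_matching c E l"
    using S l unfolding has_disconnected_matching_def solution_def by blast
qed

section \<open>Tables for parts of the graph\<close>

definition code :: "('a \<Rightarrow> nat) \<Rightarrow> 'a set \<Rightarrow> 'a \<Rightarrow> nat" where
  "code \<phi> X v = (if \<phi> v = 0 then 0 else if v \<in> X then 2 * \<phi> v else 2 * \<phi> v - 1)"

lemma col_code [simp]: "col (code \<phi> X v) = \<phi> v"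
  by (auto simp: code_def col_def)

lemma isM_code [simp]: "isM (code \<phi> X v) \<longleftrightarrow> 0 < \<phi> v \<and> v \<in> X"
proof -
  have "odd (2 * \<phi> v - Suc 0)" if "0 < \<phi> v" using that by presburger
  then show ?thesis by (auto simp: code_def isM_def)
qed

lemma code_le: "\<phi> v \<le> c \<Longrightarrow> code \<phi> X v < 2 * c + 1"
  by (auto simp: code_def)

lemma col_le: "d < 2 * c + 1 \<Longrightarrow> col d \<le> c"
  by (auto simp: col_def)

lemma eq_code: "col d = \<phi> v \<Longrightarrow> (isM d \<longleftrightarrow> v \<in> X) \<Longrightarrow> d = code \<phi> X v"
proof -
  assume d: "col d = \<phi> v" "isM d \<longleftrightarrow> v \<in> X"
  have "0 < \<phi> v" if "isM d" using that col_pos[of d] unfolding isM_def d(1) by blast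
  then have "isM d = isM (code \<phi> X v)" unfolding isM_code d(2)[symmetric] by blast
  moreover have "col d = col (code \<phi> X v)" unfolding col_code by (rule d(1))
  ultimately show "d = code \<phi> X v" by (rule eq_if_col_eq[rotated])
qed

definition fits :: "nat \<Rightarrow> 'a list \<Rightarrow> ('a \<Rightarrow> nat) \<Rightarrow> 'a set \<Rightarrow> nat \<Rightarrow> bool" where
  "fits q b \<phi> X i \<longleftrightarrow> (\<forall>j<length b. dig q j i = code \<phi> X (b ! j))"

text \<open>A coloured vertex of the boundary \<open>D\<close> may still wait for a partner outside
  the part, whereas an inner vertex has all its edges inside and must be matched already.\<close>

definition partial_solution ::
    "nat \<Rightarrow> 'a set \<Rightarrow> 'a set set \<Rightarrow> 'a set \<Rightarrow> ('a \<Rightarrow> nat) \<Rightarrow> 'a set set \<Rightarrow> bool" where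
  "partial_solution c VA EA D \<phi> M \<longleftrightarrow> matching EA M \<and> (\<forall>v\<in>VA. \<phi> v \<le> c) \<and> conflict_free EA \<phi> \<and>
     (\<forall>v\<in>\<Union>M. 0 < \<phi> v) \<and> (\<forall>v\<in>VA - D. 0 < \<phi> v \<longrightarrow> v \<in> \<Union>M)"

abbreviation join_code :: "nat \<Rightarrow> nat \<Rightarrow> nat" where
  "join_code U1 U2 \<equiv> set_encode (set_decode U1 \<union> set_decode U2)"

lemma set_encode_less: "A \<subseteq> {..c} \<Longrightarrow> set_encode A < 2 ^ (c + 1)"
proof -
  assume "A \<subseteq> {..c}"
  then have "set_encode A \<le> set_encode {..<c+1}"
    unfolding set_encode_def by (intro sum_mono2) auto
  also have "set_encode {..<c+1} < 2 ^ (c + 1)"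
    unfolding set_encode_def using sum_power2[of "c+1"] by (simp add: lessThan_atLeast0)
  finally show ?thesis .
qed

text \<open>\<open>t\<close> bounds the bag sizes. All states have \<open>t\<close> digits, so that
  bags of different sizes share one index range; the digits beyond the bag are padding.\<close>

locale graph_dp =
  fixes c n t :: nat and E :: "nat set set"
  assumes graph: "simple_graph {..<n} E" and c_pos: "1 \<le> c"
begin

definition "q = 2 * c + 1"
text \<open>Codes of subsets of the colours \<open>1, ..., c\<close> use bits up to
  \<open>c\<close>, hence the exponent \<open>c + 1\<close>; bit 0 belongs to no colour.\<close>

definition "CU = (2 :: nat) ^ (c + 1)"
abbreviation "Z \<equiv> q ^ t"

definition optimal :: "(nat \<Rightarrow> nat) \<Rightarrow> nat set set \<Rightarrow> bool" where
  "optimal \<phi> M \<longleftrightarrow> solution c E \<phi> M \<and> (\<forall>\<phi>' M'. solution c E \<phi>' M' \<longrightarrow> card M' \<le> card M)"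

text \<open>The last clause makes \<open>b\<close> separate the inner vertices from the rest of the
  graph. An edge between two boundary vertices may be missing from \<open>EA\<close> or belong to
  several parts.\<close>

definition part :: "nat list \<Rightarrow> nat set \<Rightarrow> nat set set \<Rightarrow> bool" where
  "part b VA EA \<longleftrightarrow> distinct b \<and> length b \<le> t \<and> set b \<subseteq> VA \<and> VA \<subseteq> {..<n} \<and> EA \<subseteq> E \<and>
     (\<forall>e\<in>EA. e \<subseteq> VA) \<and> (\<forall>e\<in>E. e \<inter> (VA - set b) \<noteq> {} \<longrightarrow> e \<in> EA)"

text \<open>A table maps a set \<open>U\<close> of colours (encoded as a bit vector) and a state \<open>i\<close> of the bag to one
  more than the size of a matching that uses exactly the colours in \<open>U\<close>; the value \<open>0\<close> means that
  there is none.\<close>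

definition sound :: "nat list \<Rightarrow> (nat \<Rightarrow> nat \<Rightarrow> nat) \<Rightarrow> nat set \<Rightarrow> nat set set \<Rightarrow> bool" where
  "sound b T VA EA \<longleftrightarrow> (\<forall>U<CU. \<forall>i<Z. 0 < T U i \<longrightarrow>
     (\<exists>\<phi> M. partial_solution c VA EA (set b) \<phi> M \<and> fits q b \<phi> (\<Union>M) i \<and>
        set_encode (\<phi> ` \<Union>M) = U \<and> T U i = Suc (card M)))"

text \<open>Only restrictions of optimal solutions have to be represented; this is what makes the
  window in the convolution admissible. An optimal matching may be split arbitrarily among parts
  that share boundary edges, hence the quantification over \<open>M'\<close>.\<close>

definition complete :: "nat list \<Rightarrow> (nat \<Rightarrow> nat \<Rightarrow> nat) \<Rightarrow> nat set \<Rightarrow> nat set set \<Rightarrow> bool" where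
  "complete b T VA EA \<longleftrightarrow> (\<forall>\<phi> M M' i. optimal \<phi> M \<longrightarrow> M' \<subseteq> M \<inter> EA \<longrightarrow>
     (\<forall>e\<in>M. e \<inter> (VA - set b) \<noteq> {} \<longrightarrow> e \<in> M') \<longrightarrow> i < Z \<longrightarrow> fits q b \<phi> (\<Union>M') i \<longrightarrow>
     (\<forall>j<t. length b \<le> j \<longrightarrow> \<not> isM (dig q j i)) \<longrightarrow> Suc (card M') \<le> T (set_encode (\<phi> ` \<Union>M')) i)"

definition good :: "nat list \<Rightarrow> (nat \<Rightarrow> nat \<Rightarrow> nat) \<Rightarrow> nat set \<Rightarrow> nat set set \<Rightarrow> bool" where
  "good b T VA EA \<longleftrightarrow> part b VA EA \<and> sound b T VA EA \<and> complete b T VA EA"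

lemma E_finite [simp]: "finite E" and edge_finite: "e \<in> E \<Longrightarrow> finite e"
  and edge_nonempty: "e \<in> E \<Longrightarrow> e \<noteq> {}" and edge_subset: "e \<in> E \<Longrightarrow> e \<subseteq> {..<n}"
  using simple_graph_finite[OF graph] by auto

lemma finite_Union_edges: "M \<subseteq> E \<Longrightarrow> finite (\<Union>M)"
  using finite_subset[OF _ E_finite] edge_finite by (intro finite_Union) auto

lemma dig_less_q [simp]: "dig q j i < q"
  by (rule dig_less) (simp add: q_def)

lemma q_pos [simp]: "0 < q" and q_odd: "odd q"
  by (simp_all add: q_def)

lemma part_closed: "part b VA EA \<Longrightarrow> e \<in> E \<Longrightarrow> e \<inter> (VA - set b) \<noteq> {} \<Longrightarrow> e \<in> EA"
  by (simp add: part_def)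

lemma solution_le: "solution c E \<phi> M \<Longrightarrow> \<phi> v \<le> c"
proof (cases "v \<in> \<Union>M")
  case True
  then show "solution c E \<phi> M \<Longrightarrow> \<phi> v \<le> c" unfolding solution_def
    by (metis atLeastAtMost_iff image_eqI)
next
  case False
  then show "solution c E \<phi> M \<Longrightarrow> \<phi> v \<le> c" unfolding solution_def by (metis gr0I le0)
qed

text \<open>Exchange argument: inside a part, an optimal solution is at most \<open>length b\<close> edges worse than
  any partial solution with the same boundary colouring and the same colours. Otherwise
  substitute the partial solution and drop the outer matching edges that collide with it; each of them
  contains a boundary vertex, and every colour survives.\<close>

lemma exchange:
  assumes p: "part b VA EA" and opt: "optimal \<phi> M" and M': "M' \<subseteq> M \<inter> EA"
    and inner: "\<forall>e\<in>M. e \<inter> (VA - set b) \<noteq> {} \<longrightarrow> e \<in> M'"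
    and ps: "partial_solution c VA EA (set b) \<psi> M1" and agree: "\<forall>v\<in>set b. \<psi> v = \<phi> v"
    and cols: "\<psi> ` \<Union>M1 = \<phi> ` \<Union>M'"
  shows "card M1 \<le> card M' + length b"
proof -
  have sol: "solution c E \<phi> M" using opt by (simp add: optimal_def)
  have ME: "M \<subseteq> E" "M1 \<subseteq> EA" "EA \<subseteq> E" using sol ps p
    by (auto simp: solution_def matching_def partial_solution_def part_def)
  have fM: "finite M" "finite M1" using ME finite_subset E_finite by (blast, metis finite_subset)
  have M1VA: "\<Union>M1 \<subseteq> VA" using ME p by (auto simp: part_def)
  \<comment> \<open>The outer edges of the optimal matching: \<open>Rk\<close> collects those that
    can stay next to \<open>M1\<close>, \<open>Rd\<close> those that collide with it.\<close>
  define R where "R = M - M'"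
  define Rk where "Rk = {e \<in> R. e \<inter> \<Union>M1 = {}}"
  define Rd where "Rd = {e \<in> R. e \<inter> \<Union>M1 \<noteq> {}}"
  define N where "N = M1 \<union> Rk"
  \<comment> \<open>A vertex whose edge is dropped loses its colour, since a solution colours
    exactly the matched vertices.\<close>
  define \<chi> where "\<chi> v = (if v \<in> \<Union>N then (if v \<in> VA then \<psi> v else \<phi> v) else 0)" for v
  have Rb: "e \<inter> VA \<subseteq> set b" if "e \<in> R" for e using that inner by (auto simp: R_def)
  have posM: "0 < \<phi> v \<longleftrightarrow> v \<in> \<Union>M" for v using sol by (auto simp: solution_def)
  have disjM: "e = f" if "e \<in> M" "f \<in> M" "v \<in> e" "v \<in> f" for e f v
    using sol that by (auto simp: solution_def matching_def)
  have \<chi>R: "\<chi> v = \<phi> v" if "e \<in> Rk" "v \<in> e" for e v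
    using that Rb[of e] agree by (auto simp: \<chi>_def N_def Rk_def)
  have \<chi>1: "\<chi> v = \<psi> v" if "v \<in> \<Union>M1" for v
    using that M1VA by (auto simp: \<chi>_def N_def)
  have "matching E N"
    unfolding matching_def
  proof (intro conjI ballI impI)
    show "N \<subseteq> E" using ME by (auto simp: N_def Rk_def R_def)
    fix e f assume ef: "e \<in> N" "f \<in> N" "e \<noteq> f"
    have m1: "e \<inter> f = {}" if "e \<in> M1" "f \<in> M1"
      using that ps ef(3) by (simp add: partial_solution_def matching_def)
    have m2: "e \<inter> f = {}" if "e \<in> Rk" "f \<in> Rk"
      using that sol ef(3) by (simp add: solution_def matching_def Rk_def R_def)
    have m3: "e \<inter> f = {}" if "e \<in> M1" "f \<in> Rk" for e f using that by (auto simp: Rk_def)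
    show "e \<inter> f = {}" using ef(1,2) m1 m2 m3[of e f] m3[of f e] unfolding N_def by blast
  qed
  moreover have pos: "0 < \<chi> v \<longleftrightarrow> v \<in> \<Union>N" for v
  proof
    assume "v \<in> \<Union>N"
    then consider "v \<in> \<Union>M1" | e where "e \<in> Rk" "v \<in> e" by (auto simp: N_def)
    then show "0 < \<chi> v"
    proof cases
      case 1
      then show ?thesis using \<chi>1 ps by (auto simp: partial_solution_def)
    next
      case 2
      then show ?thesis using \<chi>R posM by (auto simp: Rk_def R_def)
    qed
  qed (auto simp: \<chi>_def split: if_splits)
  moreover have "conflict_free E \<chi>"
    unfolding conflict_free_def
  proof (intro ballI)
    fix e u v assume e: "e \<in> E" "u \<in> e" "v \<in> e"
    show "\<chi> u = 0 \<or> \<chi> v = 0 \<or> \<chi> u = \<chi> v"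
    proof (cases "e \<in> EA")
      case True
      then have "u \<in> VA" "v \<in> VA" using e p by (auto simp: part_def)
      moreover have "\<psi> u = 0 \<or> \<psi> v = 0 \<or> \<psi> u = \<psi> v"
        using True e ps unfolding partial_solution_def conflict_free_def by blast
      ultimately show ?thesis by (auto simp: \<chi>_def)
    next
      case False
      then have "e \<inter> (VA - set b) = {}" using e p by (auto simp: part_def)
      \<comment> \<open>An edge outside the part meets \<open>VA\<close> only in the boundary, where
        both colourings agree.\<close>
      then have "\<chi> w = 0 \<or> \<chi> w = \<phi> w" if "w \<in> e" for w using that agree by (auto simp: \<chi>_def)
      moreover have "\<phi> u = 0 \<or> \<phi> v = 0 \<or> \<phi> u = \<phi> v"
        using e sol unfolding solution_def conflict_free_def by blast
      ultimately show ?thesis using e by metis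
    qed
  qed
  moreover have "\<chi> ` \<Union>N = {1..c}"
  proof
    have c1: "\<psi> v \<le> c" if "v \<in> VA" for v using ps that by (auto simp: partial_solution_def)
    have "\<chi> v \<le> c" for v using c1 solution_le[OF sol] by (auto simp: \<chi>_def)
    then show "\<chi> ` \<Union>N \<subseteq> {1..c}" using pos by (auto simp: Suc_le_eq)
    show "{1..c} \<subseteq> \<chi> ` \<Union>N"
    proof
      have img1: "\<psi> ` \<Union>M1 \<subseteq> \<chi> ` \<Union>N"
      proof
        fix i assume "i \<in> \<psi> ` \<Union>M1"
        then obtain w where "w \<in> \<Union>M1" "i = \<psi> w" by blast
        then show "i \<in> \<chi> ` \<Union>N" using \<chi>1 by (intro image_eqI[of _ _ w]) (auto simp: N_def)
      qed
      fix i assume "i \<in> {1..c}"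
      then obtain e z where z: "e \<in> M" "z \<in> e" "\<phi> z = i" using sol unfolding solution_def
        by (metis (no_types, lifting) UnionE imageE)
      show "i \<in> \<chi> ` \<Union>N"
      proof (cases "e \<in> M'")
        case True
        then have "i \<in> \<psi> ` \<Union>M1" using cols z by auto
        then show ?thesis using img1 by blast
      next
        case False
        then have eR: "e \<in> R" using z by (simp add: R_def)
        show ?thesis
        proof (cases "e \<in> Rk")
          case True
          then show ?thesis using \<chi>R[OF True z(2)] z by (intro image_eqI[of _ _ z]) (auto simp: N_def)
        next
          case False
          \<comment> \<open>The colour of a dropped edge survives: the edge meets \<open>M1\<close>
            in a boundary vertex \<open>y\<close>, where both colourings agree, and its two
            endpoints have the same colour.\<close>
          then obtain y where y: "y \<in> e" "y \<in> \<Union>M1" using eR by (auto simp: Rk_def)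
          then have "y \<in> set b" using Rb[OF eR] M1VA by blast
          then have "\<psi> y = \<phi> y" using agree by blast
          also have "\<phi> y = \<phi> z"
          proof -
            have "0 < \<phi> y" "0 < \<phi> z" using posM y z by auto
            moreover have "e \<in> E" using z ME by blast
            ultimately show ?thesis
              using sol y z unfolding solution_def conflict_free_def by (metis neq0_conv)
          qed
          finally have "i = \<psi> y" using z by simp
          then have "i \<in> \<psi> ` \<Union>M1" using y by blast
          then show ?thesis using img1 by blast
        qed
      qed
    qed
  qed
  ultimately have "solution c E \<chi> N" unfolding solution_def by blast
  then have "card N \<le> card M" using opt by (simp add: optimal_def)
  have M1R: "M1 \<inter> Rk = {}"
  proof -
    have "e \<inter> \<Union>M1 \<noteq> {}" if "e \<in> M1" for e using that edge_nonempty ME by blast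
    then show ?thesis by (auto simp: Rk_def)
  qed
  have fR: "finite Rk" "finite Rd" "finite R" "finite M'"
    using fM M' finite_subset by (auto simp: Rk_def Rd_def R_def)
  have "card N = card M1 + card Rk"
    unfolding N_def by (rule card_Un_disjoint) (use fM fR M1R in auto)
  moreover have "card M = card M' + card R"
    unfolding R_def using card_Un_disjoint[of M' "M - M'"] fM fR M' by (simp add: Un_absorb1 R_def)
  moreover have "card R = card Rk + card Rd"
  proof -
    have "R = Rk \<union> Rd" "Rk \<inter> Rd = {}" by (auto simp: Rk_def Rd_def)
    then show ?thesis using card_Un_disjoint fR by metis
  qed
  moreover have "card Rd \<le> length b"
  proof -
    \<comment> \<open>Each dropped edge contains a vertex of \<open>b\<close>, and distinct edges of
      the matching \<open>M\<close> contain distinct ones.\<close>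
    define h where "h e = (SOME v. v \<in> e \<inter> set b)" for e :: "nat set"
    have h: "h e \<in> e \<inter> set b" if "e \<in> Rd" for e
      unfolding h_def by (rule someI_ex) (use that Rb[of e] M1VA in \<open>fastforce simp: Rd_def\<close>)
    have "inj_on h Rd"
    proof (rule inj_onI)
      fix e f assume ef: "e \<in> Rd" "f \<in> Rd" "h e = h f"
      then show "e = f" using h[OF ef(1)] h[OF ef(2)] disjM[of e f "h e"] by (auto simp: Rd_def R_def)
    qed
    moreover have "h ` Rd \<subseteq> set b" using h by auto
    ultimately have "card Rd \<le> card (set b)" by (metis card_inj_on_le List.finite_set)
    also have "\<dots> \<le> length b" by (rule card_length)
    finally show ?thesis .
  qed
  ultimately show ?thesis using \<open>card N \<le> card M\<close> by linarith
qed

end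

section \<open>Table operations that preserve soundness and completeness\<close>

context graph_dp
begin

definition initial_table :: "nat \<Rightarrow> nat \<Rightarrow> nat" where
  "initial_table U i = (if U = 0 \<and> rk q t i = 0 then 1 else 0)"

text \<open>The edge forbids two different colours at its ends even if it is left out of the
  matching. If it is taken, rank 2 excludes further matched positions, and the value is 2 because
  entries are sizes plus one.\<close>

definition edge_table :: "nat \<Rightarrow> nat \<Rightarrow> nat \<Rightarrow> nat \<Rightarrow> nat" where
  "edge_table pa pb U i = (let d = dig q pa i; d' = dig q pb i in
     if 0 < d \<and> 0 < d' \<and> col d \<noteq> col d' then 0
     else if U = 0 \<and> rk q t i = 0 then 1
     else if isM d \<and> isM d' \<and> rk q t i = 2 \<and> U = 2 ^ col d then 2 else 0)"

text \<open>Two guarantees of different strength: every positive entry comes from some pair, but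
  only pairs with both entries within \<open>t\<close> of the best entry for their colouring are
  sure to be taken into account. The subtracted 1 corrects for adding two values that are each one
  more than a size.\<close>

definition joined :: "(nat \<Rightarrow> nat \<Rightarrow> nat) \<Rightarrow> (nat \<Rightarrow> nat \<Rightarrow> nat) \<Rightarrow> (nat \<Rightarrow> nat \<Rightarrow> nat) \<Rightarrow> bool" where
  "joined f g h \<longleftrightarrow>
     (\<forall>U<CU. \<forall>i<Z. 0 < h U i \<longrightarrow> (\<exists>U1<CU. \<exists>U2<CU. \<exists>i1<Z. \<exists>i2<Z. U = join_code U1 U2 \<and>
        jn q t i1 i2 i \<and> 0 < f U1 i1 \<and> 0 < g U2 i2 \<and> h U i = f U1 i1 + g U2 i2 - 1)) \<and>
     (\<forall>U1<CU. \<forall>U2<CU. \<forall>i1<Z. \<forall>i2<Z. \<forall>i<Z. jn q t i1 i2 i \<longrightarrow> 0 < f U1 i1 \<longrightarrow> 0 < g U2 i2 \<longrightarrow>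
        cmax q t (f U1) t i1 \<le> f U1 i1 + t \<longrightarrow> cmax q t (g U2) t i2 \<le> g U2 i2 + t \<longrightarrow>
        f U1 i1 + g U2 i2 - 1 \<le> h (join_code U1 U2) i)"

text \<open>An odd digit means coloured and unmatched, which is forbidden for a vertex that leaves
  the bag. A vertex that enters can have any colour but is not yet matched, and padding is treated
  like an entering vertex.\<close>

definition compat :: "nat list \<Rightarrow> nat list \<Rightarrow> nat \<Rightarrow> nat \<Rightarrow> bool" where
  "compat bv bu i' i \<longleftrightarrow>
     (\<forall>j<length bv. \<forall>k<length bu. bv ! j = bu ! k \<longrightarrow> dig q j i' = dig q k i) \<and>
     (\<forall>j<length bv. bv ! j \<notin> set bu \<longrightarrow> \<not> odd (dig q j i')) \<and>
     (\<forall>k<t. (k < length bu \<longrightarrow> bu ! k \<notin> set bv) \<longrightarrow> \<not> isM (dig q k i))"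

definition projected :: "nat list \<Rightarrow> nat list \<Rightarrow> (nat \<Rightarrow> nat \<Rightarrow> nat) \<Rightarrow> (nat \<Rightarrow> nat \<Rightarrow> nat) \<Rightarrow> bool" where
  "projected bv bu T g \<longleftrightarrow>
     (\<forall>U<CU. \<forall>i<Z. 0 < g U i \<longrightarrow> (\<exists>i'<Z. compat bv bu i' i \<and> g U i = T U i')) \<and>
     (\<forall>U<CU. \<forall>i<Z. \<forall>i'<Z. compat bv bu i' i \<longrightarrow> T U i' \<le> g U i)"

text \<open>The padding \<open>dd\<close> is a parameter because a join has to copy the padding of
  its target state, while other uses pad with 0.\<close>

lemma code_fits:
  fixes X :: "nat set"
  assumes "\<And>v. v \<in> set b \<Longrightarrow> \<phi> v \<le> c" "length b \<le> t" "\<And>j. dd j < q"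
  defines "i \<equiv> enc q t (\<lambda>j. if j < length b then code \<phi> X (b ! j) else dd j)"
  shows "i < Z" "fits q b \<phi> X i" "\<And>j. j < t \<Longrightarrow> length b \<le> j \<Longrightarrow> dig q j i = dd j"
    "\<And>j. j < length b \<Longrightarrow> dig q j i = code \<phi> X (b ! j)"
proof -
  let ?d = "\<lambda>j. if j < length b then code \<phi> X (b ! j) else dd j"
  have d: "?d j < q" for j using code_le[of \<phi> "b ! j" c X] assms(1)[of "b ! j"] assms(3)
    by (auto simp: q_def)
  show "i < Z" unfolding i_def by (rule enc_less) (rule d)
  have *: "dig q j i = ?d j" if "j < t" for j unfolding i_def by (rule dig_enc[OF d that])
  show "dig q j i = dd j" if "j < t" "length b \<le> j" for j using * that by simp
  show "dig q j i = code \<phi> X (b ! j)" if "j < length b" for j using * that assms(2) by simp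
  then show "fits q b \<phi> X i" by (simp add: fits_def)
qed

lemma colours_less: "optimal \<phi> M \<Longrightarrow> M' \<subseteq> M \<Longrightarrow> set_encode (\<phi> ` \<Union>M') < CU"
proof -
  assume opt: "optimal \<phi> M" and M': "M' \<subseteq> M"
  have "\<phi> ` \<Union>M' \<subseteq> \<phi> ` \<Union>M" using M' by blast
  also have "\<dots> = {1..c}" using opt by (simp add: optimal_def solution_def)
  also have "\<dots> \<subseteq> {..c}" by auto
  finally show ?thesis unfolding CU_def by (rule set_encode_less)
qed

lemma index_colouring:
  assumes "distinct b"
  obtains \<phi> where "\<And>j. j < length b \<Longrightarrow> \<phi> (b ! j) = col (dig q j i)" "\<And>v. \<phi> v \<le> c"
proof -
  define \<phi> where "\<phi> v = (if v \<in> set b then col (dig q (THE j. j < length b \<and> b ! j = v) i) else 0)" for v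
  have "\<phi> (b ! j) = col (dig q j i)" if "j < length b" for j
  proof -
    have "(THE k. k < length b \<and> b ! k = b ! j) = j"
      using that assms by (intro the_equality) (auto simp: nth_eq_iff_index_eq)
    then show ?thesis using that by (simp add: \<phi>_def)
  qed
  moreover have "\<phi> v \<le> c" for v using col_le dig_less_q by (simp add: \<phi>_def q_def)
  ultimately show ?thesis by (rule that)
qed

lemma rk_0_iff: "rk q t i = 0 \<longleftrightarrow> (\<forall>k<t. \<not> isM (dig q k i))"
  by (auto simp: rk_def)

lemma good_initial:
  assumes "distinct b" "length b \<le> t" "set b \<subseteq> {..<n}"
  shows "good b initial_table (set b) {}"
proof -
  have "sound b initial_table (set b) {}"
    unfolding sound_def
  proof (intro allI impI)
    fix U i assume "0 < initial_table U i"
    then have U: "U = 0" "\<And>k. k < t \<Longrightarrow> \<not> isM (dig q k i)"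
      by (auto simp: initial_table_def rk_0_iff split: if_splits)
    obtain \<phi> where \<phi>: "\<And>j. j < length b \<Longrightarrow> \<phi> (b ! j) = col (dig q j i)" "\<And>v. \<phi> v \<le> c"
      using index_colouring[OF assms(1)] by metis
    have "fits q b \<phi> (\<Union>{}) i" using \<phi> U(2) assms(2) by (auto simp: fits_def intro!: eq_code)
    moreover have "partial_solution c (set b) {} (set b) \<phi> {}"
      using \<phi> by (auto simp: partial_solution_def matching_def conflict_free_def)
    moreover have "initial_table U i = Suc (card ({} :: nat set set))"
      using U by (simp add: initial_table_def rk_0_iff)
    ultimately show "\<exists>\<phi> M. partial_solution c (set b) {} (set b) \<phi> M \<and> fits q b \<phi> (\<Union>M) i \<and>
      set_encode (\<phi> ` \<Union>M) = U \<and> initial_table U i = Suc (card M)"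
      using U(1) by (intro exI[of _ \<phi>] exI[of _ "{}"]) auto
  qed
  moreover have "complete b initial_table (set b) {}"
    unfolding complete_def
  proof (intro allI impI)
    fix \<phi> M i and M' :: "nat set set"
    assume M': "M' \<subseteq> M \<inter> {}" and f: "fits q b \<phi> (\<Union>M') i" and
      d: "\<forall>j<t. length b \<le> j \<longrightarrow> \<not> isM (dig q j i)"
    have "\<not> isM (dig q j i)" if "j < t" for j
      using d f M' that by (cases "j < length b") (auto simp: fits_def)
    then show "Suc (card M') \<le> initial_table (set_encode (\<phi> ` \<Union>M')) i"
      using M' by (simp add: initial_table_def rk_0_iff)
  qed
  ultimately show ?thesis using assms by (auto simp: good_def part_def)
qed

lemma good_edge:
  assumes "distinct b" "length b \<le> t" "set b \<subseteq> {..<n}"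
    and ab: "pa < length b" "pb < length b" "{b ! pa, b ! pb} \<in> E"
  shows "good b (edge_table pa pb) (set b) {{b ! pa, b ! pb}}"
proof -
  let ?e = "{b ! pa, b ! pb}"
  have "card ?e = 2" using ab(3) graph by (auto simp: simple_graph_def)
  then have neq: "b ! pa \<noteq> b ! pb" "pa \<noteq> pb" by (auto simp: card_2_iff)
  have lt: "pa < t" "pb < t" using ab assms by auto
  have "sound b (edge_table pa pb) (set b) {?e}"
    unfolding sound_def
  proof (intro allI impI)
    fix U i assume pos: "0 < edge_table pa pb U i"
    obtain \<phi> where \<phi>: "\<And>j. j < length b \<Longrightarrow> \<phi> (b ! j) = col (dig q j i)" "\<And>v. \<phi> v \<le> c"
      using index_colouring[OF assms(1)] by metis
    have cf: "conflict_free {?e} \<phi>"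
      using pos \<phi>(1)[OF ab(1)] \<phi>(1)[OF ab(2)]
      by (auto simp: conflict_free_def edge_table_def Let_def col_def split: if_splits)
    show "\<exists>\<phi> M. partial_solution c (set b) {?e} (set b) \<phi> M \<and> fits q b \<phi> (\<Union>M) i \<and>
      set_encode (\<phi> ` \<Union>M) = U \<and> edge_table pa pb U i = Suc (card M)"
    proof (cases "U = 0 \<and> rk q t i = 0")
      case True
      then have "fits q b \<phi> (\<Union>{}) i"
        using \<phi> assms(2) by (auto simp: fits_def rk_0_iff intro!: eq_code)
      moreover have "partial_solution c (set b) {?e} (set b) \<phi> {}"
        using \<phi> cf by (auto simp: partial_solution_def matching_def)
      moreover have "edge_table pa pb U i = Suc (card ({} :: nat set set))"
        using pos True by (auto simp: edge_table_def Let_def split: if_splits)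
      ultimately show ?thesis using True by (intro exI[of _ \<phi>] exI[of _ "{}"]) auto
    next
      case False
      then have m: "isM (dig q pa i)" "isM (dig q pb i)" "rk q t i = 2" "U = 2 ^ col (dig q pa i)"
        "edge_table pa pb U i = 2"
        using pos isM_dec by (auto simp: edge_table_def Let_def split: if_splits)
      have "{pa, pb} = {k. k < t \<and> isM (dig q k i)}"
      proof (rule card_seteq)
        show "card {k. k < t \<and> isM (dig q k i)} \<le> card {pa, pb}" using m(3) neq by (simp add: rk_def)
      qed (use m lt in auto)
      then have M: "isM (dig q k i) \<longleftrightarrow> k = pa \<or> k = pb" if "k < t" for k using that by blast
      have "dig q j i = code \<phi> (\<Union>{?e}) (b ! j)" if "j < length b" for j
      proof (rule eq_code)
        show "col (dig q j i) = \<phi> (b ! j)" using \<phi>(1)[OF that] by simp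
        show "isM (dig q j i) \<longleftrightarrow> b ! j \<in> \<Union>{?e}"
          using M[of j] that assms(1,2) ab by (auto simp: nth_eq_iff_index_eq)
      qed
      then have "fits q b \<phi> (\<Union>{?e}) i" by (simp add: fits_def)
      moreover have ph: "\<phi> (b ! pa) = col (dig q pa i)" "\<phi> (b ! pb) = col (dig q pb i)" using \<phi> ab by auto
      have gt: "0 < \<phi> (b ! pa)" "0 < \<phi> (b ! pb)" using m(1,2) ph col_pos isM_dec by metis+
      then have eq: "\<phi> (b ! pb) = \<phi> (b ! pa)"
        using cf[unfolded conflict_free_def, rule_format, of ?e "b ! pa" "b ! pb"] by simp
      moreover have "partial_solution c (set b) {?e} (set b) \<phi> {?e}"
        using \<phi> cf gt by (auto simp: partial_solution_def matching_def)
      moreover have "set_encode (\<phi> ` \<Union>{?e}) = U" using m ph eq by (simp add: set_encode_def)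
      ultimately show ?thesis using m by (intro exI[of _ \<phi>] exI[of _ "{?e}"]) auto
    qed
  qed
  moreover have "complete b (edge_table pa pb) (set b) {?e}"
    unfolding complete_def
  proof (intro allI impI)
    fix \<phi> M i and M' :: "nat set set"
    assume opt: "optimal \<phi> M" and M': "M' \<subseteq> M \<inter> {?e}" and f: "fits q b \<phi> (\<Union>M') i" and
      d: "\<forall>j<t. length b \<le> j \<longrightarrow> \<not> isM (dig q j i)"
    have cf: "conflict_free E \<phi>" and pos: "\<And>v. 0 < \<phi> v \<longleftrightarrow> v \<in> \<Union>M"
      using opt by (auto simp: optimal_def solution_def)
    have dg: "col (dig q pa i) = \<phi> (b ! pa)" "col (dig q pb i) = \<phi> (b ! pb)"
      using f ab by (auto simp: fits_def)
    have nc: "\<phi> (b ! pa) = 0 \<or> \<phi> (b ! pb) = 0 \<or> \<phi> (b ! pa) = \<phi> (b ! pb)"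
      using cf[unfolded conflict_free_def, rule_format, OF ab(3), of "b ! pa" "b ! pb"] by simp
    then have nc': "\<not> (0 < dig q pa i \<and> 0 < dig q pb i \<and> col (dig q pa i) \<noteq> col (dig q pb i))"
      using col_pos[of "dig q pa i"] col_pos[of "dig q pb i"] unfolding dg by auto
    have M: "isM (dig q j i) \<longleftrightarrow> j < length b \<and> b ! j \<in> \<Union>M'" if "j < t" for j
      using d f that pos M' by (cases "j < length b") (auto simp: fits_def)
    show "Suc (card M') \<le> edge_table pa pb (set_encode (\<phi> ` \<Union>M')) i"
    proof (cases "M' = {}")
      case True
      then have "rk q t i = 0" using M by (simp add: rk_0_iff)
      then show ?thesis using True nc' by (simp add: edge_table_def Let_def)
    next
      case False
      then have Me: "M' = {?e}" "?e \<in> M" using M' by auto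
      then have gt: "0 < \<phi> (b ! pa)" "0 < \<phi> (b ! pb)" using pos by auto
      have "{k. k < t \<and> isM (dig q k i)} = {pa, pb}"
        using M Me lt assms ab by (auto simp: nth_eq_iff_index_eq)
      then have r: "rk q t i = 2" using neq by (simp add: rk_def)
      have m: "isM (dig q pa i)" "isM (dig q pb i)" using M lt ab Me by auto
      have "set_encode (\<phi> ` \<Union>M') = 2 ^ col (dig q pa i)"
        using Me dg nc gt by (simp add: set_encode_def)
      then show ?thesis using Me r m nc' by (simp add: edge_table_def Let_def)
    qed
  qed
  ultimately show ?thesis using assms by (auto simp: good_def part_def)
qed

text \<open>\<open>exchange\<close> in terms of tables: the maximum over the states of the same
  colouring is attained by a partial solution with the same boundary colours and the same colour
  set, so it exceeds the entry in question by at most \<open>length b\<close>. This makes the second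
  half of \<open>joined\<close> applicable to optimal solutions.\<close>

lemma window:
  assumes g: "good b T VA EA" and opt: "optimal \<phi> M" and M': "M' \<subseteq> M \<inter> EA"
    and inner: "\<forall>e\<in>M. e \<inter> (VA - set b) \<noteq> {} \<longrightarrow> e \<in> M'" and i: "i < Z"
    and f: "fits q b \<phi> (\<Union>M') i" and d: "\<forall>j<t. length b \<le> j \<longrightarrow> \<not> isM (dig q j i)"
  defines "U \<equiv> set_encode (\<phi> ` \<Union>M')"
  shows "Suc (card M') \<le> T U i" "cmax q t (T U) t i \<le> T U i + t" "U < CU"
proof -
  show le: "Suc (card M') \<le> T U i"
    using g opt M' inner i f d unfolding good_def complete_def U_def by blast
  show U: "U < CU" unfolding U_def by (rule colours_less[OF opt]) (use M' in blast)
  have p: "part b VA EA" using g by (simp add: good_def)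
  obtain i' where i': "i' < Z" "\<And>k. k < t \<Longrightarrow> col (dig q k i') = col (dig q k i)"
    "T U i' = cmax q t (T U) t i"
    using cmax_attained[OF i le_refl] by metis
  show "cmax q t (T U) t i \<le> T U i + t"
  proof (cases "T U i' = 0")
    case False
    then obtain \<psi> M1 where ps: "partial_solution c VA EA (set b) \<psi> M1" "fits q b \<psi> (\<Union>M1) i'"
      "set_encode (\<psi> ` \<Union>M1) = U" "T U i' = Suc (card M1)"
      using g U i'(1) unfolding good_def sound_def by blast
    have b: "distinct b" "length b \<le> t" using p by (auto simp: part_def)
    have "\<psi> v = \<phi> v" if vb: "v \<in> set b" for v
    proof -
      obtain j where j: "j < length b" "v = b ! j" using vb unfolding in_set_conv_nth by blast
      have "\<psi> (b ! j) = col (dig q j i')" "\<phi> (b ! j) = col (dig q j i)"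
        using ps(2) f j by (simp_all add: fits_def)
      then show ?thesis using i'(2)[of j] j b by simp
    qed
    moreover have "\<psi> ` \<Union>M1 = \<phi> ` \<Union>M'"
    proof -
      have "M1 \<subseteq> E" "M' \<subseteq> E" using ps(1) M' p by (auto simp: partial_solution_def matching_def part_def)
      then have "finite (\<psi> ` \<Union>M1)" "finite (\<phi> ` \<Union>M')" using finite_Union_edges by blast+
      from set_encode_eq[OF this] show ?thesis using ps(3) U_def by metis
    qed
    ultimately have "card M1 \<le> card M' + length b" using exchange[OF p opt M' inner ps(1)] by blast
    then show ?thesis using ps(4) i'(3) le b(2) by linarith
  qed (use i' in simp)
qed

text \<open>The parts meet only in \<open>b\<close>, so matched sets that are disjoint there make
  the union of two matchings a matching. Conversely, an optimal solution is split along
  \<open>E1\<close>, and \<open>window\<close> puts both halves within reach of the join.\<close>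

lemma good_join:
  assumes f: "good b f V1 E1" and g: "good b g V2 E2" and V: "V1 \<inter> V2 = set b"
    and h: "joined f g h"
  shows "good b h (V1 \<union> V2) (E1 \<union> E2)"
proof -
  have p1: "part b V1 E1" and p2: "part b V2 E2" using f g by (simp_all add: good_def)
  have b: "distinct b" "length b \<le> t" using p1 by (auto simp: part_def)
  have EV: "e \<subseteq> V1" if "e \<in> E1" for e using p1 that by (auto simp: part_def)
  have EV2: "e \<subseteq> V2" if "e \<in> E2" for e using p2 that by (auto simp: part_def)
  have bV: "set b \<subseteq> V1" "set b \<subseteq> V2" using V by auto
  have "part b (V1 \<union> V2) (E1 \<union> E2)"
  proof -
    have "e \<in> E1 \<union> E2" if "e \<in> E" "e \<inter> (V1 \<union> V2 - set b) \<noteq> {}" for e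
    proof -
      have "e \<inter> (V1 - set b) \<noteq> {} \<or> e \<inter> (V2 - set b) \<noteq> {}" using that(2) by blast
      then show ?thesis using part_closed[OF p1 that(1)] part_closed[OF p2 that(1)] by blast
    qed
    moreover have "V1 \<union> V2 \<subseteq> {..<n}" "E1 \<union> E2 \<subseteq> E" using p1 p2 by (simp_all add: part_def)
    moreover have "\<forall>e\<in>E1 \<union> E2. e \<subseteq> V1 \<union> V2" using EV EV2 by blast
    ultimately show ?thesis using b bV unfolding part_def by (simp add: le_supI1)
  qed
  moreover have "sound b h (V1 \<union> V2) (E1 \<union> E2)"
    unfolding sound_def
  proof (intro allI impI)
    fix U i assume Ui: "U < CU" "i < Z" "0 < h U i"
    then obtain U1 U2 i1 i2 where j: "U1 < CU" "U2 < CU" "i1 < Z" "i2 < Z" "U = join_code U1 U2"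
      "jn q t i1 i2 i" "0 < f U1 i1" "0 < g U2 i2" "h U i = f U1 i1 + g U2 i2 - 1"
      using h unfolding joined_def by blast
    obtain \<phi>1 M1 where 1: "partial_solution c V1 E1 (set b) \<phi>1 M1" "fits q b \<phi>1 (\<Union>M1) i1"
      "set_encode (\<phi>1 ` \<Union>M1) = U1" "f U1 i1 = Suc (card M1)"
      using f j unfolding good_def sound_def by blast
    obtain \<phi>2 M2 where 2: "partial_solution c V2 E2 (set b) \<phi>2 M2" "fits q b \<phi>2 (\<Union>M2) i2"
      "set_encode (\<phi>2 ` \<Union>M2) = U2" "g U2 i2 = Suc (card M2)"
      using g j unfolding good_def sound_def by blast
    have M: "M1 \<subseteq> E1" "M2 \<subseteq> E2" "M1 \<subseteq> E" "M2 \<subseteq> E" using 1 2 p1 p2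
      by (auto simp: partial_solution_def matching_def part_def)
    have MV: "\<Union>M1 \<subseteq> V1" "\<Union>M2 \<subseteq> V2" using M EV EV2 by blast+
    have jk: "col (dig q k i1) = col (dig q k i)" "col (dig q k i2) = col (dig q k i)"
      "\<not> (isM (dig q k i1) \<and> isM (dig q k i2))"
      "isM (dig q k i) \<longleftrightarrow> isM (dig q k i1) \<or> isM (dig q k i2)" if "k < length b" for k
      using j(6) that b by (auto simp: jn_def)
    have d1: "dig q k i1 = code \<phi>1 (\<Union>M1) (b ! k)" "dig q k i2 = code \<phi>2 (\<Union>M2) (b ! k)"
      if "k < length b" for k using 1 2 that by (simp_all add: fits_def)
    have agree: "\<phi>1 v = \<phi>2 v" if vb: "v \<in> set b" for v
    proof -
      obtain k where k: "k < length b" "v = b ! k" using vb unfolding in_set_conv_nth by blast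
      then show ?thesis using jk[of k] d1[of k] by simp
    qed
    have pos: "v \<in> \<Union>M1 \<Longrightarrow> 0 < \<phi>1 v" "v \<in> \<Union>M2 \<Longrightarrow> 0 < \<phi>2 v" for v
      using 1 2 unfolding partial_solution_def by blast+
    have disj: "\<Union>M1 \<inter> \<Union>M2 = {}"
    proof (rule ccontr)
      assume "\<Union>M1 \<inter> \<Union>M2 \<noteq> {}"
      then obtain v where v: "v \<in> \<Union>M1" "v \<in> \<Union>M2" by blast
      then have "v \<in> set b" using MV V by blast
      then obtain k where k: "k < length b" "v = b ! k" unfolding in_set_conv_nth by blast
      have "isM (dig q k i1)" "isM (dig q k i2)" using d1[OF k(1)] k v pos[of v] by simp_all
      then show False using jk(3)[OF k(1)] by blast
    qed
    define \<phi> where "\<phi> v = (if v \<in> V1 then \<phi>1 v else \<phi>2 v)" for v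
    have \<phi>1: "\<phi> v = \<phi>1 v" if "v \<in> V1" for v using that by (simp add: \<phi>_def)
    have \<phi>2: "\<phi> v = \<phi>2 v" if "v \<in> V2" for v using that V agree by (auto simp: \<phi>_def)
    have U: "\<Union>(M1 \<union> M2) = \<Union>M1 \<union> \<Union>M2" by blast
    have "partial_solution c (V1 \<union> V2) (E1 \<union> E2) (set b) \<phi> (M1 \<union> M2)"
      unfolding partial_solution_def
    proof (intro conjI)
      have "e \<inter> e' = {}" if "e \<in> M1" "e' \<in> M2" for e e' using that disj by blast
      then show "matching (E1 \<union> E2) (M1 \<union> M2)" using 1 2 M unfolding partial_solution_def matching_def
        by (metis (no_types, lifting) Un_iff inf_commute Un_mono)
      show "\<forall>v\<in>V1 \<union> V2. \<phi> v \<le> c" using 1 2 \<phi>1 \<phi>2 by (auto simp: partial_solution_def)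
      show "conflict_free (E1 \<union> E2) \<phi>"
        unfolding conflict_free_def
      proof (intro ballI)
        fix e u v assume e: "e \<in> E1 \<union> E2" "u \<in> e" "v \<in> e"
        show "\<phi> u = 0 \<or> \<phi> v = 0 \<or> \<phi> u = \<phi> v"
        proof (cases "e \<in> E1")
          case True
          then have "u \<in> V1" "v \<in> V1" using EV e by blast+
          then show ?thesis using 1(1) True e \<phi>1 unfolding partial_solution_def conflict_free_def by metis
        next
          case False
          then have "u \<in> V2" "v \<in> V2" "e \<in> E2" using EV2 e by blast+
          then show ?thesis using 2(1) e \<phi>2 unfolding partial_solution_def conflict_free_def by metis
        qed
      qed
      show "\<forall>v\<in>\<Union>(M1 \<union> M2). 0 < \<phi> v" unfolding U using pos \<phi>1 \<phi>2 MV by (metis Un_iff subsetD)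
      show "\<forall>v\<in>V1 \<union> V2 - set b. 0 < \<phi> v \<longrightarrow> v \<in> \<Union>(M1 \<union> M2)"
        unfolding U using 1(1) 2(1) \<phi>1 \<phi>2 unfolding partial_solution_def
        by (metis (no_types, lifting) Diff_iff Un_iff)
    qed
    moreover have "fits q b \<phi> (\<Union>(M1 \<union> M2)) i"
      unfolding fits_def
    proof (intro allI impI eq_code)
      fix k assume k: "k < length b"
      have v: "b ! k \<in> V1" "b ! k \<in> V2" using k bV by (meson nth_mem subsetD)+
      show "col (dig q k i) = \<phi> (b ! k)" using jk(1)[OF k] d1(1)[OF k] \<phi>1[OF v(1)] by simp
      show "isM (dig q k i) \<longleftrightarrow> b ! k \<in> \<Union>(M1 \<union> M2)"
      proof -
        have "isM (dig q k i1) \<longleftrightarrow> b ! k \<in> \<Union>M1" unfolding d1(1)[OF k] isM_code using pos(1) by blast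
        moreover have "isM (dig q k i2) \<longleftrightarrow> b ! k \<in> \<Union>M2" unfolding d1(2)[OF k] isM_code using pos(2) by blast
        ultimately show ?thesis unfolding U using jk(4)[OF k] by blast
      qed
    qed
    moreover have "set_encode (\<phi> ` \<Union>(M1 \<union> M2)) = U"
    proof -
      have "\<phi> ` \<Union>M1 = \<phi>1 ` \<Union>M1" by (rule image_cong[OF refl], rule \<phi>1) (use MV in blast)
      moreover have "\<phi> ` \<Union>M2 = \<phi>2 ` \<Union>M2" by (rule image_cong[OF refl], rule \<phi>2) (use MV in blast)
      moreover have "finite (\<phi>1 ` \<Union>M1)" "finite (\<phi>2 ` \<Union>M2)" using finite_Union_edges M by blast+
      ultimately show ?thesis
        unfolding U image_Un j(5) 1(3)[symmetric] 2(3)[symmetric] by (simp only: set_encode_inverse)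
    qed
    moreover have "h U i = Suc (card (M1 \<union> M2))"
    proof -
      have "finite M1" "finite M2" using M finite_subset E_finite by blast+
      moreover have "M1 \<inter> M2 = {}" using disj edge_nonempty M by blast
      ultimately show ?thesis using j(9) 1(4) 2(4) by (simp add: card_Un_disjoint)
    qed
    ultimately show "\<exists>\<phi> M. partial_solution c (V1 \<union> V2) (E1 \<union> E2) (set b) \<phi> M \<and> fits q b \<phi> (\<Union>M) i \<and>
      set_encode (\<phi> ` \<Union>M) = U \<and> h U i = Suc (card M)" by blast
  qed
  moreover have "complete b h (V1 \<union> V2) (E1 \<union> E2)"
    unfolding complete_def
  proof (intro allI impI)
    fix \<phi> M M' i
    assume opt: "optimal \<phi> M" and M': "M' \<subseteq> M \<inter> (E1 \<union> E2)"
      and inner: "\<forall>e\<in>M. e \<inter> (V1 \<union> V2 - set b) \<noteq> {} \<longrightarrow> e \<in> M'" and i: "i < Z"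
      and fi: "fits q b \<phi> (\<Union>M') i" and d: "\<forall>j<t. length b \<le> j \<longrightarrow> \<not> isM (dig q j i)"
    \<comment> \<open>Edges lying in both parts are all given to the first one; completeness
      quantifies over every such split.\<close>
    define M1 M2 where "M1 = M' \<inter> E1" and "M2 = M' - E1"
    have M12: "M' = M1 \<union> M2" "M1 \<inter> M2 = {}" "M1 \<subseteq> M \<inter> E1" "M2 \<subseteq> M \<inter> E2"
      using M' by (auto simp: M1_def M2_def)
    have ple: "\<phi> v \<le> c" for v using opt solution_le by (auto simp: optimal_def)
    have pos: "0 < \<phi> v" if "v \<in> \<Union>M" for v using opt that by (auto simp: optimal_def solution_def)
    have disjV: "e \<inter> (V1 - set b) = {}" if "e \<in> E2" for e using EV2[OF that] V by blast
    have disjV2: "e \<inter> (V2 - set b) = {}" if "e \<in> E1" for e using EV[OF that] V by blast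
    have in1: "\<forall>e\<in>M. e \<inter> (V1 - set b) \<noteq> {} \<longrightarrow> e \<in> M1"
    proof (intro ballI impI)
      fix e assume e: "e \<in> M" "e \<inter> (V1 - set b) \<noteq> {}"
      then have "e \<in> M'" using inner by blast
      moreover have "e \<notin> E2" using disjV e by blast
      ultimately show "e \<in> M1" using M' by (auto simp: M1_def)
    qed
    have in2: "\<forall>e\<in>M. e \<inter> (V2 - set b) \<noteq> {} \<longrightarrow> e \<in> M2"
    proof (intro ballI impI)
      fix e assume e: "e \<in> M" "e \<inter> (V2 - set b) \<noteq> {}"
      then have "e \<in> M'" using inner by blast
      moreover have "e \<notin> E1" using disjV2 e by blast
      ultimately show "e \<in> M2" by (auto simp: M2_def)
    qed
    \<comment> \<open>The boundary state of either half. Its padding is that of \<open>i\<close>, so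
      the colours agree there, and by assumption no padding digit is matched.\<close>
    define ix where "ix N = enc q t (\<lambda>j. if j < length b then code \<phi> (\<Union>N) (b ! j) else dig q j i)"
      for N :: "nat set set"
    have ix: "ix N < Z" "fits q b \<phi> (\<Union>N) (ix N)"
      "\<And>j. j < t \<Longrightarrow> length b \<le> j \<Longrightarrow> dig q j (ix N) = dig q j i"
      "\<And>j. j < length b \<Longrightarrow> dig q j (ix N) = code \<phi> (\<Union>N) (b ! j)" for N
      using code_fits[where b = b and \<phi> = \<phi> and dd = "\<lambda>j. dig q j i" and X = "\<Union>N", OF ple b(2) dig_less_q] unfolding ix_def by blast+
    have dd: "\<forall>j<t. length b \<le> j \<longrightarrow> \<not> isM (dig q j (ix N))" for N using d ix(3) by auto
    let ?U1 = "set_encode (\<phi> ` \<Union>M1)" and ?U2 = "set_encode (\<phi> ` \<Union>M2)"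
    note w1 = window[OF f opt M12(3) in1 ix(1,2) dd]
    note w2 = window[OF g opt M12(4) in2 ix(1,2) dd]
    have disj: "\<Union>M1 \<inter> \<Union>M2 = {}"
    proof (rule ccontr)
      assume "\<Union>M1 \<inter> \<Union>M2 \<noteq> {}"
      then obtain v e e' where "v \<in> e" "v \<in> e'" "e \<in> M1" "e' \<in> M2" by blast
      moreover have "matching E M" using opt by (simp add: optimal_def solution_def)
      moreover from calculation have "e \<in> M" "e' \<in> M" "e \<noteq> e'" using M12 by blast+
      ultimately show False unfolding matching_def by blast
    qed
    have "jn q t (ix M1) (ix M2) i"
      unfolding jn_def
    proof (intro allI impI)
      fix k assume k: "k < t"
      show "col (dig q k (ix M1)) = col (dig q k i) \<and> col (dig q k (ix M2)) = col (dig q k i) \<and>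
        \<not> (isM (dig q k (ix M1)) \<and> isM (dig q k (ix M2))) \<and>
        (isM (dig q k i) \<longleftrightarrow> isM (dig q k (ix M1)) \<or> isM (dig q k (ix M2)))"
      proof (cases "k < length b")
        case True
        moreover have "\<Union>M' = \<Union>M1 \<union> \<Union>M2" using M12 by blast
        ultimately show ?thesis using ix(4) fi disj by (auto simp: fits_def)
      next
        case False
        then show ?thesis using ix(3) d k by auto
      qed
    qed
    then have "f ?U1 (ix M1) + g ?U2 (ix M2) - 1 \<le> h (join_code ?U1 ?U2) i"
      using h w1 w2 ix(1) i unfolding joined_def by (metis (no_types, lifting) Suc_le_lessD gr0I not_less_eq_eq zero_le)
    moreover have "join_code ?U1 ?U2 = set_encode (\<phi> ` \<Union>M')"
    proof -
      have "M1 \<subseteq> E" "M2 \<subseteq> E" using M12 p1 p2 by (auto simp: part_def)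
      then have "finite (\<phi> ` \<Union>M1)" "finite (\<phi> ` \<Union>M2)" using finite_Union_edges by blast+
      then have "join_code ?U1 ?U2 = set_encode (\<phi> ` \<Union>M1 \<union> \<phi> ` \<Union>M2)"
        by (simp only: set_encode_inverse)
      also have "\<phi> ` \<Union>M1 \<union> \<phi> ` \<Union>M2 = \<phi> ` \<Union>M'" using M12(1) by blast
      finally show ?thesis .
    qed
    moreover have "card M' = card M1 + card M2"
    proof -
      have "M' \<subseteq> E" using M' p1 p2 by (auto simp: part_def)
      then have "finite M1" "finite M2" using M12(1) finite_subset E_finite by (metis finite_Un)+
      then show ?thesis using M12 by (simp add: card_Un_disjoint)
    qed
    ultimately show "Suc (card M') \<le> h (set_encode (\<phi> ` \<Union>M')) i" using w1(1) w2(1) by simp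
  qed
  ultimately show ?thesis by (simp add: good_def)
qed

text \<open>Vertices leaving the bag become inner, which is legitimate when they are uncoloured or
  matched. Vertices entering it are new to the part, because \<open>VA\<close> meets the new bag
  only inside the old one, and hence unmatched. Matching and colour set stay the same.\<close>

lemma good_project:
  assumes T: "good bv T VA EA" and bu: "distinct bu" "length bu \<le> t" "set bu \<subseteq> {..<n}"
    and V: "VA \<inter> set bu \<subseteq> set bv" and cl: "\<forall>e\<in>E. e \<inter> (VA - set bu) \<noteq> {} \<longrightarrow> e \<in> EA"
    and g: "projected bv bu T g"
  shows "good bu g (VA \<union> set bu) EA"
proof -
  have p: "part bv VA EA" using T by (simp add: good_def)
  have bv: "distinct bv" "length bv \<le> t" "set bv \<subseteq> VA" using p by (auto simp: part_def)
  have EV: "e \<subseteq> VA" if "e \<in> EA" for e using p that by (auto simp: part_def)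
  have VA: "(VA \<union> set bu) - set bu = VA - set bu" by blast
  have "part bu (VA \<union> set bu) EA" 
  proof -
    have "VA \<subseteq> {..<n}" "EA \<subseteq> E" using p by (simp_all add: part_def)
    then show ?thesis using bu cl EV unfolding part_def VA by (simp add: le_supI1)
  qed
  moreover have "sound bu g (VA \<union> set bu) EA"
    unfolding sound_def VA partial_solution_def
  proof (intro allI impI)
    fix U i assume Ui: "U < CU" "i < Z" "0 < g U i"
    then obtain i' where i': "i' < Z" "compat bv bu i' i" "g U i = T U i'"
      using g unfolding projected_def by blast
    then obtain \<psi> M where ps: "partial_solution c VA EA (set bv) \<psi> M" "fits q bv \<psi> (\<Union>M) i'"
      "set_encode (\<psi> ` \<Union>M) = U" "T U i' = Suc (card M)"
      using T Ui unfolding good_def sound_def by fastforce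
    obtain \<xi> where \<xi>: "\<And>j. j < length bu \<Longrightarrow> \<xi> (bu ! j) = col (dig q j i)" "\<And>v. \<xi> v \<le> c"
      using index_colouring[OF bu(1)] by metis
    \<comment> \<open>New bag vertices get the colours recorded in the target state
      \<open>i\<close>; no edge of the part touches them.\<close>
    define \<phi> where "\<phi> v = (if v \<in> VA then \<psi> v else \<xi> v)" for v
    have MV: "\<Union>M \<subseteq> VA" using ps(1) EV unfolding partial_solution_def matching_def by blast
    have eq: "\<phi> v = \<psi> v" if "v \<in> \<Union>M" for v using MV that by (auto simp: \<phi>_def)
    have dv: "dig q j i' = code \<psi> (\<Union>M) (bv ! j)" if "j < length bv" for j
      using ps(2) that by (simp add: fits_def)
    have "matching EA M \<and> (\<forall>v\<in>VA \<union> set bu. \<phi> v \<le> c) \<and> conflict_free EA \<phi> \<and> (\<forall>v\<in>\<Union>M. 0 < \<phi> v) \<and>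
      (\<forall>v\<in>VA - set bu. 0 < \<phi> v \<longrightarrow> v \<in> \<Union>M)"
    proof (intro conjI)
      show "matching EA M" using ps(1) by (simp add: partial_solution_def)
      show "\<forall>v\<in>VA \<union> set bu. \<phi> v \<le> c" using ps(1) \<xi>(2) by (auto simp: \<phi>_def partial_solution_def)
      show "conflict_free EA \<phi>"
        unfolding conflict_free_def
      proof (intro ballI)
        fix e u v assume e: "e \<in> EA" "u \<in> e" "v \<in> e"
        then have "u \<in> VA" "v \<in> VA" using EV by blast+
        then show "\<phi> u = 0 \<or> \<phi> v = 0 \<or> \<phi> u = \<phi> v"
          using ps(1)[unfolded partial_solution_def conflict_free_def] e by (simp add: \<phi>_def) blast
      qed
      show "\<forall>v\<in>\<Union>M. 0 < \<phi> v" using ps(1) eq by (auto simp: partial_solution_def)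
      show "\<forall>v\<in>VA - set bu. 0 < \<phi> v \<longrightarrow> v \<in> \<Union>M"
      proof (intro ballI impI)
        fix v assume v: "v \<in> VA - set bu" "0 < \<phi> v"
        then have \<psi>v: "0 < \<psi> v" by (simp add: \<phi>_def)
        show "v \<in> \<Union>M"
        proof (cases "v \<in> set bv")
          case True
          then obtain j where j: "j < length bv" "v = bv ! j" unfolding in_set_conv_nth by blast
          then have "\<not> odd (dig q j i')" using i'(2) v by (auto simp: compat_def)
          then show ?thesis using dv[OF j(1)] j(2) \<psi>v by (auto simp: code_def split: if_splits)
        next
          case False
          then show ?thesis using ps(1) v \<psi>v by (auto simp: partial_solution_def)
        qed
      qed
    qed
    moreover have "fits q bu \<phi> (\<Union>M) i"
      unfolding fits_def
    proof (intro allI impI)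
      fix k assume k: "k < length bu"
      show "dig q k i = code \<phi> (\<Union>M) (bu ! k)"
      proof (cases "bu ! k \<in> set bv")
        case True
        then obtain j where j: "j < length bv" "bv ! j = bu ! k" unfolding in_set_conv_nth by blast
        then have "dig q k i = dig q j i'" using i'(2) k by (simp add: compat_def)
        also have "\<dots> = code \<psi> (\<Union>M) (bu ! k)" using dv[OF j(1)] j(2) by simp
        also have "\<dots> = code \<phi> (\<Union>M) (bu ! k)" using True bv(3) by (auto simp: \<phi>_def code_def)
        finally show ?thesis .
      next
        case False
        then have out: "bu ! k \<notin> VA" using V k by auto
        then have "bu ! k \<notin> \<Union>M" using MV by blast
        moreover have "\<not> isM (dig q k i)" using i'(2) k bu(2) False by (simp add: compat_def)
        ultimately show ?thesis using \<xi>(1)[OF k] out by (intro eq_code) (auto simp: \<phi>_def)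
      qed
    qed
    moreover have "\<phi> ` \<Union>M = \<psi> ` \<Union>M" using eq by (rule image_cong[OF refl])
    ultimately show "\<exists>\<phi> M. (matching EA M \<and> (\<forall>v\<in>VA \<union> set bu. \<phi> v \<le> c) \<and> conflict_free EA \<phi> \<and>
      (\<forall>v\<in>\<Union>M. 0 < \<phi> v) \<and> (\<forall>v\<in>VA - set bu. 0 < \<phi> v \<longrightarrow> v \<in> \<Union>M)) \<and> fits q bu \<phi> (\<Union>M) i \<and>
      set_encode (\<phi> ` \<Union>M) = U \<and> g U i = Suc (card M)"
      using ps(3,4) i'(3) by (intro exI[of _ \<phi>] exI[of _ M]) auto
  qed
  moreover have "complete bu g (VA \<union> set bu) EA"
    unfolding complete_def VA
  proof (intro allI impI)
    fix \<phi> M M' i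
    assume opt: "optimal \<phi> M" and M': "M' \<subseteq> M \<inter> EA"
      and inner: "\<forall>e\<in>M. e \<inter> (VA - set bu) \<noteq> {} \<longrightarrow> e \<in> M'" and i: "i < Z"
      and fi: "fits q bu \<phi> (\<Union>M') i" and d: "\<forall>j<t. length bu \<le> j \<longrightarrow> \<not> isM (dig q j i)"
    have ple: "\<phi> v \<le> c" for v using opt solution_le by (auto simp: optimal_def)
    have pos: "0 < \<phi> v \<longleftrightarrow> v \<in> \<Union>M" for v using opt by (auto simp: optimal_def solution_def)
    have inner': "\<forall>e\<in>M. e \<inter> (VA - set bv) \<noteq> {} \<longrightarrow> e \<in> M'" using inner V by blast
    have MV: "\<Union>M' \<subseteq> VA" using M' EV by blast
    define i' where "i' = enc q t (\<lambda>j. if j < length bv then code \<phi> (\<Union>M') (bv ! j) else 0)"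
    have ix: "i' < Z" "fits q bv \<phi> (\<Union>M') i'" "\<And>j. j < t \<Longrightarrow> length bv \<le> j \<Longrightarrow> dig q j i' = 0"
      "\<And>j. j < length bv \<Longrightarrow> dig q j i' = code \<phi> (\<Union>M') (bv ! j)"
      using code_fits[where b = bv and \<phi> = \<phi> and dd = "\<lambda>j. 0" and X = "\<Union>M'", OF ple bv(2)] unfolding i'_def by simp_all
    have "Suc (card M') \<le> T (set_encode (\<phi> ` \<Union>M')) i'"
      using T opt M' inner' ix unfolding good_def complete_def by simp
    also have "\<dots> \<le> g (set_encode (\<phi> ` \<Union>M')) i"
    proof -
      have "compat bv bu i' i"
        unfolding compat_def
      proof (intro conjI allI impI)
        fix j k assume "j < length bv" "k < length bu" "bv ! j = bu ! k"
        then show "dig q j i' = dig q k i" using ix(4) fi by (simp add: fits_def)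
      next
        fix j assume j: "j < length bv" "bv ! j \<notin> set bu"
        \<comment> \<open>A coloured vertex that leaves the bag is matched by the optimal solution,
          and its edge now touches an inner vertex, hence belongs to \<open>M'\<close>.\<close>
        have "bv ! j \<in> \<Union>M'" if gt: "0 < \<phi> (bv ! j)"
        proof -
          obtain e where e: "e \<in> M" "bv ! j \<in> e" using pos gt by blast
          have "bv ! j \<in> VA" using j bv(3) nth_mem by blast
          then have "e \<in> M'" using inner e j by blast
          then show ?thesis using e by blast
        qed
        then show "\<not> odd (dig q j i')" using ix(4)[OF j(1)] by (auto simp: code_def)
      next
        fix k assume k: "k < t" "k < length bu \<longrightarrow> bu ! k \<notin> set bv"
        show "\<not> isM (dig q k i)"
        proof (cases "k < length bu")
          case True
          then have "bu ! k \<notin> VA" using k V by auto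
          then show ?thesis using True fi MV by (auto simp: fits_def)
        qed (use d k in auto)
      qed
      moreover have "set_encode (\<phi> ` \<Union>M') < CU" by (rule colours_less[OF opt]) (use M' in blast)
      ultimately show ?thesis using g ix(1) i unfolding projected_def by blast
    qed
    finally show "Suc (card M') \<le> g (set_encode (\<phi> ` \<Union>M')) i" .
  qed
  ultimately show ?thesis by (simp add: good_def)
qed

text \<open>Even digits mean that no bag vertex is coloured but unmatched, so a partial solution of
  the whole graph is a solution. The comparison with \<open>l\<close> is strict because entries are
  sizes plus one.\<close>

lemma good_root:
  assumes g: "good b T {..<n} E"
  shows "(\<exists>i<Z. (\<forall>j<t. even (dig q j i)) \<and> l < T (set_encode {1..c}) i) \<longleftrightarrow>
    has_disconnected_matching c E l"
  unfolding solution_iff[OF graph c_pos]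
proof
  assume "\<exists>i<Z. (\<forall>j<t. even (dig q j i)) \<and> l < T (set_encode {1..c}) i"
  then obtain i where i: "i < Z" "\<forall>j<t. even (dig q j i)" "l < T (set_encode {1..c}) i" by blast
  have "set_encode {1..c} < CU" unfolding CU_def by (rule set_encode_less) auto
  then obtain \<phi> M where ps: "partial_solution c {..<n} E (set b) \<phi> M" "fits q b \<phi> (\<Union>M) i"
    "set_encode (\<phi> ` \<Union>M) = set_encode {1..c}" "T (set_encode {1..c}) i = Suc (card M)"
    using g i unfolding good_def sound_def by (metis bot_nat_0.extremum_strict gr0I)
  have ME: "M \<subseteq> E" using ps(1) by (simp add: partial_solution_def matching_def)
  have MV: "\<Union>M \<subseteq> {..<n}" using ME edge_subset by blast
  have bt: "length b \<le> t" using g by (simp add: good_def part_def)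
  have full: "v \<in> \<Union>M" if v: "v < n" "0 < \<phi> v" for v
  proof (cases "v \<in> set b")
    case True
    then obtain j where j: "j < length b" "v = b ! j" unfolding in_set_conv_nth by blast
    then have "dig q j i = code \<phi> (\<Union>M) v" using ps(2) by (simp add: fits_def)
    then have "even (code \<phi> (\<Union>M) v)" using i(2) bt j(1) by (metis less_le_trans)
    then show ?thesis using v by (auto simp: code_def split: if_splits)
  next
    case False
    then show ?thesis using ps(1) v by (auto simp: partial_solution_def)
  qed
  \<comment> \<open>A partial solution says nothing about numbers outside the vertex set, while a
    solution leaves them uncoloured.\<close>
  define \<chi> where "\<chi> v = (if v < n then \<phi> v else 0)" for v
  have eq: "\<chi> v = \<phi> v" if "v \<in> \<Union>M" for v using MV that by (auto simp: \<chi>_def)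
  have "solution c E \<chi> M"
    unfolding solution_def
  proof (intro conjI allI)
    show "matching E M" using ps(1) by (simp add: partial_solution_def)
    show "0 < \<chi> v \<longleftrightarrow> v \<in> \<Union>M" for v
    proof
      assume "v \<in> \<Union>M"
      then have "0 < \<phi> v" using ps(1) unfolding partial_solution_def by blast
      then show "0 < \<chi> v" using eq[OF \<open>v \<in> \<Union>M\<close>] by simp
    next
      assume "0 < \<chi> v"
      then have "v < n" "0 < \<phi> v" by (auto simp: \<chi>_def split: if_splits)
      then show "v \<in> \<Union>M" by (rule full)
    qed
    show "conflict_free E \<chi>"
      using ps(1) unfolding partial_solution_def conflict_free_def \<chi>_def by (metis (no_types, lifting))
    have "\<chi> ` \<Union>M = \<phi> ` \<Union>M" using eq by (rule image_cong[OF refl])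
    also have "\<dots> = {1..c}" using ps(3) set_encode_eq[of "\<phi> ` \<Union>M" "{1..c}"] finite_Union_edges[OF ME] by simp
    finally show "\<chi> ` \<Union>M = {1..c}" .
  qed
  then show "\<exists>\<phi> M. solution c E \<phi> M \<and> l \<le> card M" using i(3) ps(4) by (intro exI conjI) auto
next
  assume "\<exists>\<phi> M. solution c E \<phi> M \<and> l \<le> card M"
  then obtain \<phi>0 M0 where 0: "solution c E \<phi>0 M0" "l \<le> card M0" by blast
  \<comment> \<open>Completeness speaks of optimal solutions only, so a largest solution is chosen;
    sizes are bounded by the number of edges.\<close>
  let ?P = "\<lambda>k. \<exists>\<phi> M. solution c E \<phi> M \<and> card M = k"
  have bound: "k \<le> card E" if "?P k" for k
    using that card_mono[OF E_finite] by (auto simp: solution_def matching_def)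
  have "?P (card M0)" using 0 by blast
  from GreatestI_nat[where P = ?P, OF this bound] Greatest_le_nat[where P = ?P, OF _ bound]
  obtain \<phi> M where opt: "optimal \<phi> M" unfolding optimal_def by metis
  have sol: "solution c E \<phi> M" and ge: "card M0 \<le> card M" using opt 0 by (auto simp: optimal_def)
  have ME: "M \<subseteq> M \<inter> E" using sol by (auto simp: solution_def matching_def)
  have bt: "length b \<le> t" using g by (simp add: good_def part_def)
  define i where "i = enc q t (\<lambda>j. if j < length b then code \<phi> (\<Union>M) (b ! j) else 0)"
  have ix: "i < Z" "fits q b \<phi> (\<Union>M) i" "\<And>j. j < t \<Longrightarrow> length b \<le> j \<Longrightarrow> dig q j i = 0"
    "\<And>j. j < length b \<Longrightarrow> dig q j i = code \<phi> (\<Union>M) (b ! j)"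
    using code_fits[where b = b and \<phi> = \<phi> and dd = "\<lambda>j. 0" and X = "\<Union>M", OF solution_le[OF sol] bt] unfolding i_def by simp_all
  have "Suc (card M) \<le> T (set_encode (\<phi> ` \<Union>M)) i"
    using g opt ME ix unfolding good_def complete_def by simp
  moreover have "\<phi> ` \<Union>M = {1..c}" using sol by (simp add: solution_def)
  moreover have "even (dig q j i)" if "j < t" for j
  proof (cases "j < length b")
    case True
    have "0 < \<phi> (b ! j) \<longleftrightarrow> b ! j \<in> \<Union>M" using sol unfolding solution_def by blast
    then show ?thesis using ix(4)[OF True] by (auto simp: code_def)
  next
    case False
    then show ?thesis using ix(3)[OF that] by simp
  qed
  ultimately show "\<exists>i<Z. (\<forall>j<t. even (dig q j i)) \<and> l < T (set_encode {1..c}) i"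
    using ix(1) ge 0(2) by (intro exI[of _ i]) auto
qed

text \<open>The edges of a matching have distinct representatives among the \<open>n\<close>
  vertices. This crude bound keeps the sum of two entries below \<open>B\<close>.\<close>

lemma good_le:
  assumes "good b T VA EA" "U < CU" "i < Z"
  shows "T U i \<le> n + 1"
proof (cases "T U i = 0")
  case False
  then obtain \<phi> M where ps: "partial_solution c VA EA (set b) \<phi> M" "T U i = Suc (card M)"
    using assms unfolding good_def sound_def by blast
  have ME: "M \<subseteq> E" using ps(1) assms(1)
    by (auto simp: good_def part_def partial_solution_def matching_def)
  define h where "h e = (SOME v. v \<in> e)" for e :: "nat set"
  have h: "h e \<in> e" if "e \<in> M" for e
    unfolding h_def by (rule someI_ex) (use that ME edge_nonempty in blast)
  have "inj_on h M"
  proof (rule inj_onI)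
    fix e f assume ef: "e \<in> M" "f \<in> M" "h e = h f"
    then have "e \<inter> f \<noteq> {}" using h[of e] h[of f] by auto
    then show "e = f" using ps(1) ef unfolding partial_solution_def matching_def by blast
  qed
  moreover have "h ` M \<subseteq> {..<n}" using h ME edge_subset by blast
  ultimately have "card M \<le> card {..<n}" by (intro card_inj_on_le) auto
  then show ?thesis using ps(2) by simp
qed simp

end

section \<open>Stripping the leaves of the decomposition tree\<close>

definition nb :: "nat set set \<Rightarrow> nat set \<Rightarrow> nat \<Rightarrow> nat set" where
  "nb F Al v = {u \<in> Al. {v, u} \<in> F}"

lemma nb_subset: "nb F Al v \<subseteq> Al"
  by (auto simp: nb_def)

lemma nb_sym: "u \<in> nb F Al v \<Longrightarrow> v \<in> Al \<Longrightarrow> v \<in> nb F Al u"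
  by (auto simp: nb_def insert_commute)

lemma nb_remove: "nb F (Al - {v}) x = nb F Al x - {v}"
  by (auto simp: nb_def)

lemma nb_irrefl: "simple_graph X F \<Longrightarrow> v \<notin> nb F Al v"
  by (auto simp: nb_def simple_graph_def)

text \<open>The first vertex of a longest path is a leaf: two neighbours on the path would close a cycle.\<close>

lemma leaf_exists:
  assumes fin: "finite Al" and ne: "Al \<noteq> {}" and G: "simple_graph X F"
    and acyc: "\<nexists>vs. is_cycle F vs" and nbs: "\<And>v. v \<in> Al \<Longrightarrow> nb F Al v \<noteq> {}"
  shows "\<exists>v\<in>Al. card (nb F Al v) = 1"
proof -
  define path where "path vs \<longleftrightarrow> vs \<noteq> [] \<and> distinct vs \<and> set vs \<subseteq> Al \<and>
    (\<forall>i. Suc i < length vs \<longrightarrow> {vs ! i, vs ! Suc i} \<in> F)" for vs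
  let ?P = "\<lambda>k. \<exists>vs. path vs \<and> length vs = k"
  have bound: "k \<le> card Al" if "?P k" for k
  proof -
    obtain vs where vs: "path vs" "length vs = k" using \<open>?P k\<close> by blast
    have "card (set vs) \<le> card Al" by (rule card_mono[OF fin]) (use vs in \<open>simp add: path_def\<close>)
    then show ?thesis using vs distinct_card[of vs] by (simp add: path_def)
  qed
  obtain a where "a \<in> Al" using ne by blast
  then have "?P 1" by (intro exI[of _ "[a]"]) (simp add: path_def)
  from GreatestI_nat[where P = ?P, OF this bound] Greatest_le_nat[where P = ?P, OF _ bound]
  obtain vs where vs: "path vs" and longest: "\<And>ws. path ws \<Longrightarrow> length ws \<le> length vs" by metis
  define h where "h = vs ! 0"
  have len: "0 < length vs" using vs by (simp add: path_def)
  have hA: "h \<in> Al" using vs len unfolding path_def h_def by (meson nth_mem subsetD)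
  have on: "x \<in> set vs" if x: "x \<in> nb F Al h" for x
  proof (rule ccontr)
    assume "x \<notin> set vs"
    then have "path (x # vs)"
      using vs x len unfolding path_def nb_def h_def
      by (auto simp: nth_Cons insert_commute split: nat.splits)
    then show False using longest by fastforce
  qed
  have idx: "x = vs ! 1" "1 < length vs" if x: "x \<in> nb F Al h" for x
  proof -
    obtain i where i: "i < length vs" "vs ! i = x" using on[OF x] by (auto simp: in_set_conv_nth)
    have "i \<noteq> 0" using i x nb_irrefl[OF G] h_def by metis
    moreover have "\<not> 2 \<le> i"
    proof
      assume 2: "2 \<le> i"
      have "is_cycle F (take (Suc i) vs)"
        unfolding is_cycle_def
      proof (intro conjI allI impI)
        show "3 \<le> length (take (Suc i) vs)" using 2 i by simp
        show "distinct (take (Suc i) vs)" using vs by (simp add: path_def)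
        show "{take (Suc i) vs ! j, take (Suc i) vs ! Suc j} \<in> F" if "Suc j < length (take (Suc i) vs)" for j
          using that vs by (simp add: path_def)
        have "last (take (Suc i) vs) = x" using i by (simp add: take_Suc_conv_app_nth)
        moreover have "hd (take (Suc i) vs) = h" using len by (simp add: hd_conv_nth h_def)
        ultimately show "{last (take (Suc i) vs), hd (take (Suc i) vs)} \<in> F"
          using x by (simp add: nb_def insert_commute)
      qed
      then show False using acyc by blast
    qed
    ultimately have "i = 1" by linarith
    then show "x = vs ! 1" "1 < length vs" using i by auto
  qed
  obtain x where x: "x \<in> nb F Al h" using nbs[OF hA] by blast
  then have "nb F Al h = {x}" using idx by blast
  then show ?thesis using hA by (intro bexI[of _ h]) auto
qed

text \<open>\<open>Al\<close> is the set of nodes that are still alive and \<open>D x\<close> the set of nodes absorbed by \<open>x\<close>.\<close>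

definition stripped :: "nat set set \<Rightarrow> nat \<Rightarrow> nat set \<Rightarrow> (nat \<Rightarrow> nat set) \<Rightarrow> bool" where
  "stripped F N Al D \<longleftrightarrow> Al \<subseteq> {..<N} \<and>
     (\<forall>u\<in>Al. \<forall>v\<in>Al. (u, v) \<in> {(x, y). x \<in> Al \<and> y \<in> Al \<and> {x, y} \<in> F}\<^sup>*) \<and>
     (\<forall>x\<in>Al. x \<in> D x \<and> D x \<subseteq> {..<N}) \<and> (\<forall>y<N. \<exists>x\<in>Al. y \<in> D x) \<and>
     (\<forall>x\<in>Al. \<forall>y\<in>Al. x \<noteq> y \<longrightarrow> D x \<inter> D y = {} \<and>
        (\<forall>a\<in>D x. \<forall>b\<in>D y. {a, b} \<in> F \<longrightarrow> a = x \<and> b = y))"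

lemma strippedD:
  assumes "stripped F N Al D"
  shows "x \<in> Al \<Longrightarrow> x < N"
    and "u \<in> Al \<Longrightarrow> v \<in> Al \<Longrightarrow> (u, v) \<in> {(x, y). x \<in> Al \<and> y \<in> Al \<and> {x, y} \<in> F}\<^sup>*"
    and "x \<in> Al \<Longrightarrow> x \<in> D x" and "x \<in> Al \<Longrightarrow> D x \<subseteq> {..<N}"
    and "y < N \<Longrightarrow> \<exists>x\<in>Al. y \<in> D x"
    and "x \<in> Al \<Longrightarrow> y \<in> Al \<Longrightarrow> x \<noteq> y \<Longrightarrow> D x \<inter> D y = {}"
    and "x \<in> Al \<Longrightarrow> y \<in> Al \<Longrightarrow> x \<noteq> y \<Longrightarrow> a \<in> D x \<Longrightarrow> b \<in> D y \<Longrightarrow> {a, b} \<in> F \<Longrightarrow> a = x \<and> b = y"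
proof -
  have *: "Al \<subseteq> {..<N}" "\<forall>u\<in>Al. \<forall>v\<in>Al. (u, v) \<in> {(x, y). x \<in> Al \<and> y \<in> Al \<and> {x, y} \<in> F}\<^sup>*"
    "\<forall>x\<in>Al. x \<in> D x \<and> D x \<subseteq> {..<N}" "\<forall>y<N. \<exists>x\<in>Al. y \<in> D x"
    "\<forall>x\<in>Al. \<forall>y\<in>Al. x \<noteq> y \<longrightarrow> D x \<inter> D y = {} \<and>
        (\<forall>a\<in>D x. \<forall>b\<in>D y. {a, b} \<in> F \<longrightarrow> a = x \<and> b = y)"
    using assms unfolding stripped_def by - (elim conjE, assumption)+
  show "x \<in> Al \<Longrightarrow> x < N" using *(1) by blast
  show "u \<in> Al \<Longrightarrow> v \<in> Al \<Longrightarrow> (u, v) \<in> {(x, y). x \<in> Al \<and> y \<in> Al \<and> {x, y} \<in> F}\<^sup>*"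
    using *(2) by blast
  show "x \<in> Al \<Longrightarrow> x \<in> D x" "x \<in> Al \<Longrightarrow> D x \<subseteq> {..<N}" using *(3) by blast+
  show "y < N \<Longrightarrow> \<exists>x\<in>Al. y \<in> D x" using *(4) by blast
  show "x \<in> Al \<Longrightarrow> y \<in> Al \<Longrightarrow> x \<noteq> y \<Longrightarrow> D x \<inter> D y = {}"
    "x \<in> Al \<Longrightarrow> y \<in> Al \<Longrightarrow> x \<noteq> y \<Longrightarrow> a \<in> D x \<Longrightarrow> b \<in> D y \<Longrightarrow> {a, b} \<in> F \<Longrightarrow> a = x \<and> b = y"
    using *(5) by blast+
qed

lemma stripped_init:
  assumes "is_tree {..<N} F"
  shows "stripped F N {..<N} (\<lambda>x. {x})"
proof -
  have e: "e \<subseteq> {..<N}" if "e \<in> F" for e using assms that by (auto simp: is_tree_def simple_graph_def)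
  have "{(x, y). x \<in> {..<N} \<and> y \<in> {..<N} \<and> {x, y} \<in> F} = {(x, y). {x, y} \<in> F}" using e by blast
  then show ?thesis using assms
    unfolding stripped_def is_tree_def connected_graph_def reachable_def by auto
qed

text \<open>A path between surviving nodes that visits the leaf \<open>v\<close> enters and leaves
  it through \<open>u\<close>, so the detour can be cut out. The only tree edge leaving
  \<open>D v\<close> joins \<open>v\<close> to \<open>u\<close>, and it becomes internal.\<close>

lemma stripped_step:
  assumes S: "stripped F N Al D" and G: "simple_graph X F" and v: "v \<in> Al" and u: "nb F Al v = {u}"
  shows "stripped F N (Al - {v}) (D(u := D u \<union> D v))"
proof -
  have uA: "u \<in> Al" using u by (auto simp: nb_def)
  have uv: "u \<noteq> v" using u nb_irrefl[OF G, of v Al] by auto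
  let ?R = "{(x, y). x \<in> Al \<and> y \<in> Al \<and> {x, y} \<in> F}"
  let ?R' = "{(x, y). x \<in> Al - {v} \<and> y \<in> Al - {v} \<and> {x, y} \<in> F}"
  \<comment> \<open>While the old path stands at the removed node \<open>v\<close>, the new path
    waits at \<open>u\<close>.\<close>
  have path: "(w \<noteq> v \<longrightarrow> (a, w) \<in> ?R'\<^sup>*) \<and> (w = v \<longrightarrow> (a, u) \<in> ?R'\<^sup>*)"
    if "(a, w) \<in> ?R\<^sup>*" "a \<noteq> v" for a w
    using that(1)
  proof induction
    case base
    then show ?case using that(2) by simp
  next
    case (step y z)
    have yz: "y \<in> Al" "z \<in> Al" "{y, z} \<in> F" using step.hyps by auto
    show ?case
    proof (cases "z = v")
      case True
      then have "y \<in> nb F Al v" using yz by (auto simp: nb_def insert_commute)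
      then have "y = u" using u by simp
      then show ?thesis using step.IH True uv by simp
    next
      case False
      show ?thesis
      proof (cases "y = v")
        case True
        then have "z \<in> nb F Al v" using yz by (auto simp: nb_def)
        then show ?thesis using u step.IH True False by simp
      next
        case yv: False
        then have "(y, z) \<in> ?R'" using yz False by simp
        then show ?thesis using step.IH yv False by (meson rtrancl.rtrancl_into_rtrancl)
      qed
    qed
  qed
  have cross: "D x \<inter> D y = {}" "\<And>a b. a \<in> D x \<Longrightarrow> b \<in> D y \<Longrightarrow> {a, b} \<in> F \<Longrightarrow> a = x \<and> b = y"
    if "x \<in> Al" "y \<in> Al" "x \<noteq> y" for x y using strippedD(6,7)[OF S that] by blast+
  have toV: "y = u" if "y \<in> Al" "y \<noteq> v" "a \<in> D v" "b \<in> D y" "{a, b} \<in> F" for a b y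
  proof -
    have "a = v" "b = y" using cross(2)[OF v that(1) _ that(3,4,5)] that(2) by auto
    then have "y \<in> nb F Al v" using that by (simp add: nb_def)
    then show ?thesis using u by simp
  qed
  let ?D = "D(u := D u \<union> D v)"
  have k5: "?D x \<inter> ?D y = {} \<and> (\<forall>a\<in>?D x. \<forall>b\<in>?D y. {a, b} \<in> F \<longrightarrow> a = x \<and> b = y)"
    if x: "x \<in> Al - {v}" and y: "y \<in> Al - {v}" and xy: "x \<noteq> y" for x y
  proof (intro conjI ballI impI)
    show "?D x \<inter> ?D y = {}"
      using cross(1)[of x y] cross(1)[of x v] cross(1)[of v y] x y xy v uA by auto
    fix a b assume ab: "a \<in> ?D x" "b \<in> ?D y" "{a, b} \<in> F"
    then have ba: "{b, a} \<in> F" by (simp add: insert_commute)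
    show "a = x" "b = y"
      using cross(2)[of x y a b] toV[of y a b] toV[of x b a] ab ba x y xy by (auto split: if_splits)
  qed
  have k4: "\<exists>x\<in>Al - {v}. y \<in> ?D x" if yN: "y < N" for y
  proof -
    obtain x where x: "x \<in> Al" "y \<in> D x" using strippedD(5)[OF S yN] by blast
    show ?thesis
    proof (cases "x = v")
      case True
      then show ?thesis using x uA uv by (intro bexI[of _ u]) auto
    next
      case False
      then show ?thesis using x by (intro bexI[of _ x]) auto
    qed
  qed
  have k3: "\<forall>x\<in>Al - {v}. x \<in> ?D x \<and> ?D x \<subseteq> {..<N}" using strippedD(3,4)[OF S] v uA by auto
  have k2: "(a, w) \<in> ?R'\<^sup>*" if "a \<in> Al - {v}" "w \<in> Al - {v}" for a w
    using path[OF strippedD(2)[OF S]] that by blast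
  have k1: "Al - {v} \<subseteq> {..<N}" using strippedD(1)[OF S] by blast
  show ?thesis unfolding stripped_def
    by (intro conjI ballI allI impI k1 k2 k4) (use k3 k5 in blast)+
qed

lemma stripped_nb:
  assumes S: "stripped F N Al D" and v: "v \<in> Al" and c: "2 \<le> card Al"
  shows "nb F Al v \<noteq> {}"
proof -
  have "\<not> Al \<subseteq> {v}" using c card_mono[of "{v}" Al] by fastforce
  then obtain w where w: "w \<in> Al" "w \<noteq> v" by blast
  then have "(v, w) \<in> {(x, y). x \<in> Al \<and> y \<in> Al \<and> {x, y} \<in> F}\<^sup>*"
    using strippedD(2)[OF S v] by blast
  then obtain z where "(v, z) \<in> {(x, y). x \<in> Al \<and> y \<in> Al \<and> {x, y} \<in> F}"
    using w(2) by (auto elim: converse_rtranclE)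
  then show ?thesis by (auto simp: nb_def)
qed

lemma stripped_leaf:
  assumes T: "is_tree {..<N} F" and S: "stripped F N Al D" and c: "2 \<le> card Al"
  shows "\<exists>v\<in>Al. card (nb F Al v) = 1"
proof (rule leaf_exists)
  show "finite Al" "Al \<noteq> {}" using c card.infinite by fastforce+
  show "simple_graph {..<N} F" "\<nexists>vs. is_cycle F vs" using T by (auto simp: is_tree_def)
qed (use stripped_nb[OF S _ c] in blast)

section \<open>Vertices and edges covered by absorbed nodes, and their separation\<close>

definition bagsUn :: "(nat \<Rightarrow> nat set) \<Rightarrow> nat set \<Rightarrow> nat set" where
  "bagsUn Bg D = (\<Union>y\<in>D. Bg y)"

definition bagsE :: "nat set set \<Rightarrow> (nat \<Rightarrow> nat set) \<Rightarrow> nat set \<Rightarrow> nat set set" where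
  "bagsE E Bg D = {e \<in> E. \<exists>y\<in>D. e \<subseteq> Bg y}"

lemma bags_Un: "bagsUn Bg (D \<union> D') = bagsUn Bg D \<union> bagsUn Bg D'"
  "bagsE E Bg (D \<union> D') = bagsE E Bg D \<union> bagsE E Bg D'"
  by (auto simp: bagsUn_def bagsE_def)

text \<open>The nodes whose bags contain \<open>w\<close> are connected, so a walk among them leaves
  \<open>D v\<close>. The only tree edge leaving \<open>D v\<close> joins \<open>v\<close> to
  \<open>u\<close>, hence \<open>w\<close> lies in both bags.\<close>

lemma separation:
  assumes td: "tree_decomposition {..<n} E {..<N} F Bg" and S: "stripped F N Al D"
    and v: "v \<in> Al" and u: "nb F Al v = {u}"
    and w: "a \<in> D v" "w \<in> Bg a" "b < N" "b \<notin> D v" "w \<in> Bg b"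
  shows "w \<in> Bg v \<and> w \<in> Bg u"
proof -
  have aN: "a < N" using strippedD(4)[OF S v] w by blast
  then have "w < n" using td w(2) by (auto simp: tree_decomposition_def)
  let ?S = "{x \<in> {..<N}. w \<in> Bg x}"
  have "connected_graph ?S (induced_edges F ?S)"
    using td \<open>w < n\<close> by (simp add: tree_decomposition_def Let_def)
  then have "(a, b) \<in> {(x, y). {x, y} \<in> induced_edges F ?S}\<^sup>*"
    using w aN by (auto simp: connected_graph_def reachable_def)
  then have "b \<in> D v \<or> (\<exists>x y. x \<in> D v \<and> y \<notin> D v \<and> {x, y} \<in> induced_edges F ?S)"
  proof induction
    case (step y z)
    then show ?case by blast
  qed (use w in blast)
  then obtain x y where xy: "x \<in> D v" "y \<notin> D v" "{x, y} \<in> F" "x \<in> ?S" "y \<in> ?S"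
    using w by (auto simp: induced_edges_def)
  then obtain y' where y': "y' \<in> Al" "y \<in> D y'" using strippedD(5)[OF S, of y] xy(5) by blast
  moreover have "y' \<noteq> v" using y' xy by blast
  ultimately have "x = v \<and> y = y'" using strippedD(7)[OF S v _ _ xy(1) _ xy(3)] by blast
  then have "y \<in> nb F Al v" using xy y' by (simp add: nb_def)
  then show ?thesis using u xy \<open>x = v \<and> y = y'\<close> by auto
qed

text \<open>The three claims are the side conditions of \<open>good_project\<close> and
  \<open>good_join\<close> for merging the part of the leaf \<open>v\<close> into that of
  \<open>u\<close>.\<close>

lemma separation_bags:
  assumes td: "tree_decomposition {..<n} E {..<N} F Bg" and S: "stripped F N Al D"
    and G: "simple_graph X F" and v: "v \<in> Al" and u: "nb F Al v = {u}"
  shows "bagsUn Bg (D v) \<inter> Bg u \<subseteq> Bg v"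
    and "bagsUn Bg (D u) \<inter> (bagsUn Bg (D v) \<union> Bg u) = Bg u"
    and "\<forall>e\<in>E. e \<inter> (bagsUn Bg (D v) - Bg u) \<noteq> {} \<longrightarrow> e \<in> bagsE E Bg (D v)"
proof -
  have uA: "u \<in> Al" using u by (auto simp: nb_def)
  have uv: "u \<noteq> v" using u nb_irrefl[OF G, of v Al] by auto
  have D: "D u \<inter> D v = {}" "u \<in> D u" "D u \<subseteq> {..<N}"
    using strippedD(6)[OF S uA v uv] strippedD(3,4)[OF S uA] by blast+
  note sep = separation[OF td S v u]
  show "bagsUn Bg (D v) \<inter> Bg u \<subseteq> Bg v" using sep D unfolding bagsUn_def by blast
  show "bagsUn Bg (D u) \<inter> (bagsUn Bg (D v) \<union> Bg u) = Bg u"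
    using sep D unfolding bagsUn_def by blast
  show "\<forall>e\<in>E. e \<inter> (bagsUn Bg (D v) - Bg u) \<noteq> {} \<longrightarrow> e \<in> bagsE E Bg (D v)"
  proof (intro ballI impI)
    fix e assume e: "e \<in> E" "e \<inter> (bagsUn Bg (D v) - Bg u) \<noteq> {}"
    then obtain w a where w: "w \<in> e" "a \<in> D v" "w \<in> Bg a" "w \<notin> Bg u" by (auto simp: bagsUn_def)
    obtain y where y: "y < N" "e \<subseteq> Bg y" using td e(1) by (auto simp: tree_decomposition_def)
    then have "y \<in> D v" using sep[OF w(2,3) y(1)] w by blast
    then show "e \<in> bagsE E Bg (D v)" using y e by (auto simp: bagsE_def)
  qed
qed

context graph_dp
begin

lemma good_merge:
  assumes td: "tree_decomposition {..<n} E {..<N} F Bg" and S: "stripped F N Al D"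
    and G: "simple_graph X F" and v: "v \<in> Al" and u: "nb F Al v = {u}"
    and bags: "set bv = Bg v" "set bu = Bg u" "distinct bu" "length bu \<le> t"
    and gv: "good bv Tv (bagsUn Bg (D v)) (bagsE E Bg (D v))"
    and gu: "good bu Tu (bagsUn Bg (D u)) (bagsE E Bg (D u))"
    and p: "projected bv bu Tv g" and j: "joined Tu g h"
  shows "good bu h (bagsUn Bg (D u \<union> D v)) (bagsE E Bg (D u \<union> D v))"
proof -
  note sep = separation_bags[OF td S G v u]
  have "u \<in> Al" using u unfolding nb_def by blast
  then have uD: "u \<in> D u" "u < N" using strippedD(1,3)[OF S] by blast+
  then have bn: "set bu \<subseteq> {..<n}" using td bags(2) unfolding tree_decomposition_def by blast
  have "good bu g (bagsUn Bg (D v) \<union> set bu) (bagsE E Bg (D v))"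
    by (rule good_project[OF gv bags(3,4) bn _ _ p]) (use sep bags in simp_all)
  from good_join[OF gu this _ j]
  have "good bu h (bagsUn Bg (D u) \<union> (bagsUn Bg (D v) \<union> set bu)) (bagsE E Bg (D u) \<union> bagsE E Bg (D v))"
    using sep(2) bags by simp
  moreover have "set bu \<subseteq> bagsUn Bg (D u)" using uD bags(2) by (auto simp: bagsUn_def)
  then have "bagsUn Bg (D u) \<union> (bagsUn Bg (D v) \<union> set bu) = bagsUn Bg (D u) \<union> bagsUn Bg (D v)" by blast
  ultimately show ?thesis by (simp only: bags_Un)
qed

end

section \<open>Program fragments\<close>

text \<open>Registers 1 to 12 hold the parameters of the instance. Array \<open>aPT\<close> points to the bags in the
  input, \<open>aADJ\<close> is the adjacency matrix, \<open>aTB\<close> holds the tables of all nodes, \<open>aFT\<close>, \<open>aGT\<close> and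
  \<open>aHT\<close> the operands and the result of a join. \<open>aDEG\<close> and \<open>aSM\<close> hold, for each tree node, the number
  and the sum of its remaining neighbours: for a leaf, the sum is its only neighbour.\<close>

abbreviation (input) "rL \<equiv> (2::nat)"
abbreviation (input) "rM \<equiv> (3::nat)"
abbreviation (input) "rN \<equiv> (4::nat)"
abbreviation (input) "rMF \<equiv> (5::nat)"
abbreviation (input) "rT \<equiv> (6::nat)"
abbreviation (input) "rT1 \<equiv> (7::nat)"
abbreviation (input) "rZ \<equiv> (8::nat)"
abbreviation (input) "rP0 \<equiv> (10::nat)"
abbreviation (input) "rCU \<equiv> (11::nat)"
abbreviation (input) "rNT \<equiv> (12::nat)"
abbreviation (input) "rI \<equiv> (13::nat)"
abbreviation (input) "rJ \<equiv> (14::nat)"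
abbreviation (input) "rK \<equiv> (15::nat)"
abbreviation (input) "rU \<equiv> (16::nat)"
abbreviation (input) "rU1 \<equiv> (17::nat)"
abbreviation (input) "rU2 \<equiv> (18::nat)"
abbreviation (input) "rD1 \<equiv> (19::nat)"
abbreviation (input) "rD2 \<equiv> (20::nat)"
abbreviation (input) "rR1 \<equiv> (21::nat)"
abbreviation (input) "rR2 \<equiv> (22::nat)"
abbreviation (input) "rU3 \<equiv> (23::nat)"
abbreviation (input) "rE \<equiv> (24::nat)"
abbreviation (input) "rPA \<equiv> (25::nat)"
abbreviation (input) "rPB \<equiv> (26::nat)"
abbreviation (input) "rX \<equiv> (27::nat)"
abbreviation (input) "rHi \<equiv> (28::nat)"
abbreviation (input) "rLo \<equiv> (29::nat)"
abbreviation (input) "rP \<equiv> (30::nat)"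
abbreviation (input) "rTail \<equiv> (32::nat)"
abbreviation (input) "rRoot \<equiv> (33::nat)"
abbreviation (input) "rTg \<equiv> (34::nat)"
abbreviation (input) "rOk \<equiv> (35::nat)"

abbreviation (input) "aINP \<equiv> (0::nat)"
abbreviation (input) "aPT \<equiv> (1::nat)"
abbreviation (input) "aDEG \<equiv> (2::nat)"
abbreviation (input) "aSM \<equiv> (3::nat)"
abbreviation (input) "aADJ \<equiv> (4::nat)"
abbreviation (input) "aPW \<equiv> (5::nat)"
abbreviation (input) "aQU \<equiv> (6::nat)"
abbreviation (input) "aTB \<equiv> (7::nat)"
abbreviation (input) "aGT \<equiv> (8::nat)"
abbreviation (input) "aHT \<equiv> (9::nat)"
abbreviation (input) "aBF \<equiv> (10::nat)"
abbreviation (input) "aBG \<equiv> (11::nat)"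
abbreviation (input) "aFZ \<equiv> (12::nat)"
abbreviation (input) "aGZ \<equiv> (13::nat)"
abbreviation (input) "aHZ \<equiv> (14::nat)"
abbreviation (input) "aRK \<equiv> (15::nat)"
abbreviation (input) "aIV \<equiv> (16::nat)"
abbreviation (input) "aCV \<equiv> (17::nat)"
abbreviation (input) "aFT \<equiv> (18::nat)"
abbreviation (input) "aGS \<equiv> (19::nat)"
abbreviation (input) "aORT \<equiv> (20::nat)"
abbreviation (input) "aSG \<equiv> (21::nat)"

text \<open>A pairing function by squares: \<open>(i + j) ^ 2 + i\<close> stays below
  \<open>(i + j + 1) ^ 2\<close>, so different sums never collide. It leaves gaps, but it uses only
  word operations and keeps addresses polynomial in the indices.\<close>

definition pr :: "nat \<Rightarrow> nat \<Rightarrow> nat" where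
  "pr i j = (i + j) * (i + j) + i"

lemma pr_eq_iff [simp]: "pr i j = pr i' j' \<longleftrightarrow> i = i' \<and> j = j'"
proof
  assume eq: "pr i j = pr i' j'"
  have less: "pr a b < pr a' b'" if "a + b < a' + b'" for a b a' b'
  proof -
    have "(a + b) * (a + b) + a < (a + b + 1) * (a + b + 1)" by simp
    also have "\<dots> \<le> (a' + b') * (a' + b')" using that by (intro mult_le_mono) auto
    finally show ?thesis by (simp add: pr_def)
  qed
  have "i + j = i' + j'" using less[of i j i' j'] less[of i' j' i j] eq by linarith
  then show "i = i' \<and> j = j'" using eq by (simp add: pr_def)
qed simp

text \<open>Truth values are the numbers 0 and 1, obtained by truncated subtraction, so that most
  case distinctions of the program become arithmetic.\<close>

definition "prE a b = Bop Add (Bop Mul (Bop Add a b) (Bop Add a b)) a"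
definition "posE a = Bop Sub (Kn 1) (Bop Sub (Kn 1) a)"
definition "eqE a b = Bop Sub (Kn 1) (Bop Add (Bop Sub a b) (Bop Sub b a))"
definition "ltE a b = posE (Bop Sub b a)"
definition "notE a = Bop Sub (Kn 1) a"
definition "isME d = Bop Mul (Bop Sub (Kn 1) (Bop Mod d (Kn 2))) (posE d)"
definition "colE d = Bop Div (Bop Add d (Kn 1)) (Kn 2)"
definition "maxE a b = clamp (Bop Add a (Bop Sub b a))"
definition "nop = Asg 39 (Kn 0)"

lemma ev_macros [simp]:
  "ev (prE a b) s = pr (ev a s) (ev b s)"
  "ev (posE a) s = of_bool (0 < ev a s)"
  "ev (eqE a b) s = of_bool (ev a s = ev b s)"
  "ev (ltE a b) s = of_bool (ev a s < ev b s)"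
  "ev (notE a) s = of_bool (ev a s = 0)"
  "ev (isME a) s = of_bool (isM (ev a s))"
  "ev (colE a) s = col (ev a s)"
  "ev (clamp a) s = min (ev a s) (fst s rB)"
  "ev (maxE a b) s = min (max (ev a s) (ev b s)) (fst s rB)"
proof -
  show "ev (posE a) s = of_bool (0 < ev a s)" by (simp add: posE_def)
  then show "ev (isME a) s = of_bool (isM (ev a s))"
    by (auto simp: isME_def posE_def isM_def parity_cases even_iff_mod_2_eq_zero odd_iff_mod_2_eq_one)
qed (auto simp: prE_def pr_def posE_def eqE_def ltE_def notE_def colE_def col_def
  ev_clamp maxE_def max_def)

lemma wr_nop [simp]: "wr nop = {39}" "wa nop = {}"
  by (simp_all add: nop_def)

lemma den_nop [simp]: "den nop s = setr 39 0 s"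
  by (simp add: nop_def)

text \<open>Since the addresses are injective, round \<open>k\<close> still sees the old content of
  its own cell. The premise \<open>step\<close> may use this, which permits updates in
  place.\<close>

lemma map_loop:
  assumes m: "fst s r = m" and inj: "inj_on ixf {..<m}"
    and step: "\<And>k s2. k < m \<Longrightarrow> fst s2 i = k \<Longrightarrow> (\<And>r'. r' \<noteq> i \<Longrightarrow> fst s2 r' = fst s r') \<Longrightarrow>
      (\<And>a'. a' \<noteq> a \<Longrightarrow> snd s2 a' = snd s a') \<Longrightarrow>
      (\<And>x. x \<notin> ixf ` {..<k} \<Longrightarrow> snd s2 a x = snd s a x) \<Longrightarrow> ev ix s2 = ixf k \<and> ev e s2 = val k"
  defines "s' \<equiv> den (For i r (Sto a ix e)) s"
  shows "\<And>k. k < m \<Longrightarrow> snd s' a (ixf k) = val k"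
    and "\<And>x. x \<notin> ixf ` {..<m} \<Longrightarrow> snd s' a x = snd s a x"
proof -
  define P where "P k s2 \<longleftrightarrow> (\<forall>r'. r' \<noteq> i \<longrightarrow> fst s2 r' = fst s r') \<and>
    (\<forall>a'. a' \<noteq> a \<longrightarrow> snd s2 a' = snd s a') \<and> (\<forall>x. x \<notin> ixf ` {..<k} \<longrightarrow> snd s2 a x = snd s a x) \<and>
    (\<forall>k'<k. snd s2 a (ixf k') = val k')" for k s2
  have "P (fst s r) s'"
    unfolding s'_def
  proof (rule for_rule)
    fix k s2 assume k: "k < fst s r" "P k s2" "fst s2 i = k"
    have st: "ev ix s2 = ixf k \<and> ev e s2 = val k"
      by (rule step) (use k m in \<open>auto simp: P_def\<close>)
    have "ixf k' \<noteq> ixf k" if "k' < k" for k' using inj that k m by (auto simp: inj_on_def)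
    then show "P (Suc k) (setr i (Suc k) (den (Sto a ix e) s2))"
      using k st by (auto simp: P_def less_Suc_eq lessThan_Suc fun_eq_iff)
  qed (auto simp: P_def)
  then show "\<And>k. k < m \<Longrightarrow> snd s' a (ixf k) = val k"
    "\<And>x. x \<notin> ixf ` {..<m} \<Longrightarrow> snd s' a x = snd s a x" using m by (auto simp: P_def)
qed

lemma map2_loop:
  assumes m: "fst s r1 = m1" "fst s r2 = m2"
    and inj: "\<And>k1 k1' k2 k2'. ixf k1 k2 = ixf k1' k2' \<Longrightarrow> k1 = k1' \<and> k2 = k2'"
    and i: "i1 \<noteq> i2" "i1 \<noteq> r2" "i2 \<noteq> r2"
    and step: "\<And>k1 k2 s2. k1 < m1 \<Longrightarrow> k2 < m2 \<Longrightarrow> fst s2 i1 = k1 \<Longrightarrow> fst s2 i2 = k2 \<Longrightarrow>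
      (\<And>r'. r' \<noteq> i1 \<Longrightarrow> r' \<noteq> i2 \<Longrightarrow> fst s2 r' = fst s r') \<Longrightarrow>
      (\<And>a'. a' \<noteq> a \<Longrightarrow> snd s2 a' = snd s a') \<Longrightarrow> snd s2 a (ixf k1 k2) = snd s a (ixf k1 k2) \<Longrightarrow>
      ev ix s2 = ixf k1 k2 \<and> ev e s2 = val k1 k2"
  defines "s' \<equiv> den (For i1 r1 (For i2 r2 (Sto a ix e))) s"
  shows "\<And>k1 k2. k1 < m1 \<Longrightarrow> k2 < m2 \<Longrightarrow> snd s' a (ixf k1 k2) = val k1 k2"
    and "\<And>x. (\<And>k1 k2. k1 < m1 \<Longrightarrow> k2 < m2 \<Longrightarrow> x \<noteq> ixf k1 k2) \<Longrightarrow> snd s' a x = snd s a x"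
proof -
  define P where "P k s2 \<longleftrightarrow> (\<forall>r'. r' \<noteq> i1 \<longrightarrow> r' \<noteq> i2 \<longrightarrow> fst s2 r' = fst s r') \<and>
    (\<forall>a'. a' \<noteq> a \<longrightarrow> snd s2 a' = snd s a') \<and>
    (\<forall>x. (\<forall>k1<k. \<forall>k2<m2. x \<noteq> ixf k1 k2) \<longrightarrow> snd s2 a x = snd s a x) \<and>
    (\<forall>k1<k. \<forall>k2<m2. snd s2 a (ixf k1 k2) = val k1 k2)" for k s2
  have "P (fst s r1) s'"
    unfolding s'_def
  proof (rule for_rule)
    fix k s2 assume k: "k < fst s r1" "P k s2" "fst s2 i1 = k"
    let ?c = "For i2 r2 (Sto a ix e)"
    have P: "\<And>r'. r' \<noteq> i1 \<Longrightarrow> r' \<noteq> i2 \<Longrightarrow> fst s2 r' = fst s r'" "\<And>a'. a' \<noteq> a \<Longrightarrow> snd s2 a' = snd s a'"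
      "\<And>x. (\<forall>k1<k. \<forall>k2<m2. x \<noteq> ixf k1 k2) \<Longrightarrow> snd s2 a x = snd s a x"
      "\<And>k1 k2. k1 < k \<Longrightarrow> k2 < m2 \<Longrightarrow> snd s2 a (ixf k1 k2) = val k1 k2"
      using k(2) by (simp_all add: P_def)
    have m2: "fst s2 r2 = m2 \<or> r2 = i2" using P(1)[of r2] m i by auto
    have fr: "fst (den ?c s2) r' = fst s r'" if "r' \<noteq> i1" "r' \<noteq> i2" for r' using P(1) that by simp
    have fr': "snd (den ?c s2) a' = snd s a'" if "a' \<noteq> a" for a' using P(2) that by simp
    have st: "ev ix s3 = ixf k k' \<and> ev e s3 = val k k'" if A: "k' < m2" "fst s3 i2 = k'"
        "\<And>r'. r' \<noteq> i2 \<Longrightarrow> fst s3 r' = fst s2 r'" "\<And>a'. a' \<noteq> a \<Longrightarrow> snd s3 a' = snd s2 a'"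
        "\<And>x. x \<notin> ixf k ` {..<k'} \<Longrightarrow> snd s3 a x = snd s2 a x" for k' s3
      proof (rule step)
        have "ixf k k' \<notin> ixf k ` {..<k'}" by (metis imageE inj lessThan_iff less_irrefl)
        then have "snd s3 a (ixf k k') = snd s2 a (ixf k k')" by (rule A(5))
        also have "\<dots> = snd s a (ixf k k')" by (rule P(3)) (metis inj less_irrefl)
        finally show "snd s3 a (ixf k k') = snd s a (ixf k k')" .
      qed (use A P i k m in auto)
    have inj': "inj_on (ixf k) {..<m2}" using inj by (meson inj_onI)
    have inner: "snd (den ?c s2) a (ixf k k2) = val k k2" if "k2 < m2" "fst s2 r2 = m2" for k2
        by (rule map_loop(1)[OF that(2) inj']) (use st that in auto)
    have rest: "snd (den ?c s2) a x = snd s2 a x" if "x \<notin> ixf k ` {..<m2}" "fst s2 r2 = m2" for x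
        by (rule map_loop(2)[OF that(2) inj']) (use st that in auto)
    show "P (Suc k) (setr i1 (Suc k) (den ?c s2))"
    proof -
      have m2': "fst s2 r2 = m2" using m2 i by blast
      have "snd (den ?c s2) a x = snd s a x" if A: "\<forall>k1<Suc k. \<forall>k2<m2. x \<noteq> ixf k1 k2" for x
      proof -
        have "x \<notin> ixf k ` {..<m2}" using A by auto
        then have "snd (den ?c s2) a x = snd s2 a x" using rest m2' by blast
        also have "\<dots> = snd s a x" by (rule P(3)) (use A in auto)
        finally show ?thesis .
      qed
      moreover have "snd (den ?c s2) a (ixf k1 k2) = val k1 k2" if A: "k1 < Suc k" "k2 < m2" for k1 k2
      proof (cases "k1 = k")
        case True
        then show ?thesis using inner m2' A by blast
      next
        case False
        have "ixf k1 k2 \<notin> ixf k ` {..<m2}" using False by (metis imageE inj)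
        then have "snd (den ?c s2) a (ixf k1 k2) = snd s2 a (ixf k1 k2)" using rest m2' by blast
        then show ?thesis using P(4) A False by simp
      qed
      ultimately show ?thesis using fr fr' unfolding P_def by simp
    qed
  qed (use i in \<open>auto simp: P_def\<close>)
  then show "\<And>k1 k2. k1 < m1 \<Longrightarrow> k2 < m2 \<Longrightarrow> snd s' a (ixf k1 k2) = val k1 k2"
    "\<And>x. (\<And>k1 k2. k1 < m1 \<Longrightarrow> k2 < m2 \<Longrightarrow> x \<noteq> ixf k1 k2) \<Longrightarrow> snd s' a x = snd s a x"
    using m by (auto simp: P_def)
qed

text \<open>Layer \<open>j + 1\<close> of the array is computed from layer \<open>j\<close>, the
  layer number being the first component of the address. No layer is overwritten, so the states of a
  layer can be processed in any order.\<close>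

definition sweep :: "nat \<Rightarrow> expr \<Rightarrow> stmt" where
  "sweep a e = For rJ rT (For rI rZ (Sto a (prE (Bop Add (Vr rJ) (Kn 1)) (Vr rI)) e))"

lemma wr_sweep [simp]: "wr (sweep a e) = {rI, rJ}" "wa (sweep a e) = {a}"
  by (auto simp: sweep_def)

lemma sweep_correct:
  assumes m: "fst s rT = t" "fst s rZ = z" and F0: "\<And>i. i < z \<Longrightarrow> snd s a (pr 0 i) = F 0 i"
    and step: "\<And>j i s2. j < t \<Longrightarrow> i < z \<Longrightarrow> fst s2 rJ = j \<Longrightarrow> fst s2 rI = i \<Longrightarrow>
      (\<And>r. r \<noteq> rI \<Longrightarrow> r \<noteq> rJ \<Longrightarrow> fst s2 r = fst s r) \<Longrightarrow> (\<And>a'. a' \<noteq> a \<Longrightarrow> snd s2 a' = snd s a') \<Longrightarrow>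
      (\<And>i'. i' < z \<Longrightarrow> snd s2 a (pr j i') = F j i') \<Longrightarrow> ev e s2 = F (Suc j) i"
    and i: "i < z"
  shows "snd (den (sweep a e) s) a (pr t i) = F t i"
proof -
  define P where "P k s2 \<longleftrightarrow> (\<forall>r'. r' \<noteq> rI \<longrightarrow> r' \<noteq> rJ \<longrightarrow> fst s2 r' = fst s r') \<and>
    (\<forall>a'. a' \<noteq> a \<longrightarrow> snd s2 a' = snd s a') \<and> (\<forall>i<z. snd s2 a (pr k i) = F k i)" for k s2
  let ?c = "For rI rZ (Sto a (prE (Bop Add (Vr rJ) (Kn 1)) (Vr rI)) e)"
  have "P (fst s rT) (den (sweep a e) s)"
    unfolding sweep_def
  proof (rule for_rule)
    fix k s2 assume k: "k < fst s rT" "P k s2" "fst s2 rJ = k"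
    have P: "\<And>r'. r' \<noteq> rI \<Longrightarrow> r' \<noteq> rJ \<Longrightarrow> fst s2 r' = fst s r'" "\<And>a'. a' \<noteq> a \<Longrightarrow> snd s2 a' = snd s a'"
      "\<And>i. i < z \<Longrightarrow> snd s2 a (pr k i) = F k i"
      using k(2) by (simp_all add: P_def)
    have z: "fst s2 rZ = z" using P(1)[of rZ] m by simp
    have "snd (den ?c s2) a (pr (Suc k) i') = F (Suc k) i'" if "i' < z" for i'
    proof (rule map_loop(1)[OF z, where ixf = "pr (Suc k)" and val = "F (Suc k)", OF _ _ that])
      show "inj_on (pr (Suc k)) {..<z}" by (auto intro: inj_onI)
      fix k' s3
      assume A: "k' < z" "fst s3 rI = k'" "\<And>r'. r' \<noteq> rI \<Longrightarrow> fst s3 r' = fst s2 r'"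
        "\<And>a'. a' \<noteq> a \<Longrightarrow> snd s3 a' = snd s2 a'"
        "\<And>x. x \<notin> pr (Suc k) ` {..<k'} \<Longrightarrow> snd s3 a x = snd s2 a x"
      have "snd s3 a (pr k i') = F k i'" if "i' < z" for i'
      proof -
        have "pr k i' \<notin> pr (Suc k) ` {..<k'}" by auto
        then show ?thesis using A(5) P(3)[OF that] by simp
      qed
      then have "ev e s3 = F (Suc k) k'"
        by (intro step) (use A P k m in auto)
      then show "ev (prE (Bop Add (Vr rJ) (Kn 1)) (Vr rI)) s3 = pr (Suc k) k' \<and> ev e s3 = F (Suc k) k'"
        using A k by simp
    qed
    then show "P (Suc k) (setr rJ (Suc k) (den ?c s2))" using P by (simp add: P_def)
  qed (use F0 in \<open>auto simp: P_def\<close>)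
  then show ?thesis using i m by (simp add: P_def)
qed

section \<open>Joining two tables\<close>

definition "digE q j i = Bop Mod (Bop Div i (Ar aPW j)) (Kn q)"

lemma ev_digE [simp]: "ev (digE q j i) s = ev i s div snd s aPW (ev j s) mod q"
  by (simp add: digE_def)

lemma set_decode_le: "U < 2 ^ (c + 1) \<Longrightarrow> set_decode U \<subseteq> {..c}"
proof
  fix i assume U: "U < 2 ^ (c + 1)" and i: "i \<in> set_decode U"
  have "set_encode {i} \<le> set_encode (set_decode U)"
    unfolding set_encode_def by (rule sum_mono2) (use i in auto)
  moreover have "set_encode {i} = 2 ^ i" by (simp add: set_encode_def)
  ultimately have "2 ^ i \<le> U" by simp
  then have "(2::nat) ^ i < 2 ^ (c + 1)" using U by linarith
  then have "i < c + 1" by (rule power_less_imp_less_exp[rotated]) simp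
  then show "i \<in> {..c}" by simp
qed

lemma join_code_less: "U1 < 2 ^ (c + 1) \<Longrightarrow> U2 < 2 ^ (c + 1) \<Longrightarrow> join_code U1 U2 < 2 ^ (c + 1)"
  using set_encode_less set_decode_le by (meson Un_least)

context graph_dp
begin

definition "dE = digE q (Vr rJ) (Vr rI)"
definition "pwE = Ar aPW (Vr rJ)"
definition "cellE a = Ar a (prE (Vr rJ) (Vr rI))"
definition "lastE a = Ar a (prE (Vr rT) (Vr rI))"

text \<open>The second summand is switched off by the factor \<open>isME dE\<close>; for an
  unmatched digit the cell at the lowered index is read but does not count.\<close>

definition "zetaE a = clamp (Bop Add (cellE a)
  (Bop Mul (isME dE) (Ar a (prE (Vr rJ) (Bop Sub (Vr rI) pwE)))))"
definition "moebiusE a = Bop Sub (cellE a)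
  (Bop Mul (isME dE) (Ar a (prE (Vr rJ) (Bop Sub (Vr rI) pwE))))"
definition "partnerE = Bop Sub (Bop Add (Vr rI) (Bop Mul (Bop Mod dE (Kn 2)) pwE))
  (Bop Mul (isME dE) pwE)"
definition "colmaxE a = maxE (cellE a) (Ar a (prE (Vr rJ) partnerE))"

definition copyI :: "nat \<Rightarrow> expr \<Rightarrow> stmt" where
  "copyI a e = For rI rZ (Sto a (prE (Kn 0) (Vr rI)) e)"

definition "selectE a b u d r = clamp (Bop Mul (Bop Mul (posE (Ar a (prE (Vr u) (Vr rI))))
  (eqE (Bop Add (Ar a (prE (Vr u) (Vr rI))) (Vr d)) (lastE b))) (eqE (Ar aRK (Vr rI)) (Vr r)))"

definition "hitE = Bop Mul (posE (lastE aHZ)) (eqE (Ar aRK (Vr rI)) (Bop Add (Vr rR1) (Vr rR2)))"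
text \<open>Counting alone cannot maximize. The maxima in \<open>aBF\<close> and \<open>aBG\<close>
  depend only on the colouring, which \<open>i\<close> shares with both states of any counted pair,
  and the offsets are fixed in this round; so all pairs counted at \<open>i\<close> have the same
  total, and it can be computed without knowing the pair.\<close>

definition "valueE = Bop Sub (Bop Add (Bop Sub (lastE aBF) (Vr rD1)) (Bop Sub (lastE aBG) (Vr rD2))) (Kn 1)"

text \<open>One counter in mixed radix replaces six nested loops over two colour sets, two offsets
  and two ranks. The last quotient is below \<open>t + 1\<close> by the range of the
  counter.\<close>

definition "decode = Sq (Asg rU1 (Bop Mod (Vr rK) (Vr rCU))) (Sq (Asg rE (Bop Div (Vr rK) (Vr rCU)))
  (Sq (Asg rU2 (Bop Mod (Vr rE) (Vr rCU))) (Sq (Asg rE (Bop Div (Vr rE) (Vr rCU)))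
  (Sq (Asg rD1 (Bop Mod (Vr rE) (Vr rT1))) (Sq (Asg rE (Bop Div (Vr rE) (Vr rT1)))
  (Sq (Asg rD2 (Bop Mod (Vr rE) (Vr rT1))) (Sq (Asg rE (Bop Div (Vr rE) (Vr rT1)))
  (Sq (Asg rR1 (Bop Mod (Vr rE) (Vr rT1))) (Sq (Asg rR2 (Bop Div (Vr rE) (Vr rT1)))
  (Asg rU3 (Ar aORT (prE (Vr rU1) (Vr rU2)))))))))))))"

definition "colmax a b u = Sq (copyI b (Ar a (prE (Vr u) (Vr rI)))) (sweep b (colmaxE b))"
definition "zeta z a b u d r = Sq (copyI z (selectE a b u d r)) (sweep z (zetaE z))"
definition "moebius = Sq (copyI aHZ (clamp (Bop Mul (lastE aFZ) (lastE aGZ)))) (sweep aHZ (moebiusE aHZ))"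
definition "update = For rI rZ (Sto aHT (prE (Vr rU3) (Vr rI))
  (maxE (Ar aHT (prE (Vr rU3) (Vr rI))) (Bop Mul hitE valueE)))"

definition "joinBody = Sq decode (Sq (colmax aFT aBF rU1) (Sq (colmax aGT aBG rU2)
  (Sq (zeta aFZ aFT aBF rU1 rD1 rR1) (Sq (zeta aGZ aGT aBG rU2 rD2 rR2) (Sq moebius update)))))"

definition forUI :: "nat \<Rightarrow> expr \<Rightarrow> expr \<Rightarrow> stmt" where
  "forUI a ix e = For rU rCU (For rI rZ (Sto a ix e))"

definition "uiE = prE (Vr rU) (Vr rI)"

text \<open>The result is collected in \<open>aHT\<close> and copied at the end, since every round
  reads the operand \<open>aFT\<close>.\<close>

definition "JOIN = Sq (forUI aHT uiE (Kn 0)) (Sq (For rK rNT joinBody) (forUI aFT uiE (Ar aHT uiE)))"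

lemma wr_join_parts [simp]:
  "wr (copyI a e) = {rI}" "wa (copyI a e) = {a}"
  "wr decode = {rU1, rU2, rE, rD1, rD2, rR1, rR2, rU3}" "wa decode = {}"
  "wr (colmax a b u) = {rI, rJ}" "wa (colmax a b u) = {b}"
  "wr (zeta z a b u d r) = {rI, rJ}" "wa (zeta z a b u d r) = {z}"
  "wr moebius = {rI, rJ}" "wa moebius = {aHZ}"
  "wr update = {rI}" "wa update = {aHT}"
  "wr (forUI a e1 e2) = {rU, rI}" "wa (forUI a e1 e2) = {a}"
  by (auto simp: copyI_def decode_def colmax_def zeta_def moebius_def update_def forUI_def)

lemma wr_joinBody [simp]:
  "wr joinBody = {rI, rJ, rU1, rU2, rE, rD1, rD2, rR1, rR2, rU3}"
  "wa joinBody = {aBF, aBG, aFZ, aGZ, aHZ, aHT}"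
  by (auto simp: joinBody_def)

lemma wr_JOIN [simp]:
  "wr JOIN = {rI, rJ, rK, rU, rU1, rU2, rE, rD1, rD2, rR1, rR2, rU3}"
  "wa JOIN = {aBF, aBG, aFZ, aGZ, aHZ, aHT, aFT}"
  by (auto simp: JOIN_def)

end

text \<open>The four bounds cover, in this order, counts of pairs in the convolution, codes of
  colour sets, ranks and offsets, and sums of two table entries of size at most
  \<open>n + 1\<close>.\<close>

locale ram = graph_dp +
  fixes B :: nat
  assumes B_ge: "q ^ t * q ^ t \<le> B" "CU \<le> B" "t + 1 \<le> B" "2 * n + 4 \<le> B"
begin

definition base :: "store \<Rightarrow> bool" where
  "base s \<longleftrightarrow> fst s rT = t \<and> fst s rT1 = t + 1 \<and> fst s rZ = Z \<and> fst s rB = B \<and> fst s rCU = CU \<and>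
     fst s rNT = CU * CU * (t + 1) ^ 4 \<and> (\<forall>j<t. snd s aPW j = q ^ j) \<and>
     (\<forall>i<Z. snd s aRK i = rk q t i) \<and>
     (\<forall>U1<CU. \<forall>U2<CU. snd s aORT (pr U1 U2) = join_code U1 U2) \<and> (\<forall>i\<le>c. snd s aSG i = 2 ^ i)"

lemma base_cong:
  assumes "base s" "\<forall>r\<in>{rT, rT1, rZ, rB, rCU, rNT}. fst s' r = fst s r"
    "\<forall>a\<in>{aPW, aRK, aORT, aSG}. snd s' a = snd s a"
  shows "base s'"
  using assms by (simp add: base_def)

lemma base_den [intro]:
  assumes "base s" "wr C \<inter> {rT, rT1, rZ, rB, rCU, rNT} = {}" "wa C \<inter> {aPW, aRK, aORT, aSG} = {}"
  shows "base (den C s)"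
  by (rule base_cong[OF assms(1)]) (use assms(2,3) in auto)

lemma base_setr [intro]: "base s \<Longrightarrow> r \<notin> {rT, rT1, rZ, rB, rCU, rNT} \<Longrightarrow> base (setr r v s)"
  by (rule base_cong) auto

lemma Z_pos [simp]: "0 < Z" and Z_le: "Z \<le> B" and Z_nz [simp]: "q \<noteq> 0"
proof -
  show "0 < Z" by simp
  then have "1 * Z \<le> Z * Z" by (intro mult_le_mono1) (simp only: Suc_leI One_nat_def)
  then show "Z \<le> B" using B_ge by linarith
  show "q \<noteq> 0" using q_pos by simp
qed

lemma digit_eval: "base s \<Longrightarrow> fst s rJ = j \<Longrightarrow> j < t \<Longrightarrow> fst s rI = i \<Longrightarrow>
    ev dE s = dig q j i \<and> ev pwE s = q ^ j"
  by (simp add: base_def dE_def pwE_def dig_def)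

lemma copyI_correct:
  assumes b: "base s" and e: "\<And>i s2. i < Z \<Longrightarrow> fst s2 rI = i \<Longrightarrow>
      (\<And>r. r \<noteq> rI \<Longrightarrow> fst s2 r = fst s r) \<Longrightarrow> (\<And>a'. a' \<noteq> a \<Longrightarrow> snd s2 a' = snd s a') \<Longrightarrow>
      ev e s2 = val i"
    and i: "i < Z"
  shows "snd (den (copyI a e) s) a (pr 0 i) = val i"
  unfolding copyI_def
proof (rule map_loop(1)[where m = Z and ixf = "pr 0", OF _ _ _ i])
  show "fst s rZ = Z" using b by (simp add: base_def)
  show "inj_on (pr 0) {..<Z}" by (auto intro: inj_onI)
qed (auto intro: e)

lemma colmax_correct:
  assumes b: "base s" and ab: "a \<noteq> b" "b \<notin> {aPW, aRK, aORT, aSG}" and u: "fst s u = U" "u \<notin> {rI, rJ}"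
    and fB: "\<And>i. i < Z \<Longrightarrow> snd s a (pr U i) \<le> B" and i: "i < Z"
  shows "snd (den (colmax a b u) s) b (pr t i) = cmax q t (\<lambda>i. snd s a (pr U i)) t i"
proof -
  let ?f = "\<lambda>i. snd s a (pr U i)"
  define s1 where "s1 = den (copyI b (Ar a (prE (Vr u) (Vr rI)))) s"
  have b1: "base s1" unfolding s1_def by (rule base_den[OF b]) (use ab in auto)
  have 1: "snd s1 b (pr 0 i) = ?f i" if "i < Z" for i
    unfolding s1_def by (rule copyI_correct[OF b _ that]) (use u ab in auto)
  have le: "cmax q t ?f j i \<le> B" if "i < Z" "j \<le> t" for j i
    using cmax_attained[OF that, of ?f] fB by metis
  have "snd (den (sweep b (colmaxE b)) s1) b (pr t i) = cmax q t ?f t i"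
  proof (rule sweep_correct[where F = "cmax q t ?f" and z = Z, OF _ _ _ _ i])
    show "fst s1 rT = t" "fst s1 rZ = Z" using b1 by (auto simp: base_def)
    show "snd s1 b (pr 0 i) = cmax q t ?f 0 i" if "i < Z" for i using 1 that by (simp add: cmax_0)
    fix j i s2
    assume A: "j < t" "i < Z" "fst s2 rJ = j" "fst s2 rI = i"
      "\<And>r. r \<noteq> rI \<Longrightarrow> r \<noteq> rJ \<Longrightarrow> fst s2 r = fst s1 r" "\<And>a'. a' \<noteq> b \<Longrightarrow> snd s2 a' = snd s1 a'"
      "\<And>i'. i' < Z \<Longrightarrow> snd s2 b (pr j i') = cmax q t ?f j i'"
    have b2: "base s2" by (rule base_cong[OF b1]) (use A(5,6) ab in auto)
    note d = digit_eval[OF b2 A(3) A(1) A(4)]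
    have "ev partnerE s2 = partner q j i"
      using d A(4) by (simp add: partnerE_def partner_def[OF q_pos A(2,1)])
    moreover have "partner q j i < Z" using dig_partner(1)[OF q_pos A(2,1) q_odd] .
    ultimately show "ev (colmaxE b) s2 = cmax q t ?f (Suc j) i"
      using A le[of i j] le[of "partner q j i" j] b2 cmax_Suc[OF q_pos A(2,1) q_odd, of ?f]
      by (simp add: colmaxE_def cellE_def base_def)
  qed
  then show ?thesis by (simp add: colmax_def s1_def)
qed

lemma zeta_correct:
  assumes b: "base s" and zab: "z \<noteq> a" "z \<noteq> b" "z \<notin> {aPW, aRK, aORT, aSG}"
    and r: "fst s u = U" "fst s d = dv" "fst s r = rv" "u \<notin> {rI, rJ}" "d \<notin> {rI, rJ}" "r \<notin> {rI, rJ}"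
    and bF: "\<And>i. i < Z \<Longrightarrow> snd s b (pr t i) = bf i" and i: "i < Z"
  shows "snd (den (zeta z a b u d r) s) z (pr t i) = zcount q t
    (\<lambda>i. 0 < snd s a (pr U i) \<and> snd s a (pr U i) + dv = bf i \<and> rk q t i = rv) t i"
proof -
  define P where "P i \<longleftrightarrow> 0 < snd s a (pr U i) \<and> snd s a (pr U i) + dv = bf i \<and> rk q t i = rv" for i
  define s1 where "s1 = den (copyI z (selectE a b u d r)) s"
  have b1: "base s1" unfolding s1_def by (rule base_den[OF b]) (use zab in auto)
  have B1: "1 \<le> B" using B_ge by linarith
  have 1: "snd s1 z (pr 0 i) = of_bool (P i)" if "i < Z" for i
    unfolding s1_def
  proof (rule copyI_correct[OF b _ that])
    fix k s2
    assume A: "k < Z" "fst s2 rI = k" "\<And>r. r \<noteq> rI \<Longrightarrow> fst s2 r = fst s r" "\<And>a'. a' \<noteq> z \<Longrightarrow> snd s2 a' = snd s a'"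
    show "ev (selectE a b u d r) s2 = of_bool (P k)"
      using A r zab bF b B1 by (auto simp: selectE_def lastE_def base_def P_def min_def)
  qed
  have le: "zcount q t P j i \<le> B" for j i using zcount_le Z_le by (rule le_trans)
  have "snd (den (sweep z (zetaE z)) s1) z (pr t i) = zcount q t P t i"
  proof (rule sweep_correct[where F = "zcount q t P" and z = Z, OF _ _ _ _ i])
    show "fst s1 rT = t" "fst s1 rZ = Z" using b1 by (auto simp: base_def)
    show "snd s1 z (pr 0 i) = zcount q t P 0 i" if "i < Z" for i using 1 that by (simp add: zcount_0)
    fix j i s2
    assume A: "j < t" "i < Z" "fst s2 rJ = j" "fst s2 rI = i"
      "\<And>r. r \<noteq> rI \<Longrightarrow> r \<noteq> rJ \<Longrightarrow> fst s2 r = fst s1 r" "\<And>a'. a' \<noteq> z \<Longrightarrow> snd s2 a' = snd s1 a'"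
      "\<And>i'. i' < Z \<Longrightarrow> snd s2 z (pr j i') = zcount q t P j i'"
    have b2: "base s2" by (rule base_cong[OF b1]) (use A(5,6) zab in auto)
    note d = digit_eval[OF b2 A(3) A(1) A(4)]
    have "i - q ^ j < Z" using A(2) by simp
    then show "ev (zetaE z) s2 = zcount q t P (Suc j) i"
      using A d le[of "Suc j" i] b2 zcount_Suc[OF q_pos A(2,1), of P]
      by (cases "isM (dig q j i)") (simp_all add: zetaE_def cellE_def base_def)
  qed
  then show ?thesis by (simp add: zeta_def s1_def P_def[abs_def])
qed

text \<open>The first layer holds products of two zeta counts, up to \<open>Z * Z\<close>, which
  explains the first bound on \<open>B\<close>. The later layers only decrease, so they are stored
  without a clamp.\<close>

lemma moebius_correct:
  assumes b: "base s" and F: "\<And>i. i < Z \<Longrightarrow> snd s aFZ (pr t i) = zcount q t P t i"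
    and G: "\<And>i. i < Z \<Longrightarrow> snd s aGZ (pr t i) = zcount q t Q t i" and i: "i < Z"
  shows "snd (den moebius s) aHZ (pr t i) = mcount q t P Q t i"
proof -
  let ?e = "clamp (Bop Mul (lastE aFZ) (lastE aGZ))"
  define s1 where "s1 = den (copyI aHZ ?e) s"
  have b1: "base s1" unfolding s1_def by (rule base_den[OF b]) auto
  have le: "mcount q t P Q j i \<le> B" for j i using mcount_le B_ge(1) by (rule le_trans)
  have 1: "snd s1 aHZ (pr 0 i) = mcount q t P Q 0 i" if "i < Z" for i
    unfolding s1_def
  proof (rule copyI_correct[OF b _ that])
    fix k s2
    assume A: "k < Z" "fst s2 rI = k" "\<And>r. r \<noteq> rI \<Longrightarrow> fst s2 r = fst s r" "\<And>a'. a' \<noteq> aHZ \<Longrightarrow> snd s2 a' = snd s a'"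
    show "ev ?e s2 = mcount q t P Q 0 k"
      using A F G b le[of 0 k] by (simp add: lastE_def base_def mcount_0)
  qed
  have "snd (den (sweep aHZ (moebiusE aHZ)) s1) aHZ (pr t i) = mcount q t P Q t i"
  proof (rule sweep_correct[where F = "mcount q t P Q" and z = Z, OF _ _ _ _ i])
    show "fst s1 rT = t" "fst s1 rZ = Z" using b1 by (auto simp: base_def)
    show "snd s1 aHZ (pr 0 i) = mcount q t P Q 0 i" if "i < Z" for i using 1 that .
    fix j i s2
    assume A: "j < t" "i < Z" "fst s2 rJ = j" "fst s2 rI = i"
      "\<And>r. r \<noteq> rI \<Longrightarrow> r \<noteq> rJ \<Longrightarrow> fst s2 r = fst s1 r" "\<And>a'. a' \<noteq> aHZ \<Longrightarrow> snd s2 a' = snd s1 a'"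
      "\<And>i'. i' < Z \<Longrightarrow> snd s2 aHZ (pr j i') = mcount q t P Q j i'"
    have b2: "base s2" by (rule base_cong[OF b1]) (use A(5,6) in auto)
    note d = digit_eval[OF b2 A(3) A(1) A(4)]
    have "i - q ^ j < Z" using A(2) by simp
    then show "ev (moebiusE aHZ) s2 = mcount q t P Q (Suc j) i"
      using A d mcount_Suc[OF q_pos A(2,1), of P Q] by (simp add: moebiusE_def cellE_def)
  qed
  then show ?thesis by (simp add: moebius_def s1_def)
qed

definition "k1 \<kappa> = \<kappa> mod CU"
definition "k2 \<kappa> = \<kappa> div CU mod CU"
definition "k3 \<kappa> = \<kappa> div CU div CU mod (t + 1)"
definition "k4 \<kappa> = \<kappa> div CU div CU div (t + 1) mod (t + 1)"
definition "k5 \<kappa> = \<kappa> div CU div CU div (t + 1) div (t + 1) mod (t + 1)"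
definition "k6 \<kappa> = \<kappa> div CU div CU div (t + 1) div (t + 1) div (t + 1)"

definition selects :: "(nat \<Rightarrow> nat) \<Rightarrow> nat \<Rightarrow> nat \<Rightarrow> nat \<Rightarrow> bool" where
  "selects f d r i \<longleftrightarrow> 0 < f i \<and> f i + d = cmax q t f t i \<and> rk q t i = r"

definition hit :: "(nat \<Rightarrow> nat \<Rightarrow> nat) \<Rightarrow> (nat \<Rightarrow> nat \<Rightarrow> nat) \<Rightarrow> nat \<Rightarrow> nat \<Rightarrow> bool" where
  "hit f g \<kappa> i \<longleftrightarrow> 0 < mcount q t (selects (f (k1 \<kappa>)) (k3 \<kappa>) (k5 \<kappa>)) (selects (g (k2 \<kappa>)) (k4 \<kappa>) (k6 \<kappa>)) t i \<and>
     rk q t i = k5 \<kappa> + k6 \<kappa>"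

definition hitval :: "(nat \<Rightarrow> nat \<Rightarrow> nat) \<Rightarrow> (nat \<Rightarrow> nat \<Rightarrow> nat) \<Rightarrow> nat \<Rightarrow> nat \<Rightarrow> nat" where
  "hitval f g \<kappa> i = (cmax q t (f (k1 \<kappa>)) t i - k3 \<kappa>) + (cmax q t (g (k2 \<kappa>)) t i - k4 \<kappa>) - 1"

text \<open>\<open>mset\<close> at stage \<open>t\<close> makes the two matched sets cover that of
  \<open>i\<close>; the equation between the ranks makes them disjoint.\<close>

lemma hit_iff:
  "hit f g \<kappa> i \<longleftrightarrow> (\<exists>i1<Z. \<exists>i2<Z. jn q t i1 i2 i \<and> selects (f (k1 \<kappa>)) (k3 \<kappa>) (k5 \<kappa>) i1 \<and>
     selects (g (k2 \<kappa>)) (k4 \<kappa>) (k6 \<kappa>) i2)" (is "_ \<longleftrightarrow> ?R")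
proof
  assume h: "hit f g \<kappa> i"
  then have "mset q t (selects (f (k1 \<kappa>)) (k3 \<kappa>) (k5 \<kappa>)) (selects (g (k2 \<kappa>)) (k4 \<kappa>) (k6 \<kappa>)) t i \<noteq> {}"
    unfolding hit_def mcount_def by force
  then obtain i1 i2 where *: "i1 \<in> zset q t t i" "i2 \<in> zset q t t i" "selects (f (k1 \<kappa>)) (k3 \<kappa>) (k5 \<kappa>) i1"
    "selects (g (k2 \<kappa>)) (k4 \<kappa>) (k6 \<kappa>) i2" "\<forall>k<t. isM (dig q k i) \<longrightarrow> isM (dig q k i1) \<or> isM (dig q k i2)"
    unfolding mset_def by blast
  then have lt: "i1 < Z" "i2 < Z" by (auto simp: zset_def)
  have "rk q t i1 + rk q t i2 = rk q t i" using * h by (simp add: selects_def hit_def)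
  then have "jn q t i1 i2 i" using jn_iff[OF lt, of i] * by blast
  then show ?R using lt * by blast
next
  assume ?R
  then obtain i1 i2 where *: "i1 < Z" "i2 < Z" "jn q t i1 i2 i" "selects (f (k1 \<kappa>)) (k3 \<kappa>) (k5 \<kappa>) i1"
    "selects (g (k2 \<kappa>)) (k4 \<kappa>) (k6 \<kappa>) i2" by blast
  note j = jn_iff[OF *(1,2), of i, THEN iffD2, OF *(3)]
  have "(i1, i2) \<in> mset q t (selects (f (k1 \<kappa>)) (k3 \<kappa>) (k5 \<kappa>)) (selects (g (k2 \<kappa>)) (k4 \<kappa>) (k6 \<kappa>)) t i"
    using j * by (simp add: mset_def)
  then have "0 < mcount q t (selects (f (k1 \<kappa>)) (k3 \<kappa>) (k5 \<kappa>)) (selects (g (k2 \<kappa>)) (k4 \<kappa>) (k6 \<kappa>)) t i"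
    unfolding mcount_def by (auto simp: card_gt_0_iff)
  then show "hit f g \<kappa> i" using j * by (simp add: hit_def selects_def)
qed

lemma hitval_eq:
  assumes "jn q t i1 i2 i" "selects (f (k1 \<kappa>)) (k3 \<kappa>) r i1" "selects (g (k2 \<kappa>)) (k4 \<kappa>) r' i2"
  shows "hitval f g \<kappa> i = f (k1 \<kappa>) i1 + g (k2 \<kappa>) i2 - 1"
proof -
  have "cmax q t (f (k1 \<kappa>)) t i1 = cmax q t (f (k1 \<kappa>)) t i" "cmax q t (g (k2 \<kappa>)) t i2 = cmax q t (g (k2 \<kappa>)) t i"
    by (rule cmax_col_eq, use assms(1) in \<open>simp add: jn_def\<close>)+
  then show ?thesis using assms(2,3) unfolding selects_def hitval_def by linarith
qed

text \<open>Inverts \<open>decode\<close>: every admissible choice of colour sets, offsets and ranks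
  is treated in some round.\<close>

lemma k_exists:
  assumes "U1 < CU" "U2 < CU" "d1 \<le> t" "d2 \<le> t" "r1 \<le> t" "r2 \<le> t"
  shows "\<exists>\<kappa><CU * CU * (t + 1) ^ 4. k1 \<kappa> = U1 \<and> k2 \<kappa> = U2 \<and> k3 \<kappa> = d1 \<and> k4 \<kappa> = d2 \<and> k5 \<kappa> = r1 \<and> k6 \<kappa> = r2"
proof -
  define T where "T = t + 1"
  have T: "d1 < T" "d2 < T" "r1 < T" "r2 < T" using assms by (auto simp: T_def)
  define x4 where "x4 = r1 + T * r2"
  define x3 where "x3 = d2 + T * x4"
  define x2 where "x2 = d1 + T * x3"
  define x1 where "x1 = U2 + CU * x2"
  define \<kappa> where "\<kappa> = U1 + CU * x1"
  have e: "x1 = \<kappa> div CU" "x2 = x1 div CU" "x3 = x2 div T" "x4 = x3 div T" "r2 = x4 div T"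
    "\<kappa> mod CU = U1" "x1 mod CU = U2" "x2 mod T = d1" "x3 mod T = d2" "x4 mod T = r1"
    using assms T by (simp_all add: \<kappa>_def x1_def x2_def x3_def x4_def)
  have step: "a + m * b < m * k" if "a < m" "b < k" for a b m k :: nat
  proof -
    have "a + m * b < m * (b + 1)" using that by simp
    also have "\<dots> \<le> m * k" using that by (intro mult_le_mono2) simp
    finally show ?thesis .
  qed
  have "x4 < T * T" unfolding x4_def using T by (intro step)
  then have "x3 < T * (T * T)" unfolding x3_def using T by (intro step)
  then have "x2 < T * (T * (T * T))" unfolding x2_def using T by (intro step)
  then have "x1 < CU * (T * (T * (T * T)))" unfolding x1_def using assms by (intro step)
  then have "\<kappa> < CU * (CU * (T * (T * (T * T))))" unfolding \<kappa>_def using assms by (intro step)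
  also have "\<dots> = CU * CU * T ^ 4" by (simp add: power4_eq_xxxx mult.assoc)
  finally show ?thesis
    using e by (intro exI[of _ \<kappa>]) (simp add: k1_def k2_def k3_def k4_def k5_def k6_def T_def)
qed

lemma joinBody_correct:
  assumes b: "base s" and f: "\<And>U i. f U i = snd s aFT (pr U i)" and g: "\<And>U i. g U i = snd s aGT (pr U i)"
    and bound: "\<And>U1 U2 i1 i2. U1 < CU \<Longrightarrow> U2 < CU \<Longrightarrow> i1 < Z \<Longrightarrow> i2 < Z \<Longrightarrow> f U1 i1 + g U2 i2 \<le> B"
    and hb: "\<And>i. i < Z \<Longrightarrow> snd s aHT (pr (join_code (k1 \<kappa>) (k2 \<kappa>)) i) \<le> B"
    and k: "fst s rK = \<kappa>" and i: "i < Z"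
  shows "snd (den joinBody s) aHT (pr U i) =
    (if U = join_code (k1 \<kappa>) (k2 \<kappa>) \<and> hit f g \<kappa> i
     then max (snd s aHT (pr U i)) (hitval f g \<kappa> i) else snd s aHT (pr U i))"
proof -
  have CU: "0 < CU" by (simp add: CU_def)
  have kk: "k1 \<kappa> < CU" "k2 \<kappa> < CU" using CU by (simp_all add: k1_def k2_def)
  define s1 where "s1 = den decode s"
  have b1: "base s1" unfolding s1_def by (rule base_den[OF b]) auto
  have r1: "fst s1 rU1 = k1 \<kappa>" "fst s1 rU2 = k2 \<kappa>" "fst s1 rD1 = k3 \<kappa>" "fst s1 rD2 = k4 \<kappa>"
    "fst s1 rR1 = k5 \<kappa>" "fst s1 rR2 = k6 \<kappa>" "fst s1 rU3 = join_code (k1 \<kappa>) (k2 \<kappa>)"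
    using b k kk unfolding s1_def decode_def
    by (auto simp: base_def k1_def k2_def k3_def k4_def k5_def k6_def)
  have a1: "snd s1 = snd s" by (simp add: s1_def fun_eq_iff)
  define s2 where "s2 = den (colmax aFT aBF rU1) s1"
  have b2: "base s2" unfolding s2_def by (rule base_den[OF b1]) auto
  have fB: "f U i \<le> B" "g U i \<le> B" if "U < CU" "i < Z" for U i
    using bound[OF that(1) that(1) that(2) that(2)] by simp_all
  have 2: "snd s2 aBF (pr t i) = cmax q t (f (k1 \<kappa>)) t i" if "i < Z" for i
    unfolding s2_def using colmax_correct[OF b1, of aFT aBF rU1 "k1 \<kappa>" i] r1 that fB kk
    by (simp add: a1 f[symmetric])
  define s3 where "s3 = den (colmax aGT aBG rU2) s2"
  have b3: "base s3" unfolding s3_def by (rule base_den[OF b2]) auto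
  have 3: "snd s3 aBG (pr t i) = cmax q t (g (k2 \<kappa>)) t i" if "i < Z" for i
    unfolding s3_def using colmax_correct[OF b2, of aGT aBG rU2 "k2 \<kappa>" i] r1 that fB kk
    by (simp add: a1 g[symmetric] s2_def)
  define s4 where "s4 = den (zeta aFZ aFT aBF rU1 rD1 rR1) s3"
  have b4: "base s4" unfolding s4_def by (rule base_den[OF b3]) auto
  have 4: "snd s4 aFZ (pr t i) = zcount q t (selects (f (k1 \<kappa>)) (k3 \<kappa>) (k5 \<kappa>)) t i" if "i < Z" for i
    unfolding s4_def using zeta_correct[OF b3, of aFZ aFT aBF rU1 "k1 \<kappa>" rD1 "k3 \<kappa>" rR1 "k5 \<kappa>"
      "cmax q t (f (k1 \<kappa>)) t" i] r1 that 2 f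
    by (simp add: a1 s3_def s2_def selects_def[abs_def])
  define s5 where "s5 = den (zeta aGZ aGT aBG rU2 rD2 rR2) s4"
  have b5: "base s5" unfolding s5_def by (rule base_den[OF b4]) auto
  have 5: "snd s5 aGZ (pr t i) = zcount q t (selects (g (k2 \<kappa>)) (k4 \<kappa>) (k6 \<kappa>)) t i" if "i < Z" for i
    unfolding s5_def using zeta_correct[OF b4, of aGZ aGT aBG rU2 "k2 \<kappa>" rD2 "k4 \<kappa>" rR2 "k6 \<kappa>"
      "cmax q t (g (k2 \<kappa>)) t" i] r1 that 3 g
    by (simp add: a1 s4_def s3_def s2_def selects_def[abs_def])
  define s6 where "s6 = den moebius s5"
  have b6: "base s6" unfolding s6_def by (rule base_den[OF b5]) auto
  have 6: "snd s6 aHZ (pr t i) = mcount q t (selects (f (k1 \<kappa>)) (k3 \<kappa>) (k5 \<kappa>))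
      (selects (g (k2 \<kappa>)) (k4 \<kappa>) (k6 \<kappa>)) t i" if "i < Z" for i
    unfolding s6_def by (rule moebius_correct[OF b5 _ _ that]) (use 4 5 in \<open>simp_all add: s5_def\<close>)
  have r6: "fst s6 rU3 = join_code (k1 \<kappa>) (k2 \<kappa>)" "fst s6 rD1 = k3 \<kappa>" "fst s6 rD2 = k4 \<kappa>"
    "fst s6 rR1 = k5 \<kappa>" "fst s6 rR2 = k6 \<kappa>"
    using r1 by (simp_all add: s6_def s5_def s4_def s3_def s2_def)
  have a6: "snd s6 aBF = snd s2 aBF" "snd s6 aBG = snd s3 aBG" "snd s6 aHT = snd s aHT"
    using a1 by (simp_all add: s6_def s5_def s4_def s3_def s2_def)
  let ?U = "join_code (k1 \<kappa>) (k2 \<kappa>)"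
  have vB: "hitval f g \<kappa> i \<le> B" if i: "i < Z" for i
  proof -
    obtain i1 where 1: "i1 < Z" "f (k1 \<kappa>) i1 = cmax q t (f (k1 \<kappa>)) t i"
      using cmax_attained[OF i le_refl] by metis
    obtain i2 where 2: "i2 < Z" "g (k2 \<kappa>) i2 = cmax q t (g (k2 \<kappa>)) t i"
      using cmax_attained[OF i le_refl] by metis
    show ?thesis using bound[OF kk 1(1) 2(1)] 1 2 by (simp add: hitval_def)
  qed
  have upd: "\<And>i. i < Z \<Longrightarrow> snd (den update s6) aHT (pr ?U i) =
      max (snd s aHT (pr ?U i)) (of_bool (hit f g \<kappa> i) * hitval f g \<kappa> i)"
    and old: "\<And>x. x \<notin> pr ?U ` {..<Z} \<Longrightarrow> snd (den update s6) aHT x = snd s6 aHT x"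
  proof -
    have z: "fst s6 rZ = Z" using b6 by (simp add: base_def)
    have inj: "inj_on (pr ?U) {..<Z}" by (auto intro: inj_onI)
    have st: "ev (prE (Vr rU3) (Vr rI)) s7 = pr ?U k \<and>
        ev (maxE (Ar aHT (prE (Vr rU3) (Vr rI))) (Bop Mul hitE valueE)) s7 =
        max (snd s aHT (pr ?U k)) (of_bool (hit f g \<kappa> k) * hitval f g \<kappa> k)"
      if A: "k < Z" "fst s7 rI = k" "\<And>r'. r' \<noteq> rI \<Longrightarrow> fst s7 r' = fst s6 r'"
        "\<And>a'. a' \<noteq> aHT \<Longrightarrow> snd s7 a' = snd s6 a'"
        "\<And>x. x \<notin> pr ?U ` {..<k} \<Longrightarrow> snd s7 aHT x = snd s6 aHT x" for k s7
    proof -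
      have "pr ?U k \<notin> pr ?U ` {..<k}" by auto
      then have h: "snd s7 aHT (pr ?U k) = snd s aHT (pr ?U k)" using A(5) a6 by simp
      have b7: "base s7" by (rule base_cong[OF b6]) (use A in auto)
      have hit7: "ev hitE s7 = of_bool (hit f g \<kappa> k)"
        using A r6 b7 6[OF A(1)] by (auto simp: hitE_def lastE_def base_def hit_def)
      have val7: "ev valueE s7 = hitval f g \<kappa> k"
        using A r6 b7 a6 2[OF A(1)] 3[OF A(1)] by (simp add: valueE_def lastE_def base_def hitval_def)
      have "max (snd s aHT (pr ?U k)) (of_bool (hit f g \<kappa> k) * hitval f g \<kappa> k) \<le> B"
        using vB[OF A(1)] hb[OF A(1)] by (simp add: of_bool_def)
      then show ?thesis using h hit7 val7 A r6 b7 by (simp add: base_def)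
    qed
    show "snd (den update s6) aHT (pr ?U i) =
      max (snd s aHT (pr ?U i)) (of_bool (hit f g \<kappa> i) * hitval f g \<kappa> i)" if "i < Z" for i
      unfolding update_def by (rule map_loop(1)[OF z inj _ that]) (rule st; simp)
    show "snd (den update s6) aHT x = snd s6 aHT x" if "x \<notin> pr ?U ` {..<Z}" for x
      unfolding update_def by (rule map_loop(2)[OF z inj _ that]) (rule st; simp)
  qed
  have eq: "den joinBody s = den update s6"
    by (simp add: joinBody_def s6_def s5_def s4_def s3_def s2_def s1_def)
  show ?thesis
  proof (cases "U = ?U")
    case True
    then show ?thesis using upd[OF i] unfolding eq by auto
  next
    case False
    then have "pr U i \<notin> pr ?U ` {..<Z}" by auto
    then show ?thesis using old a6 False unfolding eq by auto
  qed
qed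

end

section \<open>Edge tables, stored tables and the complete join\<close>

context graph_dp
begin

definition "edgeE = (let da = digE q (Vr rPA) (Vr rI); db = digE q (Vr rPB) (Vr rI);
    z = Bop Mul (eqE (Vr rU) (Kn 0)) (eqE (Ar aRK (Vr rI)) (Kn 0)) in
  clamp (Bop Mul (notE (Bop Mul (Bop Mul (posE da) (posE db)) (notE (eqE (colE da) (colE db)))))
    (Bop Add z (Bop Mul (notE z) (Bop Mul (Bop Mul (isME da) (isME db))
      (Bop Mul (Bop Mul (eqE (Ar aRK (Vr rI)) (Kn 2)) (eqE (Vr rU) (Ar aSG (colE da)))) (Kn 2)))))))"

definition "EDGE = forUI aGT uiE edgeE"
definition "INITFT = forUI aFT uiE (clamp (Bop Mul (eqE (Vr rU) (Kn 0)) (eqE (Ar aRK (Vr rI)) (Kn 0))))"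
definition "STORET x = forUI aTB (prE (Vr x) uiE) (Ar aFT uiE)"
definition "LOADT x = forUI aFT uiE (Ar aTB (prE (Vr x) uiE))"

lemma wr_tables [simp]:
  "wr EDGE = {rU, rI}" "wa EDGE = {aGT}" "wr INITFT = {rU, rI}" "wa INITFT = {aFT}"
  "wr (STORET x) = {rU, rI}" "wa (STORET x) = {aTB}" "wr (LOADT x) = {rU, rI}" "wa (LOADT x) = {aFT}"
  by (simp_all add: EDGE_def INITFT_def STORET_def LOADT_def)

end

context ram
begin

lemma forUI_correct:
  assumes b: "base s" and a: "a \<notin> {aPW, aRK, aORT, aSG}"
    and inj: "\<And>U U' i i'. ixf U i = ixf U' i' \<Longrightarrow> U = U' \<and> i = i'"
    and step: "\<And>U i s2. U < CU \<Longrightarrow> i < Z \<Longrightarrow> fst s2 rU = U \<Longrightarrow> fst s2 rI = i \<Longrightarrow> base s2 \<Longrightarrow>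
      (\<And>r. r \<noteq> rU \<Longrightarrow> r \<noteq> rI \<Longrightarrow> fst s2 r = fst s r) \<Longrightarrow> (\<And>a'. a' \<noteq> a \<Longrightarrow> snd s2 a' = snd s a') \<Longrightarrow>
      ev ix s2 = ixf U i \<and> ev e s2 = val U i"
  shows "U < CU \<Longrightarrow> i < Z \<Longrightarrow> snd (den (forUI a ix e) s) a (ixf U i) = val U i"
    and "(\<And>U i. U < CU \<Longrightarrow> i < Z \<Longrightarrow> x \<noteq> ixf U i) \<Longrightarrow> snd (den (forUI a ix e) s) a x = snd s a x"
proof -
  have m: "fst s rCU = CU" "fst s rZ = Z" using b by (auto simp: base_def)
  have st: "ev ix s2 = ixf U i \<and> ev e s2 = val U i"
    if A: "U < CU" "i < Z" "fst s2 rU = U" "fst s2 rI = i"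
      "\<And>r. r \<noteq> rU \<Longrightarrow> r \<noteq> rI \<Longrightarrow> fst s2 r = fst s r" "\<And>a'. a' \<noteq> a \<Longrightarrow> snd s2 a' = snd s a'" for U i s2
  proof (rule step[OF A(1-4)])
    show "base s2" by (rule base_cong[OF b]) (use A a in auto)
  qed (use A in auto)
  show "snd (den (forUI a ix e) s) a (ixf U i) = val U i" if "U < CU" "i < Z"
    unfolding forUI_def
    by (rule map2_loop(1)[OF m inj _ _ _ _ that]) (simp_all add: st)
  show "snd (den (forUI a ix e) s) a x = snd s a x" if "\<And>U i. U < CU \<Longrightarrow> i < Z \<Longrightarrow> x \<noteq> ixf U i"
    unfolding forUI_def
    by (rule map2_loop(2)[OF m inj]) (use that in \<open>simp_all add: st\<close>)
qed

lemma forUI_pr: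
  assumes b: "base s" and a: "a \<notin> {aPW, aRK, aORT, aSG}"
    and step: "\<And>U i s2. U < CU \<Longrightarrow> i < Z \<Longrightarrow> fst s2 rU = U \<Longrightarrow> fst s2 rI = i \<Longrightarrow> base s2 \<Longrightarrow>
      (\<And>r. r \<noteq> rU \<Longrightarrow> r \<noteq> rI \<Longrightarrow> fst s2 r = fst s r) \<Longrightarrow> (\<And>a'. a' \<noteq> a \<Longrightarrow> snd s2 a' = snd s a') \<Longrightarrow>
      ev e s2 = val U i"
    and Ui: "U < CU" "i < Z"
  shows "snd (den (forUI a uiE e) s) a (pr U i) = val U i"
  by (rule forUI_correct(1)[OF b a _ _ Ui]) (auto simp: uiE_def intro!: step)

text \<open>The loop invariant mirrors the two halves of \<open>joined\<close>: every positive cell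
  has a witnessing pair, and every hit of a finished round is dominated by its cell.\<close>

lemma JOIN_correct:
  assumes b: "base s"
    and bound: "\<And>U1 U2 i1 i2. U1 < CU \<Longrightarrow> U2 < CU \<Longrightarrow> i1 < Z \<Longrightarrow> i2 < Z \<Longrightarrow>
      snd s aFT (pr U1 i1) + snd s aGT (pr U2 i2) \<le> B"
  shows "joined (\<lambda>U i. snd s aFT (pr U i)) (\<lambda>U i. snd s aGT (pr U i)) (\<lambda>U i. snd (den JOIN s) aFT (pr U i))"
proof -
  define f where "f U i = snd s aFT (pr U i)" for U i
  define g where "g U i = snd s aGT (pr U i)" for U i
  define wit where "wit U i v \<longleftrightarrow> (\<exists>U1<CU. \<exists>U2<CU. \<exists>i1<Z. \<exists>i2<Z. U = join_code U1 U2 \<and>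
        jn q t i1 i2 i \<and> 0 < f U1 i1 \<and> 0 < g U2 i2 \<and> v = f U1 i1 + g U2 i2 - 1)" for U i v
  have witB: "v \<le> B" if w: "wit U i v" for U i v
  proof -
    obtain U1 U2 i1 i2 where "U1 < CU" "U2 < CU" "i1 < Z" "i2 < Z" "v = f U1 i1 + g U2 i2 - 1"
      using w unfolding wit_def by blast
    then show ?thesis using bound[of U1 U2 i1 i2] by (simp add: f_def g_def)
  qed
  define s1 where "s1 = den (forUI aHT uiE (Kn 0)) s"
  have b1: "base s1" unfolding s1_def by (rule base_den[OF b]) auto
  have h1: "snd s1 aHT (pr U i) = 0" if "U < CU" "i < Z" for U i
    unfolding s1_def by (rule forUI_pr[OF b _ _ that]) auto
  have CU0: "0 < CU" by (simp add: CU_def)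
  have kk: "k1 \<kappa> < CU" "k2 \<kappa> < CU" "join_code (k1 \<kappa>) (k2 \<kappa>) < CU" for \<kappa>
    using CU0 join_code_less[of "k1 \<kappa>" c "k2 \<kappa>"] by (simp_all add: k1_def k2_def CU_def)
  define P where "P k s2 \<longleftrightarrow> base s2 \<and> snd s2 aFT = snd s aFT \<and> snd s2 aGT = snd s aGT \<and>
    (\<forall>U<CU. \<forall>i<Z. 0 < snd s2 aHT (pr U i) \<longrightarrow> wit U i (snd s2 aHT (pr U i))) \<and>
    (\<forall>\<kappa><k. \<forall>i<Z. hit f g \<kappa> i \<longrightarrow> hitval f g \<kappa> i \<le> snd s2 aHT (pr (join_code (k1 \<kappa>) (k2 \<kappa>)) i))" for k s2
  define s3 where "s3 = den (For rK rNT joinBody) s1"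
  have "P (fst s1 rNT) s3"
    unfolding s3_def
  proof (rule for_rule)
    show "P 0 (setr rK 0 s1)" using b1 h1 by (auto simp: P_def s1_def)
    fix k s2 assume k: "k < fst s1 rNT" "P k s2" "fst s2 rK = k"
    have b2: "base s2" and F: "snd s2 aFT = snd s aFT" "snd s2 aGT = snd s aGT"
      and H: "\<And>U i. U < CU \<Longrightarrow> i < Z \<Longrightarrow> 0 < snd s2 aHT (pr U i) \<Longrightarrow> wit U i (snd s2 aHT (pr U i))"
      and Cv: "\<And>\<kappa> i. \<kappa> < k \<Longrightarrow> i < Z \<Longrightarrow> hit f g \<kappa> i \<Longrightarrow> hitval f g \<kappa> i \<le> snd s2 aHT (pr (join_code (k1 \<kappa>) (k2 \<kappa>)) i)"
      using k(2) by (auto simp: P_def)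
    have body: "snd (den joinBody s2) aHT (pr U i) = (if U = join_code (k1 k) (k2 k) \<and> hit f g k i
        then max (snd s2 aHT (pr U i)) (hitval f g k i) else snd s2 aHT (pr U i))" if i: "i < Z" for U i
    proof (rule joinBody_correct[OF b2])
      show "snd s2 aHT (pr (join_code (k1 k) (k2 k)) i) \<le> B" if "i < Z" for i
        using H[OF kk(3) that] witB by (metis gr0I le0)
    qed (use F k(3) bound i in \<open>simp_all add: f_def g_def\<close>)
    have hw: "wit (join_code (k1 k) (k2 k)) i (hitval f g k i)" if h: "hit f g k i" for i
    proof -
      from h obtain i1 i2 where *: "i1 < Z" "i2 < Z" "jn q t i1 i2 i" "selects (f (k1 k)) (k3 k) (k5 k) i1"
        "selects (g (k2 k)) (k4 k) (k6 k) i2" unfolding hit_iff by blast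
      show ?thesis using hitval_eq[where f = f and g = g, OF *(3,4,5)] * kk unfolding wit_def selects_def by blast
    qed
    have "base (setr rK (Suc k) (den joinBody s2))" by (intro base_setr base_den[OF b2]) auto
    moreover have "wit U i (snd (den joinBody s2) aHT (pr U i))"
      if A: "U < CU" "i < Z" "0 < snd (den joinBody s2) aHT (pr U i)" for U i
      using H[OF A(1,2)] hw[of i] A(3) body[OF A(2), of U] by (auto simp: max_def split: if_splits)
    moreover have "hitval f g \<kappa> i \<le> snd (den joinBody s2) aHT (pr (join_code (k1 \<kappa>) (k2 \<kappa>)) i)"
      if A: "\<kappa> < Suc k" "i < Z" "hit f g \<kappa> i" for \<kappa> i
    proof (cases "\<kappa> = k")
      case False
      then have "hitval f g \<kappa> i \<le> snd s2 aHT (pr (join_code (k1 \<kappa>) (k2 \<kappa>)) i)" using Cv A by simp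
      then show ?thesis using body[OF A(2)] by (auto simp: max_def)
    qed (use A body in auto)
    ultimately show "P (Suc k) (setr rK (Suc k) (den joinBody s2))" using F by (simp add: P_def)
  qed simp
  then have P: "P (CU * CU * (t + 1) ^ 4) s3" using b1 by (simp add: base_def)
  have res: "snd (den JOIN s) aFT (pr U i) = snd s3 aHT (pr U i)" if "U < CU" "i < Z" for U i
  proof -
    have b3: "base s3" using P by (simp add: P_def)
    have "snd (den (forUI aFT uiE (Ar aHT uiE)) s3) aFT (pr U i) = snd s3 aHT (pr U i)"
      by (rule forUI_pr[OF b3 _ _ that]) (auto simp: uiE_def)
    then show ?thesis by (simp add: JOIN_def s3_def s1_def)
  qed
  show ?thesis
    unfolding joined_def f_def[symmetric] g_def[symmetric]
  proof (intro conjI allI impI)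
    fix U i assume A: "U < CU" "i < Z" "0 < snd (den JOIN s) aFT (pr U i)"
    then show "\<exists>U1<CU. \<exists>U2<CU. \<exists>i1<Z. \<exists>i2<Z. U = join_code U1 U2 \<and> jn q t i1 i2 i \<and> 0 < f U1 i1 \<and> 0 < g U2 i2 \<and>
       snd (den JOIN s) aFT (pr U i) = f U1 i1 + g U2 i2 - 1"
      using P res[OF A(1,2)] unfolding P_def wit_def by simp
  next
    fix U1 U2 i1 i2 i
    assume A: "U1 < CU" "U2 < CU" "i1 < Z" "i2 < Z" "i < Z" "jn q t i1 i2 i" "0 < f U1 i1" "0 < g U2 i2"
      "cmax q t (f U1) t i1 \<le> f U1 i1 + t" "cmax q t (g U2) t i2 \<le> g U2 i2 + t"
    \<comment> \<open>The offsets are at most \<open>t\<close> by the window, so there is a round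
      with exactly these offsets and ranks.\<close>
    let ?d1 = "cmax q t (f U1) t i1 - f U1 i1" and ?d2 = "cmax q t (g U2) t i2 - g U2 i2"
    have "?d1 \<le> t" "?d2 \<le> t" using A(9,10) by linarith+
    then obtain \<kappa> where k: "\<kappa> < CU * CU * (t + 1) ^ 4" "k1 \<kappa> = U1" "k2 \<kappa> = U2" "k3 \<kappa> = ?d1" "k4 \<kappa> = ?d2"
      "k5 \<kappa> = rk q t i1" "k6 \<kappa> = rk q t i2"
      using k_exists[OF A(1,2) _ _ rk_le rk_le] by blast
    have ge: "f U1 i1 \<le> cmax q t (f U1) t i1" "g U2 i2 \<le> cmax q t (g U2) t i2"
      by (rule cmax_ge[OF A(3) refl], rule cmax_ge[OF A(4) refl])
    have sel: "selects (f (k1 \<kappa>)) (k3 \<kappa>) (k5 \<kappa>) i1" "selects (g (k2 \<kappa>)) (k4 \<kappa>) (k6 \<kappa>) i2"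
      using A(7,8) ge by (simp_all add: selects_def k)
    then have "hit f g \<kappa> i" unfolding hit_iff using A by blast
    then have "hitval f g \<kappa> i \<le> snd s3 aHT (pr (join_code U1 U2) i)"
      using P k A(5) unfolding P_def by blast
    also have "\<dots> = snd (den JOIN s) aFT (pr (join_code U1 U2) i)" using res kk(3)[of \<kappa>] k A(5) by simp
    finally show "f U1 i1 + g U2 i2 - 1 \<le> snd (den JOIN s) aFT (pr (join_code U1 U2) i)"
      using hitval_eq[where f = f and g = g, OF A(6) sel] k by simp
  qed
qed

lemma INITFT_correct:
  assumes b: "base s" and "U < CU" "i < Z"
  shows "snd (den INITFT s) aFT (pr U i) = initial_table U i"
  unfolding INITFT_def
proof (rule forUI_pr[OF b _ _ assms(2,3)])
  have "1 \<le> B" using B_ge by linarith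
  then show "ev (clamp (Bop Mul (eqE (Vr rU) (Kn 0)) (eqE (Ar aRK (Vr rI)) (Kn 0)))) s2 = initial_table U i"
    if "i < Z" "fst s2 rU = U" "fst s2 rI = i" "base s2" for U i s2
    using that by (auto simp: initial_table_def base_def)
qed auto

lemma STORET_correct:
  assumes b: "base s" and x: "fst s rx = x" "rx \<notin> {rU, rI}"
  shows "U < CU \<Longrightarrow> i < Z \<Longrightarrow> snd (den (STORET rx) s) aTB (pr x (pr U i)) = snd s aFT (pr U i)"
    and "x' \<noteq> x \<Longrightarrow> snd (den (STORET rx) s) aTB (pr x' y) = snd s aTB (pr x' y)"
proof -
  let ?ix = "\<lambda>U i. pr x (pr U i)" and ?val = "\<lambda>U i. snd s aFT (pr U i)"
  have inj: "?ix U i = ?ix U' i' \<Longrightarrow> U = U' \<and> i = i'" for U U' i i' by simp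
  have st: "ev (prE (Vr rx) uiE) s2 = ?ix U i \<and> ev (Ar aFT uiE) s2 = ?val U i"
    if A: "fst s2 rU = U" "fst s2 rI = i" "\<And>r. r \<noteq> rU \<Longrightarrow> r \<noteq> rI \<Longrightarrow> fst s2 r = fst s r"
      "\<And>a'. a' \<noteq> aTB \<Longrightarrow> snd s2 a' = snd s a'" for U i s2
    using A(1,2) A(3)[of rx] A(4)[of aFT] x by (simp add: uiE_def)
  show "snd (den (STORET rx) s) aTB (pr x (pr U i)) = snd s aFT (pr U i)" if "U < CU" "i < Z"
    unfolding STORET_def
    by (rule forUI_correct(1)[OF b _ inj st that]) simp
  show "snd (den (STORET rx) s) aTB (pr x' y) = snd s aTB (pr x' y)" if "x' \<noteq> x"
    unfolding STORET_def
    by (rule forUI_correct(2)[OF b _ inj st]) (use that in simp_all)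
qed

lemma LOADT_correct:
  assumes b: "base s" and x: "fst s rx = x" "rx \<notin> {rU, rI}" and "U < CU" "i < Z"
  shows "snd (den (LOADT rx) s) aFT (pr U i) = snd s aTB (pr x (pr U i))"
  unfolding LOADT_def
  by (rule forUI_pr[OF b _ _ assms(4,5)]) (use x in \<open>auto simp: uiE_def\<close>)

lemma edge_arith:
  fixes d d' k k' r U u b :: nat
  assumes "2 \<le> b"
  shows "min (of_bool (of_bool (0 < d) * of_bool (0 < d') * of_bool (of_bool (k = k') = (0 :: nat)) = (0 :: nat)) *
      (of_bool (U = 0) * of_bool (r = 0) + of_bool (of_bool (U = 0) * of_bool (r = 0) = (0 :: nat)) *
        (of_bool m * of_bool m' * (of_bool (r = 2) * of_bool (U = u) * 2)))) b =
    (if 0 < d \<and> 0 < d' \<and> k \<noteq> k' then 0 else if U = 0 \<and> r = 0 then 1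
     else if m \<and> m' \<and> r = 2 \<and> U = u then 2 else 0)"
  using assms by (cases "0 < d \<and> 0 < d' \<and> k \<noteq> k'"; cases "U = 0 \<and> r = 0"; cases "m \<and> m' \<and> r = 2 \<and> U = u")
    auto

lemma EDGE_correct:
  assumes b: "base s" and p: "fst s rPA = pa" "fst s rPB = pb" "pa < t" "pb < t" and "U < CU" "i < Z"
  shows "snd (den EDGE s) aGT (pr U i) = edge_table pa pb U i"
  unfolding EDGE_def
proof (rule forUI_pr[OF b _ _ assms(6,7)])
  have B2: "2 \<le> B" using B_ge by linarith
  fix U i s2
  assume A: "U < CU" "i < Z" "fst s2 rU = U" "fst s2 rI = i" "base s2"
    "\<And>r. r \<noteq> rU \<Longrightarrow> r \<noteq> rI \<Longrightarrow> fst s2 r = fst s r"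
  have d: "ev (digE q (Vr rPA) (Vr rI)) s2 = dig q pa i" "ev (digE q (Vr rPB) (Vr rI)) s2 = dig q pb i"
    using A p by (simp_all add: base_def dig_def)
  have "col (dig q pa i) \<le> c" using col_le dig_less_q by (simp add: q_def)
  then have sg: "snd s2 aSG (col (dig q pa i)) = 2 ^ col (dig q pa i)" using A(5) by (simp add: base_def)
  have rk: "snd s2 aRK i = rk q t i" "fst s2 rB = B" using A(2,5) by (simp_all add: base_def)
  show "ev edgeE s2 = edge_table pa pb U i"
    unfolding edgeE_def Let_def ev_macros ev.simps apply_binop.simps d A(3,4) rk sg edge_table_def
    by (rule edge_arith[OF B2])
qed auto

lemma acc_loop:
  assumes m: "fst s r = m" and i: "i \<noteq> acc" and A0: "A 0 = fst s acc" and iacc: "i \<noteq> r"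
    and step: "\<And>k s2. k < m \<Longrightarrow> fst s2 i = k \<Longrightarrow> fst s2 acc = A k \<Longrightarrow>
      (\<And>r'. r' \<noteq> i \<Longrightarrow> r' \<noteq> acc \<Longrightarrow> fst s2 r' = fst s r') \<Longrightarrow> snd s2 = snd s \<Longrightarrow> ev e s2 = A (Suc k)"
  shows "fst (den (For i r (Asg acc e)) s) acc = A m"
proof -
  define P where "P k s2 \<longleftrightarrow> fst s2 acc = A k \<and> (\<forall>r'. r' \<noteq> i \<longrightarrow> r' \<noteq> acc \<longrightarrow> fst s2 r' = fst s r') \<and>
    snd s2 = snd s" for k s2
  have "P (fst s r) (den (For i r (Asg acc e)) s)"
  proof (rule for_rule)
    fix k s2 assume k: "k < fst s r" "P k s2" "fst s2 i = k"
    have "ev e s2 = A (Suc k)" by (rule step) (use k m in \<open>auto simp: P_def\<close>)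
    then show "P (Suc k) (setr i (Suc k) (den (Asg acc e) s2))" using k i by (simp add: P_def)
  qed (use i A0 in \<open>auto simp: P_def\<close>)
  then show ?thesis using m by (simp add: P_def)
qed

end

section \<open>Projecting the table of a node to a neighbouring bag\<close>

text \<open>Zero stands for an absent vertex, which is why positions are shifted by one. The program
  obtains the same value by a forward scan in which later hits overwrite earlier ones.\<close>

primrec posof :: "nat list \<Rightarrow> nat list \<Rightarrow> nat \<Rightarrow> nat \<Rightarrow> nat" where
  "posof bx by k 0 = 0"
| "posof bx by k (Suc j) =
     (if j < length bx \<and> k < length by \<and> bx ! j = by ! k then Suc j else posof bx by k j)"

lemma posof_0_iff:
  "posof bx by k m = 0 \<longleftrightarrow> (\<forall>j<m. \<not> (j < length bx \<and> k < length by \<and> bx ! j = by ! k))"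
  by (induction m) (auto simp: less_Suc_eq)

lemma posof_SucD:
  "posof bx by k m = Suc j \<Longrightarrow> j < m \<and> j < length bx \<and> k < length by \<and> bx ! j = by ! k"
  by (induction m) (auto split: if_splits)

lemma posof_le: "posof bx by k m \<le> m"
  by (induction m) auto

lemma posof_0_iff_mem:
  assumes "length bx \<le> t" "k < length by"
  shows "posof bx by k t = 0 \<longleftrightarrow> by ! k \<notin> set bx"
  unfolding posof_0_iff using assms by (auto simp: in_set_conv_nth)

context graph_dp
begin

definition "lenE x = Ar aINP (Ar aPT (Vr x))"
definition "bagE x j = Ar aINP (Bop Add (Bop Add (Ar aPT (Vr x)) (Kn 1)) j)"

definition "matchE x y = Bop Mul (Bop Mul (ltE (Vr rI) (lenE x)) (ltE (Vr rJ) (lenE y)))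
   (eqE (bagE x (Vr rI)) (bagE y (Vr rJ)))"

definition "posmap a x y = For rJ rT (Sq (Asg rTg (Kn 0)) (Sq
   (For rI rT (Asg rTg (clamp (Bop Add (Bop Mul (matchE x y) (Bop Add (Vr rI) (Kn 1)))
      (Bop Mul (notE (matchE x y)) (Vr rTg))))))
   (Sto a (Vr rJ) (Vr rTg))))"

definition "ivE = Ar aIV (Vr rJ)"

definition "target d = Sq (Asg rTg (Kn 0)) (For rJ rT (Asg rTg
   (clamp (Bop Add (Vr rTg) (Bop Mul (Bop Mul (posE ivE) d) pwE)))))"

definition "allOk e = Sq (Asg rOk (Kn 1)) (For rJ rT (Asg rOk (clamp (Bop Mul (Vr rOk) (notE e)))))"

definition "scatterE = Bop Mul (Bop Mul (ltE (Vr rJ) (lenE rLo)) (notE (Ar aCV (Vr rJ))))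
   (Bop Mod dE (Kn 2))"
definition "gatherE = Bop Mul (notE ivE) (isME dE)"

definition "gsE = prE (Vr rU) (Vr rTg)"

text \<open>Trying all pairs of states would be quadratic in \<open>q ^ t\<close>. Instead every
  state of the old bag is sent to a key made of its digits at the common vertices, placed at the
  positions of the new bag. \<open>aGS\<close> keeps the maximum for each key, and
  \<open>gatherBody\<close> looks the keys up.\<close>

definition "scatterBody = Sq (target (digE q (Bop Sub ivE (Kn 1)) (Vr rI))) (Sq (allOk scatterE)
   (For rU rCU (Sto aGS gsE (maxE (Ar aGS gsE) (Bop Mul (Vr rOk) (Ar aTB (prE (Vr rLo) uiE)))))))"
definition "gatherBody = Sq (target dE) (Sq (allOk gatherE)
   (For rU rCU (Sto aGT uiE (clamp (Bop Mul (Vr rOk) (Ar aGS gsE))))))"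

definition "PROJECT = Sq (posmap aIV rLo rHi) (Sq (posmap aCV rHi rLo) (Sq (forUI aGS uiE (Kn 0))
   (Sq (For rI rZ scatterBody) (For rI rZ gatherBody))))"

lemma wr_project [simp]:
  "wr (posmap a x y) = {rJ, rTg, rI}" "wa (posmap a x y) = {a}"
  "wr (target d) = {rJ, rTg}" "wa (target d) = {}"
  "wr (allOk e) = {rJ, rOk}" "wa (allOk e) = {}"
  "wr scatterBody = {rJ, rTg, rOk, rU}" "wa scatterBody = {aGS}"
  "wr gatherBody = {rJ, rTg, rOk, rU}" "wa gatherBody = {aGT}"
  by (auto simp: posmap_def target_def allOk_def scatterBody_def gatherBody_def)

lemma wr_PROJECT [simp]:
  "wr PROJECT = {rI, rJ, rTg, rOk, rU}" "wa PROJECT = {aIV, aCV, aGS, aGT}"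
  by (auto simp: PROJECT_def)

definition "targetHi bv bu i = enc q t (\<lambda>k. if posof bv bu k t = 0 then 0 else dig q k i)"
definition "targetLo bv bu i = enc q t (\<lambda>k. if posof bv bu k t = 0 then 0 else dig q (posof bv bu k t - 1) i)"
definition "okLo bv bu i \<longleftrightarrow> (\<forall>j<t. \<not> (j < length bv \<and> posof bu bv j t = 0 \<and> odd (dig q j i)))"
definition "okHi bv bu i \<longleftrightarrow> (\<forall>k<t. \<not> (posof bv bu k t = 0 \<and> isM (dig q k i)))"

text \<open>Compatibility splits into a condition on each state alone and the equality of two keys;
  hence scattering and gathering amount to a search over all pairs.\<close>

lemma compat_iff:
  assumes "distinct bv" "length bv \<le> t" "length bu \<le> t"
  shows "compat bv bu i' i \<longleftrightarrow> okLo bv bu i' \<and> okHi bv bu i \<and> targetLo bv bu i' = targetHi bv bu i"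
proof -
  let ?p = "\<lambda>k. posof bv bu k t"
  have lo: "okLo bv bu i' \<longleftrightarrow> (\<forall>j<length bv. bv ! j \<notin> set bu \<longrightarrow> \<not> odd (dig q j i'))"
    using posof_0_iff_mem[of bu t _ bv] assms unfolding okLo_def by (meson less_le_trans)
  have hi: "okHi bv bu i \<longleftrightarrow> (\<forall>k<t. (k < length bu \<longrightarrow> bu ! k \<notin> set bv) \<longrightarrow> \<not> isM (dig q k i))"
  proof -
    have "?p k = 0 \<longleftrightarrow> (k < length bu \<longrightarrow> bu ! k \<notin> set bv)" for k
    proof (cases "k < length bu")
      case True
      then show ?thesis using posof_0_iff_mem[of bv t k bu] assms by simp
    next
      case False
      then show ?thesis by (simp add: posof_0_iff)
    qed
    then show ?thesis by (auto simp: okHi_def)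
  qed
  have "targetLo bv bu i' = targetHi bv bu i \<longleftrightarrow> (\<forall>k<t. ?p k \<noteq> 0 \<longrightarrow> dig q (?p k - 1) i' = dig q k i)"
  proof
    assume eq: "targetLo bv bu i' = targetHi bv bu i"
    show "\<forall>k<t. ?p k \<noteq> 0 \<longrightarrow> dig q (?p k - 1) i' = dig q k i"
    proof (intro allI impI)
      fix k assume k: "k < t" "?p k \<noteq> 0"
      have "dig q k (targetLo bv bu i') = dig q (?p k - 1) i'"
        unfolding targetLo_def by (subst dig_enc[OF _ k(1)]) (use k in auto)
      moreover have "dig q k (targetHi bv bu i) = dig q k i"
        unfolding targetHi_def by (subst dig_enc[OF _ k(1)]) (use k in auto)
      ultimately show "dig q (?p k - 1) i' = dig q k i" using eq by simp
    qed
  next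
    assume "\<forall>k<t. ?p k \<noteq> 0 \<longrightarrow> dig q (?p k - 1) i' = dig q k i"
    then show "targetLo bv bu i' = targetHi bv bu i"
      unfolding targetLo_def targetHi_def by (intro enc_cong) auto
  qed
  also have "\<dots> \<longleftrightarrow> (\<forall>j<length bv. \<forall>k<length bu. bv ! j = bu ! k \<longrightarrow> dig q j i' = dig q k i)"
  proof
    assume L: "\<forall>k<t. ?p k \<noteq> 0 \<longrightarrow> dig q (?p k - 1) i' = dig q k i"
    show "\<forall>j<length bv. \<forall>k<length bu. bv ! j = bu ! k \<longrightarrow> dig q j i' = dig q k i"
    proof (intro allI impI)
      fix j k assume jk: "j < length bv" "k < length bu" "bv ! j = bu ! k"
      then have "?p k \<noteq> 0" using assms(2) unfolding posof_0_iff by (meson less_le_trans)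
      then obtain j' where j': "?p k = Suc j'" using not0_implies_Suc by blast
      then have "j' < length bv" "bv ! j' = bu ! k" using posof_SucD by blast+
      then have "j' = j" using jk nth_eq_iff_index_eq[OF assms(1)] by metis
      then show "dig q j i' = dig q k i" using L[rule_format, of k] j' jk assms by simp
    qed
  next
    assume R: "\<forall>j<length bv. \<forall>k<length bu. bv ! j = bu ! k \<longrightarrow> dig q j i' = dig q k i"
    show "\<forall>k<t. ?p k \<noteq> 0 \<longrightarrow> dig q (?p k - 1) i' = dig q k i"
    proof (intro allI impI)
      fix k assume "?p k \<noteq> 0"
      then obtain j where j: "?p k = Suc j" using not0_implies_Suc by blast
      then show "dig q (?p k - 1) i' = dig q k i" using R posof_SucD[OF j] by simp
    qed
  qed
  finally show ?thesis unfolding compat_def lo hi by blast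
qed

end

section \<open>Correctness of the projection program\<close>

context ram
begin

definition bags_ok :: "store \<Rightarrow> (nat \<Rightarrow> nat list) \<Rightarrow> nat \<Rightarrow> bool" where
  "bags_ok s bl N \<longleftrightarrow> (\<forall>x<N. snd s aINP (snd s aPT x) = length (bl x) \<and>
     (\<forall>j<length (bl x). snd s aINP (snd s aPT x + 1 + j) = bl x ! j))"

lemma bags_ok_cong: "bags_ok s bl N \<Longrightarrow> snd s' aINP = snd s aINP \<Longrightarrow> snd s' aPT = snd s aPT \<Longrightarrow> bags_ok s' bl N"
  by (simp add: bags_ok_def)

lemma posmap_correct:
  assumes b: "base s" and bo: "bags_ok s bl N" and a: "a \<notin> {aINP, aPT, aPW, aRK, aORT, aSG}"
    and x: "fst s rx = x" "x < N" "rx \<notin> {rI, rJ, rTg}" and y: "fst s ry = y" "y < N" "ry \<notin> {rI, rJ, rTg}"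
    and k: "k < t"
  shows "snd (den (posmap a rx ry) s) a k = posof (bl x) (bl y) k t"
proof -
  let ?e = "clamp (Bop Add (Bop Mul (matchE rx ry) (Bop Add (Vr rI) (Kn 1)))
      (Bop Mul (notE (matchE rx ry)) (Vr rTg)))"
  define P where "P k s2 \<longleftrightarrow> (\<forall>r. r \<notin> {rI, rJ, rTg} \<longrightarrow> fst s2 r = fst s r) \<and>
    (\<forall>a'. a' \<noteq> a \<longrightarrow> snd s2 a' = snd s a') \<and> (\<forall>k'<k. snd s2 a k' = posof (bl x) (bl y) k' t)" for k s2
  have "P (fst s rT) (den (posmap a rx ry) s)"
    unfolding posmap_def
  proof (rule for_rule)
    fix k s2 assume k: "k < fst s rT" "P k s2" "fst s2 rJ = k"
    define s3 where "s3 = setr rTg 0 s2"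
    define s4 where "s4 = den (For rI rT (Asg rTg ?e)) s3"
    have P: "\<And>r. r \<notin> {rI, rJ, rTg} \<Longrightarrow> fst s2 r = fst s r" "\<And>a'. a' \<noteq> a \<Longrightarrow> snd s2 a' = snd s a'"
      "\<And>k'. k' < k \<Longrightarrow> snd s2 a k' = posof (bl x) (bl y) k' t" using k(2) by (auto simp: P_def)
    have r3: "fst s3 rT = t" using P(1)[of rT] b by (simp add: s3_def base_def)
    have "fst s4 rTg = posof (bl x) (bl y) k t"
      unfolding s4_def
    proof (rule acc_loop[OF r3])
      show "posof (bl x) (bl y) k 0 = fst s3 rTg" by (simp add: s3_def)
      fix j s5
      assume A: "j < t" "fst s5 rI = j" "fst s5 rTg = posof (bl x) (bl y) k j"
        "\<And>r'. r' \<noteq> rI \<Longrightarrow> r' \<noteq> rTg \<Longrightarrow> fst s5 r' = fst s3 r'" "snd s5 = snd s3"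
      have regs: "fst s5 rx = x" "fst s5 ry = y" "fst s5 rJ = k" "fst s5 rB = B"
        using A(4) P(1) x y k b by (auto simp: s3_def base_def)
      have arr: "snd s5 aINP = snd s aINP" "snd s5 aPT = snd s aPT"
        using A(5) P(2) a by (simp_all add: s3_def)
      have len: "ev (lenE rx) s5 = length (bl x)" "ev (lenE ry) s5 = length (bl y)"
        using bo x y regs arr by (simp_all add: bags_ok_def lenE_def)
      have bag: "ev (bagE rx (Vr rI)) s5 = bl x ! j" if "j < length (bl x)"
        using bo x regs arr A that by (simp add: bags_ok_def bagE_def)
      have bag': "ev (bagE ry (Vr rJ)) s5 = bl y ! k" if "k < length (bl y)"
        using bo y regs arr that by (simp add: bags_ok_def bagE_def)
      have m: "ev (matchE rx ry) s5 = of_bool (j < length (bl x) \<and> k < length (bl y) \<and> bl x ! j = bl y ! k)"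
        using len bag bag' A(2) regs by (auto simp: matchE_def)
      have "posof (bl x) (bl y) k (Suc j) \<le> B"
        using posof_le[of "bl x" "bl y" k "Suc j"] A(1) B_ge(3) by linarith
      then show "ev ?e s5 = posof (bl x) (bl y) k (Suc j)"
        using m A regs by (auto split: if_splits)
    qed auto
    moreover have "fst s4 r = fst s r" if "r \<notin> {rI, rJ, rTg}" for r
      using P(1)[OF that] that by (simp add: s4_def s3_def)
    moreover have "snd s4 = snd s2" "fst s4 rJ = k" using k by (simp_all add: s4_def s3_def fun_eq_iff)
    ultimately have "P (Suc k) (setr rJ (Suc k) (seta a k (fst s4 rTg) s4))"
      using P(2,3) by (auto simp: P_def less_Suc_eq fun_eq_iff)
    then show "P (Suc k) (setr rJ (Suc k) (den (Sq (Asg rTg (Kn 0)) (Sq (For rI rT (Asg rTg ?e))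
        (Sto a (Vr rJ) (Vr rTg)))) s2))"
      using \<open>fst s4 rJ = k\<close> by (simp add: s4_def s3_def)
  qed (auto simp: P_def)
  moreover have "fst s rT = t" using b by (simp add: base_def)
  ultimately show ?thesis using k by (simp add: P_def)
qed

text \<open>The digit \<open>\<delta> k\<close> has to be right only where \<open>aIV\<close> is
  nonzero, because elsewhere the scattering expression subtracts 1 from an absent position.\<close>

lemma target_correct:
  assumes b: "base s" and d: "\<And>k s2. k < t \<Longrightarrow> fst s2 rJ = k \<Longrightarrow> snd s2 = snd s \<Longrightarrow>
      (\<And>r. r \<noteq> rJ \<Longrightarrow> r \<noteq> rTg \<Longrightarrow> fst s2 r = fst s r) \<Longrightarrow> snd s aIV k \<noteq> 0 \<Longrightarrow> ev d s2 = \<delta> k \<and> \<delta> k < q"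
  shows "fst (den (target d) s) rTg = enc q t (\<lambda>k. if snd s aIV k = 0 then 0 else \<delta> k)"
proof -
  let ?d = "\<lambda>k. if snd s aIV k = 0 then 0 else \<delta> k"
  have t: "fst (setr rTg 0 s) rT = t" using b by (simp add: base_def)
  have dq: "?d k < q" if "k < t" for k
    using d[OF that, of "setr rJ k s"] by auto
  have "fst (den (For rJ rT (Asg rTg (clamp (Bop Add (Vr rTg) (Bop Mul (Bop Mul (posE ivE) d) pwE)))))
      (setr rTg 0 s)) rTg = enc q t ?d"
  proof (rule acc_loop[OF t, where A = "\<lambda>k. enc q k ?d"])
    fix k s2
    assume A: "k < t" "fst s2 rJ = k" "fst s2 rTg = enc q k ?d"
      "\<And>r'. r' \<noteq> rJ \<Longrightarrow> r' \<noteq> rTg \<Longrightarrow> fst s2 r' = fst (setr rTg 0 s) r'" "snd s2 = snd (setr rTg 0 s)"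
    have e: "ev (posE ivE) s2 * ev d s2 = ?d k"
      using d[OF A(1,2)] A(2,4,5) by (auto simp: ivE_def)
    have pw: "ev pwE s2 = q ^ k" "fst s2 rB = B" using A b by (simp_all add: pwE_def base_def)
    have "enc q (Suc k) ?d < q ^ Suc k" by (rule enc_less) (use dq A(1) in auto)
    also have "\<dots> \<le> q ^ t" by (rule power_increasing) (use A(1) in \<open>auto simp: q_def\<close>)
    also have "\<dots> \<le> B" by (rule Z_le)
    finally show "ev (clamp (Bop Add (Vr rTg) (Bop Mul (Bop Mul (posE ivE) d) pwE))) s2 = enc q (Suc k) ?d"
      using e pw A(3) by (simp add: enc_Suc)
  qed auto
  then show ?thesis by (simp add: target_def)
qed

lemma allOk_correct:
  assumes b: "base s" and e: "\<And>k s2. k < t \<Longrightarrow> fst s2 rJ = k \<Longrightarrow> snd s2 = snd s \<Longrightarrow>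
      (\<And>r. r \<noteq> rJ \<Longrightarrow> r \<noteq> rOk \<Longrightarrow> fst s2 r = fst s r) \<Longrightarrow> ev e s2 = 0 \<longleftrightarrow> \<not> bad k"
  shows "fst (den (allOk e) s) rOk = of_bool (\<forall>k<t. \<not> bad k)"
proof -
  have t: "fst (setr rOk 1 s) rT = t" using b by (simp add: base_def)
  have B1: "1 \<le> B" using B_ge by linarith
  have "fst (den (For rJ rT (Asg rOk (clamp (Bop Mul (Vr rOk) (notE e))))) (setr rOk 1 s)) rOk =
      of_bool (\<forall>k<t. \<not> bad k)"
  proof (rule acc_loop[OF t, where A = "\<lambda>m. of_bool (\<forall>k<m. \<not> bad k)"])
    fix k s2
    assume A: "k < t" "fst s2 rJ = k" "fst s2 rOk = of_bool (\<forall>j<k. \<not> bad j)"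
      "\<And>r'. r' \<noteq> rJ \<Longrightarrow> r' \<noteq> rOk \<Longrightarrow> fst s2 r' = fst (setr rOk 1 s) r'" "snd s2 = snd (setr rOk 1 s)"
    have "ev e s2 = 0 \<longleftrightarrow> \<not> bad k" using e[OF A(1,2)] A(4,5) by simp
    moreover have "fst s2 rB = B" using A(4) b by (simp add: base_def)
    ultimately show "ev (clamp (Bop Mul (Vr rOk) (notE e))) s2 = of_bool (\<forall>j<Suc k. \<not> bad j)"
      using A(3) B1 by (auto simp: less_Suc_eq)
  qed auto
  then show ?thesis by (simp add: allOk_def)
qed

lemma target_less: "targetLo bv bu i < Z" "targetHi bv bu i < Z"
  unfolding targetLo_def targetHi_def by (rule enc_less; simp)+

lemma PROJECT_correct:
  assumes b: "base s" and bo: "bags_ok s bl N" and u: "fst s rHi = u" "u < N" and v: "fst s rLo = v" "v < N"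
    and bags: "distinct (bl v)" "length (bl v) \<le> t" "length (bl u) \<le> t"
    and TB: "\<And>U i. U < CU \<Longrightarrow> i < Z \<Longrightarrow> snd s aTB (pr v (pr U i)) \<le> B"
  shows "projected (bl v) (bl u) (\<lambda>U i. snd s aTB (pr v (pr U i))) (\<lambda>U i. snd (den PROJECT s) aGT (pr U i))"
proof -
  define T where "T U i = snd s aTB (pr v (pr U i))" for U i
  define s1 where "s1 = den (posmap aIV rLo rHi) s"
  have b1: "base s1" unfolding s1_def by (rule base_den[OF b]) auto
  have bo1: "bags_ok s1 bl N" by (rule bags_ok_cong[OF bo]) (simp_all add: s1_def)
  have iv: "snd s1 aIV k = posof (bl v) (bl u) k t" if "k < t" for k
    unfolding s1_def by (rule posmap_correct[OF b bo _ v(1,2) _ u(1,2) _ that]) auto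
  define s2 where "s2 = den (posmap aCV rHi rLo) s1"
  have b2: "base s2" unfolding s2_def by (rule base_den[OF b1]) auto
  have cv: "snd s2 aCV k = posof (bl u) (bl v) k t" if "k < t" for k
    unfolding s2_def by (rule posmap_correct[OF b1 bo1 _ _ u(2) _ _ v(2) _ that])
      (use u v in \<open>auto simp: s1_def\<close>)
  define s3 where "s3 = den (forUI aGS uiE (Kn 0)) s2"
  have b3: "base s3" unfolding s3_def by (rule base_den[OF b2]) auto
  have gs0: "snd s3 aGS (pr U i) = 0" if "U < CU" "i < Z" for U i
    unfolding s3_def by (rule forUI_pr[OF b2 _ _ that]) auto
  have a3: "snd s3 aIV = snd s1 aIV" "snd s3 aCV = snd s2 aCV" "snd s3 aTB = snd s aTB"
    "snd s3 aINP = snd s aINP" "snd s3 aPT = snd s aPT" "fst s3 rLo = v"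
    using v by (simp_all add: s3_def s2_def s1_def)
  have CUr: "fst s3 rCU = CU" "fst s3 rZ = Z" "fst s3 rB = B" using b3 by (simp_all add: base_def)
  define same where "same a s4 \<longleftrightarrow> (\<forall>r. r \<notin> {rI, rJ, rTg, rOk, rU} \<longrightarrow> fst s4 r = fst s3 r) \<and>
    (\<forall>a'. a' \<notin> {aGS, a} \<longrightarrow> snd s4 a' = snd s3 a')" for a s4
  have sameD: "base s4" "\<And>k. k < t \<Longrightarrow> snd s4 aIV k = posof (bl v) (bl u) k t"
    "\<And>k. k < t \<Longrightarrow> snd s4 aCV k = posof (bl u) (bl v) k t" "\<And>U i. snd s4 aTB (pr v (pr U i)) = T U i"
    "fst s4 rLo = v" "fst s4 rCU = CU" "fst s4 rB = B" "bags_ok s4 bl N" if "same a s4" "a \<in> {aGS, aGT}" for s4 a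
  proof -
    show "base s4" by (rule base_cong[OF b3]) (use that in \<open>auto simp: same_def\<close>)
    show "bags_ok s4 bl N" by (rule bags_ok_cong[OF bo]) (use that a3 in \<open>auto simp: same_def\<close>)
  qed (use that a3 iv cv CUr in \<open>auto simp: same_def T_def\<close>)
  have dgt: "ev dE s5 = dig q k (fst s5 rI)" if "base s5" "fst s5 rJ = k" "k < t" for s5 k
    using that by (simp add: dE_def dig_def base_def)
  \<comment> \<open>Half soundness, half dominance: a positive cell comes from an admissible state
    with that key, and each admissible state treated so far is dominated at its key.\<close>
  define PS where "PS k s4 \<longleftrightarrow> same aGS s4 \<and>
    (\<forall>U<CU. \<forall>x<Z. 0 < snd s4 aGS (pr U x) \<longrightarrow> (\<exists>i<Z. okLo (bl v) (bl u) i \<and> targetLo (bl v) (bl u) i = x \<and>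
       snd s4 aGS (pr U x) = T U i)) \<and>
    (\<forall>i<k. okLo (bl v) (bl u) i \<longrightarrow> (\<forall>U<CU. T U i \<le> snd s4 aGS (pr U (targetLo (bl v) (bl u) i))))" for k s4
  define s4 where "s4 = den (For rI rZ scatterBody) s3"
  have "PS (fst s3 rZ) s4"
    unfolding s4_def
  proof (rule for_rule)
    show "PS 0 (setr rI 0 s3)" using gs0 by (auto simp: PS_def same_def)
    fix k s5 assume k: "k < fst s3 rZ" "PS k s5" "fst s5 rI = k"
    have kZ: "k < Z" using k CUr by simp
    have same5: "same aGS s5" using k by (simp add: PS_def)
    note S5 = sameD[OF same5, simplified]
    have So: "\<And>U x. U < CU \<Longrightarrow> x < Z \<Longrightarrow> 0 < snd s5 aGS (pr U x) \<Longrightarrow> \<exists>i<Z. okLo (bl v) (bl u) i \<and>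
        targetLo (bl v) (bl u) i = x \<and> snd s5 aGS (pr U x) = T U i"
      and Co: "\<And>i U. i < k \<Longrightarrow> okLo (bl v) (bl u) i \<Longrightarrow> U < CU \<Longrightarrow> T U i \<le> snd s5 aGS (pr U (targetLo (bl v) (bl u) i))"
      using k(2) by (simp_all add: PS_def)
    let ?d = "digE q (Bop Sub ivE (Kn 1)) (Vr rI)"
    define s6 where "s6 = den (target ?d) s5"
    have tg: "fst s6 rTg = targetLo (bl v) (bl u) k"
    proof -
      have "fst s6 rTg = enc q t (\<lambda>j. if snd s5 aIV j = 0 then 0 else dig q (snd s5 aIV j - 1) k)"
        unfolding s6_def
      proof (rule target_correct[OF S5(1)])
        fix j s7 assume A: "j < t" "fst s7 rJ = j" "snd s7 = snd s5"
          "\<And>r. r \<noteq> rJ \<Longrightarrow> r \<noteq> rTg \<Longrightarrow> fst s7 r = fst s5 r" "snd s5 aIV j \<noteq> 0"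
        have "snd s5 aIV j - 1 < t"
          using S5(2)[OF A(1)] posof_le[of "bl v" "bl u" j t] A(5) by linarith
        then have "snd s5 aPW (snd s5 aIV j - 1) = q ^ (snd s5 aIV j - 1)" using S5(1) by (simp add: base_def)
        then show "ev ?d s7 = dig q (snd s5 aIV j - 1) k \<and> dig q (snd s5 aIV j - 1) k < q"
          using A k by (simp add: ivE_def dig_def)
      qed
      also have "\<dots> = targetLo (bl v) (bl u) k"
        unfolding targetLo_def by (rule enc_cong) (use S5(2) in simp)
      finally show ?thesis .
    qed
    have same6: "same aGS s6" "fst s6 rI = k" using same5 k by (simp_all add: s6_def same_def)
    note S6 = sameD[OF same6(1), simplified]
    define s7 where "s7 = den (allOk scatterE) s6"
    have okr: "fst s7 rOk = of_bool (okLo (bl v) (bl u) k)"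
      unfolding s7_def okLo_def
    proof (rule allOk_correct[OF S6(1)])
      fix j s8 assume A: "j < t" "fst s8 rJ = j" "snd s8 = snd s6"
        "\<And>r. r \<noteq> rJ \<Longrightarrow> r \<noteq> rOk \<Longrightarrow> fst s8 r = fst s6 r"
      have b8: "base s8" by (rule base_cong[OF S6(1)]) (use A in auto)
      have "ev dE s8 = dig q j k" using dgt[OF b8 A(2,1)] A(4) same6 by simp
      moreover have "ev (lenE rLo) s8 = length (bl v)"
        using S6(5,8) v(2) A by (simp add: lenE_def bags_ok_def)
      ultimately show "ev scatterE s8 = 0 \<longleftrightarrow>
          \<not> (j < length (bl v) \<and> posof (bl u) (bl v) j t = 0 \<and> odd (dig q j k))"
        using A S6(3)[OF A(1)] by (auto simp: scatterE_def odd_iff_mod_2_eq_one)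
    qed
    have same7: "same aGS s7" "fst s7 rI = k" "fst s7 rTg = targetLo (bl v) (bl u) k" "snd s7 aGS = snd s5 aGS"
      using same6 tg by (simp_all add: s7_def s6_def same_def)
    note S7 = sameD[OF same7(1), simplified]
    let ?tg = "targetLo (bl v) (bl u) k"
    let ?val = "\<lambda>U. max (snd s5 aGS (pr U ?tg)) (of_bool (okLo (bl v) (bl u) k) * T U k)"
    let ?c = "For rU rCU (Sto aGS gsE (maxE (Ar aGS gsE) (Bop Mul (Vr rOk) (Ar aTB (prE (Vr rLo) uiE)))))"
    have inj: "inj_on (\<lambda>U. pr U ?tg) {..<CU}" by (auto intro: inj_onI)
    have st: "ev gsE s8 = pr U ?tg \<and>
        ev (maxE (Ar aGS gsE) (Bop Mul (Vr rOk) (Ar aTB (prE (Vr rLo) uiE)))) s8 = ?val U"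
      if A: "U < CU" "fst s8 rU = U" "\<And>r'. r' \<noteq> rU \<Longrightarrow> fst s8 r' = fst s7 r'"
        "\<And>a'. a' \<noteq> aGS \<Longrightarrow> snd s8 a' = snd s7 a'"
        "\<And>x. x \<notin> (\<lambda>U. pr U ?tg) ` {..<U} \<Longrightarrow> snd s8 aGS x = snd s7 aGS x" for U s8
    proof -
      have "pr U ?tg \<notin> (\<lambda>U. pr U ?tg) ` {..<U}" by auto
      then have c: "snd s8 aGS (pr U ?tg) = snd s5 aGS (pr U ?tg)" using A(5) same7 by simp
      have "snd s5 aGS (pr U ?tg) \<le> B" using So[OF A(1) target_less(1)] TB[OF A(1)] unfolding T_def
        by (metis gr0I le0)
      then have "?val U \<le> B" using TB[OF A(1) kZ] by (simp add: T_def of_bool_def)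
      then show ?thesis using A c same7 S7 okr by (simp add: gsE_def uiE_def)
    qed
    have new: "snd (den ?c s7) aGS (pr U ?tg) = ?val U" if "U < CU" for U
      by (rule map_loop(1)[OF S7(6) inj _ that]) (rule st; simp)
    have old: "snd (den ?c s7) aGS y = snd s7 aGS y" if "y \<notin> (\<lambda>U. pr U ?tg) ` {..<CU}" for y
      by (rule map_loop(2)[OF S7(6) inj _ that]) (rule st; simp)
    have eq: "den scatterBody s5 = den ?c s7" by (simp add: scatterBody_def s7_def s6_def)
    have cell: "snd (den scatterBody s5) aGS (pr U x) = (if x = ?tg then ?val U else snd s5 aGS (pr U x))"
      if "U < CU" for U x
    proof (cases "x = ?tg")
      case True
      then show ?thesis using new[OF that] eq by simp
    next
      case False
      then have "pr U x \<notin> (\<lambda>U. pr U ?tg) ` {..<CU}" by auto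
      then show ?thesis using old eq same7 False by simp
    qed
    have "same aGS (setr rI (Suc k) (den scatterBody s5))" using same5 by (auto simp: same_def)
    moreover have "\<exists>i<Z. okLo (bl v) (bl u) i \<and> targetLo (bl v) (bl u) i = x \<and>
        snd (den scatterBody s5) aGS (pr U x) = T U i"
      if A: "U < CU" "x < Z" "0 < snd (den scatterBody s5) aGS (pr U x)" for U x
      using So[OF A(1,2)] A(3) kZ cell[OF A(1), of x]
      by (cases "x = ?tg"; cases "okLo (bl v) (bl u) k") (auto simp: max_def split: if_splits)
    moreover have "T U i \<le> snd (den scatterBody s5) aGS (pr U (targetLo (bl v) (bl u) i))"
      if A: "i < Suc k" "okLo (bl v) (bl u) i" "U < CU" for i U
    proof (cases "i = k")
      case True
      then show ?thesis using cell[OF A(3)] A(2) by simp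
    next
      case False
      then have "T U i \<le> snd s5 aGS (pr U (targetLo (bl v) (bl u) i))" using Co A by simp
      then show ?thesis using cell[OF A(3), of "targetLo (bl v) (bl u) i"] by (auto simp: max_def)
    qed
    ultimately show "PS (Suc k) (setr rI (Suc k) (den scatterBody s5))" by (simp add: PS_def)
  qed simp
  then have PSZ: "PS Z s4" by (simp add: CUr)
  have r4: "fst s4 rZ = Z" by (simp add: s4_def CUr)
  define PG where "PG k s5 \<longleftrightarrow> same aGT s5 \<and> snd s5 aGS = snd s4 aGS \<and>
    (\<forall>i<k. \<forall>U<CU. snd s5 aGT (pr U i) = of_bool (okHi (bl v) (bl u) i) * snd s4 aGS (pr U (targetHi (bl v) (bl u) i)))" for k s5
  have "PG (fst s4 rZ) (den (For rI rZ gatherBody) s4)"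
  proof (rule for_rule)
    show "PG 0 (setr rI 0 s4)" using PSZ by (auto simp: PG_def PS_def same_def)
    fix k s5 assume k: "k < fst s4 rZ" "PG k s5" "fst s5 rI = k"
    have kZ: "k < Z" using k r4 by simp
    have same5: "same aGT s5" "snd s5 aGS = snd s4 aGS" using k by (simp_all add: PG_def)
    note S5 = sameD[OF same5(1), simplified]
    define s6 where "s6 = den (target dE) s5"
    have tg: "fst s6 rTg = targetHi (bl v) (bl u) k"
    proof -
      have "fst s6 rTg = enc q t (\<lambda>j. if snd s5 aIV j = 0 then 0 else dig q j k)"
        unfolding s6_def
      proof (rule target_correct[OF S5(1)])
        fix j s7 assume A: "j < t" "fst s7 rJ = j" "snd s7 = snd s5"
          "\<And>r. r \<noteq> rJ \<Longrightarrow> r \<noteq> rTg \<Longrightarrow> fst s7 r = fst s5 r"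
        have "base s7" by (rule base_cong[OF S5(1)]) (use A in auto)
        then show "ev dE s7 = dig q j k \<and> dig q j k < q" using dgt[OF _ A(2,1)] A(4) k by simp
      qed
      also have "\<dots> = targetHi (bl v) (bl u) k"
        unfolding targetHi_def by (rule enc_cong) (use S5(2) in simp)
      finally show ?thesis .
    qed
    have same6: "same aGT s6" "fst s6 rI = k" using same5 k by (simp_all add: s6_def same_def)
    note S6 = sameD[OF same6(1), simplified]
    define s7 where "s7 = den (allOk gatherE) s6"
    have okr: "fst s7 rOk = of_bool (okHi (bl v) (bl u) k)"
      unfolding s7_def okHi_def
    proof (rule allOk_correct[OF S6(1)])
      fix j s8 assume A: "j < t" "fst s8 rJ = j" "snd s8 = snd s6"
        "\<And>r. r \<noteq> rJ \<Longrightarrow> r \<noteq> rOk \<Longrightarrow> fst s8 r = fst s6 r"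
      have b8: "base s8" by (rule base_cong[OF S6(1)]) (use A in auto)
      have "ev dE s8 = dig q j k" using dgt[OF b8 A(2,1)] A(4) same6 by simp
      then show "ev gatherE s8 = 0 \<longleftrightarrow> \<not> (posof (bl v) (bl u) j t = 0 \<and> isM (dig q j k))"
        using A S6(2)[OF A(1)] by (auto simp: gatherE_def ivE_def)
    qed
    have same7: "same aGT s7" "fst s7 rI = k" "fst s7 rTg = targetHi (bl v) (bl u) k"
      "snd s7 aGS = snd s4 aGS" "snd s7 aGT = snd s5 aGT"
      using same6 tg same5 by (simp_all add: s7_def s6_def same_def)
    note S7 = sameD[OF same7(1), simplified]
    let ?tg = "targetHi (bl v) (bl u) k"
    let ?val = "\<lambda>U. of_bool (okHi (bl v) (bl u) k) * snd s4 aGS (pr U ?tg)"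
    let ?c = "For rU rCU (Sto aGT uiE (clamp (Bop Mul (Vr rOk) (Ar aGS gsE))))"
    have inj: "inj_on (\<lambda>U. pr U k) {..<CU}" by (auto intro: inj_onI)
    have st: "ev uiE s8 = pr U k \<and> ev (clamp (Bop Mul (Vr rOk) (Ar aGS gsE))) s8 = ?val U"
      if A: "U < CU" "fst s8 rU = U" "\<And>r'. r' \<noteq> rU \<Longrightarrow> fst s8 r' = fst s7 r'"
        "\<And>a'. a' \<noteq> aGT \<Longrightarrow> snd s8 a' = snd s7 a'" for U s8
    proof -
      have So: "0 < snd s4 aGS (pr U ?tg) \<Longrightarrow> \<exists>i<Z. snd s4 aGS (pr U ?tg) = T U i"
        using PSZ A(1) target_less(2) unfolding PS_def by metis
      have "snd s4 aGS (pr U ?tg) \<le> B" using So TB[OF A(1)] unfolding T_def by (metis gr0I le0)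
      then show ?thesis using A same7 S7 okr by (simp add: gsE_def uiE_def)
    qed
    have new: "snd (den ?c s7) aGT (pr U k) = ?val U" if "U < CU" for U
      by (rule map_loop(1)[OF S7(6) inj _ that]) (rule st; simp)
    have old: "snd (den ?c s7) aGT y = snd s7 aGT y" if "y \<notin> (\<lambda>U. pr U k) ` {..<CU}" for y
      by (rule map_loop(2)[OF S7(6) inj _ that]) (rule st; simp)
    have eq: "den gatherBody s5 = den ?c s7" by (simp add: gatherBody_def s7_def s6_def)
    have "snd (den gatherBody s5) aGT (pr U i) =
        of_bool (okHi (bl v) (bl u) i) * snd s4 aGS (pr U (targetHi (bl v) (bl u) i))"
      if A: "i < Suc k" "U < CU" for U i
    proof (cases "i = k")
      case True
      then show ?thesis using new[OF A(2)] eq by simp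
    next
      case False
      then have "pr U i \<notin> (\<lambda>U. pr U k) ` {..<CU}" by auto
      then have "snd (den gatherBody s5) aGT (pr U i) = snd s5 aGT (pr U i)" using old eq same7 by simp
      then show ?thesis using k(2) A False by (simp add: PG_def)
    qed
    moreover have "same aGT (setr rI (Suc k) (den gatherBody s5))" using same5 by (auto simp: same_def)
    ultimately show "PG (Suc k) (setr rI (Suc k) (den gatherBody s5))" using same5 by (simp add: PG_def)
  qed simp
  moreover have eq: "den PROJECT s = den (For rI rZ gatherBody) s4"
    by (simp add: PROJECT_def s4_def s3_def s2_def s1_def)
  ultimately have G: "snd (den PROJECT s) aGT (pr U i) =
      of_bool (okHi (bl v) (bl u) i) * snd s4 aGS (pr U (targetHi (bl v) (bl u) i))" if "i < Z" "U < CU" for U i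
    using that r4 by (simp add: PG_def)
  note cmp = compat_iff[OF bags]
  show ?thesis
    unfolding projected_def T_def[symmetric]
  proof (intro conjI allI impI)
    fix U i assume A: "U < CU" "i < Z" "0 < snd (den PROJECT s) aGT (pr U i)"
    then have ok: "okHi (bl v) (bl u) i" "0 < snd s4 aGS (pr U (targetHi (bl v) (bl u) i))"
      using G[OF A(2,1)] by (auto split: if_splits)
    then obtain i' where "i' < Z" "okLo (bl v) (bl u) i'" "targetLo (bl v) (bl u) i' = targetHi (bl v) (bl u) i"
      "snd s4 aGS (pr U (targetHi (bl v) (bl u) i)) = T U i'"
      using PSZ A(1) target_less(2) unfolding PS_def by metis
    then show "\<exists>i'<Z. compat (bl v) (bl u) i' i \<and> snd (den PROJECT s) aGT (pr U i) = T U i'"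
      using cmp ok(1) G[OF A(2,1)] by (intro exI[of _ i']) simp
  next
    fix U i i' assume A: "U < CU" "i < Z" "i' < Z" "compat (bl v) (bl u) i' i"
    then have c: "okLo (bl v) (bl u) i'" "okHi (bl v) (bl u) i" "targetLo (bl v) (bl u) i' = targetHi (bl v) (bl u) i"
      using cmp by simp_all
    have "T U i' \<le> snd s4 aGS (pr U (targetLo (bl v) (bl u) i'))"
      using PSZ A(1,3) c(1) unfolding PS_def by blast
    then show "T U i' \<le> snd (den PROJECT s) aGT (pr U i)" using c G[OF A(2,1)] by simp
  qed
qed

end

section \<open>The input and its tables\<close>

lemma nth_concat_pairs:
  "e < length es \<Longrightarrow> concat (map (\<lambda>(u, v). [u, v]) es) ! (2 * e) = fst (es ! e) \<and>
     concat (map (\<lambda>(u, v). [u, v]) es) ! Suc (2 * e) = snd (es ! e)"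
proof (induction es arbitrary: e)
  case (Cons p es)
  then show ?case by (cases e; cases p) auto
qed simp

lemma length_concat_pairs [simp]: "length (concat (map (\<lambda>(u, v). [u, v]) es)) = 2 * length es"
  by (induction es) (auto split: prod.splits)

definition blocks :: "nat list list \<Rightarrow> nat list" where
  "blocks bs = concat (map (\<lambda>b. length b # b) bs)"

definition block_start :: "nat list list \<Rightarrow> nat \<Rightarrow> nat" where
  "block_start bs x = (\<Sum>y<x. length (bs ! y) + 1)"

lemma block_start_Suc [simp]: "block_start bs (Suc x) = block_start bs x + length (bs ! x) + 1"
  and block_start_0 [simp]: "block_start bs 0 = 0"
  by (simp_all add: block_start_def)

lemma blocks_nth:
  assumes "x < length bs"
  shows "blocks bs ! block_start bs x = length (bs ! x)"
    and "j < length (bs ! x) \<Longrightarrow> blocks bs ! (block_start bs x + 1 + j) = bs ! x ! j"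
    and "block_start bs (Suc x) \<le> length (blocks bs)"
proof -
  have s: "block_start bs x = length (blocks (take x bs))" if "x \<le> length bs" for x
    using that
    by (induction x) (auto simp: blocks_def take_Suc_conv_app_nth)
  have "blocks bs = blocks (take x bs) @ (length (bs ! x) # bs ! x) @ blocks (drop (Suc x) bs)"
    by (subst id_take_nth_drop[OF assms]) (simp add: blocks_def)
  then show "blocks bs ! block_start bs x = length (bs ! x)"
    "j < length (bs ! x) \<Longrightarrow> blocks bs ! (block_start bs x + 1 + j) = bs ! x ! j"
    "block_start bs (Suc x) \<le> length (blocks bs)"
    using s[of x] assms by (simp_all add: nth_append)
qed

lemma block_start_length: "block_start bs (length bs) = length (blocks bs)"
  unfolding block_start_def blocks_def
  by (simp add: length_concat comp_def sum_list_sum_nth atLeast0LessThan)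

section \<open>Programs for the constant tables, the adjacency matrix and the degrees\<close>

context graph_dp
begin

definition "initPW = Sq (Sto aPW (Kn 0) (Kn 1))
  (For rJ rT (Sto aPW (Bop Add (Vr rJ) (Kn 1)) (clamp (Bop Mul (Ar aPW (Vr rJ)) (Kn q)))))"
definition "initRK = For rI rZ (Sq (Asg rTg (Kn 0)) (Sq
  (For rJ rT (Asg rTg (clamp (Bop Add (Vr rTg) (isME dE))))) (Sto aRK (Vr rI) (Vr rTg))))"

text \<open>Straight-line code: since \<open>c\<close> is fixed, tables over colour sets are written
  out in the program. The final statement copies a cell to itself and serves as an empty
  program.\<close>

definition "constTable a ps = foldr (\<lambda>(i, v) C. Sq (Sto a (Kn i) (Kn v)) C) ps (Sto a (Kn 0) (Ar a (Kn 0)))"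
definition "initORT = constTable aORT [(pr U1 U2, join_code U1 U2). U1 \<leftarrow> [0..<CU], U2 \<leftarrow> [0..<CU]]"
definition "initSG = constTable aSG [(i, 2 ^ i). i \<leftarrow> [0..<c+1]]"

definition "inpE a e = Ar aINP (Bop Add a (Bop Add e e))"
definition "initPT = Sq (Asg rP (Vr rP0)) (For rX rN (Sq (Sto aPT (Vr rX) (Vr rP))
  (Asg rP (clamp (Bop Add (Bop Add (Vr rP) (Ar aINP (Vr rP))) (Kn 1))))))"
text \<open>Memory is zero at the start, so it is enough to write the entries of the edges, in time
  linear in their number.\<close>

definition "initADJ = For rE rM (Sq (Asg rHi (inpE (Kn 3) (Vr rE))) (Sq (Asg rLo (inpE (Kn 4) (Vr rE)))
  (Sq (Sto aADJ (prE (Vr rHi) (Vr rLo)) (Kn 1)) (Sto aADJ (prE (Vr rLo) (Vr rHi)) (Kn 1)))))"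
definition "mE k = Bop Add (Kn k) (Bop Add (Vr rM) (Vr rM))"
definition "incE a r = clamp (Bop Add (Ar a (Vr r)) (Kn 1))"
definition "addE a r r' = clamp (Bop Add (Ar a (Vr r)) (Vr r'))"
definition "initDEG = For rE rMF (Sq (Asg rHi (inpE (mE 5) (Vr rE))) (Sq (Asg rLo (inpE (mE 6) (Vr rE)))
  (Sq (Sto aDEG (Vr rHi) (incE aDEG rHi)) (Sq (Sto aDEG (Vr rLo) (incE aDEG rLo))
  (Sq (Sto aSM (Vr rHi) (addE aSM rHi rLo)) (Sto aSM (Vr rLo) (addE aSM rLo rHi)))))))"

lemma wr_constTable [simp]: "wr (constTable a ps) = {}" "wa (constTable a ps) = {a}"
  by (induction ps) (auto simp: constTable_def)

lemma wr_init [simp]: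
  "wr initPW = {rJ}" "wa initPW = {aPW}" "wr initRK = {rI, rTg, rJ}" "wa initRK = {aRK}"
  "wr initORT = {}" "wa initORT = {aORT}" "wr initSG = {}" "wa initSG = {aSG}"
  "wr initPT = {rP, rX}" "wa initPT = {aPT}"
  "wr initADJ = {rE, rHi, rLo}" "wa initADJ = {aADJ}"
  "wr initDEG = {rE, rHi, rLo}" "wa initDEG = {aDEG, aSM}"
  by (auto simp: initPW_def initRK_def initORT_def initSG_def initPT_def initADJ_def initDEG_def)

lemma den_constTable:
  assumes "distinct (map fst ps)"
  shows "(i, v) \<in> set ps \<Longrightarrow> snd (den (constTable a ps) s) a i = v"
    and "i \<notin> fst ` set ps \<Longrightarrow> snd (den (constTable a ps) s) a i = snd s a i"
proof -
  have "((i, v) \<in> set ps \<longrightarrow> snd (den (constTable a ps) s) a i = v) \<and>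
    (i \<notin> fst ` set ps \<longrightarrow> snd (den (constTable a ps) s) a i = snd s a i)"
    using assms
  proof (induction ps arbitrary: s)
    case (Cons p ps)
    obtain j w where p: "p = (j, w)" by (cases p)
    have "den (constTable a (p # ps)) s = den (constTable a ps) (seta a j w s)"
      by (simp add: constTable_def p)
    moreover have "distinct (map fst ps)" "j \<notin> fst ` set ps" using Cons.prems p by auto
    ultimately show ?case using Cons.IH[of "seta a j w s"] p by (cases "i = j") auto
  qed (simp add: constTable_def)
  then show "(i, v) \<in> set ps \<Longrightarrow> snd (den (constTable a ps) s) a i = v"
    "i \<notin> fst ` set ps \<Longrightarrow> snd (den (constTable a ps) s) a i = snd s a i" by blast+
qed

lemma good_cong:
  assumes g: "good b T VA EA" and eq: "\<And>U i. U < CU \<Longrightarrow> i < Z \<Longrightarrow> T' U i = T U i"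
  shows "good b T' VA EA"
  unfolding good_def
proof (intro conjI)
  show "part b VA EA" using g by (simp add: good_def)
  show "sound b T' VA EA" using g eq unfolding good_def sound_def by simp
  show "complete b T' VA EA"
    unfolding complete_def
  proof (intro allI impI)
    fix \<phi> M M' i
    assume A: "optimal \<phi> M" "M' \<subseteq> M \<inter> EA" "\<forall>e\<in>M. e \<inter> (VA - set b) \<noteq> {} \<longrightarrow> e \<in> M'" "i < Z"
      "fits q b \<phi> (\<Union>M') i" "\<forall>j<t. length b \<le> j \<longrightarrow> \<not> isM (dig q j i)"
    have "set_encode (\<phi> ` \<Union>M') < CU" by (rule colours_less[OF A(1)]) (use A(2) in blast)
    then show "Suc (card M') \<le> T' (set_encode (\<phi> ` \<Union>M')) i"
      using g A eq[OF _ A(4)] unfolding good_def complete_def by metis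
  qed
qed

end

text \<open>\<open>N * N\<close> bounds sums of node numbers, and \<open>N + 1\<close> the length of
  the queue after one more insertion.\<close>

locale inst = ram +
  fixes es fs :: "(nat \<times> nat) list" and bs :: "nat list list" and l N :: nat
    and F :: "nat set set" and Bg :: "nat \<Rightarrow> nat set"
  assumes es: "edge_list es E" and fs: "edge_list fs F" and bs: "length bs = N"
    and bag: "x < N \<Longrightarrow> distinct (bs ! x)" "x < N \<Longrightarrow> set (bs ! x) = Bg x"
    and td: "tree_decomposition {..<n} E {..<N} F Bg"
    and bag_le: "x < N \<Longrightarrow> length (bs ! x) \<le> t"
    and NB: "N * N \<le> B" "N + 1 \<le> B"
begin

definition "xs = [n, l] @ flatten_edges es @ [N] @ flatten_edges fs @ blocks bs"
text \<open>The first bag block comes after the five numbers \<open>n\<close>, \<open>l\<close>,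
  \<open>N\<close> and the two edge counts, and after two numbers for each edge.\<close>

definition "p0 = 5 + 2 * length es + 2 * length fs"

definition cst :: "store \<Rightarrow> bool" where
  "cst s \<longleftrightarrow> fst s rT = t \<and> fst s rT1 = t + 1 \<and> fst s rZ = Z \<and> fst s rB = B \<and> fst s rCU = CU \<and>
     fst s rNT = CU * CU * (t + 1) ^ 4 \<and> fst s rL = l \<and> fst s rM = length es \<and> fst s rN = N \<and>
     fst s rMF = length fs \<and> fst s rP0 = p0 \<and> (\<forall>i<length xs. snd s aINP i = xs ! i)"

lemma tree: "is_tree {..<N} F" and F_graph: "simple_graph {..<N} F"
  using td by (auto simp: tree_decomposition_def is_tree_def)

lemma N_pos: "0 < N"
  using tree by (auto simp: is_tree_def connected_graph_def)

lemma xs_eq: "xs = n # l # length es # concat (map (\<lambda>(u, v). [u, v]) es) @ N # length fs #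
    concat (map (\<lambda>(u, v). [u, v]) fs) @ blocks bs"
  by (simp add: xs_def flatten_edges_def)

lemma length_xs: "length xs = p0 + length (blocks bs)"
  by (simp add: xs_eq p0_def)

lemma xs_es: "e < length es \<Longrightarrow> xs ! (3 + 2 * e) = fst (es ! e) \<and> xs ! (4 + 2 * e) = snd (es ! e)"
  using nth_concat_pairs[of e es] by (simp add: xs_eq nth_append numeral_3_eq_3 eval_nat_numeral)

lemma xs_N: "xs ! (3 + 2 * length es) = N" "xs ! (4 + 2 * length es) = length fs"
  by (simp_all add: xs_eq nth_append numeral_3_eq_3 eval_nat_numeral)

lemma xs_fs: "e < length fs \<Longrightarrow> xs ! (5 + 2 * length es + 2 * e) = fst (fs ! e) \<and>
    xs ! (6 + 2 * length es + 2 * e) = snd (fs ! e)"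
  using nth_concat_pairs[of e fs] by (simp add: xs_eq nth_append eval_nat_numeral)

lemma xs_blocks: "xs ! (p0 + i) = blocks bs ! i"
  by (simp add: xs_eq nth_append p0_def eval_nat_numeral)

lemma edge_list_nth:
  assumes "edge_list es' E'" "simple_graph X E'" "e < length es'"
  shows "{fst (es' ! e), snd (es' ! e)} \<in> E'" "fst (es' ! e) \<noteq> snd (es' ! e)" "fst (es' ! e) \<in> X" "snd (es' ! e) \<in> X"
    and "e' < length es' \<Longrightarrow> {fst (es' ! e), snd (es' ! e)} = {fst (es' ! e'), snd (es' ! e')} \<Longrightarrow> e = e'"
proof -
  let ?ps = "map (\<lambda>(u, v). {u, v}) es'"
  have ps: "distinct ?ps" "set ?ps = E'" using assms(1) by (simp_all add: edge_list_def Let_def)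
  have nth: "?ps ! k = {fst (es' ! k), snd (es' ! k)}" if "k < length es'" for k
    using that by (simp add: case_prod_beta)
  show E: "{fst (es' ! e), snd (es' ! e)} \<in> E'" using ps(2) nth[OF assms(3)] assms(3) nth_mem[of e ?ps] by simp
  then have "card {fst (es' ! e), snd (es' ! e)} = 2" "{fst (es' ! e), snd (es' ! e)} \<subseteq> X"
    using assms(2) by (auto simp: simple_graph_def)
  then show "fst (es' ! e) \<noteq> snd (es' ! e)" "fst (es' ! e) \<in> X" "snd (es' ! e) \<in> X" by (auto simp: card_2_iff)
  show "e = e'" if "e' < length es'" "{fst (es' ! e), snd (es' ! e)} = {fst (es' ! e'), snd (es' ! e')}"
    using nth_eq_iff_index_eq[OF ps(1), of e e'] nth that assms(3) by simp
qed

lemma edge_list_mem: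
  assumes "edge_list es' E'"
  shows "X \<in> E' \<longleftrightarrow> (\<exists>e<length es'. X = {fst (es' ! e), snd (es' ! e)})"
proof -
  have "E' = set (map (\<lambda>(u, v). {u, v}) es')" using assms by (simp add: edge_list_def Let_def)
  also have "\<dots> = {{fst (es' ! e), snd (es' ! e)} | e. e < length es'}"
    by (subst set_map, subst set_conv_nth) (auto simp: case_prod_beta)
  finally show ?thesis by blast
qed

lemma cst_cong: "cst s \<Longrightarrow> \<forall>r\<in>{1..12}. fst s' r = fst s r \<Longrightarrow> snd s' aINP = snd s aINP \<Longrightarrow> cst s'"
  by (simp add: cst_def)

lemma cst_den: "cst s \<Longrightarrow> wr C \<inter> {1..12} = {} \<Longrightarrow> aINP \<notin> wa C \<Longrightarrow> cst (den C s)"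
proof (rule cst_cong, assumption)
  assume C: "wr C \<inter> {1..12} = {}" "aINP \<notin> wa C"
  show "\<forall>r\<in>{1..12}. fst (den C s) r = fst s r"
  proof
    fix r :: nat assume "r \<in> {1..12}"
    then have "r \<notin> wr C" using C(1) by blast
    then show "fst (den C s) r = fst s r" by (rule fst_den)
  qed
  show "snd (den C s) aINP = snd s aINP" by (rule snd_den[OF C(2)])
qed

lemma initPW_correct:
  assumes c: "cst s" and j: "j < t"
  shows "snd (den initPW s) aPW j = q ^ j"
proof -
  define P where "P k s2 \<longleftrightarrow> fst s2 rB = B \<and> (\<forall>j\<le>k. snd s2 aPW j = q ^ j)" for k s2
  let ?c = "Sto aPW (Bop Add (Vr rJ) (Kn 1)) (clamp (Bop Mul (Ar aPW (Vr rJ)) (Kn q)))"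
  let ?s1 = "seta aPW 0 1 s"
  have t: "fst ?s1 rT = t" using c by (simp add: cst_def)
  have "P (fst ?s1 rT) (den (For rJ rT ?c) ?s1)"
  proof (rule for_rule)
    show "P 0 (setr rJ 0 ?s1)" using c by (simp add: P_def cst_def)
    fix k s2 assume k: "k < fst ?s1 rT" "P k s2" "fst s2 rJ = k"
    have "q ^ Suc k \<le> q ^ t" by (rule power_increasing) (use k t in \<open>auto simp: q_def\<close>)
    then have "q ^ Suc k \<le> B" using Z_le by linarith
    then show "P (Suc k) (setr rJ (Suc k) (den ?c s2))"
      using k by (auto simp: P_def le_Suc_eq mult.commute)
  qed simp
  then show ?thesis using j t by (simp add: P_def initPW_def)
qed

lemma initRK_correct:
  assumes c: "cst s" and pw: "\<And>j. j < t \<Longrightarrow> snd s aPW j = q ^ j" and i: "i < Z"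
  shows "snd (den initRK s) aRK i = rk q t i"
proof -
  let ?e = "clamp (Bop Add (Vr rTg) (isME dE))"
  define P where "P k s2 \<longleftrightarrow> cst s2 \<and> snd s2 aPW = snd s aPW \<and> (\<forall>i<k. snd s2 aRK i = rk q t i)" for k s2
  have "P (fst s rZ) (den initRK s)"
    unfolding initRK_def
  proof (rule for_rule)
    show "P 0 (setr rI 0 s)" using cst_cong[OF c] by (simp add: P_def)
    fix k s2 assume k: "k < fst s rZ" "P k s2" "fst s2 rI = k"
    define s3 where "s3 = setr rTg 0 s2"
    define s4 where "s4 = den (For rJ rT (Asg rTg ?e)) s3"
    have c3: "cst s3" using k(2) cst_cong[of s2 s3] by (simp add: P_def s3_def)
    have t3: "fst s3 rT = t" using c3 by (simp add: cst_def)
    have "fst s4 rTg = card {j. j < t \<and> isM (dig q j k)}"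
      unfolding s4_def
    proof (rule acc_loop[OF t3, where A = "\<lambda>m. card {j. j < m \<and> isM (dig q j k)}"])
      show "card {j. j < 0 \<and> isM (dig q j k)} = fst s3 rTg" by (simp add: s3_def)
      fix m s5 assume A: "m < t" "fst s5 rJ = m" "fst s5 rTg = card {j. j < m \<and> isM (dig q j k)}"
        "\<And>r'. r' \<noteq> rJ \<Longrightarrow> r' \<noteq> rTg \<Longrightarrow> fst s5 r' = fst s3 r'" "snd s5 = snd s3"
      have d: "ev dE s5 = dig q m k" "fst s5 rB = B"
        using A k pw c3 by (simp_all add: dE_def dig_def s3_def P_def cst_def)
      have "{j. j < Suc m \<and> isM (dig q j k)} =
          (if isM (dig q m k) then insert m {j. j < m \<and> isM (dig q j k)} else {j. j < m \<and> isM (dig q j k)})"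
        by (auto simp: less_Suc_eq)
      then have "card {j. j < Suc m \<and> isM (dig q j k)} = card {j. j < m \<and> isM (dig q j k)} + of_bool (isM (dig q m k))"
        by simp
      moreover have "card {j. j < m \<and> isM (dig q j k)} + 1 \<le> B"
      proof -
        have "card {j. j < m \<and> isM (dig q j k)} \<le> card {..<m}" by (rule card_mono) auto
        then show ?thesis using A(1) B_ge(3) by simp
      qed
      ultimately show "ev ?e s5 = card {j. j < Suc m \<and> isM (dig q j k)}"
        using A d by (auto simp: of_bool_def)
    qed auto
    moreover have "fst s4 rI = k" "cst s4" "snd s4 = snd s2"
      using k c3 cst_den[OF c3, of "For rJ rT (Asg rTg ?e)"] by (simp_all add: s4_def s3_def fun_eq_iff)
    ultimately have "P (Suc k) (setr rI (Suc k) (seta aRK k (fst s4 rTg) s4))"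
      using k(2) cst_cong[of s4] by (simp add: P_def less_Suc_eq rk_def fun_eq_iff)
    then show "P (Suc k) (setr rI (Suc k) (den (Sq (Asg rTg (Kn 0)) (Sq (For rJ rT (Asg rTg ?e))
        (Sto aRK (Vr rI) (Vr rTg)))) s2))"
      using \<open>fst s4 rI = k\<close> by (simp add: s4_def s3_def)
  qed simp
  then show ?thesis using i c by (simp add: P_def cst_def)
qed

lemma initORT_correct:
  assumes "U1 < CU" "U2 < CU"
  shows "snd (den initORT s) aORT (pr U1 U2) = join_code U1 U2"
  unfolding initORT_def
proof (rule den_constTable(1))
  let ?ps = "[(pr U1 U2, join_code U1 U2). U1 \<leftarrow> [0..<CU], U2 \<leftarrow> [0..<CU]]"
  have eq: "map fst ?ps = map (\<lambda>(x, y). pr x y) (List.product [0..<CU] [0..<CU])"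
    by (simp add: map_concat comp_def product_concat_map)
  show "distinct (map fst ?ps)"
    unfolding eq by (subst distinct_map) (auto simp: distinct_product inj_on_def)
  show "(pr U1 U2, join_code U1 U2) \<in> set ?ps"
    using assms by (auto intro!: bexI[of _ U1] image_eqI[of _ _ U2])
qed

lemma initSG_correct: "i \<le> c \<Longrightarrow> snd (den initSG s) aSG i = 2 ^ i"
  unfolding initSG_def by (rule den_constTable(1)) (auto simp: comp_def)

lemma initPT_correct:
  assumes c: "cst s" and LB: "length xs \<le> B"
  shows "bags_ok (den initPT s) (\<lambda>x. bs ! x) N"
proof -
  define P where "P k s2 \<longleftrightarrow> cst s2 \<and> fst s2 rP = p0 + block_start bs k \<and>
    (\<forall>x<k. snd s2 aPT x = p0 + block_start bs x)" for k s2
  let ?e = "clamp (Bop Add (Bop Add (Vr rP) (Ar aINP (Vr rP))) (Kn 1))"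
  let ?c = "Sq (Sto aPT (Vr rX) (Vr rP)) (Asg rP ?e)"
  let ?s1 = "setr rP (fst s rP0) s"
  have N: "fst ?s1 rN = N" using c by (simp add: cst_def)
  have inp: "snd s2 aINP (p0 + block_start bs x) = length (bs ! x)"
    "j < length (bs ! x) \<Longrightarrow> snd s2 aINP (p0 + block_start bs x + 1 + j) = bs ! x ! j"
    if "cst s2" "x < N" for s2 x j
  proof -
    note bl = blocks_nth[of x bs, unfolded bs, OF that(2)]
    have "p0 + block_start bs x < length xs" using bl(3) by (simp add: length_xs)
    then show "snd s2 aINP (p0 + block_start bs x) = length (bs ! x)"
      using that(1) bl(1) xs_blocks by (simp add: cst_def)
    assume j: "j < length (bs ! x)"
    then have "p0 + (block_start bs x + 1 + j) < length xs" using bl(3) by (simp add: length_xs)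
    then have "snd s2 aINP (p0 + (block_start bs x + 1 + j)) = xs ! (p0 + (block_start bs x + 1 + j))"
      using that(1) by (simp add: cst_def)
    also have "\<dots> = bs ! x ! j" unfolding xs_blocks by (rule bl(2)[OF j])
    finally show "snd s2 aINP (p0 + block_start bs x + 1 + j) = bs ! x ! j" by (simp add: add.assoc)
  qed
  have "P (fst ?s1 rN) (den (For rX rN ?c) ?s1)"
  proof (rule for_rule)
    show "P 0 (setr rX 0 ?s1)" using c cst_cong[OF c, of "setr rX 0 ?s1"] by (simp add: P_def cst_def)
    fix k s2 assume k: "k < fst ?s1 rN" "P k s2" "fst s2 rX = k"
    have kN: "k < N" using k N by simp
    have c2: "cst s2" using k by (simp add: P_def)
    have "p0 + block_start bs (Suc k) \<le> length xs"
      using blocks_nth(3)[of k bs] kN bs by (simp add: length_xs)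
    then have le: "p0 + block_start bs k + length (bs ! k) + 1 \<le> B" using LB by simp
    have "cst (setr rX (Suc k) (den ?c s2))" by (rule cst_cong[OF c2]) auto
    moreover have "fst (den ?c s2) rP = p0 + block_start bs (Suc k)"
      using k inp(1)[OF c2 kN] le c2 by (simp add: P_def cst_def)
    ultimately show "P (Suc k) (setr rX (Suc k) (den ?c s2))"
      using k by (simp add: P_def less_Suc_eq)
  qed simp
  then have PN: "P N (den initPT s)" using N by (simp add: initPT_def)
  then have c1: "cst (den initPT s)" and PT: "\<And>x. x < N \<Longrightarrow> snd (den initPT s) aPT x = p0 + block_start bs x"
    by (simp_all add: P_def)
  show ?thesis unfolding bags_ok_def
  proof (intro allI impI conjI)
    fix x assume x: "x < N"
    show "snd (den initPT s) aINP (snd (den initPT s) aPT x) = length (bs ! x)"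
      unfolding PT[OF x] by (rule inp(1)[OF c1 x])
    show "snd (den initPT s) aINP (snd (den initPT s) aPT x + 1 + j) = bs ! x ! j" if "j < length (bs ! x)" for j
      unfolding PT[OF x] by (rule inp(2)[OF c1 x that])
  qed
qed

lemma initADJ_correct:
  assumes c: "cst s" and z: "\<And>x. snd s aADJ x = 0"
  shows "snd (den initADJ s) aADJ (pr u v) = of_bool ({u, v} \<in> E)"
proof -
  define P where "P k s2 \<longleftrightarrow> cst s2 \<and>
    (\<forall>u v. snd s2 aADJ (pr u v) = of_bool (\<exists>e<k. {u, v} = {fst (es ! e), snd (es ! e)}))" for k s2
  have m: "fst s rM = length es" using c by (simp add: cst_def)
  let ?c = "Sq (Asg rHi (inpE (Kn 3) (Vr rE))) (Sq (Asg rLo (inpE (Kn 4) (Vr rE)))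
    (Sq (Sto aADJ (prE (Vr rHi) (Vr rLo)) (Kn 1)) (Sto aADJ (prE (Vr rLo) (Vr rHi)) (Kn 1))))"
  have "P (fst s rM) (den initADJ s)"
    unfolding initADJ_def
  proof (rule for_rule)
    show "P 0 (setr rE 0 s)" using z cst_cong[OF c, of "setr rE 0 s"] by (simp add: P_def)
    fix k s2 assume k: "k < fst s rM" "P k s2" "fst s2 rE = k"
    have c2: "cst s2" using k by (simp add: P_def)
    have ke: "k < length es" using k m by simp
    then have "4 + 2 * k < length xs" by (simp add: length_xs p0_def)
    then have inp: "snd s2 aINP (3 + (k + k)) = fst (es ! k)" "snd s2 aINP (4 + (k + k)) = snd (es ! k)"
    proof -
      have dbl: "k + k = 2 * k" by simp
      have lt: "4 + 2 * k < length xs" using ke by (simp add: length_xs p0_def)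
      then have "3 + 2 * k < length xs" by linarith
      then have "snd s2 aINP (3 + 2 * k) = xs ! (3 + 2 * k)" using c2 unfolding cst_def by blast
      then show "snd s2 aINP (3 + (k + k)) = fst (es ! k)" unfolding dbl using xs_es[OF ke] by (simp only:)
      have "snd s2 aINP (4 + 2 * k) = xs ! (4 + 2 * k)" using c2 lt unfolding cst_def by blast
      then show "snd s2 aINP (4 + (k + k)) = snd (es ! k)" unfolding dbl using xs_es[OF ke] by (simp only:)
    qed
    have cell: "snd (den ?c s2) aADJ (pr u v) =
        (if {u, v} = {fst (es ! k), snd (es ! k)} then 1 else snd s2 aADJ (pr u v))" for u v
    proof -
      define x y where "x = fst (es ! k)" and "y = snd (es ! k)"
      have "ev (inpE (Kn 3) (Vr rE)) s2 = x"
        unfolding inpE_def ev.simps apply_binop.simps k(3) inp x_def ..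
      moreover have "ev (inpE (Kn 4) (Vr rE)) (setr rHi x s2) = y"
        unfolding inpE_def ev.simps apply_binop.simps snd_setr using inp(2) k(3) by (simp add: y_def)
      ultimately have eq: "den ?c s2 = seta aADJ (pr y x) 1 (seta aADJ (pr x y) 1 (setr rLo y (setr rHi x s2)))"
        by simp
      have "snd (den ?c s2) aADJ (pr u v) =
          (if pr u v = pr y x then 1 else if pr u v = pr x y then 1 else snd s2 aADJ (pr u v))"
        unfolding eq snd_seta snd_setr by presburger
      also have "\<dots> = (if {u, v} = {x, y} then 1 else snd s2 aADJ (pr u v))"
        unfolding pr_eq_iff doubleton_eq_iff by presburger
      finally show ?thesis unfolding x_def y_def .
    qed
    have "cst (setr rE (Suc k) (den ?c s2))" by (rule cst_cong[OF c2]) auto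
    moreover have "snd (den ?c s2) aADJ (pr u v) = of_bool (\<exists>e<Suc k. {u, v} = {fst (es ! e), snd (es ! e)})"
      for u v
      unfolding cell using k(2) by (auto simp: P_def less_Suc_eq)
    ultimately show "P (Suc k) (setr rE (Suc k) (den ?c s2))" by (simp add: P_def)
  qed simp
  then show ?thesis unfolding edge_list_mem[OF es] using m by (simp add: P_def)
qed

definition nbk :: "nat \<Rightarrow> nat \<Rightarrow> nat set" where
  "nbk k a = {b. \<exists>e<k. {a, b} = {fst (fs ! e), snd (fs ! e)}}"

text \<open>The listed edges are distinct and have different ends, so a further edge adds a new
  neighbour at either end. Counting and summing edge by edge therefore gives the degrees and the
  neighbour sums.\<close>

lemma nbk_Suc:
  assumes k: "k < length fs"
  shows "nbk (Suc k) a = (if a = fst (fs ! k) then insert (snd (fs ! k)) (nbk k a)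
      else if a = snd (fs ! k) then insert (fst (fs ! k)) (nbk k a) else nbk k a)"
    and "snd (fs ! k) \<notin> nbk k (fst (fs ! k))" and "fst (fs ! k) \<notin> nbk k (snd (fs ! k))"
proof -
  have ne: "fst (fs ! k) \<noteq> snd (fs ! k)" using edge_list_nth(2)[OF fs F_graph k] .
  show "nbk (Suc k) a = (if a = fst (fs ! k) then insert (snd (fs ! k)) (nbk k a)
      else if a = snd (fs ! k) then insert (fst (fs ! k)) (nbk k a) else nbk k a)"
    using ne by (auto simp: nbk_def less_Suc_eq doubleton_eq_iff)
  have no: "\<not> (\<exists>e<k. {fst (fs ! k), snd (fs ! k)} = {fst (fs ! e), snd (fs ! e)})"
    using edge_list_nth(5)[OF fs F_graph k] k by (metis less_irrefl less_trans)
  show "snd (fs ! k) \<notin> nbk k (fst (fs ! k))" using no by (simp add: nbk_def)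
  show "fst (fs ! k) \<notin> nbk k (snd (fs ! k))" using no by (simp add: nbk_def insert_commute)
qed

lemma nbk_subset: "k \<le> length fs \<Longrightarrow> nbk k a \<subseteq> {..<N}"
proof
  fix b assume k: "k \<le> length fs" and "b \<in> nbk k a"
  then obtain e where e: "e < k" "{a, b} = {fst (fs ! e), snd (fs ! e)}" by (auto simp: nbk_def)
  then show "b \<in> {..<N}" using edge_list_nth(3,4)[OF fs F_graph, of e] k by (auto simp: doubleton_eq_iff)
qed

lemma nbk_nb: "a < N \<Longrightarrow> nbk (length fs) a = nb F {..<N} a"
  using nbk_subset[of "length fs" a] unfolding nb_def edge_list_mem[OF fs] by (auto simp: nbk_def)

lemma sum_nbk_le: "k \<le> length fs \<Longrightarrow> \<Sum>(nbk k a) \<le> B" "k \<le> length fs \<Longrightarrow> card (nbk k a) \<le> B"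
proof -
  assume k: "k \<le> length fs"
  have fin: "finite (nbk k a)" using nbk_subset[OF k] finite_subset by blast
  have card: "card (nbk k a) \<le> N" using card_mono[OF _ nbk_subset[OF k], of a] by simp
  have "\<Sum>(nbk k a) \<le> card (nbk k a) * N"
    using sum_bounded_above[of "nbk k a" "\<lambda>x. x" N] nbk_subset[OF k, of a] by force
  also have "\<dots> \<le> N * N" using card by simp
  finally show "\<Sum>(nbk k a) \<le> B" using NB(1) by linarith
  show "card (nbk k a) \<le> B" using card NB(2) by linarith
qed

lemma initDEG_correct:
  assumes c: "cst s" and z: "\<And>x. snd s aDEG x = 0" "\<And>x. snd s aSM x = 0" and a: "a < N"
  shows "snd (den initDEG s) aDEG a = card (nb F {..<N} a)" "snd (den initDEG s) aSM a = \<Sum>(nb F {..<N} a)"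
proof -
  define P where "P k s2 \<longleftrightarrow> cst s2 \<and>
    (\<forall>a. snd s2 aDEG a = card (nbk k a) \<and> snd s2 aSM a = \<Sum>(nbk k a))" for k s2
  have m: "fst s rMF = length fs" using c by (simp add: cst_def)
  let ?c = "(Sq (Asg rHi (inpE (mE 5) (Vr rE))) (Sq (Asg rLo (inpE (mE 6) (Vr rE)))
  (Sq (Sto aDEG (Vr rHi) (incE aDEG rHi)) (Sq (Sto aDEG (Vr rLo) (incE aDEG rLo))
  (Sq (Sto aSM (Vr rHi) (addE aSM rHi rLo)) (Sto aSM (Vr rLo) (addE aSM rLo rHi)))))))"
  have "P (fst s rMF) (den initDEG s)"
    unfolding initDEG_def
  proof (rule for_rule)
    show "P 0 (setr rE 0 s)" using z cst_cong[OF c, of "setr rE 0 s"] by (simp add: P_def nbk_def)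
    fix k s2 assume k: "k < fst s rMF" "P k s2" "fst s2 rE = k"
    have c2: "cst s2" using k by (simp add: P_def)
    have ke: "k < length fs" using k m by simp
    then have "6 + 2 * length es + 2 * k < length xs" by (simp add: length_xs p0_def)
    then have inp: "snd s2 aINP (5 + (length es + length es) + (k + k)) = fst (fs ! k)"
      "snd s2 aINP (6 + (length es + length es) + (k + k)) = snd (fs ! k)"
    proof -
      have dbl: "length es + length es = 2 * length es" "k + k = 2 * k" by simp_all
      have lt: "6 + 2 * length es + 2 * k < length xs" using ke by (simp add: length_xs p0_def)
      then have "5 + 2 * length es + 2 * k < length xs" by linarith
      then have "snd s2 aINP (5 + 2 * length es + 2 * k) = xs ! (5 + 2 * length es + 2 * k)"
        using c2 unfolding cst_def by blast
      then show "snd s2 aINP (5 + (length es + length es) + (k + k)) = fst (fs ! k)"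
        unfolding dbl using xs_fs[OF ke] by (simp only:)
      have "snd s2 aINP (6 + 2 * length es + 2 * k) = xs ! (6 + 2 * length es + 2 * k)"
        using c2 lt unfolding cst_def by blast
      then show "snd s2 aINP (6 + (length es + length es) + (k + k)) = snd (fs ! k)"
        unfolding dbl using xs_fs[OF ke] by (simp only:)
    qed
    define x y where "x = fst (fs ! k)" and "y = snd (fs ! k)"
    have xy: "x \<noteq> y" using edge_list_nth(2)[OF fs F_graph ke] by (simp add: x_def y_def)
    have fin: "finite (nbk k a)" for a using nbk_subset[of k a] ke finite_subset by (metis finite_lessThan less_imp_le)
    note S = nbk_Suc[OF ke, folded x_def y_def]
    have cs: "card (nbk (Suc k) a) = card (nbk k a) + of_bool (a = x \<or> a = y)"
      "\<Sum>(nbk (Suc k) a) = \<Sum>(nbk k a) + (if a = x then y else if a = y then x else 0)" for a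
      using S fin xy by (auto simp: S(1))
    have le: "card (nbk k x) + 1 \<le> B" "card (nbk k y) + 1 \<le> B" "\<Sum>(nbk k x) + y \<le> B" "\<Sum>(nbk k y) + x \<le> B"
      using sum_nbk_le[of "Suc k" x] sum_nbk_le[of "Suc k" y] ke cs[of x] cs[of y] xy by simp_all
    have "cst (setr rE (Suc k) (den ?c s2))" by (rule cst_cong[OF c2]) auto
    moreover have "snd (den ?c s2) aDEG a = card (nbk (Suc k) a) \<and> snd (den ?c s2) aSM a = \<Sum>(nbk (Suc k) a)" for a
    proof -
      have M: "fst s2 rM = length es" "fst s2 rB = B" using c2 by (simp_all add: cst_def)
      have D: "snd s2 aDEG a = card (nbk k a)" "snd s2 aSM a = \<Sum>(nbk k a)" for a using k(2) by (simp_all add: P_def)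
      have "ev (inpE (mE 5) (Vr rE)) s2 = x"
        unfolding inpE_def mE_def ev.simps apply_binop.simps k(3) M inp x_def ..
      moreover have "ev (inpE (mE 6) (Vr rE)) (setr rHi x s2) = y"
        unfolding inpE_def mE_def ev.simps apply_binop.simps snd_setr using inp(2) k(3) M by (simp add: y_def)
      moreover define s3 where "s3 = setr rLo y (setr rHi x s2)"
      ultimately have eq: "den ?c s2 = den (Sq (Sto aDEG (Vr rHi) (incE aDEG rHi)) (Sq (Sto aDEG (Vr rLo) (incE aDEG rLo))
          (Sq (Sto aSM (Vr rHi) (addE aSM rHi rLo)) (Sto aSM (Vr rLo) (addE aSM rLo rHi))))) s3"
        by simp
      have "fst s3 rHi = x" "fst s3 rLo = y" "fst s3 rB = B" "snd s3 = snd s2"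
        using M by (simp_all add: s3_def)
      then show ?thesis unfolding cs eq using D xy le by (simp add: incE_def addE_def)
    qed
    ultimately show "P (Suc k) (setr rE (Suc k) (den ?c s2))" by (simp add: P_def)
  qed simp
  then show "snd (den initDEG s) aDEG a = card (nb F {..<N} a)" "snd (den initDEG s) aSM a = \<Sum>(nb F {..<N} a)"
    using m nbk_nb[OF a] by (simp_all add: P_def)
qed

end

section \<open>The dynamic program\<close>

lemma snd_seta_other [simp]: "a' \<noteq> a \<Longrightarrow> snd (seta a i v s) a' = snd s a'"
  by (simp add: seta_def)

context graph_dp
begin

definition "edgeGuard = Bop Mul (Bop Mul (ltE (Vr rPA) (lenE rX)) (ltE (Vr rPB) (lenE rX)))
  (Ar aADJ (prE (bagE rX (Vr rPA)) (bagE rX (Vr rPB))))"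
definition "edgeStep = Cond edgeGuard (Sq EDGE JOIN) nop"
text \<open>All ordered pairs of positions are tried, so an edge inside the bag is joined twice.
  This is harmless, as the edge set after a join is a union and completeness allows any
  split.\<close>

definition "nodeBody = Sq INITFT (Sq (For rPA rT (For rPB rT edgeStep)) (STORET rX))"

definition "pushE r = Cond (eqE (Ar aDEG (Vr r)) (Kn 1))
  (Sq (Sto aQU (Vr rTail) (Vr r)) (Asg rTail (clamp (Bop Add (Vr rTail) (Kn 1))))) nop"

definition "mergeBody = Sq (Asg rLo (Ar aQU (Vr rX))) (Sq (Asg rHi (Ar aSM (Vr rLo))) (Sq (LOADT rHi)
  (Sq PROJECT (Sq JOIN (Sq (STORET rHi)
  (Sq (Sto aDEG (Vr rHi) (Bop Sub (Ar aDEG (Vr rHi)) (Kn 1)))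
  (Sq (Sto aSM (Vr rHi) (Bop Sub (Ar aSM (Vr rHi)) (Vr rLo))) (Sq (pushE rHi) (Asg rRoot (Vr rHi))))))))))"
text \<open>A tree with \<open>N\<close> nodes is exhausted after \<open>N - 1\<close> merges, but
  the loop is bounded by the register that holds \<open>N\<close>, so a test skips the last
  round.\<close>

definition "mergeStep = Cond (ltE (Bop Add (Vr rX) (Kn 1)) (Vr rN)) mergeBody nop"

definition "fullE = Ar aTB (prE (Vr rRoot) (prE (Kn (set_encode {1..c})) (Vr rI)))"
definition "finalBody = Sq (allOk (Bop Mod dE (Kn 2)))
  (Asg 0 (maxE (Vr 0) (Bop Mul (Vr rOk) (ltE (Vr rL) fullE))))"

definition "mainProg = Sq initPW (Sq initRK (Sq initORT (Sq initSG (Sq initPT (Sq initADJ (Sq initDEG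
  (Sq (For rX rN nodeBody) (Sq (Asg rTail (Kn 0)) (Sq (For rX rN (pushE rX)) (Sq (Asg rRoot (Kn 0))
  (Sq (For rX rN mergeStep) (Sq (Asg 0 (Kn 0)) (For rI rZ finalBody)))))))))))))"

lemma wr_main [simp]:
  "wr edgeStep = {rI, rJ, rK, rU, rU1, rU2, rE, rD1, rD2, rR1, rR2, rU3, 39}"
  "wa edgeStep = {aGT, aBF, aBG, aFZ, aGZ, aHZ, aHT, aFT}"
  "wr nodeBody = {rPA, rPB, rI, rJ, rK, rU, rU1, rU2, rE, rD1, rD2, rR1, rR2, rU3, 39}"
  "wa nodeBody = {aGT, aBF, aBG, aFZ, aGZ, aHZ, aHT, aFT, aTB}"
  "wr (pushE r) = {rTail, 39}" "wa (pushE r) = {aQU}"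
  "wr mergeBody = {rLo, rHi, rI, rJ, rK, rU, rU1, rU2, rE, rD1, rD2, rR1, rR2, rU3, rTg, rOk, rTail, rRoot, 39}"
  "wa mergeBody = {aGT, aBF, aBG, aFZ, aGZ, aHZ, aHT, aFT, aTB, aIV, aCV, aGS, aDEG, aSM, aQU}"
  "wr mergeStep = {rLo, rHi, rI, rJ, rK, rU, rU1, rU2, rE, rD1, rD2, rR1, rR2, rU3, rTg, rOk, rTail, rRoot, 39}"
  "wa mergeStep = {aGT, aBF, aBG, aFZ, aGZ, aHZ, aHT, aFT, aTB, aIV, aCV, aGS, aDEG, aSM, aQU}"
  "wr finalBody = {rJ, rOk, 0}" "wa finalBody = {}"
proof -
  show e: "wr edgeStep = {rI, rJ, rK, rU, rU1, rU2, rE, rD1, rD2, rR1, rR2, rU3, 39}"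
    "wa edgeStep = {aGT, aBF, aBG, aFZ, aGZ, aHZ, aHT, aFT}" by (auto simp: edgeStep_def)
  show "wr nodeBody = {rPA, rPB, rI, rJ, rK, rU, rU1, rU2, rE, rD1, rD2, rR1, rR2, rU3, 39}"
    "wa nodeBody = {aGT, aBF, aBG, aFZ, aGZ, aHZ, aHT, aFT, aTB}" by (auto simp: nodeBody_def e)
  show p: "wr (pushE r) = {rTail, 39}" "wa (pushE r) = {aQU}" for r by (auto simp: pushE_def)
  show m: "wr mergeBody = {rLo, rHi, rI, rJ, rK, rU, rU1, rU2, rE, rD1, rD2, rR1, rR2, rU3, rTg, rOk, rTail, rRoot, 39}"
    "wa mergeBody = {aGT, aBF, aBG, aFZ, aGZ, aHZ, aHT, aFT, aTB, aIV, aCV, aGS, aDEG, aSM, aQU}"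
    by (auto simp: mergeBody_def p)
  show "wr mergeStep = {rLo, rHi, rI, rJ, rK, rU, rU1, rU2, rE, rD1, rD2, rR1, rR2, rU3, rTg, rOk, rTail, rRoot, 39}"
    "wa mergeStep = {aGT, aBF, aBG, aFZ, aGZ, aHZ, aHT, aFT, aTB, aIV, aCV, aGS, aDEG, aSM, aQU}"
    by (auto simp: mergeStep_def m)
  show "wr finalBody = {rJ, rOk, 0}" "wa finalBody = {}" by (auto simp: finalBody_def)
qed

end

section \<open>Correctness of the dynamic program\<close>

context inst
begin

definition ready :: "store \<Rightarrow> bool" where
  "ready s \<longleftrightarrow> base s \<and> fst s rN = N \<and> fst s rL = l \<and> bags_ok s (\<lambda>x. bs ! x) N \<and>
     (\<forall>u v. snd s aADJ (pr u v) = of_bool ({u, v} \<in> E))"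

lemma ready_cong:
  assumes "ready s" "\<forall>r\<in>{rT, rT1, rZ, rB, rCU, rNT, rN, rL}. fst s' r = fst s r"
    "\<forall>a\<in>{aPW, aRK, aORT, aSG, aINP, aPT, aADJ}. snd s' a = snd s a"
  shows "ready s'"
proof -
  have "base s" "bags_ok s (\<lambda>x. bs ! x) N" using assms(1) by (simp_all add: ready_def)
  then have "base s'" "bags_ok s' (\<lambda>x. bs ! x) N"
    using assms(2,3) by (auto intro: base_cong bags_ok_cong)
  then show ?thesis using assms by (simp add: ready_def)
qed

abbreviation "tab s a \<equiv> (\<lambda>U i. snd s a (pr U i))"
abbreviation "node s x \<equiv> (\<lambda>U i. snd s aTB (pr x (pr U i)))"

lemma bag_facts: "x < N \<Longrightarrow> distinct (bs ! x) \<and> length (bs ! x) \<le> t \<and> set (bs ! x) \<subseteq> {..<n}"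
  using bag bag_le td by (simp add: tree_decomposition_def)

text \<open>The edges at position pairs that precede \<open>(a, b)\<close> lexicographically, that
  is, those treated when the two nested loops have reached these counters.\<close>

definition bag_edges :: "nat \<Rightarrow> nat \<Rightarrow> nat \<Rightarrow> nat set set" where
  "bag_edges x a b = {e \<in> E. \<exists>a' b'. a' < length (bs ! x) \<and> b' < length (bs ! x) \<and>
     (a' < a \<or> a' = a \<and> b' < b) \<and> e = {bs ! x ! a', bs ! x ! b'}}"

lemma bag_edges_Suc:
  "bag_edges x a (Suc b) = (if a < length (bs ! x) \<and> b < length (bs ! x) \<and> {bs ! x ! a, bs ! x ! b} \<in> E
     then bag_edges x a b \<union> {{bs ! x ! a, bs ! x ! b}} else bag_edges x a b)"
  by (auto simp: bag_edges_def less_Suc_eq)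

lemma bag_edges_next: "x < N \<Longrightarrow> bag_edges x a t = bag_edges x (Suc a) 0"
proof -
  assume x: "x < N"
  have "a' < a \<or> a' = a \<and> b' < t \<longleftrightarrow> a' < Suc a \<or> a' = Suc a \<and> b' < 0" if "b' < length (bs ! x)" for a' b'
    using that bag_le[OF x] by auto
  then show ?thesis unfolding bag_edges_def by blast
qed

lemma bag_edges_all: "x < N \<Longrightarrow> bag_edges x t 0 = bagsE E Bg {x}"
proof -
  assume x: "x < N"
  have all: "e \<in> bag_edges x t 0" if e: "e \<in> E" "e \<subseteq> Bg x" for e
  proof -
    have "card e = 2" using e graph by (auto simp: simple_graph_def)
    then obtain u v where uv: "e = {u, v}" by (auto simp: card_2_iff)
    then have "u \<in> set (bs ! x)" "v \<in> set (bs ! x)" using e(2) bag(2)[OF x] by auto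
    then obtain a b where ab: "a < length (bs ! x)" "u = bs ! x ! a" "b < length (bs ! x)" "v = bs ! x ! b"
      unfolding in_set_conv_nth by blast
    have "a < t" using ab(1) bag_le[OF x] by linarith
    then have "a < length (bs ! x) \<and> b < length (bs ! x) \<and> (a < t \<or> a = t \<and> b < 0) \<and> e = {bs ! x ! a, bs ! x ! b}"
      using ab uv by blast
    then show ?thesis using e(1) unfolding bag_edges_def by blast
  qed
  have sub: "e \<in> E \<and> e \<subseteq> Bg x" if e: "e \<in> bag_edges x t 0" for e
  proof -
    obtain a b where "e \<in> E" "a < length (bs ! x)" "b < length (bs ! x)" "e = {bs ! x ! a, bs ! x ! b}"
      using e unfolding bag_edges_def by blast
    then show ?thesis using bag(2)[OF x] nth_mem by auto
  qed
  show "bag_edges x t 0 = bagsE E Bg {x}"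
    by (rule set_eqI, rule iffI) (use all sub in \<open>auto simp: bagsE_def\<close>)
qed

lemma edgeStep_correct:
  assumes r: "ready s" and x: "fst s rX = x" "x < N" and a: "fst s rPA = a" "a < t" and b: "fst s rPB = b" "b < t"
    and g: "good (bs ! x) (tab s aFT) (set (bs ! x)) (bag_edges x a b)"
  shows "good (bs ! x) (tab (den edgeStep s) aFT) (set (bs ! x)) (bag_edges x a (Suc b))"
proof -
  let ?b = "bs ! x"
  note bf = bag_facts[OF x(2)]
  have bs': "base s" using r by (simp add: ready_def)
  have len: "ev (lenE rX) s = length ?b" and bagE: "\<And>e. ev e s < length ?b \<Longrightarrow> ev (bagE rX e) s = ?b ! ev e s"
    using r x by (simp_all add: ready_def bags_ok_def lenE_def bagE_def)
  have gd: "ev edgeGuard s \<noteq> 0 \<longleftrightarrow> a < length ?b \<and> b < length ?b \<and> {?b ! a, ?b ! b} \<in> E"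
    using len bagE[of "Vr rPA"] bagE[of "Vr rPB"] a b r by (auto simp: edgeGuard_def ready_def)
  show ?thesis
  proof (cases "ev edgeGuard s \<noteq> 0")
    case True
    then have ab: "a < length ?b" "b < length ?b" "{?b ! a, ?b ! b} \<in> E" using gd by auto
    define s1 where "s1 = den EDGE s"
    have b1: "base s1" unfolding s1_def by (rule base_den[OF bs']) auto
    have G: "tab s1 aGT U i = edge_table a b U i" if "U < CU" "i < Z" for U i
      unfolding s1_def by (rule EDGE_correct[OF bs' a(1) b(1) a(2) b(2) that])
    have F: "tab s1 aFT = tab s aFT" by (simp add: s1_def)
    have gE: "good ?b (tab s1 aGT) (set ?b) {{?b ! a, ?b ! b}}"
      by (rule good_cong[OF good_edge G]) (use bf ab in auto)
    have "joined (tab s1 aFT) (tab s1 aGT) (tab (den JOIN s1) aFT)"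
    proof (rule JOIN_correct[OF b1])
      fix U1 U2 i1 i2 assume A: "U1 < CU" "U2 < CU" "i1 < Z" "i2 < Z"
      have "tab s1 aFT U1 i1 \<le> n + 1" using good_le[OF g A(1,3)] by (simp add: s1_def)
      moreover have "tab s1 aGT U2 i2 \<le> n + 1" by (rule good_le[OF gE A(2,4)])
      ultimately show "tab s1 aFT U1 i1 + tab s1 aGT U2 i2 \<le> B" using B_ge(4) by linarith
    qed
    from good_join[OF g gE _ this[unfolded F]]
    have "good ?b (tab (den JOIN s1) aFT) (set ?b) (bag_edges x a b \<union> {{?b ! a, ?b ! b}})" by simp
    then show ?thesis using True ab by (simp add: edgeStep_def s1_def bag_edges_Suc)
  next
    case False
    then have "bag_edges x a (Suc b) = bag_edges x a b" using gd by (auto simp: bag_edges_Suc)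
    then show ?thesis using g False by (simp add: edgeStep_def)
  qed
qed

lemma nodeBody_correct:
  assumes r: "ready s" and x: "fst s rX = x" "x < N"
  shows "good (bs ! x) (node (den nodeBody s) x) (bagsUn Bg {x}) (bagsE E Bg {x})"
    and "y \<noteq> x \<Longrightarrow> node (den nodeBody s) y = node s y"
proof -
  let ?b = "bs ! x"
  note bf = bag_facts[OF x(2)]
  have bs': "base s" using r by (simp add: ready_def)
  define s1 where "s1 = den INITFT s"
  define s2 where "s2 = den (For rPA rT (For rPB rT edgeStep)) s1"
  have r1: "ready s1" by (rule ready_cong[OF r]) (simp_all add: s1_def)
  have "bag_edges x 0 0 = {}" by (auto simp: bag_edges_def)
  then have g1: "good ?b (tab s1 aFT) (set ?b) (bag_edges x 0 0)"
    using good_cong[OF good_initial, of ?b "tab s1 aFT"] INITFT_correct[OF bs'] bf by (simp add: s1_def)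
  define P where "P a b s3 \<longleftrightarrow> ready s3 \<and> fst s3 rX = x \<and> snd s3 aTB = snd s aTB \<and>
    good ?b (tab s3 aFT) (set ?b) (bag_edges x a b)" for a b s3
  have P1: "P (fst s1 rT) 0 s2"
    unfolding s2_def
  proof (rule for_rule[where P = "\<lambda>a. P a 0"])
    show "P 0 0 (setr rPA 0 s1)"
      using g1 x ready_cong[OF r1, of "setr rPA 0 s1"] by (simp add: P_def s1_def)
    fix a s3 assume a: "a < fst s1 rT" "P a 0 s3" "fst s3 rPA = a"
    have at: "a < t" using a r1 by (simp add: ready_def base_def)
    define Q where "Q b s4 \<longleftrightarrow> P a b s4 \<and> fst s4 rPA = a" for b s4
    have "Q (fst s3 rT) (den (For rPB rT edgeStep) s3)"
    proof (rule for_rule)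
      have "ready (setr rPB 0 s3)" by (rule ready_cong[of s3]) (use a in \<open>auto simp: P_def\<close>)
      then show "Q 0 (setr rPB 0 s3)" using a by (simp add: Q_def P_def)
      fix b s4 assume b: "b < fst s3 rT" "Q b s4" "fst s4 rPB = b"
      have bt: "b < t" using a b by (simp add: P_def ready_def base_def)
      have r4: "ready s4" using b by (simp add: Q_def P_def)
      have "ready (setr rPB (Suc b) (den edgeStep s4))" by (rule ready_cong[OF r4]) auto
      moreover have "good ?b (tab (den edgeStep s4) aFT) (set ?b) (bag_edges x a (Suc b))"
        by (rule edgeStep_correct[OF r4 _ x(2) _ at b(3) bt]) (use b in \<open>auto simp: Q_def P_def\<close>)
      ultimately show "Q (Suc b) (setr rPB (Suc b) (den edgeStep s4))" using b by (simp add: Q_def P_def)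
    qed simp
    moreover have "fst s3 rT = t" using a by (simp add: P_def ready_def base_def)
    ultimately have Pa: "P a t (den (For rPB rT edgeStep) s3)" by (simp add: Q_def)
    then have "ready (den (For rPB rT edgeStep) s3)" by (simp add: P_def)
    then have "ready (setr rPA (Suc a) (den (For rPB rT edgeStep) s3))" by (rule ready_cong) simp_all
    then show "P (Suc a) 0 (setr rPA (Suc a) (den (For rPB rT edgeStep) s3))"
      using Pa unfolding P_def bag_edges_next[OF x(2)] by simp
  qed simp
  have "fst s1 rT = t" using r1 by (simp add: ready_def base_def)
  then have P2: "P t 0 s2" using P1 by simp
  have b2: "base s2" "fst s2 rX = x" using P2 by (simp_all add: P_def ready_def)
  have eq: "den nodeBody s = den (STORET rX) s2" by (simp add: nodeBody_def s2_def s1_def)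
  have "good ?b (tab s2 aFT) (bagsUn Bg {x}) (bagsE E Bg {x})"
    using P2 bag_edges_all[OF x(2)] bag(2)[OF x(2)] by (simp add: P_def bagsUn_def)
  then show "good ?b (node (den nodeBody s) x) (bagsUn Bg {x}) (bagsE E Bg {x})"
    by (rule good_cong) (simp add: eq STORET_correct(1)[OF b2])
  show "node (den nodeBody s) y = node s y" if "y \<noteq> x"
    using P2 STORET_correct(2)[OF b2 _ that] by (simp add: eq P_def fun_eq_iff)
qed

lemma nodes_correct:
  assumes r: "ready s" and x: "x < N"
  shows "good (bs ! x) (node (den (For rX rN nodeBody) s) x) (bagsUn Bg {x}) (bagsE E Bg {x})"
proof -
  define P where "P k s2 \<longleftrightarrow> ready s2 \<and>
    (\<forall>x<k. good (bs ! x) (node s2 x) (bagsUn Bg {x}) (bagsE E Bg {x}))" for k s2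
  have N: "fst s rN = N" using r by (simp add: ready_def)
  have "P (fst s rN) (den (For rX rN nodeBody) s)"
  proof (rule for_rule)
    show "P 0 (setr rX 0 s)" using ready_cong[OF r, of "setr rX 0 s"] by (simp add: P_def)
    fix k s2 assume k: "k < fst s rN" "P k s2" "fst s2 rX = k"
    have r2: "ready s2" using k by (simp add: P_def)
    have "ready (setr rX (Suc k) (den nodeBody s2))" by (rule ready_cong[OF r2]) auto
    moreover have "good (bs ! x) (node (den nodeBody s2) x) (bagsUn Bg {x}) (bagsE E Bg {x})" if "x < Suc k" for x
    proof (cases "x = k")
      case True
      then show ?thesis using nodeBody_correct(1)[OF r2 k(3)] k N by simp
    next
      case False
      then have "node (den nodeBody s2) x = node s2 x" using nodeBody_correct(2)[OF r2 k(3)] k N by simp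
      then show ?thesis using k(2) that False by (simp add: P_def)
    qed
    ultimately show "P (Suc k) (setr rX (Suc k) (den nodeBody s2))" by (simp add: P_def)
  qed simp
  then show ?thesis using x N by (simp add: P_def)
qed

definition queue :: "store \<Rightarrow> nat list \<Rightarrow> bool" where
  "queue s qs \<longleftrightarrow> fst s rTail = length qs \<and> (\<forall>i<length qs. snd s aQU i = qs ! i)"

lemma push_correct:
  assumes q: "queue s qs" and x: "fst s rx = x" and le: "length qs + 1 \<le> B" and b: "base s"
  shows "queue (den (pushE rx) s) (if snd s aDEG x = 1 then qs @ [x] else qs)"
proof -
  have "fst s rB = B" using b by (simp add: base_def)
  then show ?thesis using q x le by (auto simp: queue_def pushE_def nth_append less_Suc_eq)
qed

lemma queue_cong: "queue s qs \<Longrightarrow> fst s' rTail = fst s rTail \<Longrightarrow> snd s' aQU = snd s aQU \<Longrightarrow> queue s' qs"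
  by (simp add: queue_def)

lemma queue_init:
  assumes r: "ready s" and q: "queue s []"
  obtains qs where "queue (den (For rX rN (pushE rX)) s) qs" "distinct qs" "set qs = {x. x < N \<and> snd s aDEG x = 1}"
proof -
  define P where "P k s2 \<longleftrightarrow> ready s2 \<and> snd s2 aDEG = snd s aDEG \<and>
    (\<exists>qs. queue s2 qs \<and> distinct qs \<and> set qs = {x. x < k \<and> snd s aDEG x = 1})" for k s2
  have N: "fst s rN = N" using r by (simp add: ready_def)
  have "P (fst s rN) (den (For rX rN (pushE rX)) s)"
  proof (rule for_rule)
    show "P 0 (setr rX 0 s)"
      using ready_cong[OF r, of "setr rX 0 s"] queue_cong[OF q, of "setr rX 0 s"] by (auto simp: P_def)
    fix k s2 assume k: "k < fst s rN" "P k s2" "fst s2 rX = k"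
    then obtain qs where qs: "queue s2 qs" "distinct qs" "set qs = {x. x < k \<and> snd s aDEG x = 1}"
      by (auto simp: P_def)
    have r2: "ready s2" and D: "snd s2 aDEG = snd s aDEG" using k by (simp_all add: P_def)
    have "length qs = card (set qs)" using qs(2) distinct_card by metis
    also have "\<dots> \<le> card {..<k}" by (rule card_mono) (use qs(3) in auto)
    finally have le: "length qs + 1 \<le> B" using k N NB by simp
    have b2: "base s2" using r2 by (simp add: ready_def)
    define qs' where "qs' = (if snd s2 aDEG k = 1 then qs @ [k] else qs)"
    have "queue (den (pushE rX) s2) qs'" unfolding qs'_def by (rule push_correct[OF qs(1) k(3) le b2])
    then have "queue (setr rX (Suc k) (den (pushE rX) s2)) qs'" by (rule queue_cong) auto
    moreover have "ready (setr rX (Suc k) (den (pushE rX) s2))" by (rule ready_cong[OF r2]) auto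
    moreover have "distinct qs'" "set qs' = {x. x < Suc k \<and> snd s aDEG x = 1}"
      using qs D by (auto simp: qs'_def less_Suc_eq)
    ultimately show "P (Suc k) (setr rX (Suc k) (den (pushE rX) s2))" using D by (auto simp: P_def)
  qed simp
  then show ?thesis using that N by (auto simp: P_def)
qed

text \<open>The first \<open>k\<close> entries of the queue are the removed nodes, the others are
  waiting. A waiting node may have degree 0 instead of 1: when two nodes are left both are waiting,
  and removing one isolates the other.\<close>

definition merging :: "nat \<Rightarrow> store \<Rightarrow> nat set \<Rightarrow> (nat \<Rightarrow> nat set) \<Rightarrow> nat list \<Rightarrow> bool" where
  "merging k s Al D qs \<longleftrightarrow> ready s \<and> stripped F N Al D \<and> queue s qs \<and> distinct qs \<and> set qs \<subseteq> {..<N} \<and>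
     k \<le> length qs \<and> set (take k qs) = {..<N} - Al \<and>
     {x \<in> Al. card (nb F Al x) = 1} \<subseteq> set (drop k qs) \<and> set (drop k qs) \<subseteq> {x \<in> Al. card (nb F Al x) \<le> 1} \<and>
     (\<forall>x\<in>Al. snd s aDEG x = card (nb F Al x) \<and> snd s aSM x = \<Sum>(nb F Al x) \<and>
        good (bs ! x) (node s x) (bagsUn Bg (D x)) (bagsE E Bg (D x))) \<and> fst s rRoot \<in> Al"

lemma merging_card: "merging k s Al D qs \<Longrightarrow> card Al = N - k"
proof -
  assume m: "merging k s Al D qs"
  then have *: "Al \<subseteq> {..<N}" using strippedD(1) by (fastforce simp: merging_def)
  have "card ({..<N} - Al) = k"
    using m distinct_card[of "take k qs"] unfolding merging_def by (auto simp: min_def)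
  moreover have "card ({..<N} - Al) = N - card Al" using * by (subst card_Diff_subset) (auto intro: finite_subset)
  moreover have "card Al \<le> N" using card_mono[OF _ *] by simp
  ultimately show ?thesis by linarith
qed

lemma merge_correct:
  assumes m: "merging k s Al D qs" and k: "Suc k < N" and x: "fst s rX = k"
  shows "\<exists>Al D qs. merging (Suc k) (den mergeBody s) Al D qs"
proof -
  have r: "ready s" and S: "stripped F N Al D" and q: "queue s qs" and dq: "distinct qs" "set qs \<subseteq> {..<N}"
    and kq: "k \<le> length qs" and tk: "set (take k qs) = {..<N} - Al"
    and leaves: "{x \<in> Al. card (nb F Al x) = 1} \<subseteq> set (drop k qs)" "set (drop k qs) \<subseteq> {x \<in> Al. card (nb F Al x) \<le> 1}"
    and DS: "\<And>x. x \<in> Al \<Longrightarrow> snd s aDEG x = card (nb F Al x)" "\<And>x. x \<in> Al \<Longrightarrow> snd s aSM x = \<Sum>(nb F Al x)"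
    and gd: "\<And>x. x \<in> Al \<Longrightarrow> good (bs ! x) (node s x) (bagsUn Bg (D x)) (bagsE E Bg (D x))"
    using m by (auto simp: merging_def)
  have c2: "2 \<le> card Al" using merging_card[OF m] k by simp
  have fin: "finite (nb F Al x)" for x
    using c2 nb_subset[of F Al x] card.infinite finite_subset by (metis not_numeral_le_zero)
  \<comment> \<open>Some leaf exists and all leaves are waiting, so the queue does not run
    empty.\<close>
  obtain w where "w \<in> Al" "card (nb F Al w) = 1" using stripped_leaf[OF tree S c2] by blast
  then have "w \<in> set (drop k qs)" using leaves(1) by blast
  then have kl: "k < length qs" by (cases "k < length qs") auto
  define v where "v = qs ! k"
  have dr: "drop k qs = v # drop (Suc k) qs" using kl by (simp add: v_def Cons_nth_drop_Suc)
  then have vA: "v \<in> Al" "card (nb F Al v) \<le> 1" using leaves(2) by auto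
  have "nb F Al v \<noteq> {}" by (rule stripped_nb[OF S vA(1) c2])
  then have "card (nb F Al v) = 1" using vA(2) fin[of v] by (metis card_gt_0_iff le_antisym Suc_leI One_nat_def)
  then obtain u where u: "nb F Al v = {u}" by (auto simp: card_1_singleton_iff)
  have uA: "u \<in> Al" using u nb_subset by blast
  have uv: "u \<noteq> v" using u nb_irrefl[OF F_graph, of v Al] by auto
  have lt: "u < N" "v < N" using strippedD(1)[OF S] uA vA by auto
  have vu: "v \<in> nb F Al u" using nb_sym[of u F Al v] u vA by simp
  define s1 where "s1 = setr rHi u (setr rLo v s)"
  have "ev (Ar aQU (Vr rX)) s = v" using q kl x by (simp add: queue_def v_def)
  moreover have "ev (Ar aSM (Vr rLo)) (setr rLo v s) = u" using DS(2)[OF vA(1)] u by simp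
  ultimately have e1: "den mergeBody s = den (Sq (LOADT rHi)
    (Sq PROJECT (Sq JOIN (Sq (STORET rHi) (Sq (Sto aDEG (Vr rHi) (Bop Sub (Ar aDEG (Vr rHi)) (Kn 1)))
    (Sq (Sto aSM (Vr rHi) (Bop Sub (Ar aSM (Vr rHi)) (Vr rLo))) (Sq (pushE rHi) (Asg rRoot (Vr rHi))))))))) s1"
    by (simp add: mergeBody_def s1_def)
  have r1: "ready s1" by (rule ready_cong[OF r]) (simp_all add: s1_def)
  define s2 where "s2 = den (LOADT rHi) s1"
  have r2: "ready s2" by (rule ready_cong[OF r1]) (simp_all add: s2_def)
  have f2: "tab s2 aFT U i = node s u U i" if "U < CU" "i < Z" for U i
    unfolding s2_def using LOADT_correct[of s1 rHi u U i] r1 that by (simp add: ready_def s1_def)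
  define s3 where "s3 = den PROJECT s2"
  have r3: "ready s3" by (rule ready_cong[OF r2]) (simp_all add: s3_def)
  have g3: "projected (bs ! v) (bs ! u) (node s v) (tab s3 aGT)"
  proof -
    have "projected (bs ! v) (bs ! u) (node s2 v) (tab s3 aGT)"
      unfolding s3_def
    proof (rule PROJECT_correct[OF _ _ _ lt(1) _ lt(2)])
      fix U i assume A: "U < CU" "i < Z"
      have "node s v U i \<le> n + 1" by (rule good_le[OF gd[OF vA(1)] A])
      then show "node s2 v U i \<le> B" using B_ge(4) by (simp add: s2_def s1_def)
    qed (use r2 bag_facts lt in \<open>auto simp: ready_def s2_def s1_def\<close>)
    then show ?thesis by (simp add: s2_def s1_def)
  qed
  have f3: "tab s3 aFT = tab s2 aFT" by (simp add: s3_def)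
  have gu: "good (bs ! u) (tab s2 aFT) (bagsUn Bg (D u)) (bagsE E Bg (D u))"
    by (rule good_cong[OF gd[OF uA]]) (rule f2)
  define s4 where "s4 = den JOIN s3"
  have r4: "ready s4" by (rule ready_cong[OF r3]) (simp_all add: s4_def)
  have j: "joined (tab s2 aFT) (tab s3 aGT) (tab s4 aFT)"
    unfolding s4_def f3[symmetric]
  proof (rule JOIN_correct)
    show "base s3" using r3 by (simp add: ready_def)
    fix U1 U2 i1 i2 assume A: "U1 < CU" "U2 < CU" "i1 < Z" "i2 < Z"
    have "tab s3 aFT U1 i1 \<le> n + 1" using good_le[OF gu A(1,3)] by (simp add: s3_def)
    moreover have "tab s3 aGT U2 i2 \<le> n + 1"
    proof (cases "tab s3 aGT U2 i2 = 0")
      case False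
      then have "\<exists>i'<Z. tab s3 aGT U2 i2 = node s v U2 i'" using g3 A(2,4) unfolding projected_def by blast
      then show ?thesis using good_le[OF gd[OF vA(1)] A(2)] by fastforce
    qed simp
    ultimately show "tab s3 aFT U1 i1 + tab s3 aGT U2 i2 \<le> B" using B_ge(4) by linarith
  qed
  have gm: "good (bs ! u) (tab s4 aFT) (bagsUn Bg (D u \<union> D v)) (bagsE E Bg (D u \<union> D v))"
    by (rule good_merge[OF td S F_graph vA(1) u _ _ _ _ gd[OF vA(1)] gu g3 j]) (use bag bag_le lt in auto)
  have regs4: "fst s4 rHi = u" "fst s4 rLo = v" "snd s4 aTB = snd s aTB" "snd s4 aDEG = snd s aDEG"
    "snd s4 aSM = snd s aSM" "fst s4 rTail = fst s rTail" "snd s4 aQU = snd s aQU"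
    by (simp_all add: s4_def s3_def s2_def s1_def)
  have b4: "base s4" using r4 by (simp add: ready_def)
  define s5 where "s5 = den (STORET rHi) s4"
  have T5: "node s5 u U i = tab s4 aFT U i" if "U < CU" "i < Z" for U i
    unfolding s5_def using STORET_correct(1)[OF b4 regs4(1) _ that] by simp
  have T5': "node s5 y = node s y" if "y \<noteq> u" for y
    unfolding s5_def using STORET_correct(2)[OF b4 regs4(1) _ that] regs4(3) by (simp add: fun_eq_iff)
  define s6 where "s6 = seta aSM u (snd s aSM u - v) (seta aDEG u (snd s aDEG u - 1) s5)"
  have regs5: "fst s5 rHi = u" "fst s5 rLo = v" "snd s5 aDEG = snd s aDEG" "snd s5 aSM = snd s aSM"
    "fst s5 rTail = fst s rTail" "snd s5 aQU = snd s aQU"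
    using regs4 by (simp_all add: s5_def)
  have e2: "den mergeBody s = setr rRoot u (den (pushE rHi) s6)"
    unfolding e1 using regs5 by (simp add: s6_def s5_def s4_def s3_def s2_def)
  have r6: "ready s6" by (rule ready_cong[OF r4]) (simp_all add: s6_def s5_def)
  have q6: "queue s6 qs" by (rule queue_cong[OF q]) (simp_all add: s6_def regs5)
  have "length qs = card (set qs)" using dq(1) distinct_card by metis
  also have "\<dots> \<le> card {..<N}" by (rule card_mono) (use dq(2) in auto)
  finally have lq: "length qs + 1 \<le> B" using NB(2) by simp
  define qs' where "qs' = (if snd s6 aDEG u = 1 then qs @ [u] else qs)"
  have q7: "queue (den (pushE rHi) s6) qs'"
    unfolding qs'_def by (rule push_correct[OF q6 _ lq]) (use r6 regs5 in \<open>auto simp: ready_def s6_def\<close>)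
  let ?Al = "Al - {v}" and ?D = "D(u := D u \<union> D v)"
  have nbu: "card (nb F ?Al u) = card (nb F Al u) - 1" "\<Sum>(nb F ?Al u) = \<Sum>(nb F Al u) - v"
    unfolding nb_remove using fin[of u] vu by (simp_all add: sum_diff1_nat)
  have nbx: "nb F ?Al x = nb F Al x" if x: "x \<in> Al" "x \<noteq> u" for x
  proof -
    have "v \<notin> nb F Al x" using nb_sym[of v F Al x] x u by auto
    then show ?thesis unfolding nb_remove by blast
  qed
  have deg6: "snd s6 aDEG u = card (nb F ?Al u)" using DS(1)[OF uA] nbu by (simp add: s6_def)
  have vq: "v \<notin> set (take k qs)" "v \<notin> set (drop (Suc k) qs)"
  proof -
    show "v \<notin> set (take k qs)" using vA(1) unfolding tk by blast
    have "distinct (drop k qs)" using dq(1) by (rule distinct_drop)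
    then show "v \<notin> set (drop (Suc k) qs)" unfolding dr by simp
  qed
  \<comment> \<open>Degree 1 after the removal means degree 2 before, while nodes in the queue are
    either removed or had degree at most 1; so \<open>u\<close> is not inserted twice.\<close>
  have uq: "u \<notin> set qs" if one: "card (nb F ?Al u) = 1"
  proof
    assume "u \<in> set qs"
    then have "u \<in> set (take k qs) \<or> u \<in> set (drop k qs)" by (metis Un_iff append_take_drop_id set_append)
    then have "card (nb F Al u) \<le> 1" using tk uA leaves(2) by auto
    then show False using one nbu(1) by simp
  qed
  have "merging (Suc k) (setr rRoot u (den (pushE rHi) s6)) ?Al ?D qs'"
    unfolding merging_def
  proof (intro conjI)
    show "ready (setr rRoot u (den (pushE rHi) s6))" by (rule ready_cong[OF r6]) auto
    show "stripped F N ?Al ?D" by (rule stripped_step[OF S F_graph vA(1) u])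
    show "queue (setr rRoot u (den (pushE rHi) s6)) qs'" by (rule queue_cong[OF q7]) auto
    show "distinct qs'" using dq(1) uq deg6 by (auto simp: qs'_def)
    show "set qs' \<subseteq> {..<N}" using dq(2) lt by (auto simp: qs'_def)
    show "Suc k \<le> length qs'" using kl by (auto simp: qs'_def)
    have "take (Suc k) qs' = take k qs @ [v]" using kl by (auto simp: qs'_def take_Suc_conv_app_nth v_def nth_append)
    then show "set (take (Suc k) qs') = {..<N} - ?Al" using tk lt vA by auto
    have dr': "set (drop (Suc k) qs') = set (drop (Suc k) qs) \<union> (if card (nb F ?Al u) = 1 then {u} else {})"
      using kl deg6 by (auto simp: qs'_def)
    show "{x \<in> ?Al. card (nb F ?Al x) = 1} \<subseteq> set (drop (Suc k) qs')"
    proof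
      fix y assume y: "y \<in> {x \<in> ?Al. card (nb F ?Al x) = 1}"
      show "y \<in> set (drop (Suc k) qs')"
      proof (cases "y = u")
        case True
        then show ?thesis using y dr' by simp
      next
        case False
        then have "y \<in> set (drop k qs)" using leaves(1) y nbx by auto
        then show ?thesis using dr dr' y by auto
      qed
    qed
    show "set (drop (Suc k) qs') \<subseteq> {x \<in> ?Al. card (nb F ?Al x) \<le> 1}"
    proof
      fix y assume "y \<in> set (drop (Suc k) qs')"
      then consider "y \<in> set (drop (Suc k) qs)" | "y = u" "card (nb F ?Al u) = 1" using dr' by (auto split: if_splits)
      then show "y \<in> {x \<in> ?Al. card (nb F ?Al x) \<le> 1}"
      proof cases
        case 1
        then have "y \<in> Al" "card (nb F Al y) \<le> 1" "y \<noteq> v" using leaves(2) dr vq by auto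
        then show ?thesis using nbu(1) nbx[of y] by (cases "y = u") auto
      next
        case 2
        then show ?thesis using uA uv by simp
      qed
    qed
    show "\<forall>x\<in>?Al. snd (setr rRoot u (den (pushE rHi) s6)) aDEG x = card (nb F ?Al x) \<and>
      snd (setr rRoot u (den (pushE rHi) s6)) aSM x = \<Sum>(nb F ?Al x) \<and>
      good (bs ! x) (node (setr rRoot u (den (pushE rHi) s6)) x) (bagsUn Bg (?D x)) (bagsE E Bg (?D x))"
    proof
      fix y assume y: "y \<in> ?Al"
      have nd: "node (setr rRoot u (den (pushE rHi) s6)) y = node s5 y" by (simp add: s6_def)
      show "snd (setr rRoot u (den (pushE rHi) s6)) aDEG y = card (nb F ?Al y) \<and>
        snd (setr rRoot u (den (pushE rHi) s6)) aSM y = \<Sum>(nb F ?Al y) \<and>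
        good (bs ! y) (node (setr rRoot u (den (pushE rHi) s6)) y) (bagsUn Bg (?D y)) (bagsE E Bg (?D y))"
      proof (cases "y = u")
        case True
        have "good (bs ! u) (node s5 u) (bagsUn Bg (D u \<union> D v)) (bagsE E Bg (D u \<union> D v))"
          by (rule good_cong[OF gm]) (rule T5)
        then show ?thesis unfolding nd using True nbu DS[OF uA] by (simp add: s6_def regs5)
      next
        case False
        then show ?thesis unfolding nd T5'[OF False] using y nbx[of y] DS[of y] gd[of y] by (simp add: s6_def regs5)
      qed
    qed
    show "fst (setr rRoot u (den (pushE rHi) s6)) rRoot \<in> ?Al" using uA uv by simp
  qed
  then show ?thesis unfolding e2 by blast
qed

lemma merges_correct:
  assumes m: "merging 0 s Al0 D0 qs0"
  obtains D qs Al where "merging (N - 1) (den (For rX rN mergeStep) s) Al D qs"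
proof -
  \<comment> \<open>The minimum accounts for the last round, which merges nothing.\<close>
  define P where "P k s2 \<longleftrightarrow> (\<exists>Al D qs. merging (min k (N - 1)) s2 Al D qs)" for k s2
  have setr: "merging k (setr rX v s2) Al D qs" if "merging k s2 Al D qs" for k v s2 Al D qs
  proof -
    have "ready (setr rX v s2)" by (rule ready_cong[of s2]) (use that in \<open>auto simp: merging_def\<close>)
    moreover have "queue (setr rX v s2) qs" by (rule queue_cong[of s2]) (use that in \<open>auto simp: merging_def\<close>)
    ultimately show ?thesis using that by (simp add: merging_def)
  qed
  have nop: "merging k (setr 39 0 s2) Al D qs" if "merging k s2 Al D qs" for k s2 Al D qs
  proof -
    have "ready (setr 39 0 s2)" by (rule ready_cong[of s2]) (use that in \<open>auto simp: merging_def\<close>)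
    moreover have "queue (setr 39 0 s2) qs" by (rule queue_cong[of s2]) (use that in \<open>auto simp: merging_def\<close>)
    ultimately show ?thesis using that by (simp add: merging_def)
  qed
  have N: "fst s rN = N" using m by (simp add: merging_def ready_def)
  have "P (fst s rN) (den (For rX rN mergeStep) s)"
  proof (rule for_rule)
    show "P 0 (setr rX 0 s)" using setr[OF m] by (auto simp: P_def)
    fix k s2 assume k: "k < fst s rN" "P k s2" "fst s2 rX = k"
    then obtain Al D qs where m2: "merging k s2 Al D qs" using N by (auto simp: P_def min_def split: if_splits)
    have N2: "fst s2 rN = N" using m2 by (simp add: merging_def ready_def)
    show "P (Suc k) (setr rX (Suc k) (den mergeStep s2))"
    proof (cases "Suc k < N")
      case True
      then have "den mergeStep s2 = den mergeBody s2" using k N2 by (simp add: mergeStep_def)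
      moreover obtain Al' D' qs' where "merging (Suc k) (den mergeBody s2) Al' D' qs'"
        using merge_correct[OF m2 True k(3)] by blast
      moreover have "min (Suc k) (N - 1) = Suc k" using True by simp
      ultimately show ?thesis unfolding P_def using setr by metis
    next
      case False
      then have "den mergeStep s2 = setr 39 0 s2" using k N2 by (simp add: mergeStep_def)
      moreover have "min (Suc k) (N - 1) = k" using False k N by simp
      ultimately show ?thesis unfolding P_def using setr[OF nop[OF m2]] by auto
    qed
  qed simp
  then have "P N (den (For rX rN mergeStep) s)" using N by simp
  then show ?thesis using that by (auto simp: P_def)
qed

lemma final_correct:
  assumes r: "ready s" and root: "fst s rRoot = x" and g: "good (bs ! x) (node s x) {..<n} E" and z: "fst s 0 = 0"
  shows "fst (den (For rI rZ finalBody) s) 0 = of_bool (has_disconnected_matching c E l)"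
proof -
  let ?ok = "\<lambda>i. (\<forall>j<t. even (dig q j i)) \<and> l < node s x (set_encode {1..c}) i"
  define P where "P k s2 \<longleftrightarrow> ready s2 \<and> snd s2 = snd s \<and> fst s2 rRoot = x \<and> fst s2 0 = of_bool (\<exists>i<k. ?ok i)" for k s2
  have zr: "fst s rZ = Z" using r by (simp add: ready_def base_def)
  have B1: "1 \<le> B" using B_ge by linarith
  have "P (fst s rZ) (den (For rI rZ finalBody) s)"
  proof (rule for_rule)
    show "P 0 (setr rI 0 s)" using ready_cong[OF r, of "setr rI 0 s"] root z by (simp add: P_def)
    fix k s2 assume k: "k < fst s rZ" "P k s2" "fst s2 rI = k"
    have r2: "ready s2" and s2: "snd s2 = snd s" "fst s2 rRoot = x" "fst s2 0 = of_bool (\<exists>i<k. ?ok i)"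
      using k by (simp_all add: P_def)
    have b2: "base s2" using r2 by (simp add: ready_def)
    define s3 where "s3 = den (allOk (Bop Mod dE (Kn 2))) s2"
    have ok3: "fst s3 rOk = of_bool (\<forall>j<t. \<not> odd (dig q j k))"
      unfolding s3_def
    proof (rule allOk_correct[OF b2])
      fix j s4 assume A: "j < t" "fst s4 rJ = j" "snd s4 = snd s2" "\<And>r. r \<noteq> rJ \<Longrightarrow> r \<noteq> rOk \<Longrightarrow> fst s4 r = fst s2 r"
      have b4: "base s4" by (rule base_cong[OF b2]) (use A in auto)
      have "ev dE s4 = dig q j k" using digit_eval[OF b4 A(2,1)] A(4) k(3) by simp
      then show "ev (Bop Mod dE (Kn 2)) s4 = 0 \<longleftrightarrow> \<not> odd (dig q j k)" by (simp add: even_iff_mod_2_eq_zero)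
    qed
    have r3: "ready s3" by (rule ready_cong[OF r2]) (simp_all add: s3_def)
    have s3: "snd s3 = snd s" "fst s3 rRoot = x" "fst s3 0 = of_bool (\<exists>i<k. ?ok i)" "fst s3 rI = k" "fst s3 rL = l" "fst s3 rB = B"
      using s2 k r3 by (simp_all add: s3_def fun_eq_iff ready_def base_def)
    have "ev (maxE (Vr 0) (Bop Mul (Vr rOk) (ltE (Vr rL) fullE))) s3 = of_bool (\<exists>i<Suc k. ?ok i)"
      using s3 ok3 B1 by (auto simp: fullE_def less_Suc_eq)
    then have "den finalBody s2 = setr 0 (of_bool (\<exists>i<Suc k. ?ok i)) s3"
      by (simp add: finalBody_def s3_def)
    moreover have "ready (setr rI (Suc k) (setr 0 (of_bool (\<exists>i<Suc k. ?ok i)) s3))"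
      by (rule ready_cong[OF r3]) auto
    ultimately show "P (Suc k) (setr rI (Suc k) (den finalBody s2))" using s3 by (simp add: P_def)
  qed simp
  then have "fst (den (For rI rZ finalBody) s) 0 = of_bool (\<exists>i<Z. ?ok i)" by (simp add: P_def zr)
  then show ?thesis using good_root[OF g, of l] by simp
qed

lemma mainProg_correct:
  assumes c: "cst s" and LB: "length xs \<le> B" and z: "\<And>a x. a \<noteq> aINP \<Longrightarrow> snd s a x = 0"
  shows "fst (den mainProg s) 0 = of_bool (has_disconnected_matching c E l)"
proof -
  define s1 where "s1 = den initPW s"
  have c1: "cst s1" unfolding s1_def by (rule cst_den[OF c]) auto
  have pw: "snd s1 aPW j = q ^ j" if "j < t" for j unfolding s1_def by (rule initPW_correct[OF c that])
  define s2 where "s2 = den initRK s1"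
  have c2: "cst s2" unfolding s2_def by (rule cst_den[OF c1]) auto
  have rk: "snd s2 aRK i = rk q t i" if "i < Z" for i unfolding s2_def by (rule initRK_correct[OF c1 pw that])
  define s3 where "s3 = den initORT s2"
  have c3: "cst s3" unfolding s3_def by (rule cst_den[OF c2]) auto
  define s4 where "s4 = den initSG s3"
  have c4: "cst s4" unfolding s4_def by (rule cst_den[OF c3]) auto
  define s5 where "s5 = den initPT s4"
  have c5: "cst s5" unfolding s5_def by (rule cst_den[OF c4]) auto
  have bo: "bags_ok s5 (\<lambda>x. bs ! x) N" unfolding s5_def by (rule initPT_correct[OF c4 LB])
  define s6 where "s6 = den initADJ s5"
  have c6: "cst s6" unfolding s6_def by (rule cst_den[OF c5]) auto
  have adj: "snd s6 aADJ (pr u v) = of_bool ({u, v} \<in> E)" for u v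
    unfolding s6_def by (rule initADJ_correct[OF c5]) (simp add: z s5_def s4_def s3_def s2_def s1_def)
  define s7 where "s7 = den initDEG s6"
  have c7: "cst s7" unfolding s7_def by (rule cst_den[OF c6]) auto
  have deg: "snd s7 aDEG a = card (nb F {..<N} a)" "snd s7 aSM a = \<Sum>(nb F {..<N} a)" if "a < N" for a
    unfolding s7_def by (rule initDEG_correct[OF c6 _ _ that]; simp add: z s6_def s5_def s4_def s3_def s2_def s1_def)+
  have "base s7"
    using c7 pw rk initORT_correct[of _ _ s2] initSG_correct[of _ s3]
    by (simp add: base_def cst_def s7_def s6_def s5_def s4_def s3_def s2_def)
  moreover have "bags_ok s7 (\<lambda>x. bs ! x) N" by (rule bags_ok_cong[OF bo]) (simp_all add: s7_def s6_def)
  ultimately have r7: "ready s7" using c7 adj by (simp add: ready_def cst_def s7_def)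
  define s8 where "s8 = setr rTail 0 (den (For rX rN nodeBody) s7)"
  have r8: "ready s8" by (rule ready_cong[OF r7]) (simp_all add: s8_def)
  have g8: "good (bs ! x) (node s8 x) (bagsUn Bg {x}) (bagsE E Bg {x})" if "x < N" for x
    using nodes_correct[OF r7 that] by (simp add: s8_def)
  have q8: "queue s8 []" by (simp add: queue_def s8_def)
  obtain qs where qs: "queue (den (For rX rN (pushE rX)) s8) qs" "distinct qs"
    "set qs = {x. x < N \<and> snd s8 aDEG x = 1}" using queue_init[OF r8 q8] by blast
  have deg8: "snd s8 aDEG a = card (nb F {..<N} a)" "snd s8 aSM a = \<Sum>(nb F {..<N} a)" if "a < N" for a
    using deg[OF that] by (simp_all add: s8_def)
  define s9 where "s9 = setr rRoot 0 (den (For rX rN (pushE rX)) s8)"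
  have r9: "ready s9" by (rule ready_cong[OF r8]) (simp_all add: s9_def)
  have q9: "queue s9 qs" by (rule queue_cong[OF qs(1)]) (simp_all add: s9_def)
  have "merging 0 s9 {..<N} (\<lambda>x. {x}) qs"
    unfolding merging_def
    using r9 stripped_init[OF tree] q9 qs(2,3) deg8 g8 N_pos by (auto simp: s9_def)
  then obtain Al D qs' where m: "merging (N - 1) (den (For rX rN mergeStep) s9) Al D qs'"
    by (rule merges_correct)
  define s10 where "s10 = den (For rX rN mergeStep) s9"
  define s11 where "s11 = setr 0 0 s10"
  have m10: "merging (N - 1) s10 Al D qs'" using m by (simp add: s10_def)
  \<comment> \<open>The single surviving node has absorbed all nodes, so its part is the whole
    graph.\<close>
  have "card Al = 1" using merging_card[OF m10] N_pos by simp
  then obtain x where x: "Al = {x}" by (auto simp: card_1_singleton_iff)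
  have S: "stripped F N Al D" and root: "fst s10 rRoot = x" and r10: "ready s10"
    and g: "good (bs ! x) (node s10 x) (bagsUn Bg (D x)) (bagsE E Bg (D x))"
    using m10 x by (auto simp: merging_def)
  have "D x = {..<N}" using strippedD(4,5)[OF S] x by blast
  moreover have "bagsUn Bg {..<N} = {..<n}" using td unfolding tree_decomposition_def bagsUn_def by blast
  moreover have "bagsE E Bg {..<N} = E" using td unfolding tree_decomposition_def bagsE_def by blast
  ultimately have g': "good (bs ! x) (node s11 x) {..<n} E" using g by (simp add: s11_def)
  have r11: "ready s11" by (rule ready_cong[OF r10]) (simp_all add: s11_def)
  have "fst (den (For rI rZ finalBody) s11) 0 = of_bool (has_disconnected_matching c E l)"
    by (rule final_correct[OF r11 _ g']) (use root in \<open>simp_all add: s11_def\<close>)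
  moreover have "den mainProg s = den (For rI rZ finalBody) s11"
    by (simp add: mainProg_def s11_def s10_def s9_def s8_def s7_def s6_def s5_def s4_def s3_def s2_def s1_def)
  ultimately show ?thesis by simp
qed

end

section \<open>Reading the input\<close>

text \<open>\<open>bounded_store\<close> without its clause on \<open>rB\<close>, for the phase in
  which the bound is still being computed.\<close>

definition bnd :: "nat \<Rightarrow> store \<Rightarrow> bool" where
  "bnd B s \<longleftrightarrow> (\<forall>r. fst s r \<le> B) \<and> (\<forall>a i. snd s a i \<le> B)"

lemma bnd_setr: "bnd B s \<Longrightarrow> v \<le> B \<Longrightarrow> bnd B (setr r v s)"
  and bnd_seta: "bnd B s \<Longrightarrow> v \<le> B \<Longrightarrow> bnd B (seta a i v s)"
  by (auto simp: bnd_def)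

lemma bnd_D: "bnd B s \<Longrightarrow> fst s r \<le> B" "bnd B s \<Longrightarrow> snd s a i \<le> B"
  by (auto simp: bnd_def)

text \<open>The absence of overflow in an expression does not depend on register \<open>rB\<close>.\<close>

lemma okE_bnd:
  assumes "bnd B s" "(B + 2) ^ n \<le> W" "esz NA e \<le> n"
  shows "okE NA W e s \<and> ev e s \<le> W"
proof -
  have W: "(B + 2) ^ esz NA e \<le> W" using power_le_imp_le_power assms(2,3) .
  have "okE NA W e s \<and> ev e s \<le> (B + 2) ^ esz NA e"
    using W
  proof (induction e)
    case (Vr r)
    have "fst s r \<le> (B + 2) ^ 1" using bnd_D(1)[OF assms(1), of r] by simp
    then show ?case using Vr by (simp add: le_trans)
  next
    case (Kn k)
    have "k \<le> 2 ^ k" by (simp add: less_imp_le_nat)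
    also have "\<dots> \<le> (B + 2) ^ k" by (rule power_mono) auto
    also have "\<dots> \<le> (B + 2) ^ (k + 1)" by (rule power_increasing) auto
    finally show ?case using Kn by simp
  next
    case (Ar a e)
    from Ar.prems have W: "(B + 2) ^ (esz NA e + NA + a + 3) \<le> W" by simp
    have IH: "okE NA W e s" "ev e s \<le> (B + 2) ^ esz NA e"
      using Ar.IH power_le_imp_le_power[OF W, of "esz NA e"] by simp_all
    have "ev e s * NA + a + fst s rOFF \<le> (B + 2) ^ (esz NA e + NA + a + 3)"
      using address_le_power[of "B + 2" "ev e s" "esz NA e" "fst s rOFF" NA a]
        IH(2) bnd_D(1)[OF assms(1), of rOFF] esz_pos by simp
    moreover have "snd s a (ev e s) \<le> (B + 2) ^ 1" using bnd_D(2)[OF assms(1), of a "ev e s"] by simp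
    moreover have "(B + 2) ^ 1 \<le> (B + 2) ^ (esz NA e + NA + a + 3)" by (rule power_increasing) auto
    moreover have "NA \<le> W" "a \<le> W" by (rule nat_le_word[OF W], simp)+
    ultimately show ?case using W IH by simp
  next
    case (Bop f e1 e2)
    have 1: "okE NA W e1 s" "ev e1 s \<le> (B + 2) ^ esz NA e1"
      using Bop.IH(1) power_le_imp_le_power[OF Bop.prems, of "esz NA e1"] by simp_all
    have 2: "okE NA W e2 s" "ev e2 s \<le> (B + 2) ^ esz NA e2"
      using Bop.IH(2) power_le_imp_le_power[OF Bop.prems, of "esz NA e2"] by simp_all
    have "apply_binop f (ev e1 s) (ev e2 s) \<le> (B + 2) ^ (esz NA e1 + esz NA e2)"
      by (rule apply_binop_le_power) (use 1 2 esz_pos in auto)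
    then show ?case using 1 2 Bop.prems by simp
  qed
  then show ?thesis using W by auto
qed

lemma ok_Asg: "bnd B s \<Longrightarrow> (B + 2) ^ n \<le> W \<Longrightarrow> esz NA e \<le> n \<Longrightarrow> ok NA W (Asg r e) s"
  using okE_bnd by auto

lemma ok_Sto:
  assumes "bnd B s" "(B + 2) ^ n \<le> W" "esz NA e1 + NA + a + 3 \<le> n" "esz NA e2 \<le> n"
  shows "ok NA W (Sto a e1 e2) s"
proof -
  have W: "(B + 2) ^ (esz NA e1 + NA + a + 3) \<le> W" using power_le_imp_le_power[OF assms(2,3)] .
  have "okE NA W (Ar a e1) s" using okE_bnd[OF assms(1,2), of NA "Ar a e1"] assms(3) by simp
  then show ?thesis using okE_bnd[OF assms(1,2,4)] by simp
qed

text \<open>While the input is read nothing is clamped, so freedom from overflow depends on the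
  actual values and is proved together with the invariant.\<close>

lemma for_rule_ok:
  assumes "i \<notin> wr c" and "P 0 (setr i 0 s)" and "1 \<le> W" and "fst s r \<le> W"
    and "\<And>k s'. k < fst s r \<Longrightarrow> P k s' \<Longrightarrow> fst s' i = k \<Longrightarrow>
      ok NA W c s' \<and> P (Suc k) (setr i (Suc k) (den c s'))"
  shows "P (fst s r) (den (For i r c) s) \<and> ok NA W (For i r c) s"
proof -
  have P: "k \<le> fst s r \<Longrightarrow> P k (loop i c k s)" for k
  proof (induction k)
    case (Suc k)
    then show ?case using assms(5)[of k "loop i c k s"] fst_loop[OF assms(1)] assms(1)
      by (simp add: loop_Suc)
  qed (use assms(2) in simp)
  moreover have "ok NA W c (loop i c k s)" if "k < fst s r" for k
    using assms(5)[OF that P fst_loop[OF assms(1)]] that by simp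
  ultimately show ?thesis using assms(3,4) by (simp add: den_For)
qed

primrec maxlen :: "nat list list \<Rightarrow> nat \<Rightarrow> nat" where
  "maxlen bs 0 = 0"
| "maxlen bs (Suc k) = max (maxlen bs k) (length (bs ! k))"

lemma maxlen_ge: "x < k \<Longrightarrow> length (bs ! x) \<le> maxlen bs k"
  by (induction k) (auto simp: less_Suc_eq le_max_iff_disj)

lemma maxlen_attained: "0 < maxlen bs k \<Longrightarrow> \<exists>x<k. length (bs ! x) = maxlen bs k"
  by (induction k) (auto simp: max_def less_Suc_eq split: if_splits)

section \<open>Programs that read the input and lay out the memory\<close>

context graph_dp
begin

definition "readHead = Sq (Asg rM (Ar 0 (Kn 2))) (Sq (Asg rL (Ar 0 (Kn 1))) (Sq (Asg rN (Ar 0 (mE 3)))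
  (Sq (Asg rMF (Ar 0 (mE 4))) (Sq (Asg rP0 (Bop Add (mE 5) (Bop Add (Vr rMF) (Vr rMF)))) (Asg rP (Vr rP0))))))"
definition "readBags = For rX rN (Sq (Asg rE (Ar 0 (Vr rP))) (Sq
  (Asg rP (Bop Add (Bop Add (Vr rP) (Vr rE)) (Kn 1))) (Asg rT (Bop Add (Vr rT) (Bop Sub (Vr rE) (Vr rT))))))"
definition "setOne = Asg rZ (Kn 1)"
definition "computeZ = For rX rT (Asg rZ (Bop Mul (Vr rZ) (Kn q)))"
text \<open>The square of this sum becomes \<open>B\<close>. The sum exceeds all input numbers and
  sizes, and squaring pays for the counts of pairs in the convolution and for sums of node
  numbers.\<close>

definition "sumE = Bop Add (Bop Add (Bop Add (Vr rP) (Vr rL)) (Bop Add (Vr rZ) (Vr rNT))) (Vr rCU)"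
definition "setParams = Sq (Asg rT1 (Bop Add (Vr rT) (Kn 1))) (Sq (Asg rCU (Kn CU))
  (Sq (Asg rNT (Bop Mul (Bop Mul (Vr rCU) (Vr rCU)) (Bop Mul (Bop Mul (Vr rT1) (Vr rT1)) (Bop Mul (Vr rT1) (Vr rT1)))))
  (Asg rB (Bop Mul sumE sumE))))"
text \<open>The main program uses 22 interleaved arrays, so the input is copied with stride 22 to
  cells behind itself. The cells in between are still zero, and the source is never overwritten
  because the targets start at the input length.\<close>

definition "copyInput = For rX rP (Sto 0 (Bop Add (Vr rP) (Bop Mul (Vr rX) (Kn 22))) (Ar 0 (Vr rX)))"

text \<open>With one array and offset 0, array 0 is the raw memory, which is how the first phase
  sees the input. Passing to 22 arrays and offset \<open>rP\<close> reinterprets the same memory;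
  checked source programs may not write \<open>rOFF\<close>, so two machine instructions do
  this.\<close>

definition "wholeProg = Seq (comp 1 readHead) (Seq (comp 1 readBags) (Seq (comp 1 setOne)
  (Seq (comp 1 computeZ) (Seq (comp 1 setParams) (Seq (comp 1 copyInput)
  (Seq (Const numVars 0) (Seq (Op Add rOFF rP numVars) (comp 22 mainProg))))))))"

lemma wr_read [simp]:
  "wr readHead = {rM, rL, rN, rMF, rP0, rP}" "wr readBags = {rX, rE, rP, rT}" "wr setOne = {rZ}"
  "wr computeZ = {rX, rZ}" "wr setParams = {rT1, rCU, rNT, rB}" "wr copyInput = {rX}"
  "wa readHead = {}" "wa readBags = {}" "wa setOne = {}" "wa computeZ = {}" "wa setParams = {}" "wa copyInput = {0}"
  by (auto simp: readHead_def readBags_def setOne_def computeZ_def setParams_def copyInput_def)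

lemma lb_read [simp]:
  "lb readHead = {}" "lb readBags = {rN}" "lb setOne = {}" "lb computeZ = {rT}" "lb setParams = {}" "lb copyInput = {rP}"
  by (auto simp: readHead_def readBags_def setOne_def computeZ_def setParams_def copyInput_def)

lemma chk_read [simp]:
  "chk 1 readHead" "chk 1 readBags" "chk 1 setOne" "chk 1 computeZ" "chk 1 setParams" "chk 1 copyInput"
  by (auto simp: readHead_def readBags_def setOne_def computeZ_def setParams_def copyInput_def mE_def sumE_def)

end

context inst
begin

definition "ssum = length xs + l + Z + CU * CU * (t + 1) ^ 4 + CU"

definition "store0 = ((\<lambda>_. 0, \<lambda>a i. if a = 0 \<and> i < length xs then xs ! i else 0) :: store)"

text \<open>The exponent \<open>CU + 2 * c + 80\<close> covers the constants \<open>CU\<close> and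
  \<open>q = 2 * c + 1\<close> that occur in this phase, with a margin for the operations around
  them.\<close>

lemma phase0:
  assumes tm: "t = maxlen bs N" and Beq: "B = ssum * ssum" and vals: "\<forall>v\<in>set xs. v \<le> ssum"
    and W: "(B + 2) ^ (CU + 2 * c + 80) \<le> W"
  shows "\<exists>s. ok 1 W readHead store0 \<and> ok 1 W readBags (den readHead store0) \<and>
     ok 1 W setOne (den readBags (den readHead store0)) \<and>
     ok 1 W computeZ (den setOne (den readBags (den readHead store0))) \<and>
     ok 1 W setParams (den computeZ (den setOne (den readBags (den readHead store0)))) \<and>
     ok 1 W copyInput (den setParams (den computeZ (den setOne (den readBags (den readHead store0))))) \<and>
     s = den copyInput (den setParams (den computeZ (den setOne (den readBags (den readHead store0))))) \<and>
     bnd B s \<and> fst s rP = length xs \<and> fst s rT = t \<and> fst s rT1 = t + 1 \<and> fst s rZ = Z \<and> fst s rB = B \<and>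
     fst s rCU = CU \<and> fst s rNT = CU * CU * (t + 1) ^ 4 \<and> fst s rL = l \<and> fst s rM = length es \<and> fst s rN = N \<and>
     fst s rMF = length fs \<and> fst s rP0 = p0 \<and>
     (\<forall>X<length xs. snd s 0 (length xs + X * 22) = xs ! X) \<and>
     (\<forall>j\<ge>length xs. (\<nexists>X. X < length xs \<and> j = length xs + X * 22) \<longrightarrow> snd s 0 j = 0) \<and>
     fst (den readHead store0) rN = N \<and> fst (den setOne (den readBags (den readHead store0))) rT = t \<and>
     fst (den setParams (den computeZ (den setOne (den readBags (den readHead store0))))) rP = length xs"
proof -
  let ?n = "CU + 2 * c + 80"
  have tB: "ssum \<le> B" unfolding Beq by (cases ssum) auto
  have vB: "v \<le> B" if "v \<in> set xs" for v using vals that tB le_trans by blast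
  have xB: "xs ! i \<le> B" if "i < length xs" for i using vB nth_mem[OF that] .
  have WB: "B \<le> W"
  proof -
    have "(B + 2) ^ 1 \<le> W" by (rule power_le_imp_le_power[OF W]) simp
    then show ?thesis by simp
  qed
  have W1: "1 \<le> W" using WB B_ge(3) by linarith
  have LB: "length xs \<le> B" using tB by (simp add: ssum_def)
  have head: "xs ! 2 = length es" "xs ! 1 = l" "2 < length xs" "4 + 2 * length es < length xs"
    by (simp_all add: xs_eq)
  have p0L: "p0 \<le> length xs" by (simp add: length_xs)
  have b0: "bnd B store0" using xB by (auto simp: bnd_def store0_def)
  have inp: "snd s aINP i = xs ! i" if "snd s = snd store0" "i < length xs" for s i
    using that by (simp add: store0_def)
  define s1 where "s1 = den readHead store0"
  have lim: "length es \<le> B" "l \<le> B" "N \<le> B" "length fs \<le> B" "p0 \<le> B"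
    using xB[of 2] xB[of 1] head p0L LB by (auto simp: p0_def length_xs)
       (use xs_N xB[of "3 + 2 * length es"] in \<open>simp add: length_xs p0_def\<close>)?
  have st: "ok 1 W readHead store0 \<and> bnd B s1 \<and> snd s1 = snd store0 \<and> fst s1 rM = length es \<and> fst s1 rL = l \<and>
      fst s1 rN = N \<and> fst s1 rMF = length fs \<and> fst s1 rP0 = p0 \<and> fst s1 rP = p0 \<and> fst s1 rT = 0"
  proof -
    define a1 where "a1 = setr rM (length es) store0"
    have a1: "bnd B a1" unfolding a1_def by (rule bnd_setr[OF b0 lim(1)])
    define a2 where "a2 = setr rL l a1"
    have a2: "bnd B a2" unfolding a2_def by (rule bnd_setr[OF a1 lim(2)])
    define a3 where "a3 = setr rN N a2"
    have a3: "bnd B a3" unfolding a3_def by (rule bnd_setr[OF a2 lim(3)])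
    define a4 where "a4 = setr rMF (length fs) a3"
    have a4: "bnd B a4" unfolding a4_def by (rule bnd_setr[OF a3 lim(4)])
    define a5 where "a5 = setr rP0 p0 a4"
    have a5: "bnd B a5" unfolding a5_def by (rule bnd_setr[OF a4 lim(5)])
    have e: "ev (Ar 0 (Kn 2)) store0 = length es" "ev (Ar 0 (Kn 1)) a1 = l"
      using inp[of store0] inp[of a1] head by (simp_all add: a1_def)
    have dbl: "length es + length es = 2 * length es" by simp
    have "ev (Ar 0 (mE 3)) a2 = snd store0 0 (3 + 2 * length es)"
      unfolding mE_def ev.simps apply_binop.simps by (simp add: a2_def a1_def add.commute)
    also have "\<dots> = N" using inp[of store0 "3 + 2 * length es"] head(4) xs_N(1) by simp
    finally have e3: "ev (Ar 0 (mE 3)) a2 = N" .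
    have "ev (Ar 0 (mE 4)) a3 = snd store0 0 (4 + 2 * length es)"
      unfolding mE_def ev.simps apply_binop.simps by (simp add: a3_def a2_def a1_def add.commute)
    also have "\<dots> = length fs" using inp[of store0 "4 + 2 * length es"] head(4) xs_N(2) by simp
    finally have e4: "ev (Ar 0 (mE 4)) a3 = length fs" .
    have e5: "ev (Bop Add (mE 5) (Bop Add (Vr rMF) (Vr rMF))) a4 = p0"
      by (simp add: mE_def a4_def a3_def a2_def a1_def p0_def)
    have d: "den (Asg rM (Ar 0 (Kn 2))) store0 = a1" "den (Asg rL (Ar 0 (Kn 1))) a1 = a2"
      "den (Asg rN (Ar 0 (mE 3))) a2 = a3" "den (Asg rMF (Ar 0 (mE 4))) a3 = a4"
      "den (Asg rP0 (Bop Add (mE 5) (Bop Add (Vr rMF) (Vr rMF)))) a4 = a5"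
      unfolding den.simps e e3 e4 e5 a1_def[symmetric] a2_def[symmetric] a3_def[symmetric] a4_def[symmetric]
        a5_def[symmetric] by (rule refl)+
    have s1: "s1 = setr rP p0 a5"
      unfolding s1_def readHead_def den.simps(3) d by (simp add: a5_def)
    have "ok 1 W readHead store0"
      unfolding readHead_def ok.simps(3) d
      by (intro conjI ok_Asg[OF _ W] b0 a1 a2 a3 a4 a5) (simp_all add: mE_def)
    then show ?thesis using s1 bnd_setr[OF a5 lim(5), of rP]
      by (simp add: a5_def a4_def a3_def a2_def a1_def store0_def)
  qed
  define s2 where "s2 = den readBags s1"
  define P where "P k s \<longleftrightarrow> bnd B s \<and> snd s = snd store0 \<and> fst s rM = length es \<and> fst s rL = l \<and> fst s rN = N \<and>
    fst s rMF = length fs \<and> fst s rP0 = p0 \<and> fst s rP = p0 + block_start bs k \<and> fst s rT = maxlen bs k" for k s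
  have "P (fst s1 rN) s2 \<and> ok 1 W readBags s1"
    unfolding s2_def readBags_def
  proof (rule for_rule_ok)
    show "P 0 (setr rX 0 s1)" using st bnd_setr[of B s1 0 rX] by (simp add: P_def)
    show "fst s1 rN \<le> W" using st lim WB by simp
    fix k s assume k: "k < fst s1 rN" "P k s" "fst s rX = k"
    have kN: "k < length bs" using k(1) st bs by simp
    have le: "p0 + block_start bs (Suc k) \<le> length xs" using blocks_nth(3)[OF kN] by (simp add: length_xs)
    have bl: "length (bs ! k) \<le> B" "p0 + block_start bs (Suc k) \<le> B" "maxlen bs (Suc k) \<le> B"
    proof -
      show "p0 + block_start bs (Suc k) \<le> B" using le LB by linarith
      then show b: "length (bs ! k) \<le> B" by simp
      have "maxlen bs k \<le> B" using k(2) bnd_D(1)[of B s rT] by (simp add: P_def)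
      then show "maxlen bs (Suc k) \<le> B" using b by simp
    qed
    have "snd s 0 (p0 + block_start bs k) = xs ! (p0 + block_start bs k)"
      using inp[of s "p0 + block_start bs k"] k(2) le by (simp add: P_def)
    then have e1: "ev (Ar 0 (Vr rP)) s = length (bs ! k)"
      using k(2) xs_blocks blocks_nth(1)[OF kN] by (simp add: P_def)
    define a1 where "a1 = setr rE (length (bs ! k)) s"
    have a1: "bnd B a1" unfolding a1_def by (rule bnd_setr) (use k bl in \<open>auto simp: P_def\<close>)
    define a2 where "a2 = setr rP (p0 + block_start bs (Suc k)) a1"
    have a2: "bnd B a2" unfolding a2_def by (rule bnd_setr[OF a1 bl(2)])
    define a3 where "a3 = setr rT (maxlen bs (Suc k)) a2"
    have a3: "bnd B a3" unfolding a3_def by (rule bnd_setr[OF a2 bl(3)])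
    have d: "den (Asg rE (Ar 0 (Vr rP))) s = a1" "den (Asg rP (Bop Add (Bop Add (Vr rP) (Vr rE)) (Kn 1))) a1 = a2"
      "den (Asg rT (Bop Add (Vr rT) (Bop Sub (Vr rE) (Vr rT)))) a2 = a3"
      using e1 k(2) by (simp_all add: a1_def a2_def a3_def P_def max_def add.assoc)
    have "bnd B s" using k(2) by (simp add: P_def)
    then have "ok 1 W (Sq (Asg rE (Ar 0 (Vr rP))) (Sq (Asg rP (Bop Add (Bop Add (Vr rP) (Vr rE)) (Kn 1)))
        (Asg rT (Bop Add (Vr rT) (Bop Sub (Vr rE) (Vr rT)))))) s"
      unfolding ok.simps(3) d by (intro conjI ok_Asg[OF _ W] a1 a2) simp_all
    moreover have "P (Suc k) (setr rX (Suc k) a3)"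
    proof -
      have "Suc k \<le> B" using kN bs lim(3) by simp
      then show ?thesis using bnd_setr[OF a3, of "Suc k" rX] k(2) by (simp add: P_def a3_def a2_def a1_def)
    qed
    ultimately show "ok 1 W (Sq (Asg rE (Ar 0 (Vr rP))) (Sq (Asg rP (Bop Add (Bop Add (Vr rP) (Vr rE)) (Kn 1)))
        (Asg rT (Bop Add (Vr rT) (Bop Sub (Vr rE) (Vr rT)))))) s \<and>
      P (Suc k) (setr rX (Suc k) (den (Sq (Asg rE (Ar 0 (Vr rP))) (Sq (Asg rP (Bop Add (Bop Add (Vr rP) (Vr rE)) (Kn 1)))
        (Asg rT (Bop Add (Vr rT) (Bop Sub (Vr rE) (Vr rT)))))) s))"
      unfolding den.simps(3) d by blast
  qed (use W1 in auto)
  then have P2: "P N s2" and ok2: "ok 1 W readBags s1" using st by simp_all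
  have LP: "p0 + block_start bs N = length xs" using block_start_length[of bs] bs by (simp add: length_xs)
  define s3 where "s3 = den setOne s2"
  have s3eq: "s3 = setr rZ 1 s2" by (simp add: s3_def setOne_def)
  have b3: "bnd B s3" unfolding s3eq by (rule bnd_setr) (use P2 B_ge(3) in \<open>auto simp: P_def\<close>)
  have ok3: "ok 1 W setOne s2" unfolding setOne_def by (rule ok_Asg[OF _ W]) (use P2 in \<open>auto simp: P_def\<close>)
  define s4 where "s4 = den computeZ s3"
  define Q where "Q k s \<longleftrightarrow> bnd B s \<and> snd s = snd store0 \<and> fst s rM = length es \<and> fst s rL = l \<and> fst s rN = N \<and>
    fst s rMF = length fs \<and> fst s rP0 = p0 \<and> fst s rP = length xs \<and> fst s rT = t \<and> fst s rZ = q ^ k" for k s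
  have tT: "fst s3 rT = t" using P2 tm by (simp add: s3eq P_def)
  have tle: "t \<le> B" using B_ge(3) by linarith
  have "Q (fst s3 rT) s4 \<and> ok 1 W computeZ s3"
    unfolding s4_def computeZ_def
  proof (rule for_rule_ok)
    show "Q 0 (setr rX 0 s3)" using P2 LP tm bnd_setr[OF b3, of 0 rX] by (simp add: Q_def P_def s3eq)
    show "fst s3 rT \<le> W" using tT tle WB by linarith
    fix k s assume k: "k < fst s3 rT" "Q k s" "fst s rX = k"
    have "q ^ Suc k \<le> q ^ t" by (rule power_increasing) (use k tT in \<open>auto simp: q_def\<close>)
    then have le: "q ^ k * q \<le> B" using Z_le by (simp add: mult.commute)
    have bs': "bnd B s" using k by (simp add: Q_def)
    have d: "den (Asg rZ (Bop Mul (Vr rZ) (Kn q))) s = setr rZ (q ^ k * q) s" using k by (simp add: Q_def)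
    have "ok 1 W (Asg rZ (Bop Mul (Vr rZ) (Kn q))) s" by (rule ok_Asg[OF bs' W]) (simp add: q_def)
    moreover have "Suc k \<le> B" using k tT tle by simp
    then have "Q (Suc k) (setr rX (Suc k) (setr rZ (q ^ k * q) s))"
      using bnd_setr[OF bnd_setr[OF bs' le]] k(2) by (simp add: Q_def mult.commute)
    ultimately show "ok 1 W (Asg rZ (Bop Mul (Vr rZ) (Kn q))) s \<and>
      Q (Suc k) (setr rX (Suc k) (den (Asg rZ (Bop Mul (Vr rZ) (Kn q))) s))" unfolding d by blast
  qed (use W1 in auto)
  then have Q4: "Q t s4" and ok4: "ok 1 W computeZ s3" using tT by simp_all
  define s5 where "s5 = den setParams s4"
  let ?NT = "CU * CU * (t + 1) ^ 4"
  have NT: "CU * CU * ((t + 1) * (t + 1) * ((t + 1) * (t + 1))) = ?NT" by (simp only: power4_eq_xxxx mult.assoc)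
  have NTB: "?NT \<le> B" "CU \<le> B" "t + 1 \<le> B" using tB B_ge by (auto simp: ssum_def)
  have st5: "ok 1 W setParams s4 \<and> bnd B s5 \<and> s5 = setr rB B (setr rNT ?NT (setr rCU CU (setr rT1 (t + 1) s4)))"
  proof -
    define a1 where "a1 = setr rT1 (t + 1) s4"
    have b4: "bnd B s4" using Q4 by (simp add: Q_def)
    have a1: "bnd B a1" unfolding a1_def by (rule bnd_setr[OF b4 NTB(3)])
    define a2 where "a2 = setr rCU CU a1"
    have a2: "bnd B a2" unfolding a2_def by (rule bnd_setr[OF a1 NTB(2)])
    define a3 where "a3 = setr rNT ?NT a2"
    have a3: "bnd B a3" unfolding a3_def by (rule bnd_setr[OF a2 NTB(1)])
    let ?eN = "Bop Mul (Bop Mul (Vr rCU) (Vr rCU)) (Bop Mul (Bop Mul (Vr rT1) (Vr rT1)) (Bop Mul (Vr rT1) (Vr rT1)))"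
    have "ev ?eN a2 = CU * CU * ((t + 1) * (t + 1) * ((t + 1) * (t + 1)))" by (simp add: a2_def a1_def)
    then have eN: "ev ?eN a2 = ?NT" unfolding NT .
    have "ev sumE a3 = ssum" using Q4 by (simp add: sumE_def a3_def a2_def a1_def Q_def ssum_def)
    then have eB: "ev (Bop Mul sumE sumE) a3 = B" by (simp add: Beq)
    have d: "den (Asg rT1 (Bop Add (Vr rT) (Kn 1))) s4 = a1" "den (Asg rCU (Kn CU)) a1 = a2"
      "den (Asg rNT ?eN) a2 = a3" "den (Asg rB (Bop Mul sumE sumE)) a3 = setr rB B a3"
      using Q4 unfolding den.simps eN eB by (simp_all add: a1_def a2_def a3_def Q_def)
    have "ok 1 W setParams s4"
      unfolding setParams_def ok.simps(3) d
      by (intro conjI ok_Asg[OF _ W] b4 a1 a2 a3) (simp_all add: sumE_def)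
    moreover have "s5 = setr rB B a3" unfolding s5_def setParams_def den.simps(3) d ..
    ultimately show ?thesis using bnd_setr[OF a3 le_refl] by (simp add: a3_def a2_def a1_def)
  qed
  define s6 where "s6 = den copyInput s5"
  have b5: "bnd B s5" and s5eq: "s5 = setr rB B (setr rNT ?NT (setr rCU CU (setr rT1 (t + 1) s4)))"
    using st5 by blast+
  have s5: "fst s5 rP = length xs" "snd s5 = snd store0" "bnd B s5"
    using Q4 b5 unfolding s5eq by (simp_all add: Q_def)
  define R where "R k s \<longleftrightarrow> bnd B s \<and> (\<forall>r. r \<noteq> rX \<longrightarrow> fst s r = fst s5 r) \<and>
    (\<forall>X<k. snd s 0 (length xs + X * 22) = xs ! X) \<and> (\<forall>j<length xs. snd s 0 j = xs ! j) \<and>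
    (\<forall>j\<ge>length xs. (\<nexists>X. X < length xs \<and> j = length xs + X * 22) \<longrightarrow> snd s 0 j = 0)" for k s
  have "R (fst s5 rP) s6 \<and> ok 1 W copyInput s5"
    unfolding s6_def copyInput_def
  proof (rule for_rule_ok)
    show "R 0 (setr rX 0 s5)" using bnd_setr[OF s5(3), of 0 rX] s5(2) by (simp add: R_def store0_def)
    show "fst s5 rP \<le> W" using s5(1) LB WB by linarith
    fix k s assume k: "k < fst s5 rP" "R k s" "fst s rX = k"
    have kL: "k < length xs" using k s5 by simp
    have bs': "bnd B s" using k by (simp add: R_def)
    let ?c = "Sto 0 (Bop Add (Vr rP) (Bop Mul (Vr rX) (Kn 22))) (Ar 0 (Vr rX))"
    have d: "den ?c s = seta 0 (length xs + k * 22) (xs ! k) s" using k s5(1) kL by (simp add: R_def)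
    have "ok 1 W ?c s" by (rule ok_Sto[OF bs' W]) simp_all
    moreover have "Suc k \<le> B" using kL LB by simp
    then have "bnd B (setr rX (Suc k) (seta 0 (length xs + k * 22) (xs ! k) s))"
      using bnd_setr[OF bnd_seta[OF bs' xB[OF kL]]] by blast
    then have "R (Suc k) (setr rX (Suc k) (seta 0 (length xs + k * 22) (xs ! k) s))"
      using k(2) kL unfolding R_def by (auto simp: less_Suc_eq)
    ultimately show "ok 1 W ?c s \<and> R (Suc k) (setr rX (Suc k) (den ?c s))" unfolding d by blast
  qed (use W1 in auto)
  then have R6: "R (length xs) s6" and ok6: "ok 1 W copyInput s5" using s5 by simp_all
  show ?thesis
  proof (intro exI[of _ s6] conjI)
    show "ok 1 W readHead store0" using st by blast
    show "ok 1 W readBags (den readHead store0)" using ok2 by (simp only: s1_def)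
    show "ok 1 W setOne (den readBags (den readHead store0))" using ok3 by (simp only: s1_def s2_def)
    show "ok 1 W computeZ (den setOne (den readBags (den readHead store0)))" using ok4 by (simp only: s1_def s2_def s3_def)
    show "ok 1 W setParams (den computeZ (den setOne (den readBags (den readHead store0))))"
      using st5 by (simp only: s1_def s2_def s3_def s4_def)
    show "ok 1 W copyInput (den setParams (den computeZ (den setOne (den readBags (den readHead store0)))))"
      using ok6 by (simp only: s1_def s2_def s3_def s4_def s5_def)
    show "s6 = den copyInput (den setParams (den computeZ (den setOne (den readBags (den readHead store0)))))"
      by (simp only: s1_def s2_def s3_def s4_def s5_def s6_def)
    show "fst (den readHead store0) rN = N" using st by (simp add: s1_def)
    show "fst (den setOne (den readBags (den readHead store0))) rT = t" using tT by (simp only: s1_def s2_def s3_def)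
    show "fst (den setParams (den computeZ (den setOne (den readBags (den readHead store0))))) rP = length xs"
      using s5(1) by (simp only: s1_def s2_def s3_def s4_def s5_def)
    have f6: "fst s6 r = fst s5 r" if "r \<noteq> rX" for r using R6 that by (simp add: R_def)
    note q4 = Q4[unfolded Q_def]
    show "fst s6 rP = length xs" "fst s6 rT = t" "fst s6 rT1 = t + 1" "fst s6 rZ = Z" "fst s6 rB = B"
      "fst s6 rCU = CU" "fst s6 rNT = CU * CU * (t + 1) ^ 4" "fst s6 rL = l" "fst s6 rM = length es"
      "fst s6 rN = N" "fst s6 rMF = length fs" "fst s6 rP0 = p0"
      using f6 q4 unfolding s5eq by simp_all
  qed (use R6 in \<open>auto simp: R_def\<close>)
qed

end

section \<open>Running time\<close>

text \<open>Sequencing takes a maximum because all sums are moved into the program size. A loop with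
  bound 0 counts as one round, so that the result is positive and can absorb constant costs.\<close>

fun lp :: "(nat \<Rightarrow> nat) \<Rightarrow> stmt \<Rightarrow> nat" where
  "lp \<sigma> (Asg r e) = 1"
| "lp \<sigma> (Sto a e1 e2) = 1"
| "lp \<sigma> (Sq c1 c2) = max (lp \<sigma> c1) (lp \<sigma> c2)"
| "lp \<sigma> (Cond e c1 c2) = max (lp \<sigma> c1) (lp \<sigma> c2)"
| "lp \<sigma> (For i r c) = max 1 (\<sigma> r) * lp \<sigma> c"

lemma lp_pos: "1 \<le> lp \<sigma> C"
  by (induction C) (auto simp: le_max_iff_disj Suc_le_eq)

text \<open>The cost is at most the program size times the largest product of nested loop bounds.\<close>

lemma scost_le: "scost \<sigma> C \<le> scost (\<lambda>_. 1) C * lp \<sigma> C"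
proof (induction C)
  case (Sq c1 c2)
  define L where "L = lp \<sigma> (Sq c1 c2)"
  have "lp \<sigma> c1 \<le> L" "lp \<sigma> c2 \<le> L" by (simp_all add: L_def)
  then have "scost \<sigma> c1 \<le> scost (\<lambda>_. 1) c1 * L" "scost \<sigma> c2 \<le> scost (\<lambda>_. 1) c2 * L"
    using Sq.IH by (meson le_trans mult_le_mono2)+
  then have "scost \<sigma> (Sq c1 c2) \<le> scost (\<lambda>_. 1) (Sq c1 c2) * L" by (simp add: add_mult_distrib)
  then show ?case by (simp only: L_def)
next
  case (Cond e c1 c2)
  define L where "L = lp \<sigma> (Cond e c1 c2)"
  have "lp \<sigma> c1 \<le> L" "lp \<sigma> c2 \<le> L" by (simp_all add: L_def)
  then have "scost \<sigma> c1 \<le> scost (\<lambda>_. 1) c1 * L" "scost \<sigma> c2 \<le> scost (\<lambda>_. 1) c2 * L"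
    using Cond.IH by (meson le_trans mult_le_mono2)+
  moreover have "ecost e + 1 \<le> (ecost e + 1) * L" 
  proof -
    have "1 \<le> L" unfolding L_def by (rule lp_pos)
    then have "(ecost e + 1) * 1 \<le> (ecost e + 1) * L" by (rule mult_le_mono2)
    then show ?thesis by (simp only: mult_1_right)
  qed
  ultimately have "scost \<sigma> (Cond e c1 c2) \<le> scost (\<lambda>_. 1) (Cond e c1 c2) * L"
    by (simp add: add_mult_distrib)
  then show ?case by (simp only: L_def)
next
  case (For i r c)
  let ?m = "max 1 (\<sigma> r)" and ?s = "scost (\<lambda>_. 1) c" and ?l = "lp \<sigma> c"
  have l: "1 \<le> ?l" by (rule lp_pos)
  have "scost \<sigma> c + 4 \<le> ?s * ?l + 4 * ?l" using For l by linarith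
  also have "\<dots> = (?s + 4) * ?l" by (simp add: add_mult_distrib)
  finally have "\<sigma> r * (scost \<sigma> c + 4) \<le> ?m * ((?s + 4) * ?l)" by (intro mult_le_mono) auto
  then have "\<sigma> r * (scost \<sigma> c + 4) \<le> (?s + 4) * (?m * ?l)" by (simp only: mult.left_commute)
  moreover have "1 * 1 \<le> ?m * ?l" by (rule mult_le_mono[OF _ l]) simp
  ultimately have "3 + \<sigma> r * (scost \<sigma> c + 4) \<le> 3 * (?m * ?l) + (?s + 4) * (?m * ?l)"
    by (intro add_mono) simp_all
  then show ?case by (simp only: scost.simps lp.simps mult_1 add_mult_distrib)
qed simp_all

context graph_dp
begin

lemma constTable_static:
  assumes "a < 22" "\<And>i v. (i, v) \<in> set ps \<Longrightarrow> v \<le> CU"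
  shows "chk 22 (constTable a ps)" "sbd CU (constTable a ps)" "lb (constTable a ps) = {}" "lp \<sigma> (constTable a ps) = 1"
proof -
  have "chk 22 (constTable a ps) \<and> sbd CU (constTable a ps) \<and> lb (constTable a ps) = {} \<and> lp \<sigma> (constTable a ps) = 1"
    using assms
  proof (induction ps)
    case (Cons p ps)
    obtain i v where "p = (i, v)" by (cases p)
    moreover have "constTable a (p # ps) = Sq (Sto a (Kn (fst p)) (Kn (snd p))) (constTable a ps)"
      by (simp add: constTable_def case_prod_beta)
    ultimately show ?case using Cons by force
  qed (simp add: constTable_def)
  then show "chk 22 (constTable a ps)" "sbd CU (constTable a ps)" "lb (constTable a ps) = {}" "lp \<sigma> (constTable a ps) = 1"
    by blast+
qed

lemma CU_pos: "1 \<le> CU"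
  by (simp add: CU_def)

lemma init_const_static:
  "chk 22 initORT" "sbd CU initORT" "lb initORT = {}" "lp \<sigma> initORT = 1"
  "chk 22 initSG" "sbd CU initSG" "lb initSG = {}" "lp \<sigma> initSG = 1"
proof -
  have 1: "v \<le> CU" if "(i, v) \<in> set [(pr U1 U2, join_code U1 U2). U1 \<leftarrow> [0..<CU], U2 \<leftarrow> [0..<CU]]" for i v
    using that join_code_less[of _ c] by (auto simp: CU_def less_imp_le)
  have 2: "v \<le> CU" if "(i, v) \<in> set [(i, 2 ^ i). i \<leftarrow> [0..<c+1]]" for i v
  proof -
    have "i < c + 1" "v = 2 ^ i" using that by auto
    moreover from this have "(2 :: nat) ^ i \<le> 2 ^ (c + 1)" by (intro power_increasing) auto
    ultimately show ?thesis by (simp only: CU_def)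
  qed
  show "chk 22 initORT" "sbd CU initORT" "lb initORT = {}" "lp \<sigma> initORT = 1"
    unfolding initORT_def by (rule constTable_static; use 1 in simp)+
  show "chk 22 initSG" "sbd CU initSG" "lb initSG = {}" "lp \<sigma> initSG = 1"
    unfolding initSG_def by (rule constTable_static; use 2 in simp)+
qed

lemmas expr_defs = prE_def posE_def eqE_def ltE_def notE_def isME_def colE_def maxE_def digE_def clamp_def
  dE_def pwE_def cellE_def lastE_def zetaE_def moebiusE_def partnerE_def colmaxE_def selectE_def hitE_def
  valueE_def uiE_def edgeE_def Let_def lenE_def bagE_def matchE_def ivE_def scatterE_def gatherE_def gsE_def
  inpE_def mE_def incE_def addE_def edgeGuard_def fullE_def nop_def

lemma join_static:
  "chk 22 JOIN" "sbd CU JOIN" "lb JOIN = {rCU, rZ, rNT, rT}"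
  using CU_pos
  by (auto simp: JOIN_def joinBody_def forUI_def copyI_def decode_def colmax_def zeta_def moebius_def update_def
    sweep_def expr_defs)

lemma tables_static:
  "chk 22 EDGE" "sbd CU EDGE" "lb EDGE = {rCU, rZ}" "chk 22 INITFT" "sbd CU INITFT" "lb INITFT = {rCU, rZ}"
  "chk 22 (STORET rX)" "sbd CU (STORET rX)" "lb (STORET rX) = {rCU, rZ}"
  "chk 22 (STORET rHi)" "sbd CU (STORET rHi)" "lb (STORET rHi) = {rCU, rZ}"
  "chk 22 (LOADT rHi)" "sbd CU (LOADT rHi)" "lb (LOADT rHi) = {rCU, rZ}"
  using CU_pos by (auto simp: EDGE_def INITFT_def STORET_def LOADT_def forUI_def expr_defs)

lemma project_static:
  "chk 22 PROJECT" "sbd CU PROJECT" "lb PROJECT = {rT, rCU, rZ}"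
  using CU_pos by (auto simp: PROJECT_def posmap_def forUI_def scatterBody_def gatherBody_def target_def allOk_def expr_defs)

lemma init_static:
  "chk 22 initPW" "sbd CU initPW" "lb initPW = {rT}" "chk 22 initRK" "sbd CU initRK" "lb initRK = {rZ, rT}"
  "chk 22 initPT" "sbd CU initPT" "lb initPT = {rN}" "chk 22 initADJ" "sbd CU initADJ" "lb initADJ = {rM}"
  "chk 22 initDEG" "sbd CU initDEG" "lb initDEG = {rMF}"
  using CU_pos by (auto simp: initPW_def initRK_def initPT_def initADJ_def initDEG_def expr_defs)

lemma main_static:
  "chk 22 mainProg" "sbd CU mainProg" "\<forall>r\<in>lb mainProg. r \<notin> wr mainProg"
proof -
  note st = join_static tables_static project_static init_static init_const_static
  have e: "chk 22 edgeStep" "sbd CU edgeStep" "lb edgeStep = {rCU, rZ, rNT, rT}"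
    by (auto simp: edgeStep_def st) (auto simp: expr_defs)
  have n: "chk 22 nodeBody" "sbd CU nodeBody" "lb nodeBody = {rCU, rZ, rNT, rT}"
    by (auto simp: nodeBody_def st e)
  have p: "chk 22 (pushE rX)" "sbd CU (pushE rX)" "lb (pushE rX) = {}"
    "chk 22 (pushE rHi)" "sbd CU (pushE rHi)" "lb (pushE rHi) = {}" by (auto simp: pushE_def expr_defs)
  have m: "chk 22 mergeBody" "sbd CU mergeBody" "lb mergeBody = {rCU, rZ, rNT, rT}"
    by (auto simp: mergeBody_def st p)
  have m': "chk 22 mergeStep" "sbd CU mergeStep" "lb mergeStep = {rCU, rZ, rNT, rT}"
    by (auto simp: mergeStep_def m) (auto simp: expr_defs)
  have f: "chk 22 finalBody" "sbd CU finalBody" "lb finalBody = {rT}"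
    using CU_pos by (auto simp: finalBody_def allOk_def expr_defs)
  show "chk 22 mainProg" "sbd CU mainProg" "\<forall>r\<in>lb mainProg. r \<notin> wr mainProg"
    using CU_pos by (auto simp: mainProg_def st n p m' f)
qed

lemma le_mult_right: "(a :: nat) \<le> b \<Longrightarrow> 1 \<le> x \<Longrightarrow> a \<le> b * x"
  and le_mult_left: "(a :: nat) \<le> b \<Longrightarrow> 1 \<le> x \<Longrightarrow> a \<le> x * b"
  by (metis le_trans mult.right_neutral mult_le_mono2, metis le_trans mult.left_neutral mult_le_mono1)

text \<open>The deepest nest decides: nodes, two positions of an edge in a bag, rounds of a join,
  positions and states of a sweep. The loops over the two edge lists contribute \<open>m\<close> and
  \<open>mf\<close>.\<close>

lemma lp_main:
  assumes T: "\<sigma> rT \<le> T" and Z: "\<sigma> rZ = z" "\<sigma> rCU = CU" "\<sigma> rNT = NT" "\<sigma> rN = N" "\<sigma> rM = m" "\<sigma> rMF = mf"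
    and pos: "1 \<le> T" "1 \<le> z" "CU \<le> NT" "1 \<le> N" "T \<le> NT"
  shows "lp \<sigma> mainProg \<le> N * (T * (T * (NT * (T * z)))) + m + mf"
proof -
  have NT: "1 \<le> NT" using pos CU_pos by linarith
  have mT: "max 1 (\<sigma> rT) \<le> T" using T pos by simp
  have mx: "max 1 z = z" "max 1 CU = CU" "max 1 NT = NT" "max 1 N = N"
    "max (Suc 0) z = z" "max (Suc 0) CU = CU" "max (Suc 0) NT = NT" "max (Suc 0) N = N"
    using pos CU_pos NT by simp_all
  \<comment> \<open>Bounds for one sweep, for one join, and for all joins at one node.\<close>
  define J0 where "J0 = T * z"
  define J1 where "J1 = NT * J0"
  define J where "J = T * (T * J1)"
  have J0: "1 \<le> J0" unfolding J0_def using pos by (simp add: Suc_le_eq)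
  have J01: "J0 \<le> J1" unfolding J1_def by (rule le_mult_left[OF le_refl NT])
  have J1J: "J1 \<le> J" unfolding J_def by (intro le_mult_left pos) simp
  have zJ0: "z \<le> J0" unfolding J0_def by (rule le_mult_left[OF le_refl pos(1)])
  have TJ0: "T \<le> J0" unfolding J0_def by (rule le_mult_right[OF le_refl pos(2)])
  have zJ: "z \<le> J1" "1 \<le> J1" "z \<le> J" "1 \<le> J" using zJ0 J01 J1J J0 by linarith+
  have CUz: "CU * z \<le> J1" unfolding J1_def by (rule mult_le_mono[OF pos(3) zJ0])
  have zCU: "z * CU \<le> J1" using CUz by (simp add: mult.commute)
  have zT: "z * max 1 (\<sigma> rT) \<le> J1"
  proof -
    have "z * max 1 (\<sigma> rT) \<le> z * T" by (rule mult_le_mono2[OF mT])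
    also have "\<dots> = J0" by (simp only: J0_def mult.commute)
    finally show ?thesis using J01 by linarith
  qed
  have Tz: "max 1 (\<sigma> rT) * z \<le> J0" unfolding J0_def by (rule mult_le_mono1[OF mT])
  have TT: "max 1 (\<sigma> rT) * max 1 (\<sigma> rT) \<le> J"
  proof -
    have "max 1 (\<sigma> rT) * max 1 (\<sigma> rT) \<le> T * T" by (rule mult_le_mono[OF mT mT])
    also have "\<dots> \<le> T * (T * J1)" by (intro mult_le_mono2 le_mult_right) (use zJ in auto)
    finally show ?thesis by (simp add: J_def)
  qed
  have sw: "lp \<sigma> (sweep a e) \<le> J0" for a e using Tz by (simp add: sweep_def Z mx)
  have cp: "lp \<sigma> (copyI a e) \<le> J0" for a e using zJ0 by (simp add: copyI_def Z mx)
  have dc: "lp \<sigma> decode \<le> J0" using J0 by (simp add: decode_def)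
  have up: "lp \<sigma> update \<le> J0" using zJ0 by (simp add: update_def Z mx)
  have jb: "lp \<sigma> joinBody \<le> J0"
    unfolding joinBody_def colmax_def zeta_def moebius_def lp.simps
    by (intro max.boundedI sw cp dc up)
  have ui: "lp \<sigma> (forUI a e1 e2) \<le> J1" for a e1 e2 using CUz by (simp add: forUI_def Z mx)
  have join: "lp \<sigma> JOIN \<le> J1"
  proof -
    have "NT * lp \<sigma> joinBody \<le> J1" unfolding J1_def by (rule mult_le_mono2[OF jb])
    then show ?thesis using ui by (simp add: JOIN_def Z mx)
  qed
  have uiJ: "lp \<sigma> (forUI a e1 e2) \<le> J" for a e1 e2 using ui J1J by (rule le_trans)
  have joinJ: "lp \<sigma> JOIN \<le> J" using join J1J by (rule le_trans)
  have nop: "lp \<sigma> nop = 1" by (simp add: nop_def)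
  have es: "lp \<sigma> edgeStep \<le> J1" using ui join zJ by (simp add: edgeStep_def EDGE_def nop)
  have "max 1 (\<sigma> rT) * (max 1 (\<sigma> rT) * lp \<sigma> edgeStep) \<le> J" unfolding J_def by (intro mult_le_mono mT es)
  then have nb: "lp \<sigma> nodeBody \<le> J" using uiJ by (simp add: nodeBody_def INITFT_def STORET_def)
  have push: "lp \<sigma> (pushE r) = 1" for r by (simp add: pushE_def nop)
  have tgt: "lp \<sigma> (target d) = max 1 (\<sigma> rT)" for d by (simp add: target_def)
  have allok: "lp \<sigma> (allOk e) = max 1 (\<sigma> rT)" for e by (simp add: allOk_def)
  have pm: "lp \<sigma> (posmap a x y) \<le> J" for a x y
  proof -
    have "lp \<sigma> (posmap a x y) = max 1 (\<sigma> rT) * max 1 (max 1 (\<sigma> rT))"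
      by (simp add: posmap_def)
    then show ?thesis using TT by simp
  qed
  have sb: "z * max (max 1 (\<sigma> rT)) (max (max 1 (\<sigma> rT)) CU) \<le> J"
    using zT zCU J1J by (cases "CU \<le> max 1 (\<sigma> rT)") (auto simp: max_def split: if_splits)
  have proj: "lp \<sigma> PROJECT \<le> J"
    using pm uiJ sb by (simp add: PROJECT_def scatterBody_def gatherBody_def tgt allok Z mx)
  have mb: "lp \<sigma> mergeBody \<le> J"
    using proj joinJ uiJ zJ push by (simp add: mergeBody_def LOADT_def STORET_def)
  have ms: "lp \<sigma> mergeStep \<le> J" using mb zJ by (simp add: mergeStep_def nop)
  have NJ: "J \<le> N * J" by (rule le_mult_left[OF le_refl pos(4)])
  have N1: "N \<le> N * J" by (rule le_mult_right[OF le_refl zJ(4)])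
  have loops: "N * lp \<sigma> nodeBody \<le> N * J" "N * lp \<sigma> mergeStep \<le> N * J"
    by (intro mult_le_mono2 nb ms)+
  have rk: "z * max 1 (\<sigma> rT) \<le> N * J" using zT J1J NJ by linarith
  have fin: "lp \<sigma> finalBody = max 1 (\<sigma> rT)" by (simp add: finalBody_def allok)
  have pw: "max 1 (\<sigma> rT) \<le> N * J" using mT TJ0 J01 J1J NJ by linarith
  have 1: "1 \<le> N * J" using zJ NJ by linarith
  have parts: "lp \<sigma> initPW \<le> N * J" "lp \<sigma> initPT \<le> N * J"
    "lp \<sigma> initADJ \<le> N * J + m" "lp \<sigma> initDEG \<le> N * J + mf"
    using pw rk 1 N1 pos by (simp_all add: initPW_def initPT_def initADJ_def initDEG_def Z max_def split: if_splits)
  define R where "R = N * J + m + mf"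
  have le: "N * J \<le> R" "N * J + m \<le> R" "N * J + mf \<le> R" by (simp_all add: R_def)
  have "lp \<sigma> initRK \<le> N * J" using rk by (simp add: initRK_def Z mx)
  then have i: "lp \<sigma> initPW \<le> R" "lp \<sigma> initRK \<le> R" "lp \<sigma> initPT \<le> R" "lp \<sigma> initADJ \<le> R" "lp \<sigma> initDEG \<le> R"
    "lp \<sigma> initORT \<le> R" "lp \<sigma> initSG \<le> R"
    using parts le 1 unfolding init_const_static by linarith+
  have f: "lp \<sigma> (For rX rN nodeBody) \<le> R" "lp \<sigma> (For rX rN (pushE rX)) \<le> R"
    "lp \<sigma> (For rX rN mergeStep) \<le> R" "lp \<sigma> (For rI rZ finalBody) \<le> R"
    unfolding lp.simps Z mx push fin using loops rk N1 le(1) by linarith+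
  have a: "lp \<sigma> (Asg r e) \<le> R" for r e unfolding lp.simps using 1 le(1) by linarith
  have "lp \<sigma> mainProg \<le> R"
    unfolding mainProg_def lp.simps(3) by (intro max.boundedI i f a)
  then have "lp \<sigma> mainProg \<le> N * J + m + mf" by (simp only: R_def)
  then show ?thesis by (simp add: J_def J1_def J0_def)
qed

end

text \<open>Stripping a leaf removes at most one edge, so induction gives fewer edges than nodes;
  the list of tree edges thus contributes only linearly to the input length.\<close>

lemma tree_edges:
  assumes T: "is_tree {..<N} F" and S: "stripped F N Al D" and ne: "Al \<noteq> {}"
  shows "card {e \<in> F. e \<subseteq> Al} < card Al"
  using S ne
proof (induction "card Al" arbitrary: Al D)
  case 0
  then have "finite Al" using strippedD(1)[OF 0(2)] by (meson finite_lessThan finite_subset lessThan_iff subsetI)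
  then show ?case using 0 by simp
next
  case (Suc k)
  have G: "simple_graph {..<N} F" using T by (simp add: is_tree_def)
  have finA: "finite Al" using Suc.hyps(2) card.infinite by fastforce
  have finF: "finite F" using simple_graph_finite(2)[OF G] .
  show ?case
  proof (cases "k = 0")
    case True
    then have "card Al = 1" using Suc by simp
    then obtain x where "Al = {x}" by (auto simp: card_1_singleton_iff)
    then have "{e \<in> F. e \<subseteq> Al} = {}" using G by (fastforce simp: simple_graph_def card_2_iff)
    then show ?thesis unfolding \<open>{e \<in> F. e \<subseteq> Al} = {}\<close> using \<open>card Al = 1\<close> by simp
  next
    case False
    then have c2: "2 \<le> card Al" using Suc by simp
    obtain v where v: "v \<in> Al" "card (nb F Al v) = 1" using stripped_leaf[OF T Suc.prems(1) c2] by blast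
    then obtain u where u: "nb F Al v = {u}" by (auto simp: card_1_singleton_iff)
    have S': "stripped F N (Al - {v}) (D(u := D u \<union> D v))" by (rule stripped_step[OF Suc.prems(1) G v(1) u])
    have ck: "card (Al - {v}) = k" using v finA Suc.hyps(2) by simp
    then have "Al - {v} \<noteq> {}" using False by (metis card.empty)
    from Suc.hyps(1)[OF _ S' this] ck have IH: "card {e \<in> F. e \<subseteq> Al - {v}} < k" by simp
    have "{e \<in> F. e \<subseteq> Al} \<subseteq> insert {v, u} {e \<in> F. e \<subseteq> Al - {v}}"
    proof
      fix e assume e: "e \<in> {e \<in> F. e \<subseteq> Al}"
      show "e \<in> insert {v, u} {e \<in> F. e \<subseteq> Al - {v}}"
      proof (cases "v \<in> e")
        case True
        have "card e = 2" using e G by (auto simp: simple_graph_def)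
        then obtain w where w: "e = {v, w}" using True by (auto simp: card_2_iff insert_commute)
        then have "w \<in> nb F Al v" using e by (auto simp: nb_def)
        then show ?thesis using u w by simp
      qed (use e in auto)
    qed
    then have "card {e \<in> F. e \<subseteq> Al} \<le> card (insert {v, u} {e \<in> F. e \<subseteq> Al - {v}})"
      by (intro card_mono) (use finF in auto)
    also have "\<dots> \<le> Suc (card {e \<in> F. e \<subseteq> Al - {v}})" using finF by (simp add: card_insert_if)
    finally show ?thesis using IH Suc.hyps(2) by linarith
  qed
qed

lemma edge_list_length: "edge_list es E \<Longrightarrow> length es = card E"
  using distinct_card by (fastforce simp: edge_list_def Let_def)

context inst
begin

lemma length_fs: "length fs < N"
proof -
  have "card {e \<in> F. e \<subseteq> {..<N}} < card {..<N}"
    by (rule tree_edges[OF tree stripped_init[OF tree]]) (use N_pos in auto)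
  moreover have "{e \<in> F. e \<subseteq> {..<N}} = F" using F_graph by (auto simp: simple_graph_def)
  ultimately show ?thesis using edge_list_length[OF fs] by simp
qed

text \<open>An edge is determined by a node whose bag contains it and two positions there.\<close>

lemma length_es: "length es \<le> N * (t * t)"
proof -
  let ?h = "\<lambda>(x, a, b). {bs ! x ! a, bs ! x ! b}"
  have "E \<subseteq> ?h ` ({..<N} \<times> {..<t} \<times> {..<t})"
  proof
    fix e assume e: "e \<in> E"
    then obtain x where x: "x < N" "e \<subseteq> Bg x" using td by (auto simp: tree_decomposition_def)
    have "e \<in> bag_edges x t 0" using bag_edges_all[OF x(1)] e x by (simp add: bagsE_def)
    then obtain a b where ab: "a < length (bs ! x)" "b < length (bs ! x)" "e = {bs ! x ! a, bs ! x ! b}"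
      unfolding bag_edges_def by blast
    then have "a < t" "b < t" using bag_le[OF x(1)] by linarith+
    then show "e \<in> ?h ` ({..<N} \<times> {..<t} \<times> {..<t})"
      using ab(3) x(1) by (intro image_eqI[of _ _ "(x, a, b)"]) auto
  qed
  then have "card E \<le> card (?h ` ({..<N} \<times> {..<t} \<times> {..<t}))" by (intro card_mono) auto
  also have "\<dots> \<le> card ({..<N} \<times> {..<t} \<times> {..<t})" by (rule card_image_le) simp
  finally show ?thesis using edge_list_length[OF es] by (simp add: card_cartesian_product)
qed

lemma length_xs_le: "length xs \<le> 10 * (N * ((t + 1) * (t + 1)))"
proof -
  have "length (blocks bs) \<le> (\<Sum>x<N. t + 1)"
    unfolding block_start_length[symmetric] bs block_start_def by (rule sum_mono) (use bag_le in auto)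
  then have 1: "length (blocks bs) \<le> N * (t + 1)" by simp
  define M where "M = N * ((t + 1) * (t + 1))"
  have 2: "N * (t + 1) \<le> N * ((t + 1) * (t + 1))" "N * (t * t) \<le> N * ((t + 1) * (t + 1))" "N \<le> N * ((t + 1) * (t + 1))"
    by (intro mult_le_mono2, simp)+ simp
  have "length (blocks bs) \<le> M" "length es \<le> M" "N \<le> M"
    using 1 2 length_es unfolding M_def[symmetric] by linarith+
  then show ?thesis using length_fs N_pos unfolding M_def[symmetric] by (simp add: length_xs p0_def)
qed

text \<open>Besides \<open>l\<close>, the input consists of counts, lengths, and vertex and node
  numbers, all bounded by the input length; for vertices this rests on the hypothesis on
  \<open>n\<close>.\<close>

lemma xs_le:
  assumes "n \<le> length xs" "v \<in> set xs"
  shows "v \<le> length xs + l"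
proof -
  have NL: "N \<le> length (blocks bs)"
  proof -
    have "(\<Sum>x<N. 1) \<le> length (blocks bs)"
      unfolding block_start_length[symmetric] bs block_start_def by (rule sum_mono) simp
    then show ?thesis by simp
  qed
  have e: "v < n" if v: "v \<in> set (concat (map (\<lambda>(u, v). [u, v]) es))" for v
  proof -
    obtain p where "p \<in> set es" "v = fst p \<or> v = snd p" using v by (auto simp: case_prod_beta)
    then obtain k where "k < length es" "v = fst (es ! k) \<or> v = snd (es ! k)" by (metis in_set_conv_nth)
    then show ?thesis using edge_list_nth(3,4)[OF es graph] by auto
  qed
  have f: "v < N" if v: "v \<in> set (concat (map (\<lambda>(u, v). [u, v]) fs))" for v
  proof -
    obtain p where "p \<in> set fs" "v = fst p \<or> v = snd p" using v by (auto simp: case_prod_beta)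
    then obtain k where "k < length fs" "v = fst (fs ! k) \<or> v = snd (fs ! k)" by (metis in_set_conv_nth)
    then show ?thesis using edge_list_nth(3,4)[OF fs F_graph] by auto
  qed
  have b: "v \<le> length xs" if v: "v \<in> set (blocks bs)" for v
  proof -
    obtain w where w: "w \<in> set bs" "v = length w \<or> v \<in> set w" using v by (auto simp: blocks_def)
    then obtain x where x: "x < N" "bs ! x = w" using bs by (metis in_set_conv_nth)
    have "length w \<le> length (blocks bs)" using blocks_nth(3)[of x bs] x bs by simp
    moreover have "v < n" if "v \<in> set w" using bag_facts[OF x(1)] x(2) that by auto
    ultimately show ?thesis using w(2) assms(1) by (auto simp: length_xs)
  qed
  have "length es \<le> length xs" "length fs \<le> length xs" "N \<le> length xs" using NL by (simp_all add: length_xs p0_def)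
  then show ?thesis using assms e[of v] f[of v] b[of v] unfolding xs_eq by (auto simp del: set_concat)
qed

end

context graph_dp
begin

text \<open>Depends on \<open>c\<close> only, because every loop bound is replaced by 1. The summand
  2 pays for the two instructions that change the memory layout.\<close>

definition "progCost = scost (\<lambda>_. 1) readHead + scost (\<lambda>_. 1) readBags + scost (\<lambda>_. 1) setOne +
  scost (\<lambda>_. 1) computeZ + scost (\<lambda>_. 1) setParams + scost (\<lambda>_. 1) copyInput + scost (\<lambda>_. 1) mainProg + 2"
definition "progSize = ssz 22 mainProg + CU + 2 * c + 80"

end

context inst
begin

definition "steps = N * ((t + 1) * ((t + 1) * (CU * CU * (t + 1) ^ 4 * ((t + 1) * Z)))) + length xs"

lemma NT_ge: "CU \<le> CU * CU * (t + 1) ^ 4" "t + 1 \<le> CU * CU * (t + 1) ^ 4" "1 \<le> CU * CU * (t + 1) ^ 4" "1 \<le> Z"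
proof -
  have 1: "1 \<le> CU * CU" using mult_le_mono[OF CU_pos CU_pos] by simp
  have 2: "t + 1 \<le> (t + 1) ^ 4" using power_increasing[of 1 4 "t + 1"] by simp
  show a: "t + 1 \<le> CU * CU * (t + 1) ^ 4" by (rule le_mult_left[OF 2 1])
  then show "1 \<le> CU * CU * (t + 1) ^ 4" by linarith
  have 4: "1 \<le> (t + 1) ^ 4" using 2 by linarith
  show "CU \<le> CU * CU * (t + 1) ^ 4" by (intro le_mult_right[OF _ 4] le_mult_right[OF le_refl CU_pos])
  show "1 \<le> Z" by (simp add: q_def)
qed

lemma steps_ge: "length xs \<le> steps" "N \<le> steps" "t \<le> steps" "1 \<le> steps" "Z \<le> steps" "CU * CU * (t + 1) ^ 4 \<le> steps"
  "CU \<le> steps"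
proof -
  define NT where "NT = CU * CU * (t + 1) ^ 4"
  have NT: "1 \<le> NT" "t + 1 \<le> NT" "CU \<le> NT" using NT_ge by (simp_all add: NT_def)
  have T: "1 \<le> t + 1" by simp
  define J where "J = (t + 1) * ((t + 1) * (NT * ((t + 1) * Z)))"
  have z: "Z \<le> (t + 1) * Z" by (rule le_mult_left[OF le_refl T])
  have "NT \<le> NT * ((t + 1) * Z)" by (rule le_mult_right[OF le_refl]) (use z NT_ge(4) in linarith)
  then have NJ: "NT \<le> J" unfolding J_def by (intro le_mult_left[OF _ T])
  have ZJ: "Z \<le> J" unfolding J_def by (intro le_mult_left[OF _ T] le_mult_left[OF _ NT(1)]) simp
  have N: "1 \<le> N" using N_pos by simp
  have J: "J \<le> N * J" "N \<le> N * J"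
    by (rule le_mult_left[OF le_refl N], rule le_mult_right[OF le_refl]) (use NJ NT in linarith)
  have s: "steps = N * J + length xs" by (simp add: steps_def J_def NT_def)
  show "length xs \<le> steps" "N \<le> steps" "t \<le> steps" "1 \<le> steps" "Z \<le> steps" "CU \<le> steps"
    using J NJ ZJ NT unfolding s by linarith+
  show "CU * CU * (t + 1) ^ 4 \<le> steps" using J NJ unfolding s NT_def[symmetric] by linarith
qed

lemma scost_le_mult:
  assumes "lp \<sigma> C \<le> X"
  shows "scost \<sigma> C \<le> scost (\<lambda>_. 1) C * X"
  using le_trans[OF scost_le mult_le_mono2[OF assms]] .

lemma run:
  assumes tm: "t = maxlen bs N" and Beq: "B = ssum * ssum" and nL: "n \<le> length xs"
    and W: "(B + 2) ^ progSize \<le> W"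
  shows "\<exists>u l'. exec W wholeProg (initial_state xs) u l' \<and> u \<le> progCost * steps \<and>
     fst l' 0 = of_bool (has_disconnected_matching c E l)"
proof -
  have vals: "\<forall>v\<in>set xs. v \<le> ssum" using xs_le[OF nL] by (fastforce simp: ssum_def)
  have W0: "(B + 2) ^ (CU + 2 * c + 80) \<le> W" "(B + 2) ^ ssz 22 mainProg \<le> W" "(B + 2) ^ 1 \<le> W"
    by (rule power_le_imp_le_power[OF W], simp add: progSize_def)+
  define a1 where "a1 = den readHead store0"
  define a2 where "a2 = den readBags a1"
  define a3 where "a3 = den setOne a2"
  define a4 where "a4 = den computeZ a3"
  define a5 where "a5 = den setParams a4"
  define s where "s = den copyInput a5"
  obtain s' where "s' = s" and ok: "ok 1 W readHead store0" "ok 1 W readBags a1" "ok 1 W setOne a2" "ok 1 W computeZ a3"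
      "ok 1 W setParams a4" "ok 1 W copyInput a5"
    and bnd: "bnd B s'" and regs: "fst s' rP = length xs" "fst s' rT = t" "fst s' rT1 = t + 1" "fst s' rZ = Z" "fst s' rB = B"
      "fst s' rCU = CU" "fst s' rNT = CU * CU * (t + 1) ^ 4" "fst s' rL = l" "fst s' rM = length es" "fst s' rN = N"
      "fst s' rMF = length fs" "fst s' rP0 = p0"
    and mem: "\<And>X. X < length xs \<Longrightarrow> snd s' 0 (length xs + X * 22) = xs ! X"
      "\<And>j. length xs \<le> j \<Longrightarrow> (\<nexists>X. X < length xs \<and> j = length xs + X * 22) \<Longrightarrow> snd s' 0 j = 0"
    and bounds: "fst a1 rN = N" "fst a3 rT = t" "fst a5 rP = length xs"
    using phase0[OF tm Beq vals W0(1)]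
    unfolding a1_def[symmetric] a2_def[symmetric] a3_def[symmetric] a4_def[symmetric] a5_def[symmetric] s_def[symmetric]
    by (elim exE conjE) (rule that; (assumption | blast))
  note s' = \<open>s' = s\<close>
  note bnd = bnd[unfolded s'] and regs = regs[unfolded s'] and mem = mem[unfolded s']
  have "rel 1 store0 (initial_state xs)" by (simp add: rel_def store0_def initial_state_def)
  from comp_correct[OF this ok(1) chk_read(1), where \<sigma> = "fst store0"] obtain u1 l1 where
    1: "exec W (comp 1 readHead) (initial_state xs) u1 l1" "u1 \<le> scost (fst store0) readHead" "rel 1 a1 l1"
    by (auto simp: a1_def)
  from comp_correct[OF 1(3) ok(2) chk_read(2), where \<sigma> = "fst a1"] obtain u2 l2 where
    2: "exec W (comp 1 readBags) l1 u2 l2" "u2 \<le> scost (fst a1) readBags" "rel 1 a2 l2"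
    by (auto simp: a2_def)
  from comp_correct[OF 2(3) ok(3) chk_read(3), where \<sigma> = "fst a2"] obtain u3 l3 where
    3: "exec W (comp 1 setOne) l2 u3 l3" "u3 \<le> scost (fst a2) setOne" "rel 1 a3 l3"
    by (auto simp: a3_def)
  from comp_correct[OF 3(3) ok(4) chk_read(4), where \<sigma> = "fst a3"] obtain u4 l4 where
    4: "exec W (comp 1 computeZ) l3 u4 l4" "u4 \<le> scost (fst a3) computeZ" "rel 1 a4 l4"
    by (auto simp: a4_def)
  from comp_correct[OF 4(3) ok(5) chk_read(5), where \<sigma> = "fst a4"] obtain u5 l5 where
    5: "exec W (comp 1 setParams) l4 u5 l5" "u5 \<le> scost (fst a4) setParams" "rel 1 a5 l5"
    by (auto simp: a5_def)
  from comp_correct[OF 5(3) ok(6) chk_read(6), where \<sigma> = "fst a5"] obtain u6 l6 where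
    6: "exec W (comp 1 copyInput) l5 u6 l6" "u6 \<le> scost (fst a5) copyInput" "rel 1 s l6"
    by (auto simp: s_def)
  obtain r6 m6 where l6: "l6 = (r6, m6)" by (cases l6)
  have off: "fst s rOFF = 0"
    unfolding s_def a5_def a4_def a3_def a2_def a1_def by (simp add: fst_den store0_def)
  have r6: "r6 r = fst s r" if "r < 40" for r using 6(3) that by (simp add: rel_def l6)
  have m6: "m6 j = snd s 0 j" for j using 6(3) off unfolding rel_def l6 by force
  have LB: "length xs \<le> B" and BW: "B \<le> W"
  proof -
    have "ssum * 1 \<le> ssum * ssum" by (rule mult_le_mono2) (use CU_pos in \<open>simp add: ssum_def\<close>)
    moreover have "length xs \<le> ssum" by (simp add: ssum_def)
    ultimately show "length xs \<le> B" unfolding Beq by linarith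
    show "B \<le> W" using W0(3) by simp
  qed
  \<comment> \<open>The registers after the switch to 22 arrays; \<open>s7\<close> reads the same
    memory in the new layout.\<close>
  define r7 where "r7 = r6(40 := 0, rOFF := length xs)"
  have e7: "exec W (Const 40 0) l6 1 (r6(40 := 0), m6)" unfolding l6 by (rule exec.Const) simp
  have e8: "exec W (Op Add rOFF rP 40) (r6(40 := 0), m6) 1 (r7, m6)"
    by (rule exec_Op'[where v = "length xs"]) (use LB BW regs(1) r6 in \<open>auto simp: r7_def\<close>)
  define s7 :: store where
    "s7 = (\<lambda>r. if r < 40 then r7 r else 0, \<lambda>a i. if a = 0 \<and> i < length xs then xs ! i else 0)"
  have rel7: "rel 22 s7 (r7, m6)"
    unfolding rel_def
  proof (intro conjI allI impI)
    fix a i :: nat assume a: "a < 22"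
    have "m6 (i * 22 + a + length xs) = (if a = 0 \<and> i < length xs then xs ! i else 0)"
    proof (cases "a = 0 \<and> i < length xs")
      case True
      then show ?thesis using mem(1)[of i] by (simp add: m6 add.commute)
    next
      case False
      have "snd s 0 (i * 22 + a + length xs) = 0"
      proof (rule mem(2))
        show "\<nexists>X. X < length xs \<and> i * 22 + a + length xs = length xs + X * 22"
        proof
          assume "\<exists>X. X < length xs \<and> i * 22 + a + length xs = length xs + X * 22"
          then obtain X where "X < length xs" "i * 22 + a = X * 22" by auto
          moreover from this a have "a = 0 \<and> i = X" by presburger
          ultimately show False using False by blast
        qed
      qed simp
      then show ?thesis by (simp only: m6 if_not_P[OF False])
    qed
    then show "snd (r7, m6) (i * 22 + a + fst s7 rOFF) = snd s7 a i" by (simp add: s7_def r7_def)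
  qed (simp add: s7_def)
  have s7r: "fst s7 r = fst s r" if "r < 40" "r \<noteq> rOFF" for r using that r6 by (simp add: s7_def r7_def)
  have cst7: "cst s7" using regs unfolding cst_def by (simp add: s7r) (simp add: s7_def)
  have bs7: "bounded_store B s7"
    unfolding bounded_store_def
  proof (intro conjI allI)
    show "fst s7 rB = B" using regs(5) by (simp add: s7r)
    show "fst s7 r \<le> B" for r
    proof (cases "r < 40 \<and> r \<noteq> rOFF")
      case True
      then show ?thesis using bnd_D(1)[OF bnd] by (simp add: s7r)
    next
      case False
      then show ?thesis using LB by (auto simp: s7_def r7_def)
    qed
    show "snd s7 a i \<le> B" for a i
    proof (cases "a = 0 \<and> i < length xs")
      case True
      then show ?thesis using mem(1)[of i] bnd_D(2)[OF bnd, of 0 "length xs + i * 22"] by (simp add: s7_def)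
    qed (auto simp: s7_def)
  qed
  have ok7: "ok 22 W mainProg s7" using ok_static[OF bs7 B_ge(2) main_static(2) W0(2)] ..
  from comp_correct[OF rel7 ok7 main_static(1), where \<sigma> = "fst s7"] main_static(3) obtain u9 l9 where
    9: "exec W (comp 22 mainProg) (r7, m6) u9 l9" "u9 \<le> scost (fst s7) mainProg" "rel 22 (den mainProg s7) l9"
    by blast
  have ans: "fst l9 0 = of_bool (has_disconnected_matching c E l)"
  proof -
    have "fst (den mainProg s7) 0 = of_bool (has_disconnected_matching c E l)"
      by (rule mainProg_correct[OF cst7 LB]) (simp add: s7_def)
    then show ?thesis using 9(3) by (simp add: rel_def)
  qed
  have "exec W wholeProg (initial_state xs) (u1 + (u2 + (u3 + (u4 + (u5 + (u6 + (1 + (1 + u9)))))))) l9"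
    unfolding wholeProg_def by (rule exec.Seq 1 2 3 4 5 6 e7 e8 9(1))+
  moreover have "u1 + (u2 + (u3 + (u4 + (u5 + (u6 + (1 + (1 + u9))))))) \<le> progCost * steps"
  proof -
    have lps: "lp (fst store0) readHead \<le> steps" "lp (fst a1) readBags \<le> steps" "lp (fst a2) setOne \<le> steps"
      "lp (fst a3) computeZ \<le> steps" "lp (fst a4) setParams \<le> steps" "lp (fst a5) copyInput \<le> steps"
      using steps_ge bounds
      by (simp_all add: readHead_def readBags_def setOne_def computeZ_def setParams_def copyInput_def)
    have "lp (fst s7) mainProg \<le>
        N * ((t + 1) * ((t + 1) * (CU * CU * (t + 1) ^ 4 * ((t + 1) * Z)))) + length es + length fs"
      by (rule lp_main) (use cst7 NT_ge N_pos in \<open>auto simp: cst_def\<close>)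
    then have "lp (fst s7) mainProg \<le> steps" by (simp add: steps_def length_xs p0_def)
    note lps = lps this
    have "u1 + (u2 + (u3 + (u4 + (u5 + (u6 + (1 + (1 + u9))))))) \<le>
        scost (\<lambda>_. 1) readHead * steps + (scost (\<lambda>_. 1) readBags * steps + (scost (\<lambda>_. 1) setOne * steps +
        (scost (\<lambda>_. 1) computeZ * steps + (scost (\<lambda>_. 1) setParams * steps + (scost (\<lambda>_. 1) copyInput * steps +
        (steps + (steps + scost (\<lambda>_. 1) mainProg * steps)))))))"
      by (intro add_mono steps_ge(4) le_trans[OF 1(2)] le_trans[OF 2(2)] le_trans[OF 3(2)] le_trans[OF 4(2)]
        le_trans[OF 5(2)] le_trans[OF 6(2)] le_trans[OF 9(2)] scost_le_mult lps)
    then show ?thesis by (simp only: progCost_def add_mult_distrib mult_2 add.assoc add.commute add.left_commute)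
  qed
  ultimately show ?thesis using ans by blast
qed

text \<open>The exponent 7 collects two factors for pairs of positions, four from the number of
  rounds of a join and one from a sweep. The input length adds at most ten times the same quantity,
  hence 11.\<close>

lemma steps_le: "steps \<le> 11 * (CU * CU) * N * (t + 1) ^ 7 * Z"
proof -
  define T where "T = t + 1"
  define Q where "Q = CU * CU * Z"
  have Q: "1 \<le> Q" using mult_le_mono[OF mult_le_mono[OF CU_pos CU_pos] NT_ge(4)] by (simp add: Q_def)
  have "T * T \<le> T ^ 7" using power_increasing[of 2 7 T] by (simp add: T_def power2_eq_square)
  then have "N * (T * T) \<le> N * T ^ 7 * Q" using Q 
    using mult_le_mono[of "N * (T * T)" "N * T ^ 7" 1 Q] by simp
  then have "length xs \<le> 10 * (N * T ^ 7 * Q)" using length_xs_le unfolding T_def[symmetric] by linarith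
  moreover have "N * (T * (T * (CU * CU * T ^ 4 * (T * Z)))) = N * T ^ 7 * Q"
    by (simp add: Q_def eval_nat_numeral algebra_simps)
  ultimately have "steps \<le> 11 * (N * T ^ 7 * Q)" unfolding steps_def T_def[symmetric] by linarith
  then show ?thesis by (simp only: T_def Q_def mult.assoc mult.commute mult.left_commute)
qed

text \<open>\<open>ssum\<close> is at most \<open>4 * Y\<close>, so \<open>B\<close> is at most
  \<open>16 * Y ^ 2\<close>; as \<open>Y\<close> is at least 8, \<open>B + 2\<close> is at most
  \<open>Y ^ 4\<close>. This is the origin of the factor 4 in front of the program size.\<close>

lemma word_le:
  assumes "B = ssum * ssum" "8 \<le> CU" "steps + l \<le> Y" "4 * S \<le> K"
  shows "(B + 2) ^ S \<le> Y ^ K"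
proof -
  have s: "ssum \<le> 4 * Y" using steps_ge assms(3) unfolding ssum_def by linarith
  have "B \<le> 4 * Y * (4 * Y)" unfolding assms(1) by (rule mult_le_mono[OF s s])
  then have "B \<le> 16 * (Y * Y)" by simp
  moreover have Y: "8 \<le> Y" using steps_ge(7) assms(2,3) by linarith
  have YY: "64 \<le> Y * Y" using mult_le_mono[OF Y Y] by simp
  moreover have "64 * (Y * Y) \<le> Y * Y * (Y * Y)" by (rule mult_le_mono1[OF YY])
  moreover have "Y ^ 4 = Y * Y * (Y * Y)" by (simp only: power4_eq_xxxx mult.assoc)
  ultimately have "B + 2 \<le> Y ^ 4" by linarith
  then have "(B + 2) ^ S \<le> (Y ^ 4) ^ S" by (rule power_mono) simp
  also have "\<dots> = Y ^ (4 * S)" by (simp only: power_mult)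
  also have "\<dots> \<le> Y ^ K" by (rule power_increasing) (use assms(4) Y in auto)
  finally show ?thesis .
qed

end

text \<open>\<open>2 * c + 1 \<le> 3 * c\<close> leads from the number of digits to the base of the
  time bound. Bags have up to \<open>tw + 1\<close> vertices, which costs one surplus factor
  \<open>3 * c\<close>; the factor 128 is \<open>2 ^ 7\<close>, from
  \<open>tw + 2 \<le> 2 * (tw + 1)\<close>; the number of nodes contributes \<open>d\<close> and
  \<open>(tw + 1) ^ d\<close>.\<close>

lemma poly_absorb:
  fixes c tw :: nat
  assumes "1 \<le> c" and N: "N \<le> d * (tw + 1) ^ d * n" and K: "a * 128 * (3 * c) * d \<le> K" "d + 7 \<le> K"
  shows "a * N * (tw + 2) ^ 7 * (2 * c + 1) ^ (tw + 1) \<le> K * (3 * c) ^ tw * (tw + 1) ^ K * n"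
proof -
  define T where "T = tw + 1"
  have T: "1 \<le> T" by (simp add: T_def)
  have "(tw + 2) ^ 7 \<le> (2 * T) ^ 7" by (rule power_mono) (simp_all add: T_def)
  then have 1: "(tw + 2) ^ 7 \<le> 128 * T ^ 7" by (simp add: power_mult_distrib)
  have 2: "(2 * c + 1) ^ (tw + 1) \<le> (3 * c) ^ (tw + 1)" by (rule power_mono) (use assms(1) in auto)
  have "a * N * (tw + 2) ^ 7 * (2 * c + 1) ^ (tw + 1) \<le> a * (d * T ^ d * n) * (128 * T ^ 7) * (3 * c) ^ (tw + 1)"
    by (intro mult_le_mono le_refl 1 2) (use N in \<open>simp add: T_def\<close>)
  also have "\<dots> = a * 128 * (3 * c) * d * (3 * c) ^ tw * T ^ (d + 7) * n"
    by (simp add: power_add algebra_simps)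
  also have "\<dots> \<le> K * (3 * c) ^ tw * T ^ K * n"
    by (intro mult_le_mono le_refl K power_increasing T)
  finally show ?thesis by (simp add: T_def)
qed

text \<open>A graph with a vertex has a nonempty bag, so the truncated subtraction in
  \<open>width\<close> is exact. The bags cover the vertices, hence the bag lists are at least as
  long as \<open>n\<close>.\<close>

lemma bags_facts:
  assumes td: "tree_decomposition {..<n} E {..<N} F Bg" and n: "1 \<le> n" and bs: "length bs = N"
    and bag: "\<forall>x<N. distinct (bs ! x) \<and> set (bs ! x) = Bg x"
  shows "width {..<N} Bg + 1 = maxlen bs N" and "n \<le> length (blocks bs)" and "N \<le> length (blocks bs)"
proof -
  have card: "card (Bg x) = length (bs ! x)" if "x < N" for x
    using bag that distinct_card by metis
  have cover: "\<exists>x<N. v \<in> Bg x" if "v < n" for v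
    using td that by (auto simp: tree_decomposition_def)
  obtain x0 where x0: "x0 < N" "0 \<in> Bg x0" using cover[of 0] n by auto
  then have "0 < length (bs ! x0)" using bag by (metis length_pos_if_in_set)
  then have pos: "0 < maxlen bs N" using maxlen_ge[OF x0(1), of bs] by linarith
  have "Max ((\<lambda>x. card (Bg x)) ` {..<N}) = maxlen bs N"
  proof (rule Max_eqI)
    obtain x where "x < N" "length (bs ! x) = maxlen bs N" using maxlen_attained[OF pos] by blast
    then show "maxlen bs N \<in> (\<lambda>x. card (Bg x)) ` {..<N}" using card by force
  qed (use card maxlen_ge in auto)
  then show "width {..<N} Bg + 1 = maxlen bs N" using pos by (simp add: width_def)
  have len: "length (blocks bs) = (\<Sum>x<N. length (bs ! x) + 1)"
    using block_start_length[of bs] by (simp add: block_start_def bs)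
  have "{..<n} \<subseteq> (\<Union>x<N. Bg x)" using cover by auto
  moreover have "finite (\<Union>x<N. Bg x)" using bag by (metis List.finite_set finite_UN finite_lessThan lessThan_iff)
  ultimately have "card {..<n} \<le> card (\<Union>x<N. Bg x)" by (intro card_mono)
  also have "\<dots> \<le> (\<Sum>x<N. card (Bg x))" by (rule card_UN_le) simp
  also have "\<dots> \<le> length (blocks bs)" unfolding len by (rule sum_mono) (use card in simp)
  finally show "n \<le> length (blocks bs)" by simp
  have "(\<Sum>x<N. 1) \<le> length (blocks bs)" unfolding len by (rule sum_mono) simp
  then show "N \<le> length (blocks bs)" by simp
qed

lemma decides_in_time:
  assumes c: "2 \<le> c" and n: "1 \<le> n" and G: "simple_graph {..<n} E"
    and td: "tree_decomposition {..<n} E {..<N} F Bg" and w: "width {..<N} Bg = tw"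
    and N: "N \<le> d * (tw + 1) ^ d * n" and enc: "encodes_input ys n E l N F Bg"
    and K: "graph_dp.progCost c * (11 * (2 ^ (c + 1) * 2 ^ (c + 1))) * 128 * (3 * c) * d \<le> K" "d + 7 \<le> K"
      "4 * graph_dp.progSize c \<le> K"
  shows "answers_in_time (word_bound c K tw n l) (graph_dp.wholeProg c) ys (time_bound c K tw n)
    (has_disconnected_matching c E l)"
proof -
  from enc obtain es fs bs where es: "edge_list es E" and fs: "edge_list fs F" and bs: "length bs = N"
    and bag: "\<forall>x<N. distinct (bs ! x) \<and> set (bs ! x) = Bg x"
    and ys: "ys = [n, l] @ flatten_edges es @ [N] @ flatten_edges fs @ blocks bs"
    unfolding encodes_input_def blocks_def by blast
  note bf = bags_facts[OF td n bs bag]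
  define t where "t = maxlen bs N"
  have t: "t = tw + 1" using bf(1) w by (simp add: t_def)
  define D where "D = (2 :: nat) ^ (c + 1)"
  have CU8: "8 \<le> D" using power_increasing[of 3 "c + 1" "2 :: nat"] c by (simp add: D_def)
  \<comment> \<open>The sum that the program itself computes, written out in advance because the
    bound \<open>S * S\<close> is a parameter of the locale.\<close>
  define S where "S = length ys + l + (2 * c + 1) ^ t + D * D * (t + 1) ^ 4 + D"
  interpret graph_dp c n t E by unfold_locales (use G c in auto)
  have CUeq: "graph_dp.CU c = D" by (simp add: D_def graph_dp.CU_def[OF graph_dp_axioms])
  have len: "length (blocks bs) + 5 \<le> length ys" by (simp add: ys flatten_edges_def)
  have tN: "t + 1 \<le> D * D * (t + 1) ^ 4"
  proof (rule le_mult_left)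
    show "t + 1 \<le> (t + 1) ^ 4" using power_increasing[of 1 4 "t + 1"] by simp
    show "1 \<le> D * D" using CU8 mult_le_mono[of 1 D 1 D] by simp
  qed
  have S: "n + 8 \<le> S" "N + 8 \<le> S" "t + 1 \<le> S" "q ^ t \<le> S" "D \<le> S"
    using len bf(2,3) CU8 tN by (simp_all add: S_def q_def)
  have SS: "S \<le> S * S" by (cases S) auto
  interpret inst c n t E "S * S" es fs bs l N F Bg
  proof unfold_locales
    show "q ^ t * q ^ t \<le> S * S" by (rule mult_le_mono[OF S(4) S(4)])
    show "graph_dp.CU c \<le> S * S" unfolding CUeq using S(5) SS by linarith
    show "t + 1 \<le> S * S" using S(3) SS by linarith
    have "2 * S \<le> S * S" by (rule mult_le_mono1) (use S(1) in simp)
    then show "2 * n + 4 \<le> S * S" using S(1) by linarith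
    show "N * N \<le> S * S" by (rule mult_le_mono) (use S(2) in simp_all)
    show "N + 1 \<le> S * S" using S(2) SS by linarith
    show "x < N \<Longrightarrow> length (bs ! x) \<le> t" for x unfolding t_def by (rule maxlen_ge)
  qed (use es fs bs bag td in auto)
  have ysx: "ys = xs" by (simp add: ys xs_def)
  have Seq: "S = ssum" by (simp add: S_def ssum_def ysx CUeq q_def)
  have "steps \<le> 11 * (D * D) * N * (t + 1) ^ 7 * (2 * c + 1) ^ t" using steps_le by (simp add: CUeq q_def)
  then have "progCost * steps \<le> progCost * (11 * (D * D) * N * (t + 1) ^ 7 * (2 * c + 1) ^ t)"
    by (rule mult_le_mono2)
  also have "\<dots> = progCost * (11 * (D * D)) * N * (tw + 2) ^ 7 * (2 * c + 1) ^ (tw + 1)"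
    by (simp add: t mult.assoc)
  also have "\<dots> \<le> time_bound c K tw n"
    unfolding time_bound_def by (rule poly_absorb[OF _ N _ K(2)]) (use c K(1) in \<open>auto simp: D_def\<close>)
  finally have time: "progCost * steps \<le> time_bound c K tw n" .
  \<comment> \<open>The word size is given through the time bound, so the plain number of steps has
    to be compared with it; \<open>progCost\<close> is positive.\<close>
  have "1 * steps \<le> progCost * steps" by (rule mult_le_mono1) (simp add: progCost_def)
  then have "steps + l \<le> time_bound c K tw n + l" using time by linarith
  then have "(S * S + 2) ^ progSize \<le> word_bound c K tw n l"
    unfolding word_bound_def by (intro word_le) (use CU8 K(3) in \<open>simp_all add: Seq CUeq\<close>)
  from run[OF t_def _ _ this] obtain u l' where
    "exec (word_bound c K tw n l) wholeProg (initial_state xs) u l'" "u \<le> progCost * steps"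
    "fst l' 0 = of_bool (has_disconnected_matching c E l)"
    using Seq len bf(2) ysx by (metis add_leD1 le_trans)
  then show ?thesis
    unfolding answers_in_time_def ysx using time
    by (intro exI[of _ u] exI[of _ "fst l'"] exI[of _ "snd l'"]) (auto simp: of_bool_def)
qed

theorem theorem3:
  fixes c :: nat
  assumes "c \<ge> 2"
  shows "\<exists>p :: prog. \<forall>d :: nat. \<exists>K :: nat.
    \<forall>(n :: nat) (E :: nat set set) (l :: nat) (N :: nat) (F :: nat set set)
     (B :: nat \<Rightarrow> nat set) (tw :: nat) (xs :: nat list).
      n \<ge> 1 \<longrightarrow> simple_graph {..<n} E \<longrightarrow> l \<ge> 1 \<longrightarrow>
      tree_decomposition {..<n} E {..<N} F B \<longrightarrow> width {..<N} B = tw \<longrightarrow>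
      N \<le> d * (tw + 1) ^ d * n \<longrightarrow>
      encodes_input xs n E l N F B \<longrightarrow>
      answers_in_time (word_bound c K tw n l) p xs (time_bound c K tw n)
        (has_disconnected_matching c E l)"
proof (rule exI, rule allI)
  fix d
  \<comment> \<open>\<open>K0\<close> pays for the time, \<open>d + 7\<close> for the power of
    \<open>tw + 1\<close>, and the last summand of \<open>K\<close> for the word size. The program
    itself has been chosen before \<open>d\<close>.\<close>
  define K0 where "K0 = graph_dp.progCost c * (11 * (2 ^ (c + 1) * 2 ^ (c + 1))) * 128 * (3 * c) * d"
  define K where "K = K0 + (d + 7) + 4 * graph_dp.progSize c"
  have K: "K0 \<le> K" "d + 7 \<le> K" "4 * graph_dp.progSize c \<le> K" by (simp_all add: K_def)
  show "\<exists>K. \<forall>n E l N F B tw xs.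
      n \<ge> 1 \<longrightarrow> simple_graph {..<n} E \<longrightarrow> l \<ge> 1 \<longrightarrow>
      tree_decomposition {..<n} E {..<N} F B \<longrightarrow> width {..<N} B = tw \<longrightarrow>
      N \<le> d * (tw + 1) ^ d * n \<longrightarrow> encodes_input xs n E l N F B \<longrightarrow>
      answers_in_time (word_bound c K tw n l) (graph_dp.wholeProg c) xs (time_bound c K tw n)
        (has_disconnected_matching c E l)"
    by (intro exI[of _ K] allI impI, rule decides_in_time[OF assms]) (use K in \<open>simp_all only: K0_def\<close>)
qed

end
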